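(* Let $\Delta$ be a simple integral polytope in $\mathbb{R}^n$, let $p$ be a polynomial on $\mathbb{R}^n$, and choose an integer $k \ge \deg p + n + 1$. Then $$\sum_{\Delta \cap \mathbb{Z}^n}{}^{'} p \;=\; \left.\sum_F \sum_{\gamma \in \Gamma_F^\flat} \mathbf{M}_{\gamma,F}^k \int_{\Delta(h)} p(x)\, dx \right|_{h=0},$$ where the outer sum runs over all faces $F$ of $\Delta$.
   Context: **Polytope.** A compact convex polytope $\Delta\subset\mathbb{R}^n$ is integral if its vertices lie in $\mathbb{Z}^n$, and simple if exactly $n$ edges emanate from each vertex (equivalently each vertex is the intersection of exactly $n$ facets). Write $\Delta = \bigcap_{i=1}^d \{x : \langle u_i,x\rangle+\mu_i\ge 0\}$ where $d$ is the number of facets and $u_i\in(\mathbb{Z}^n)^*$ is the inward normal to the $i$th facet, normalized to be a primitive element of the dual lattice $(\mathbb{Z}^n)^*$. For $h=(h_1,\dots,h_d)\in\mathbb{R}^d$ near $0$ put $\Delta(h)=\bigcap_{i=1}^d\{x: \langle u_i,x\rangle+\mu_i+h_i\ge 0\}$. Faces are non-empty, and $\Delta$ itself counts as a face. For a face $F$ let $I_F\subset\{1,\dots,d\}$ be the set of (indices of) facets containing $F$; for a vertex $v$ write $I_v$. For a vertex $v$, let $\alpha_{i,v}\in\mathbb{R}^n$, $i\in I_v$, be the basis of $\mathbb{R}^n$ dual to the basis $u_i$, $i\in I_v$, of $(\mathbb{R}^n)^*$. **Weighted sum.** $\sum'_{\Delta\cap\mathbb{Z}^n}f=\sum_{x\in\Delta\cap\mathbb{Z}^n}\mathbf{1}^w_\Delta(x)f(x)$,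 where $\mathbf{1}^w_\Delta(x)=2^{-c}$ if $x$ lies in the relative interior of a face of $\Delta$ of codimension $c$. **Finite groups.** For a face $F$ let $N_F=\operatorname{span}\{u_i: i\in I_F\}\subseteq(\mathbb{R}^n)^*$ and $\Gamma_F=(N_F\cap(\mathbb{Z}^n)^* )/\sum_{i\in I_F}\mathbb{Z}u_i$, a finite abelian group. If $F\subseteq E$ are faces, the natural map $\Gamma_E\to\Gamma_F$ is injective, and we regard $\Gamma_E\subseteq\Gamma_F$. Put $\Gamma_F^\flat=\Gamma_F\setminus\bigcup_{E\supsetneq F}\Gamma_E$, the union over faces $E$ strictly containing $F$. **Roots of unity.** For a vertex $v$, $\gamma\in\Gamma_v$, $j\in I_v$, put $\lambda_{\gamma,j,v}=e^{2\pi i\langle\gamma,\alpha_{j,v}\rangle}$ (well defined, a root of unity). For $\gamma\in\Gamma_F$ and $j\in I_F$ put $\lambda_{\gamma,j,F}=\lambda_{\gamma,j,v}$ for any vertex $v\in F$ (independent of $v$); for $j\in\{1,\dots,d\}\setminus I_F$ put $\lambda_{\gamma,j,F}=1$. **Polynomials $\mathbf{M}^{k,\lambda}$.** Let $\lambda\ne1$ be a root of unity of order $N$. Set $Q_{0,\lambda}(x)=-\sum_{n\in\mathbb{Z}}\lambda^n\delta(x-n)$ and, for $m\ge1$, define the $N$-periodic $Q_{m,\lambda}$ by $\frac{d}{dx}Q_{m,\lambda}=Q_{m-1,\lambda}$ (as distributions) and $\int_0^NQ_{m,\lambda}(x)\,dx=0$; $Q_{m,\lambda}$ is a continuous function for $m\ge2$.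 For $k\ge1$, $$\mathbf{M}^{k,\lambda}(S)=\Big(\tfrac12+\tfrac{\lambda}{1-\lambda}\Big)S+Q_{2,\lambda}(0)S^2+\cdots+Q_{k,\lambda}(0)S^k .$$ For $\lambda=1$, $\mathbf{M}^{k,1}(S)$ is the truncation at degree $2\lfloor k/2\rfloor$ of the power series $\mathbf{L}(S)=\frac{S/2}{\tanh(S/2)}=1+\sum_{l\ge1}\frac{b_{2l}}{(2l)!}S^{2l}$ ($b_{2l}$ the Bernoulli numbers). **Operators.** For a face $F$ and $\gamma\in\Gamma_F$, $\mathbf{M}^k_{\gamma,F}=\prod_{j=1}^d\mathbf{M}^{k,\lambda_{\gamma,j,F}}\big(\frac{\partial}{\partial h_j}\big)$. *)

theory Defs
  imports "HOL-Analysis.Analysis" "HOL-Library.Poly_Mapping"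
begin

section \<open>Polynomials on \<open>R\<^sup>n\<close>\<close>

type_synonym 'n mpolynomial = "('n \<Rightarrow>\<^sub>0 nat) \<Rightarrow>\<^sub>0 complex"

definition mp_eval :: "'n::finite mpolynomial \<Rightarrow> real ^ 'n \<Rightarrow> complex" where
  "mp_eval p x =
     (\<Sum>m\<in>Poly_Mapping.keys p. Poly_Mapping.lookup p m *
        (\<Prod>i\<in>UNIV. complex_of_real (x $ i) ^ Poly_Mapping.lookup m i))"

definition mp_total_degree :: "'n::finite mpolynomial \<Rightarrow> nat" where
  "mp_total_degree p =
     Max (insert 0 ((\<lambda>m. \<Sum>i\<in>UNIV. Poly_Mapping.lookup m i) ` Poly_Mapping.keys p))"


section \<open>Simple integral polytopes\<close>

text \<open>The standard inner product identifies \<open>(R\<^sup>n)\<^sup>*\<close> with \<open>R\<^sup>n\<close> and the dual lattice of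
  \<open>Z\<^sup>n\<close> with \<open>Z\<^sup>n\<close>.\<close>

definition int_lattice :: "(real ^ 'n) set" where
  "int_lattice = {x. \<forall>i. x $ i \<in> \<int>}"

definition primitive_vec :: "real ^ 'n \<Rightarrow> bool" where
  "primitive_vec u \<longleftrightarrow>
     u \<in> int_lattice \<and> (\<forall>m::int. \<forall>w\<in>int_lattice. u = of_int m *\<^sub>R w \<longrightarrow> \<bar>m\<bar> = 1)"

definition integral_polytope :: "(real ^ 'n) set \<Rightarrow> bool" where
  "integral_polytope \<Delta> \<longleftrightarrow> polytope \<Delta> \<and> (\<forall>v. v extreme_point_of \<Delta> \<longrightarrow> v \<in> int_lattice)"

text \<open>Full dimension does not follow from the edge count: a 3-dimensional octahedron in \<open>R\<^sup>4\<close>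
  has four edges at each vertex.\<close>

definition simple_polytope :: "(real ^ 'n) set \<Rightarrow> bool" where
  "simple_polytope \<Delta> \<longleftrightarrow> polytope \<Delta> \<and> aff_dim \<Delta> = int CARD('n) \<and>
     (\<forall>v. v extreme_point_of \<Delta> \<longrightarrow> card {e. e edge_of \<Delta> \<and> v \<in> e} = CARD('n))"

definition shifted_polytope ::
    "nat \<Rightarrow> (nat \<Rightarrow> real ^ 'n) \<Rightarrow> (nat \<Rightarrow> real) \<Rightarrow> (nat \<Rightarrow> real) \<Rightarrow> (real ^ 'n) set" where
  "shifted_polytope d u \<mu> h = {x. \<forall>i\<in>{1..d}. u i \<bullet> x + \<mu> i + h i \<ge> 0}"

definition nth_facet ::
    "(real ^ 'n) set \<Rightarrow> (nat \<Rightarrow> real ^ 'n) \<Rightarrow> (nat \<Rightarrow> real) \<Rightarrow> nat \<Rightarrow> (real ^ 'n) set" where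
  "nth_facet \<Delta> u \<mu> i = {x \<in> \<Delta>. u i \<bullet> x + \<mu> i = 0}"

definition facet_presentation ::
    "(real ^ 'n) set \<Rightarrow> nat \<Rightarrow> (nat \<Rightarrow> real ^ 'n) \<Rightarrow> (nat \<Rightarrow> real) \<Rightarrow> bool" where
  "facet_presentation \<Delta> d u \<mu> \<longleftrightarrow>
     \<Delta> = {x. \<forall>i\<in>{1..d}. u i \<bullet> x + \<mu> i \<ge> 0} \<and>
     bij_betw (nth_facet \<Delta> u \<mu>) {1..d} {F. F facet_of \<Delta>} \<and>
     (\<forall>i\<in>{1..d}. primitive_vec (u i))"

definition faces :: "(real ^ 'n) set \<Rightarrow> (real ^ 'n) set set" where
  "faces \<Delta> = {F. F face_of \<Delta> \<and> F \<noteq> {}}"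

definition facet_ix :: "(real ^ 'n) set \<Rightarrow> nat \<Rightarrow> (nat \<Rightarrow> real ^ 'n) \<Rightarrow> (nat \<Rightarrow> real) \<Rightarrow>
    (real ^ 'n) set \<Rightarrow> nat set" where
  "facet_ix \<Delta> d u \<mu> F = {i \<in> {1..d}. F \<subseteq> nth_facet \<Delta> u \<mu> i}"

definition point_weight :: "(real ^ 'n) set \<Rightarrow> real ^ 'n \<Rightarrow> real" where
  "point_weight \<Delta> x =
     (let F = (THE F. F \<in> faces \<Delta> \<and> x \<in> rel_interior F)
      in 1 / 2 ^ nat (aff_dim \<Delta> - aff_dim F))"

definition weighted_sum :: "(real ^ 'n) set \<Rightarrow> (real ^ 'n \<Rightarrow> complex) \<Rightarrow> complex" where
  "weighted_sum \<Delta> f = (\<Sum>x\<in>\<Delta> \<inter> int_lattice. complex_of_real (point_weight \<Delta> x) * f x)"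


section \<open>The finite groups and their characters\<close>

text \<open>For an index set \<open>I\<close> the group is \<open>saturated_lattice u I\<close> modulo \<open>generated_lattice u I\<close>;
  its elements are cosets, and \<open>group_map u I\<close> is the natural map into it from the
  group of any smaller index set.\<close>

definition saturated_lattice :: "(nat \<Rightarrow> real ^ 'n) \<Rightarrow> nat set \<Rightarrow> (real ^ 'n) set" where
  "saturated_lattice u I = span (u ` I) \<inter> int_lattice"

definition generated_lattice :: "(nat \<Rightarrow> real ^ 'n) \<Rightarrow> nat set \<Rightarrow> (real ^ 'n) set" where
  "generated_lattice u I = range (\<lambda>c :: nat \<Rightarrow> int. \<Sum>i\<in>I. of_int (c i) *\<^sub>R u i)"

definition coset_rel :: "(nat \<Rightarrow> real ^ 'n) \<Rightarrow> nat set \<Rightarrow> (real ^ 'n) rel" where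
  "coset_rel u I = {(a, b). a \<in> saturated_lattice u I \<and> b \<in> saturated_lattice u I \<and>
                            a - b \<in> generated_lattice u I}"

definition Gamma_group :: "(nat \<Rightarrow> real ^ 'n) \<Rightarrow> nat set \<Rightarrow> (real ^ 'n) set set" where
  "Gamma_group u I = saturated_lattice u I // coset_rel u I"

definition group_map :: "(nat \<Rightarrow> real ^ 'n) \<Rightarrow> nat set \<Rightarrow> (real ^ 'n) set \<Rightarrow> (real ^ 'n) set" where
  "group_map u I \<gamma> = coset_rel u I `` \<gamma>"

definition Gamma_flat :: "(real ^ 'n) set \<Rightarrow> nat \<Rightarrow> (nat \<Rightarrow> real ^ 'n) \<Rightarrow> (nat \<Rightarrow> real) \<Rightarrow>
    (real ^ 'n) set \<Rightarrow> (real ^ 'n) set set" where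
  "Gamma_flat \<Delta> d u \<mu> F =
     Gamma_group u (facet_ix \<Delta> d u \<mu> F) -
     (\<Union>E \<in> {E \<in> faces \<Delta>. F \<subset> E}.
        group_map u (facet_ix \<Delta> d u \<mu> F) ` Gamma_group u (facet_ix \<Delta> d u \<mu> E))"

definition dual_basis_vec :: "(nat \<Rightarrow> real ^ 'n) \<Rightarrow> nat set \<Rightarrow> nat \<Rightarrow> real ^ 'n" where
  "dual_basis_vec u I j = (THE a. \<forall>i\<in>I. u i \<bullet> a = (if i = j then 1 else 0))"

definition lambda_vertex :: "(nat \<Rightarrow> real ^ 'n) \<Rightarrow> nat set \<Rightarrow> (real ^ 'n) set \<Rightarrow> nat \<Rightarrow> complex" where
  "lambda_vertex u I \<gamma> j =
     exp (2 * complex_of_real pi * \<i> * complex_of_real ((SOME g. g \<in> \<gamma>) \<bullet> dual_basis_vec u I j))"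

definition lambda_face :: "(real ^ 'n) set \<Rightarrow> nat \<Rightarrow> (nat \<Rightarrow> real ^ 'n) \<Rightarrow> (nat \<Rightarrow> real) \<Rightarrow>
    (real ^ 'n) set \<Rightarrow> (real ^ 'n) set \<Rightarrow> nat \<Rightarrow> complex" where
  "lambda_face \<Delta> d u \<mu> F \<gamma> j =
     (if j \<in> facet_ix \<Delta> d u \<mu> F then
        let v = (SOME v. v extreme_point_of \<Delta> \<and> v \<in> F);
            I = facet_ix \<Delta> d u \<mu> {v}
        in lambda_vertex u I (group_map u I \<gamma>) j
      else 1)"


section \<open>The distributions \<open>Q\<close> and the polynomials \<open>M\<close>\<close>

definition test_function :: "(real \<Rightarrow> complex) \<Rightarrow> bool" where
  "test_function \<phi> \<longleftrightarrow>
     (\<forall>m x. ((\<lambda>g t. vector_derivative g (at t)) ^^ m) \<phi> differentiable (at x)) \<and>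
     (\<exists>R. \<forall>x. \<bar>x\<bar> > R \<longrightarrow> \<phi> x = 0)"

type_synonym distribution = "(real \<Rightarrow> complex) \<Rightarrow> complex"

definition distr_of :: "(real \<Rightarrow> complex) \<Rightarrow> distribution" where
  "distr_of f \<phi> = integral UNIV (\<lambda>x. f x * \<phi> x)"

definition distr_deriv :: "distribution \<Rightarrow> distribution" where
  "distr_deriv T \<phi> = - T (\<lambda>x. vector_derivative \<phi> (at x))"

definition Q_zero :: "complex \<Rightarrow> distribution" where
  "Q_zero l \<phi> = - (\<Sum>\<^sub>\<infinity>n\<in>(UNIV :: int set). (l powi n) * \<phi> (of_int n))"

definition root_order :: "complex \<Rightarrow> nat" where
  "root_order l = (LEAST N. N > 0 \<and> l ^ N = 1)"

text \<open>The functions \<open>Q m\<close> for \<open>m \<ge> 1\<close>. The value \<open>Q 0\<close> plays no role, as the zeroth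
  distribution is not a function. The conditions determine \<open>Q 1\<close> almost everywhere and, by
  continuity, \<open>Q m\<close> everywhere for \<open>m \<ge> 2\<close>.\<close>

definition Q_family :: "complex \<Rightarrow> (nat \<Rightarrow> real \<Rightarrow> complex) \<Rightarrow> bool" where
  "Q_family l Q \<longleftrightarrow>
     (\<forall>m\<ge>1. (\<forall>a b. Q m absolutely_integrable_on {a..b}) \<and>
             (\<forall>x. Q m (x + real (root_order l)) = Q m x) \<and>
             integral {0..real (root_order l)} (Q m) = 0 \<and>
             (\<forall>\<phi>. test_function \<phi> \<longrightarrow>
                distr_deriv (distr_of (Q m)) \<phi> =
                  (if m = 1 then Q_zero l else distr_of (Q (m - 1))) \<phi>)) \<and>
     (\<forall>m\<ge>2. continuous_on UNIV (Q m))"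

definition Q_fun :: "complex \<Rightarrow> nat \<Rightarrow> real \<Rightarrow> complex" where
  "Q_fun l = (SOME Q. Q_family l Q)"

definition fps_sinh :: "complex \<Rightarrow> complex fps" where
  "fps_sinh c = fps_const (1 / 2) * (fps_exp c - fps_exp (- c))"

definition fps_cosh :: "complex \<Rightarrow> complex fps" where
  "fps_cosh c = fps_const (1 / 2) * (fps_exp c + fps_exp (- c))"

definition L_series :: "complex fps" where
  "L_series = (fps_const (1 / 2) * fps_X) / (fps_sinh (1 / 2) / fps_cosh (1 / 2))"

definition M_poly :: "nat \<Rightarrow> complex \<Rightarrow> complex poly" where
  "M_poly k l =
     (if l = 1 then \<Sum>m\<le>2 * (k div 2). monom (fps_nth L_series m) m
      else monom (1 / 2 + l / (1 - l)) 1 + (\<Sum>m = 2..k. monom (Q_fun l m 0) m))"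


section \<open>The differential operators\<close>

definition partial_h :: "nat \<Rightarrow> ((nat \<Rightarrow> real) \<Rightarrow> complex) \<Rightarrow> (nat \<Rightarrow> real) \<Rightarrow> complex" where
  "partial_h j G h = vector_derivative (\<lambda>t. G (h(j := t))) (at (h j))"

definition poly_diff_op ::
    "complex poly \<Rightarrow> nat \<Rightarrow> ((nat \<Rightarrow> real) \<Rightarrow> complex) \<Rightarrow> (nat \<Rightarrow> real) \<Rightarrow> complex" where
  "poly_diff_op P j G h = (\<Sum>m\<le>Polynomial.degree P. coeff P m * (partial_h j ^^ m) G h)"

definition M_op :: "(real ^ 'n) set \<Rightarrow> nat \<Rightarrow> (nat \<Rightarrow> real ^ 'n) \<Rightarrow> (nat \<Rightarrow> real) \<Rightarrow> nat \<Rightarrow>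
    (real ^ 'n) set \<Rightarrow> (real ^ 'n) set \<Rightarrow> ((nat \<Rightarrow> real) \<Rightarrow> complex) \<Rightarrow> (nat \<Rightarrow> real) \<Rightarrow> complex" where
  "M_op \<Delta> d u \<mu> k F \<gamma> =
     foldr (\<lambda>j. poly_diff_op (M_poly k (lambda_face \<Delta> d u \<mu> F \<gamma> j)) j) [1..<Suc d]"

end

theory Submission
  imports Defs
begin

text \<open>
  Both sides are linear in \<open>p\<close>, so it is enough to treat powers \<open>\<langle>\<xi>, x\<rangle>\<^sup>m\<close> of linear forms, for
  \<open>\<xi>\<close> in the open dense set of \<^emph>\<open>generic\<close> directions, those not orthogonal to any edge: by
  polarisation (\<open>monomial_times_power_EM\<close>) such powers span all polynomials of degree \<open>m\<close>. These
  powers are the Taylor coefficients in \<open>t\<close> of the exponentials \<open>exp (t \<langle>\<xi>, x\<rangle>)\<close>, whose integrals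
  and lattice sums have closed forms supported at the vertices.

  The closed forms come from a polar decomposition. The edges at a vertex \<open>v\<close> span a simplicial
  cone; flip those along which \<open>\<xi>\<close> increases and attach a sign. Then the indicator function of
  \<open>\<Delta>(h)\<close>, for every small shift \<open>h\<close>, is the signed sum of the indicator functions of these cones
  (\<open>polar_indicator\<close>), and averaging over shifts of the facets through a point gives the same identity for
  the weights \<open>2\<^bsup>-c\<^esup>\<close> (\<open>polar_weighted\<close>). On each flipped cone the exponential decays. In the coordinates
  given by the distances to the facets at \<open>v\<close>, the integral over the cone is a product of elementary
  integrals divided by the order of \<open>\<Gamma>\<^sub>v\<close> (\<open>has_bochner_integral_cone\<close>), and the lattice points are a
  sublattice of \<open>\<int>\<^sup>n\<close> that is cut out by the characters of \<open>\<Gamma>\<^sub>v\<close>, so the weighted sum is the average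
  over \<open>\<gamma> \<in> \<Gamma>\<^sub>v\<close> of products of geometric series
  \<open>1/2 \<cdot> (1 + \<lambda> exp (- s)) / (1 - \<lambda> exp (- s))\<close> (\<open>has_sum_lattice_cone\<close>).

  The link between the two is that \<open>s\<close> times this geometric series has the Taylor series
  \<open>Todd_fps \<lambda>\<close>, of which \<open>M\<^bsup>k,\<lambda>\<^esup>\<close> is a truncation (\<open>coeff_M_poly\<close>). For \<open>\<lambda> = 1\<close> this is the definition
  of \<open>L\<close>. For \<open>\<lambda> \<noteq> 1\<close> the numbers \<open>Q\<^sub>m(0)\<close> must be computed: an explicit periodic
  piecewise polynomial family with generating function \<open>\<lambda> / (exp S - \<lambda>)\<close> satisfies the distributional conditions
  (\<open>Q_family_Q_val\<close>), and these conditions determine the values at \<open>0\<close> (\<open>Q_family_unique\<close>).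

  Comparing coefficients of \<open>t\<^bsup>m+n\<^esup>\<close>, the integral of \<open>\<langle>\<xi>, x\<rangle>\<^sup>m\<close> over \<open>\<Delta>(h)\<close> is a sum over the
  vertices of coefficients of exponentials in \<open>h\<close>, on which a differential operator in \<open>h\<close> acts as
  multiplication by its symbol (\<open>foldr_poly_diff_op_exp_coeff\<close>), and the truncation at \<open>k > m + n\<close> does
  not touch the coefficient of \<open>t\<^bsup>m+n\<^esup>\<close>. Since \<open>M\<^bsup>k,\<lambda>\<^esup>\<close> has constant term \<open>1\<close> for \<open>\<lambda> = 1\<close> and \<open>0\<close>
  otherwise, the operator of a face \<open>F\<close> and \<open>\<gamma> \<in> \<Gamma>\<^sub>F\<^sup>\<flat>\<close> sees exactly the vertices of \<open>F\<close>
  (\<open>face_op_at_vertex\<close>). At a vertex \<open>v\<close> the sets \<open>\<Gamma>\<^sub>F\<^sup>\<flat>\<close> of the faces \<open>F\<close> through \<open>v\<close> partition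
  \<open>\<Gamma>\<^sub>v\<close> (\<open>sum_cell_by_faces\<close>), so the contributions add up to the vertex term of the lattice sum.
\<close>

section \<open>The cone spanned by the edges at a vertex\<close>

definition half_weight :: "real \<Rightarrow> real" where
  "half_weight y = (if y > 0 then 1 else if y = 0 then 1/2 else 0)"

lemma minimal_face_containing_point:
  fixes P :: "'a::euclidean_space set"
  assumes "polytope P" "y \<in> P"
  obtains F where "F face_of P" "y \<in> rel_interior F"
proof -
  define F where "F = \<Inter>{F. F face_of P \<and> y \<in> F}"
  have ne: "{F. F face_of P \<and> y \<in> F} \<noteq> {}"
    using assms face_of_refl polytope_imp_convex by fastforce
  have F: "F face_of P"
    unfolding F_def by (rule face_of_Inter[OF ne]) auto
  have y: "y \<in> F" by (auto simp: F_def)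
  have "polyhedron F"
    using F assms(1) face_of_polytope_polytope polytope_imp_polyhedron by blast
  have "y \<in> rel_interior F"
  proof (rule ccontr)
    assume "y \<notin> rel_interior F"
    then obtain G where G: "G facet_of F" "y \<in> G"
      using y rel_interior_of_polyhedron[OF \<open>polyhedron F\<close>] by blast
    have "G face_of P"
      using G(1) F facet_of_imp_face_of face_of_trans by blast
    then have "F \<subseteq> G" using G(2) by (auto simp: F_def)
    then show False
      using G(1) by (metis facet_of_imp_subset facet_of_irrefl subset_antisym)
  qed
  then show ?thesis using that F by blast
qed

lemma center_in_open_segment:
  fixes v z :: "'a::euclidean_space"
  assumes "z \<noteq> 0"
  shows "v \<in> open_segment (v + z) (v - z)"
proof -
  have "midpoint (v + z) (v - z) = v"
    by (simp add: midpoint_def algebra_simps flip: scaleR_add_left)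
  moreover have "v + z \<noteq> v - z"
  proof
    assume "v + z = v - z"
    then have "(1 + 1) *\<^sub>R z = 0" unfolding scaleR_add_left by (simp add: algebra_simps eq_neg_iff_add_eq_0)
    then show False using assms by simp
  qed
  ultimately show ?thesis by (metis midpoint_in_open_segment)
qed

text \<open>
  A point in the relative interior of a face of dimension at least two can be moved in two opposite
  directions inside the face and a given hyperplane. So the extreme points of a hyperplane
  section of a polytope lie on its vertices and edges.\<close>
lemma face_low_dim_if_slice_extreme:
  fixes F :: "'a::euclidean_space set"
  assumes y: "y \<in> rel_interior F" and "a \<bullet> y = b"
    and ext: "y extreme_point_of (F \<inter> {x. a \<bullet> x = b})"
  shows "aff_dim F \<le> 1"
proof (rule ccontr)
  assume "\<not> aff_dim F \<le> 1"
  then have d2: "aff_dim F \<ge> 2" by simp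
  have yF: "y \<in> F" using y rel_interior_subset by blast
  define L where "L = (\<lambda>x. x - y) ` (affine hull F)"
  have L: "subspace L"
    unfolding L_def using yF affine_diffs_subspace_subtract[of "affine hull F" y]
    by (simp add: hull_inc)
  have "int (dim L) = aff_dim F"
  proof -
    have "aff_dim F = int (dim ((+) (-y) ` F))"
      using aff_dim_eq_dim[of y F] yF by (simp add: hull_inc)
    also have "dim ((+) (-y) ` F) = dim (span ((+) (-y) ` F))" by simp
    also have "span ((+) (-y) ` F) = affine hull ((+) (-y) ` F)"
      using yF by (intro affine_hull_span_0[symmetric] hull_inc) (auto intro!: image_eqI[of _ _ y])
    also have "\<dots> = (+) (-y) ` (affine hull F)"
      by (rule affine_hull_translation)
    finally show ?thesis by (simp add: L_def image_def algebra_simps)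
  qed
  then have "dim L > 1" using d2 by simp
  then have "\<exists>z\<in>L. z \<noteq> 0 \<and> a \<bullet> z = 0"
  proof -
    have "dim (L \<inter> {x. a \<bullet> x = 0}) > 0"
    proof -
      have "dim {x + z |x z. x \<in> L \<and> z \<in> {x. a \<bullet> x = 0}} + dim (L \<inter> {x. a \<bullet> x = 0})
        = dim L + dim {x. a \<bullet> x = 0}"
        by (rule dim_sums_Int[OF L subspace_hyperplane])
      moreover have "dim {x + z |x z. x \<in> L \<and> z \<in> {x. a \<bullet> x = 0}} \<le> DIM('a)"
        by (rule dim_subset_UNIV)
      moreover have "dim {x. a \<bullet> x = 0} \<ge> DIM('a) - 1"
        by (cases "a = 0") (auto simp: dim_hyperplane)
      ultimately show ?thesis using \<open>dim L > 1\<close> by linarith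
    qed
    then have "\<not> L \<inter> {x. a \<bullet> x = 0} \<subseteq> {0}"
      by (metis dim_eq_0 less_numeral_extra(3))
    then show ?thesis by auto
  qed
  then obtain z where z: "z \<in> L" "z \<noteq> 0" "a \<bullet> z = 0" by blast
  obtain e where e: "e > 0" "ball y e \<inter> affine hull F \<subseteq> F"
    using y mem_rel_interior_ball by blast
  define s where "s = e / (2 * norm z)"
  have s: "s > 0" using e z by (simp add: s_def)
  have aff: "y + t *\<^sub>R z \<in> affine hull F" for t
  proof -
    have "t *\<^sub>R z \<in> L" using z L subspace_scale by blast
    then show ?thesis by (auto simp: L_def)
  qed
  have inF: "y + t *\<^sub>R z \<in> F \<inter> {x. a \<bullet> x = b}" if "\<bar>t\<bar> = s" for t
  proof -
    have "norm (t *\<^sub>R z) < e" using that e z by (simp add: s_def)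
    then have "y + t *\<^sub>R z \<in> ball y e" by (simp add: dist_norm)
    then show ?thesis using aff e assms(2) z by (auto simp: inner_add_right)
  qed
  have "y \<in> open_segment (y + s *\<^sub>R z) (y + (- s) *\<^sub>R z)"
    using center_in_open_segment[of "s *\<^sub>R z" y] s z by simp
  then show False
    using ext inF[of s] inF[of "-s"] s unfolding extreme_point_of_def by auto
qed

text \<open>
  Cut the polytope by a hyperplane that separates \<open>v\<close> from the other vertices. The section is the
  convex hull of its extreme points, and those lie on edges at \<open>v\<close>; every point of the
  polytope lies on a ray from \<open>v\<close> through the section.\<close>
lemma polytope_subset_edge_cone:
  fixes P :: "'a::euclidean_space set"
  assumes P: "polytope P" and v: "v extreme_point_of P"
  shows "\<exists>r. (\<forall>e. e edge_of P \<and> v \<in> e \<longrightarrow> v + r e \<in> P) \<and>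
    (\<forall>x\<in>P. \<exists>c. (\<forall>e. c e \<ge> 0) \<and> x - v = (\<Sum>e | e edge_of P \<and> v \<in> e. c e *\<^sub>R r e))"
proof -
  define E where "E = {e. e edge_of P \<and> v \<in> e}"
  have finE: "finite E"
    by (rule finite_subset[OF _ finite_polytope_faces[OF P]]) (auto simp: E_def edge_of_def)
  define W where "W = {x. x extreme_point_of P}"
  have finW: "finite W"
    using P W_def finite_polyhedron_extreme_points polytope_imp_polyhedron by blast
  have hullW: "P = convex hull W"
    unfolding W_def
    by (rule Krein_Milman_Minkowski[OF polytope_imp_compact[OF P] polytope_imp_convex[OF P]])
  have vP: "v \<in> P" using v by (auto simp: extreme_point_of_def)
  have vW: "v \<in> W" using v by (simp add: W_def)
  have "\<exists>p\<in>e. p \<noteq> v" if "e \<in> E" for e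
  proof (rule ccontr)
    assume "\<not> ?thesis"
    then have "e \<subseteq> {v}" by blast
    then have "aff_dim e \<le> 0" by (metis aff_dim_sing aff_dim_subset)
    then show False using that by (simp add: E_def edge_of_def)
  qed
  then obtain p where p: "\<And>e. e \<in> E \<Longrightarrow> p e \<in> e" "\<And>e. e \<in> E \<Longrightarrow> p e \<noteq> v" by metis
  define r where "r e = p e - v" for e
  have rP: "v + r e \<in> P" if "e \<in> E" for e
    using that p[OF that] edge_of_imp_subset by (fastforce simp: r_def E_def)
  \<comment> \<open>Every point of an edge at \<open>v\<close> is a nonnegative multiple of the chosen direction away from it.\<close>
  have edge_ray: "\<exists>s\<ge>0. y = v + s *\<^sub>R r e" if e: "e \<in> E" "y \<in> e" for e y
  proof -
    have ve: "v \<in> e" using e by (simp add: E_def)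
    have "collinear e" using e by (simp add: E_def edge_of_def collinear_aff_dim)
    then have "collinear {p e, y, v}"
      by (rule collinear_subset) (use ve e p in auto)
    then obtain s where "y = s *\<^sub>R p e + (1 - s) *\<^sub>R v"
      using p(2)[OF e(1)] unfolding collinear_3_expand by blast
    then have "y = v + s *\<^sub>R r e" by (simp add: r_def algebra_simps)
    moreover have "s \<ge> 0"
    proof (rule ccontr)
      assume "\<not> s \<ge> 0"
      then have s: "s < 0" by simp
      have yP: "y \<in> P" using e by (auto simp: E_def edge_of_def dest: face_of_imp_subset)
      let ?t = "- s / (1 - s)"
      have t: "0 < ?t" "?t < 1" using s by (auto simp: field_simps)
      have "(1 - ?t) *\<^sub>R y + ?t *\<^sub>R (v + r e) = v + ((1 - ?t) * s + ?t) *\<^sub>R r e"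
        unfolding \<open>y = v + s *\<^sub>R r e\<close> by (simp add: algebra_simps)
      also have "(1 - ?t) * s + ?t = 0" using s by (simp add: field_simps)
      finally have "v = (1 - ?t) *\<^sub>R y + ?t *\<^sub>R (v + r e)" by simp
      moreover have "y \<noteq> v + r e"
      proof
        assume "y = v + r e"
        then have "(1 - s) *\<^sub>R r e = 0" using \<open>y = v + s *\<^sub>R r e\<close> by (simp add: algebra_simps)
        then show False using s p[OF e(1)] by (simp add: r_def)
      qed
      ultimately have "v \<in> open_segment y (v + r e)"
        using t unfolding in_segment by blast
      then show False using v yP rP[OF e(1)] by (auto simp: extreme_point_of_def)
    qed
    ultimately show ?thesis by blast
  qed
  \<comment> \<open>The cone with apex \<open>v\<close> spanned by the edges; the hyperplane section lies in it.\<close>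
  define K where "K = {z. \<exists>c. (\<forall>e. c e \<ge> 0) \<and> z - v = (\<Sum>e\<in>E. c e *\<^sub>R r e)}"
  have Kconv: "convex K"
  proof (rule convexI)
    fix x y :: 'a and s t :: real
    assume "x \<in> K" "y \<in> K" and st: "0 \<le> s" "0 \<le> t" "s + t = 1"
    then obtain c c' where c: "\<forall>e. c e \<ge> 0" "x - v = (\<Sum>e\<in>E. c e *\<^sub>R r e)"
      "\<forall>e. c' e \<ge> 0" "y - v = (\<Sum>e\<in>E. c' e *\<^sub>R r e)" by (auto simp: K_def)
    have "s *\<^sub>R x + t *\<^sub>R y - v = s *\<^sub>R x + t *\<^sub>R y - (s + t) *\<^sub>R v"
      using st by simp
    also have "\<dots> = s *\<^sub>R (x - v) + t *\<^sub>R (y - v)"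
      by (simp add: algebra_simps)
    also have "\<dots> = (\<Sum>e\<in>E. (s * c e + t * c' e) *\<^sub>R r e)"
      by (simp add: c scaleR_sum_right sum.distrib scaleR_add_left)
    finally show "s *\<^sub>R x + t *\<^sub>R y \<in> K"
      unfolding K_def using c st by (auto intro!: exI[of _ "\<lambda>e. s * c e + t * c' e"])
  qed
  have Kray: "v + s *\<^sub>R (z - v) \<in> K" if "z \<in> K" "s \<ge> 0" for s z
  proof -
    obtain c where "\<forall>e. c e \<ge> 0" "z - v = (\<Sum>e\<in>E. c e *\<^sub>R r e)"
      using \<open>z \<in> K\<close> by (auto simp: K_def)
    then show ?thesis using that(2)
      by (auto simp: K_def scaleR_sum_right intro!: exI[of _ "\<lambda>e. s * c e"])
  qed
  have vK: "v \<in> K" by (auto simp: K_def intro!: exI[of _ "\<lambda>_. 0"])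
  have "P \<subseteq> K"
  proof (cases "W = {v}")
    case True
    then show ?thesis using hullW vK by simp
  next
    case False
    let ?C = "convex hull (W - {v})"
    have Cne: "W - {v} \<noteq> {}" using False vW by blast
    have "convex (P - {v})"
      using v by (simp add: extreme_point_of_stillconvex polytope_imp_convex[OF P])
    then have "?C \<subseteq> P - {v}"
      by (intro hull_minimal) (use hullW in \<open>auto intro: hull_inc\<close>)
    then have "v \<notin> ?C" by blast
    moreover have "closed ?C"
      using finW by (simp add: compact_imp_closed finite_imp_compact_convex_hull)
    \<comment> \<open>The hyperplane of the section.\<close>
    ultimately obtain a b where ab: "a \<bullet> v < b" "\<And>x. x \<in> ?C \<Longrightarrow> a \<bullet> x > b"
      using separating_hyperplane_closed_point[OF convex_convex_hull] by blast
    let ?H = "{x. a \<bullet> x = b}"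
    have Qc: "compact (P \<inter> ?H)" "convex (P \<inter> ?H)"
      using P by (auto intro!: compact_Int_closed closed_hyperplane convex_Int convex_hyperplane
          simp: polytope_imp_compact polytope_imp_convex)
    have extK: "y \<in> K" if y: "y extreme_point_of (P \<inter> ?H)" for y
    proof -
      have yP: "y \<in> P" "a \<bullet> y = b" using y by (auto simp: extreme_point_of_def)
      then obtain F where F: "F face_of P" "y \<in> rel_interior F"
        using minimal_face_containing_point[OF P] by blast
      have yF: "y \<in> F" using F rel_interior_subset by blast
      have "y extreme_point_of (F \<inter> ?H)"
        using y yF yP face_of_imp_subset[OF F(1)] by (auto simp: extreme_point_of_def)
      then have le1: "aff_dim F \<le> 1"
        using face_low_dim_if_slice_extreme[OF F(2) yP(2)] by blast
      have polyF: "polytope F" using face_of_polytope_polytope[OF P F(1)] .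
      have Fhull: "F = convex hull {x. x extreme_point_of F}"
        by (rule Krein_Milman_Minkowski[OF polytope_imp_compact[OF polyF] polytope_imp_convex[OF polyF]])
      have extF: "{x. x extreme_point_of F} \<subseteq> W"
        using extreme_point_of_face[OF F(1)] by (auto simp: W_def)
      \<comment> \<open>A face that avoids \<open>v\<close> lies entirely beyond the hyperplane.\<close>
      have vF: "v \<in> F"
      proof (rule ccontr)
        assume "v \<notin> F"
        then have "{x. x extreme_point_of F} \<subseteq> W - {v}"
          using extF by (auto simp: extreme_point_of_def)
        then have "F \<subseteq> ?C" using Fhull hull_mono by blast
        then show False using ab(2)[of y] yF yP by auto
      qed
      have "aff_dim F \<noteq> 0"
      proof
        assume "aff_dim F = 0"
        then obtain q where "F = {q}" using aff_dim_eq_0 by blast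
        then have "v = y" using vF yF by auto
        then show False using ab yP by simp
      qed
      moreover have "aff_dim F \<ge> 0"
        using yF by (metis aff_dim_negative_iff empty_iff linorder_not_less)
      ultimately have "F \<in> E" using le1 F vF by (simp add: E_def edge_of_def)
      then obtain s where s: "s \<ge> 0" "y = v + s *\<^sub>R r F" using edge_ray yF by blast
      show ?thesis
        unfolding K_def using s finE \<open>F \<in> E\<close>
        by (auto intro!: exI[of _ "\<lambda>e. if e = F then s else 0"] simp: if_distrib[of "\<lambda>c. c *\<^sub>R _"] sum.delta cong: if_cong)
    qed
    have QK: "P \<inter> ?H \<subseteq> K"
    proof -
      have "convex hull {y. y extreme_point_of (P \<inter> ?H)} \<subseteq> K"
        by (rule hull_minimal) (use extK Kconv in auto)
      then show ?thesis using Krein_Milman_Minkowski[OF Qc] by simp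
    qed
    show "P \<subseteq> K"
    proof
      fix x assume "x \<in> P"
      then have "x \<in> convex hull (insert v (W - {v}))"
        using hullW vW by (simp add: insert_absorb)
      then obtain s z where sz: "0 \<le> s" "z \<in> ?C" "x = (1 - s) *\<^sub>R v + s *\<^sub>R z" "s \<le> 1"
        using convex_hull_insert[OF Cne, of v] by (auto simp: eq_diff_eq[symmetric])
      \<comment> \<open>The segment from \<open>v\<close> to \<open>z\<close> meets the hyperplane at the parameter \<open>\<tau>\<close>.\<close>
      define \<tau> where "\<tau> = (b - a \<bullet> v) / (a \<bullet> z - a \<bullet> v)"
      have \<tau>: "0 < \<tau>" "\<tau> < 1" "\<tau> * (a \<bullet> z - a \<bullet> v) = b - a \<bullet> v"
        using ab ab(2)[OF sz(2)] by (auto simp: \<tau>_def field_simps)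
      define y where "y = (1 - \<tau>) *\<^sub>R v + \<tau> *\<^sub>R z"
      have "z \<in> P" using sz(2) hullW hull_mono[of "W - {v}" W convex] by blast
      then have "y \<in> P" unfolding y_def
        using vP \<tau> polytope_imp_convex[OF P] by (intro convexD) auto
      moreover have "a \<bullet> y = b"
        using \<tau>(3) by (simp add: y_def inner_add_right algebra_simps)
      ultimately have "y \<in> K" using QK by blast
      then have "v + (s / \<tau>) *\<^sub>R (y - v) \<in> K" using sz \<tau> by (intro Kray) auto
      moreover have "y - v = \<tau> *\<^sub>R (z - v)" by (simp add: y_def algebra_simps)
      then have "v + (s / \<tau>) *\<^sub>R (y - v) = v + s *\<^sub>R (z - v)" using \<tau> by simp
      moreover have "x = v + s *\<^sub>R (z - v)" using sz(3) by (simp add: algebra_simps)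
      ultimately show "x \<in> K" by simp
    qed
  qed
  then show ?thesis
    using rP by (intro exI[of _ r]) (auto simp: K_def E_def)
qed

section \<open>Simple polytopes\<close>

lemma linear_eq_on_spanning_inner:
  fixes x y :: "'a::euclidean_space"
  assumes "span B = UNIV" "\<And>b. b \<in> B \<Longrightarrow> b \<bullet> x = b \<bullet> y"
  shows "x = y"
proof -
  have "b \<bullet> x = b \<bullet> y" if "b \<in> span B" for b
    using that
    by (induction rule: span_induct_alt) (auto simp: inner_add_left assms(2))
  then show ?thesis using assms(1) by (metis UNIV_I vector_eq_ldot)
qed

text \<open>The coordinate functional of \<open>b\<close> is represented by a vector.\<close>
lemma dual_basis_exists:
  fixes B :: "'a::euclidean_space set"
  assumes "independent B" "span B = UNIV" "b \<in> B"
  shows "\<exists>a. \<forall>c\<in>B. c \<bullet> a = (if c = b then 1 else 0)"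
proof -
  obtain g where g: "linear g" "\<forall>c\<in>B. g c = (if c = b then 1 else (0::real))"
    using linear_independent_extend[OF assms(1), of "\<lambda>c. if c = b then 1 else (0::real)"] by blast
  have "g c = c \<bullet> adjoint g 1" for c
    using adjoint_works[OF g(1), of c 1] by (simp add: inner_commute)
  then show ?thesis using g by metis
qed

locale presented_polytope =
  fixes \<Delta> :: "(real ^ 'n) set" and d :: nat and u :: "nat \<Rightarrow> real ^ 'n" and \<mu> :: "nat \<Rightarrow> real"
  assumes simple: "simple_polytope \<Delta>" and presentation: "facet_presentation \<Delta> d u \<mu>"
begin

text \<open>The lattice distance from \<open>x\<close> to the \<open>i\<close>-th facet, because the normals are primitive.\<close>
abbreviation slack :: "nat \<Rightarrow> real ^ 'n \<Rightarrow> real" where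
  "slack i x \<equiv> u i \<bullet> x + \<mu> i"

definition vertices :: "(real ^ 'n) set" where
  "vertices = {v. v extreme_point_of \<Delta>}"

abbreviation tight :: "real ^ 'n \<Rightarrow> nat set" where
  "tight v \<equiv> facet_ix \<Delta> d u \<mu> {v}"

lemma Delta_eq: "\<Delta> = {x. \<forall>i\<in>{1..d}. slack i x \<ge> 0}"
  using presentation unfolding facet_presentation_def by (elim conjE)

lemma Delta_iff: "x \<in> \<Delta> \<longleftrightarrow> (\<forall>i\<in>{1..d}. slack i x \<ge> 0)"
  by (subst Delta_eq) simp

lemma polytope_Delta: "polytope \<Delta>" using simple by (simp add: simple_polytope_def)

lemma compact_Delta: "compact \<Delta>" by (simp add: polytope_Delta polytope_imp_compact)

lemma convex_Delta: "convex \<Delta>" by (simp add: polytope_Delta polytope_imp_convex)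

lemma aff_dim_Delta: "aff_dim \<Delta> = int CARD('n)" using simple by (simp add: simple_polytope_def)

lemma vertex_in_Delta: "v \<in> vertices \<Longrightarrow> v \<in> \<Delta>"
  by (simp add: vertices_def extreme_point_of_def)

lemma finite_vertices: "finite vertices"
  unfolding vertices_def
  using polytope_Delta finite_polyhedron_extreme_points polytope_imp_polyhedron by blast

lemma tight_eq: "v \<in> \<Delta> \<Longrightarrow> tight v = {i\<in>{1..d}. slack i v = 0}"
  by (auto simp: facet_ix_def nth_facet_def)

lemma tight_le: "tight v \<subseteq> {1..d}" by (auto simp: facet_ix_def)

lemma finite_tight [simp]: "finite (tight v)" using tight_le finite_subset by blast

lemma slack_nonneg: "x \<in> \<Delta> \<Longrightarrow> i \<in> {1..d} \<Longrightarrow> slack i x \<ge> 0" using Delta_iff by blast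

lemma facets_bij: "bij_betw (nth_facet \<Delta> u \<mu>) {1..d} {F. F facet_of \<Delta>}"
  using presentation unfolding facet_presentation_def by (elim conjE)

lemma facet_nth: "i \<in> {1..d} \<Longrightarrow> nth_facet \<Delta> u \<mu> i facet_of \<Delta>"
  using bij_betwE[OF facets_bij] by blast

lemma nth_facet_inj:
  "i \<in> {1..d} \<Longrightarrow> j \<in> {1..d} \<Longrightarrow> nth_facet \<Delta> u \<mu> i = nth_facet \<Delta> u \<mu> j \<Longrightarrow> i = j"
  using bij_betw_imp_inj_on[OF facets_bij] by (rule inj_onD)

lemma facet_is_nth: "F facet_of \<Delta> \<Longrightarrow> \<exists>i\<in>{1..d}. F = nth_facet \<Delta> u \<mu> i"
  using bij_betw_imp_surj_on[OF facets_bij] by blast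

text \<open>
  A vector orthogonal to all tight normals could be added to and subtracted from \<open>v\<close> in small
  multiples, and \<open>v\<close> would not be extreme.\<close>
lemma span_tight_UNIV:
  assumes v: "v \<in> vertices"
  shows "span (u ` tight v) = UNIV"
proof (rule ccontr)
  assume "span (u ` tight v) \<noteq> UNIV"
  then have "span (u ` tight v) \<subset> UNIV" by blast
  then obtain z where z: "z \<noteq> 0" "\<And>y. y \<in> span (u ` tight v) \<Longrightarrow> orthogonal z y"
    using orthogonal_to_subspace_exists_gen[of "u ` tight v" UNIV] by auto
  have z0: "u i \<bullet> z = 0" if "i \<in> tight v" for i
    using z(2)[of "u i"] that by (simp add: span_base orthogonal_def inner_commute)
  have vD: "v \<in> \<Delta>" using v vertex_in_Delta by blast
  have "\<exists>e>0. \<forall>t. \<bar>t\<bar> \<le> e \<longrightarrow> (\<forall>i\<in>{1..d}. slack i (v + t *\<^sub>R z) \<ge> 0)"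
  proof -
    have "\<forall>\<^sub>F t in at 0. slack i (v + t *\<^sub>R z) \<ge> 0" if i: "i \<in> {1..d}" for i
    proof (cases "i \<in> tight v")
      case True
      then show ?thesis using z0 i slack_nonneg[OF vD i] by (simp add: inner_add_right)
    next
      case False
      then have "slack i v > 0"
        using slack_nonneg[OF vD i] i tight_eq[OF vD] by force
      moreover have "((\<lambda>t. slack i (v + t *\<^sub>R z)) \<longlongrightarrow> slack i (v + 0 *\<^sub>R z)) (at 0)"
        by (intro tendsto_intros)
      ultimately have "\<forall>\<^sub>F t in at 0. slack i (v + t *\<^sub>R z) > 0"
        using order_tendstoD(1)[of _ "slack i v"] by simp
      then show ?thesis by eventually_elim simp
    qed
    then have "\<forall>\<^sub>F t in at 0. \<forall>i\<in>{1..d}. slack i (v + t *\<^sub>R z) \<ge> 0"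
      by (simp add: eventually_ball_finite)
    then obtain e where e: "e > 0" "\<And>t. t \<noteq> 0 \<Longrightarrow> \<bar>t\<bar> < e \<Longrightarrow> \<forall>i\<in>{1..d}. slack i (v + t *\<^sub>R z) \<ge> 0"
      by (auto simp: eventually_at dist_real_def)
    have "\<forall>i\<in>{1..d}. slack i (v + t *\<^sub>R z) \<ge> 0" if "\<bar>t\<bar> \<le> e / 2" for t
      using e that slack_nonneg[OF vD] by (cases "t = 0") auto
    then show ?thesis using half_gt_zero[OF e(1)] by blast
  qed
  then obtain e where e0: "e > 0"
    "\<forall>t. \<bar>t\<bar> \<le> e \<longrightarrow> (\<forall>i\<in>{1..d}. slack i (v + t *\<^sub>R z) \<ge> 0)" by blast
  have e: "e > 0" "\<And>t. \<bar>t\<bar> \<le> e \<Longrightarrow> v + t *\<^sub>R z \<in> \<Delta>"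
    unfolding Delta_iff using e0 by blast+
  have "v \<in> open_segment (v + e *\<^sub>R z) (v + (- e) *\<^sub>R z)"
    using center_in_open_segment[of "e *\<^sub>R z" v] e(1) z(1)
    unfolding scaleR_minus_left add_uminus_conv_diff by simp
  moreover have "v + e *\<^sub>R z \<in> \<Delta>" "v + (- e) *\<^sub>R z \<in> \<Delta>" using e(2)[of e] e(2)[of "- e"] e(1) by auto
  ultimately show False using v unfolding vertices_def extreme_point_of_def by blast
qed

text \<open>
  This is where simplicity is used: the \<open>n\<close> edge directions at \<open>v\<close> are a basis, and a facet through
  \<open>v\<close> contains all of them but one. Two facets that miss the same edge have proportional normals and
  coincide, so there are at most as many facets at \<open>v\<close> as edges.\<close>
lemma tight_card_le:
  assumes v: "v \<in> vertices"
  shows "card (tight v) \<le> CARD('n)"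
proof -
  have vD: "v \<in> \<Delta>" and ext: "v extreme_point_of \<Delta>" using v by (auto simp: vertices_def extreme_point_of_def)
  define E where "E = {e. e edge_of \<Delta> \<and> v \<in> e}"
  have cardE: "card E = CARD('n)"
    using simple ext unfolding simple_polytope_def E_def by blast
  then have finE: "finite E" using card_ge_0_finite[of E] by simp
  have "\<exists>r. (\<forall>e\<in>E. v + r e \<in> \<Delta>) \<and>
      (\<forall>x\<in>\<Delta>. \<exists>c. (\<forall>e. c e \<ge> 0) \<and> x - v = (\<Sum>e\<in>E. c e *\<^sub>R r e))"
    using polytope_subset_edge_cone[OF polytope_Delta ext] unfolding E_def by simp
  then obtain r where r: "\<And>e. e \<in> E \<Longrightarrow> v + r e \<in> \<Delta>"
    "\<And>x. x \<in> \<Delta> \<Longrightarrow> \<exists>c. (\<forall>e. c e \<ge> 0) \<and> x - v = (\<Sum>e\<in>E. c e *\<^sub>R r e)"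
    by blast
  have dimD: "dim ((\<lambda>x. x - v) ` \<Delta>) = CARD('n)"
    using aff_dim_eq_dim_subtract[of v \<Delta>] vD aff_dim_Delta by (simp add: hull_inc)
  have sub: "(\<lambda>x. x - v) ` \<Delta> \<subseteq> span (r ` E)"
  proof clarify
    fix x assume "x \<in> \<Delta>"
    then obtain c where c: "x - v = (\<Sum>e\<in>E. c e *\<^sub>R r e)" using r(2) by blast
    show "x - v \<in> span (r ` E)" unfolding c by (intro span_sum span_scale span_base) auto
  qed
  have dimr: "dim (r ` E) = CARD('n)"
    using dim_subset[OF sub] dim_subset_UNIV[of "r ` E"] dimD by (simp add: dim_span)
  have spanr: "span (r ` E) = UNIV"
    using dim_eq_full[of "r ` E"] dimr by simp
  \<comment> \<open>A facet has dimension one less than the polytope, so its normal is positive on one edge only.\<close>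
  have ex1: "\<exists>e\<in>E. u i \<bullet> r e > 0 \<and> (\<forall>e'\<in>E - {e}. u i \<bullet> r e' = 0)" if i: "i \<in> tight v" for i
  proof -
    have i1: "i \<in> {1..d}" and sl: "slack i v = 0" using i tight_eq[OF vD] by auto
    have nn: "u i \<bullet> r e \<ge> 0" if "e \<in> E" for e
      using slack_nonneg[OF r(1)[OF that] i1] sl by (simp add: inner_add_right)
    define Z where "Z = {e\<in>E. u i \<bullet> r e = 0}"
    let ?F = "nth_facet \<Delta> u \<mu> i"
    have vF: "v \<in> ?F" using vD sl by (simp add: nth_facet_def)
    have "aff_dim ?F = int CARD('n) - 1" using facet_nth[OF i1] aff_dim_Delta by (simp add: facet_of_def)
    then have dimF: "dim ((\<lambda>x. x - v) ` ?F) = CARD('n) - 1"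
      using aff_dim_eq_dim_subtract[of v ?F] vF by (simp add: hull_inc)
    have "(\<lambda>x. x - v) ` ?F \<subseteq> span (r ` Z)"
    proof clarify
      fix x assume x: "x \<in> ?F"
      then have xD: "x \<in> \<Delta>" by (simp add: nth_facet_def)
      then obtain c where c: "\<forall>e. c e \<ge> 0" "x - v = (\<Sum>e\<in>E. c e *\<^sub>R r e)" using r(2) by blast
      have "u i \<bullet> (x - v) = 0" using x sl by (simp add: nth_facet_def inner_diff_right)
      then have "(\<Sum>e\<in>E. c e * (u i \<bullet> r e)) = 0" by (simp add: c inner_sum_right)
      then have *: "\<forall>e\<in>E. c e * (u i \<bullet> r e) = 0"
        using finE c nn by (subst (asm) sum_nonneg_eq_0_iff) auto
      have "x - v = (\<Sum>e\<in>Z. c e *\<^sub>R r e)" unfolding c(2)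
        using * finE by (intro sum.mono_neutral_right) (auto simp: Z_def)
      then show "x - v \<in> span (r ` Z)" by (simp only:) (intro span_sum span_scale span_base, auto)
    qed
    then have "CARD('n) - 1 \<le> card Z"
      using dimF dim_le_card[of "(\<lambda>x. x - v) ` ?F" "r ` Z"] finE card_image_le[of Z r]
      by (simp add: Z_def)
    moreover have "Z \<subseteq> E" by (auto simp: Z_def)
    ultimately have "card (E - Z) \<le> 1"
      using cardE finE by (simp add: card_Diff_subset finite_subset)
    moreover have "E - Z \<noteq> {}"
    proof
      assume "E - Z = {}"
      then have "u i \<bullet> b = 0" if "b \<in> r ` E" for b using that by (auto simp: Z_def)
      then have "u i = 0"
        using linear_eq_on_spanning_inner[OF spanr, of "u i" 0] by (simp add: inner_commute)
      then have "?F = \<Delta>" using sl by (auto simp: nth_facet_def)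
      then show False using facet_nth[OF i1] by simp
    qed
    ultimately have "card (E - Z) = 1"
      using finE by (simp add: le_Suc_eq card_eq_0_iff)
    then obtain e where e: "E - Z = {e}" by (rule card_1_singletonE)
    then have "e \<in> E" "u i \<bullet> r e \<noteq> 0" "\<forall>e'\<in>E - {e}. u i \<bullet> r e' = 0" by (auto simp: Z_def)
    then show ?thesis using nn by (metis order_le_less)
  qed
  then obtain f where f: "\<And>i. i \<in> tight v \<Longrightarrow> f i \<in> E \<and> u i \<bullet> r (f i) > 0 \<and> (\<forall>e'\<in>E - {f i}. u i \<bullet> r e' = 0)"
    by metis
  have "inj_on f (tight v)"
  proof (rule inj_onI)
    fix i j assume i: "i \<in> tight v" and j: "j \<in> tight v" and eq: "f i = f j"
    have ij: "i \<in> {1..d}" "slack i v = 0" "j \<in> {1..d}" "slack j v = 0" using i j tight_eq[OF vD] by auto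
    define c where "c = (u i \<bullet> r (f i)) / (u j \<bullet> r (f j))"
    have c: "c > 0" using f[OF i] f[OF j] by (simp add: c_def)
    have "b \<bullet> u i = b \<bullet> (c *\<^sub>R u j)" if "b \<in> r ` E" for b
    proof -
      obtain e where e: "e \<in> E" "b = r e" using \<open>b \<in> r ` E\<close> by blast
      show ?thesis
      proof (cases "e = f i")
        case True
        then show ?thesis using f[OF j] e eq by (simp add: c_def inner_commute)
      next
        case False
        then have "u i \<bullet> r e = 0" "u j \<bullet> r e = 0" using f[OF i] f[OF j] e eq by auto
        then show ?thesis using e by (simp add: inner_commute)
      qed
    qed
    then have uij: "u i = c *\<^sub>R u j"
      using linear_eq_on_spanning_inner[OF spanr] by blast
    have "slack i x = c * slack j x" for x
    proof -
      have "slack i x = slack i x - slack i v" using ij by simp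
      also have "\<dots> = c * (slack j x - slack j v)" by (simp add: uij algebra_simps)
      finally show ?thesis using ij by simp
    qed
    then have "nth_facet \<Delta> u \<mu> i = nth_facet \<Delta> u \<mu> j" using c by (auto simp: nth_facet_def)
    then show "i = j" using nth_facet_inj ij by blast
  qed
  moreover have "f ` tight v \<subseteq> E" using f by blast
  ultimately show ?thesis using cardE finE by (metis card_inj_on_le)
qed

end

context presented_polytope
begin

lemma dim_tight: "v \<in> vertices \<Longrightarrow> dim (u ` tight v) = CARD('n)"
  using dim_span[of "u ` tight v"] span_tight_UNIV[of v] dim_UNIV[where 'a="real^'n"] by simp

lemma card_image_tight:
  assumes v: "v \<in> vertices"
  shows "card (u ` tight v) = CARD('n)" "card (tight v) = CARD('n)"
proof -
  have "dim (u ` tight v) \<le> card (u ` tight v)" by (intro dim_le_card') simp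
  moreover have "card (u ` tight v) \<le> card (tight v)" by (intro card_image_le) simp
  ultimately show "card (u ` tight v) = CARD('n)" "card (tight v) = CARD('n)"
    using dim_tight[OF v] tight_card_le[OF v] by auto
qed

lemma inj_on_tight: "v \<in> vertices \<Longrightarrow> inj_on u (tight v)"
  by (simp add: card_image_tight eq_card_imp_inj_on)

lemma independent_tight: "v \<in> vertices \<Longrightarrow> independent (u ` tight v)"
  by (rule card_le_dim_spanning[of _ UNIV])
    (auto simp: card_image_tight span_tight_UNIV dim_UNIV)

text \<open>
  By duality these are the directions of the edges at \<open>v\<close>, numbered by the facets at \<open>v\<close>: the
  \<open>j\<close>-th edge leaves the \<open>j\<close>-th facet and stays in the others.\<close>
definition edge_dir :: "real ^ 'n \<Rightarrow> nat \<Rightarrow> real ^ 'n" where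
  "edge_dir v = dual_basis_vec u (tight v)"

lemma inner_edge_dir:
  assumes v: "v \<in> vertices" and j: "j \<in> tight v" and i: "i \<in> tight v"
  shows "u i \<bullet> edge_dir v j = (if i = j then 1 else 0)"
proof -
  obtain a where a: "\<forall>c\<in>u ` tight v. c \<bullet> a = (if c = u j then 1 else 0)"
    using dual_basis_exists[OF independent_tight[OF v] span_tight_UNIV[OF v], of "u j"] j by blast
  have a': "\<forall>i\<in>tight v. u i \<bullet> a = (if i = j then 1 else 0)"
    using a inj_on_tight[OF v] j by (auto simp: inj_on_def)
  have "\<forall>i\<in>tight v. u i \<bullet> edge_dir v j = (if i = j then 1 else 0)"
    unfolding edge_dir_def dual_basis_vec_def
  proof (rule theI)
    fix b assume b: "\<forall>i\<in>tight v. u i \<bullet> b = (if i = j then 1 else 0)"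
    show "b = a"
      by (rule linear_eq_on_spanning_inner[OF span_tight_UNIV[OF v]]) (use a' b in auto)
  qed (use a' in simp)
  then show ?thesis using i by blast
qed

lemma expand_edge_dir:
  assumes v: "v \<in> vertices"
  shows "x = (\<Sum>j\<in>tight v. (u j \<bullet> x) *\<^sub>R edge_dir v j)"
proof (rule linear_eq_on_spanning_inner[OF span_tight_UNIV[OF v]])
  fix b assume "b \<in> u ` tight v"
  then obtain i where i: "i \<in> tight v" "b = u i" by blast
  have "u i \<bullet> (\<Sum>j\<in>tight v. (u j \<bullet> x) *\<^sub>R edge_dir v j)
      = (\<Sum>j\<in>tight v. (u j \<bullet> x) * (if i = j then 1 else 0))"
    unfolding inner_sum_right
    by (intro sum.cong refl) (simp add: inner_edge_dir[OF v] i)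
  also have "\<dots> = u i \<bullet> x" using i by (simp add: if_distrib sum.delta cong: if_cong)
  finally show "b \<bullet> x = b \<bullet> (\<Sum>j\<in>tight v. (u j \<bullet> x) *\<^sub>R edge_dir v j)" using i by simp
qed

lemma slack_tight: "v \<in> vertices \<Longrightarrow> j \<in> tight v \<Longrightarrow> slack j v = 0"
  using tight_eq[OF vertex_in_Delta] by blast

lemma slack_not_tight: "v \<in> vertices \<Longrightarrow> i \<in> {1..d} \<Longrightarrow> i \<notin> tight v \<Longrightarrow> slack i v > 0"
  using tight_eq[OF vertex_in_Delta] slack_nonneg[OF vertex_in_Delta] by force

lemma expand_from_vertex:
  assumes v: "v \<in> vertices"
  shows "x - v = (\<Sum>j\<in>tight v. slack j x *\<^sub>R edge_dir v j)"
proof -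
  have "x - v = (\<Sum>j\<in>tight v. (u j \<bullet> (x - v)) *\<^sub>R edge_dir v j)"
    by (rule expand_edge_dir[OF v])
  also have "\<dots> = (\<Sum>j\<in>tight v. slack j x *\<^sub>R edge_dir v j)"
  proof (intro sum.cong refl)
    fix j assume "j \<in> tight v"
    then have "u j \<bullet> (x - v) = slack j x" using slack_tight[OF v, of j] by (simp add: inner_diff_right)
    then show "(u j \<bullet> (x - v)) *\<^sub>R edge_dir v j = slack j x *\<^sub>R edge_dir v j" by simp
  qed
  finally show ?thesis .
qed

text \<open>The faces through a vertex correspond to the sets of facets through it; this is one half of the bijection.\<close>
definition face_cut :: "nat set \<Rightarrow> (real ^ 'n) set" where
  "face_cut S = {x \<in> \<Delta>. \<forall>i\<in>S. slack i x = 0}"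

lemma face_cut_face_of:
  assumes "S \<subseteq> {1..d}"
  shows "face_cut S face_of \<Delta>"
proof -
  have "face_cut S = \<Inter>(insert \<Delta> (nth_facet \<Delta> u \<mu> ` S))"
    by (auto simp: face_cut_def nth_facet_def)
  moreover have "\<Inter>(insert \<Delta> (nth_facet \<Delta> u \<mu> ` S)) face_of \<Delta>"
  proof (rule face_of_Inter)
    show "T face_of \<Delta>" if "T \<in> insert \<Delta> (nth_facet \<Delta> u \<mu> ` S)" for T
      using that assms facet_of_imp_face_of[OF facet_nth] face_of_refl[OF convex_Delta] by blast
  qed blast
  ultimately show ?thesis by simp
qed

abbreviation ix :: "(real ^ 'n) set \<Rightarrow> nat set" where "ix F \<equiv> facet_ix \<Delta> d u \<mu> F"

lemma ix_iff: "F \<subseteq> \<Delta> \<Longrightarrow> i \<in> ix F \<longleftrightarrow> i \<in> {1..d} \<and> (\<forall>x\<in>F. slack i x = 0)"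
  by (auto simp: facet_ix_def nth_facet_def)

lemma ix_le: "ix F \<subseteq> {1..d}" by (auto simp: facet_ix_def)

lemma finite_ix [simp]: "finite (ix F)" using ix_le finite_subset by blast

lemma face_subset: "F \<in> faces \<Delta> \<Longrightarrow> F \<subseteq> \<Delta>"
  by (simp add: faces_def face_of_imp_subset)

text \<open>Every face is an intersection of facets.\<close>
lemma face_eq_cut:
  assumes F: "F \<in> faces \<Delta>"
  shows "F = face_cut (ix F)"
proof
  show "F \<subseteq> face_cut (ix F)"
    using face_subset[OF F] ix_iff[OF face_subset[OF F]] by (auto simp: face_cut_def)
  show "face_cut (ix F) \<subseteq> F"
  proof (cases "F = \<Delta>")
    case True
    then show ?thesis by (auto simp: face_cut_def)
  next
    case False
    have "F = \<Inter>{G. G facet_of \<Delta> \<and> F \<subseteq> G}"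
      using F False by (intro face_of_polyhedron) (auto simp: faces_def polytope_Delta polytope_imp_polyhedron)
    moreover have "x \<in> G" if "x \<in> face_cut (ix F)" "G facet_of \<Delta>" "F \<subseteq> G" for x G
    proof -
      obtain i where i: "i \<in> {1..d}" "G = nth_facet \<Delta> u \<mu> i" using facet_is_nth[OF \<open>G facet_of \<Delta>\<close>] by blast
      then have "i \<in> ix F" using \<open>F \<subseteq> G\<close> by (simp add: facet_ix_def)
      then show ?thesis using that(1) i by (simp add: face_cut_def nth_facet_def)
    qed
    ultimately show ?thesis by blast
  qed
qed

lemma finite_faces: "finite (faces \<Delta>)"
  by (rule finite_subset[OF _ finite_polytope_faces[OF polytope_Delta]]) (auto simp: faces_def)

lemma ix_subset_tight: "F \<in> faces \<Delta> \<Longrightarrow> v \<in> F \<Longrightarrow> ix F \<subseteq> tight v"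
  by (auto simp: facet_ix_def)

lemma ix_mono: "E \<subseteq> F \<Longrightarrow> ix F \<subseteq> ix E"
  by (auto simp: facet_ix_def)

lemma vertex_mem_face_iff: 
  assumes "F \<in> faces \<Delta>" "v \<in> vertices"
  shows "v \<in> F \<longleftrightarrow> ix F \<subseteq> tight v"
proof
  assume "ix F \<subseteq> tight v"
  then have "v \<in> face_cut (ix F)"
    using slack_tight[OF assms(2)] vertex_in_Delta[OF assms(2)] by (auto simp: face_cut_def)
  then show "v \<in> F" using face_eq_cut[OF assms(1)] by simp
qed (rule ix_subset_tight[OF assms(1)])

lemma slack_move:
  assumes v: "v \<in> vertices" and i: "i \<in> tight v" and S: "S \<subseteq> tight v"
  shows "slack i (v + t *\<^sub>R (\<Sum>j\<in>S. edge_dir v j)) = (if i \<in> S then t else 0)"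
proof -
  have "(\<Sum>j\<in>S. u i \<bullet> edge_dir v j) = (\<Sum>j\<in>S. if i = j then 1 else 0)"
    using S by (intro sum.cong refl inner_edge_dir[OF v _ i]) auto
  also have "\<dots> = (if i \<in> S then 1 else 0)"
    using finite_subset[OF S finite_tight] by (rule sum.delta')
  finally show ?thesis
    using slack_tight[OF v i] by (simp add: inner_add_right inner_sum_right)
qed

lemma move_from_vertex:
  assumes v: "v \<in> vertices"
  shows "\<exists>e>0. \<forall>t. 0 \<le> t \<and> t \<le> e \<longrightarrow> (\<forall>S\<subseteq>tight v. v + t *\<^sub>R (\<Sum>j\<in>S. edge_dir v j) \<in> \<Delta>)"
proof -
  have ev: "\<forall>\<^sub>F t in at_right 0. v + t *\<^sub>R (\<Sum>j\<in>S. edge_dir v j) \<in> \<Delta>" if S: "S \<subseteq> tight v" for S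
  proof -
    have "\<forall>\<^sub>F t in at_right 0. slack i (v + t *\<^sub>R (\<Sum>j\<in>S. edge_dir v j)) \<ge> 0" if i: "i \<in> {1..d}" for i
    proof (cases "i \<in> tight v")
      case True
      then show ?thesis
        unfolding slack_move[OF v True S] by (intro eventually_at_rightI[of 0 1]) auto
    next
      case False
      have "((\<lambda>t. slack i (v + t *\<^sub>R (\<Sum>j\<in>S. edge_dir v j))) \<longlongrightarrow> slack i (v + 0 *\<^sub>R (\<Sum>j\<in>S. edge_dir v j))) (at_right 0)"
        by (intro tendsto_intros)
      then have "((\<lambda>t. slack i (v + t *\<^sub>R (\<Sum>j\<in>S. edge_dir v j))) \<longlongrightarrow> slack i v) (at_right 0)" by simp
      then have "\<forall>\<^sub>F t in at_right 0. slack i (v + t *\<^sub>R (\<Sum>j\<in>S. edge_dir v j)) > 0"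
        by (rule order_tendstoD(1)) (rule slack_not_tight[OF v i False])
      then show ?thesis by eventually_elim simp
    qed
    then show ?thesis unfolding Delta_iff by (intro eventually_ball_finite) auto
  qed
  have "\<forall>\<^sub>F t in at_right 0. \<forall>S\<in>Pow (tight v). v + t *\<^sub>R (\<Sum>j\<in>S. edge_dir v j) \<in> \<Delta>"
    by (intro eventually_ball_finite) (use ev in auto)
  then obtain b where b: "b > 0" "\<And>t. 0 < t \<Longrightarrow> t < b \<Longrightarrow> \<forall>S\<in>Pow (tight v). v + t *\<^sub>R (\<Sum>j\<in>S. edge_dir v j) \<in> \<Delta>"
    unfolding eventually_at_right_field by blast
  have "v + t *\<^sub>R (\<Sum>j\<in>S. edge_dir v j) \<in> \<Delta>" if "0 \<le> t" "t \<le> b / 2" "S \<subseteq> tight v" for t S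
    using b(2)[of t] that b(1) vertex_in_Delta[OF v] by (cases "t = 0") auto
  then show ?thesis using half_gt_zero[OF b(1)] by blast
qed

text \<open>
  Moving from \<open>v\<close> along all edges whose index is not in \<open>S\<close> leads to a point of the polytope that
  lies on the facets with index in \<open>S\<close> and on no other facet through \<open>v\<close>.\<close>
lemma ix_face_cut:
  assumes v: "v \<in> vertices" and S: "S \<subseteq> tight v"
  shows "ix (face_cut S) = S" "face_cut S \<in> faces \<Delta>" "v \<in> face_cut S"
proof -
  show vin: "v \<in> face_cut S"
    using v S slack_tight vertex_in_Delta by (auto simp: face_cut_def)
  show "face_cut S \<in> faces \<Delta>"
    using face_cut_face_of[of S] S tight_le vin by (auto simp: faces_def)
  have sub: "face_cut S \<subseteq> \<Delta>" by (auto simp: face_cut_def)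
  obtain e where e: "e > 0" "\<And>T. T \<subseteq> tight v \<Longrightarrow> v + e *\<^sub>R (\<Sum>j\<in>T. edge_dir v j) \<in> \<Delta>"
    using move_from_vertex[OF v] by (metis less_eq_real_def)
  let ?x = "v + e *\<^sub>R (\<Sum>j\<in>tight v - S. edge_dir v j)"
  have sl: "slack i ?x = (if i \<in> S then 0 else e)" if i: "i \<in> tight v" for i
  proof -
    show ?thesis using slack_move[OF v i, of "tight v - S" e] i by auto
  qed
  have xin: "?x \<in> face_cut S" using e(2)[of "tight v - S"] sl S by (auto simp: face_cut_def)
  show "ix (face_cut S) = S"
  proof
    show "S \<subseteq> ix (face_cut S)"
    proof
      fix i assume "i \<in> S"
      then have "i \<in> {1..d}" "\<forall>x\<in>face_cut S. slack i x = 0"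
        using S tight_le[of v] by (auto simp: face_cut_def)
      then show "i \<in> ix (face_cut S)" using ix_iff[OF sub] by blast
    qed
    show "ix (face_cut S) \<subseteq> S"
    proof
      fix i assume i: "i \<in> ix (face_cut S)"
      then have "i \<in> tight v" using vin by (auto simp: facet_ix_def)
      moreover have "slack i ?x = 0" using i xin unfolding ix_iff[OF sub] by blast
      ultimately show "i \<in> S" using sl e(1) by (metis less_irrefl)
    qed
  qed
qed

lemma extreme_point_exists_minimizing:
  fixes \<xi> :: "real ^ 'n"
  assumes F: "F \<in> faces \<Delta>"
  obtains v where "v \<in> vertices" "v \<in> F" "\<And>x. x \<in> F \<Longrightarrow> \<xi> \<bullet> v \<le> \<xi> \<bullet> x"
proof -
  have Ff: "F face_of \<Delta>" "F \<noteq> {}" using F by (auto simp: faces_def)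
  have cF: "compact F" "convex F"
    using Ff compact_Delta convex_Delta face_of_imp_compact face_of_imp_convex by blast+
  obtain y where y: "y \<in> F" "\<And>x. x \<in> F \<Longrightarrow> \<xi> \<bullet> y \<le> \<xi> \<bullet> x"
    using continuous_attains_inf[OF cF(1) Ff(2) continuous_on_inner[OF continuous_on_const continuous_on_id]]
    by blast
  let ?G = "F \<inter> {x. \<xi> \<bullet> x = \<xi> \<bullet> y}"
  have G: "?G face_of F"
    by (rule face_of_Int_supporting_hyperplane_ge[OF cF(2)]) (use y in auto)
  obtain v where v: "v extreme_point_of ?G"
    using extreme_point_exists_convex[OF compact_Int_closed[OF cF(1) closed_hyperplane]
        face_of_imp_convex[OF G]] y(1) by blast
  have "v extreme_point_of \<Delta>"
    using v extreme_point_of_face[OF face_of_trans[OF G Ff(1)]] by blast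
  then show ?thesis using that[of v] v y by (auto simp: vertices_def extreme_point_of_def)
qed

definition generic :: "real ^ 'n \<Rightarrow> bool" where
  "generic \<xi> \<longleftrightarrow> (\<forall>v\<in>vertices. \<forall>j\<in>tight v. \<xi> \<bullet> edge_dir v j \<noteq> 0)"

text \<open>
  At a vertex where \<open>\<xi>\<close> increases along all edges of \<open>F\<close>, all of \<open>F\<close> lies in the cone spanned by
  these edges, so \<open>\<xi>\<close> attains its minimum on \<open>F\<close> there and nowhere else.\<close>
lemma unique_lowest_vertex:
  assumes g: "generic \<xi>" and F: "F \<in> faces \<Delta>"
  shows "\<exists>!v. v \<in> vertices \<and> v \<in> F \<and> (\<forall>j\<in>tight v - ix F. \<xi> \<bullet> edge_dir v j > 0)"
proof (rule ex_ex1I)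
  obtain v where v: "v \<in> vertices" "v \<in> F" "\<And>x. x \<in> F \<Longrightarrow> \<xi> \<bullet> v \<le> \<xi> \<bullet> x"
    using extreme_point_exists_minimizing[OF F] by blast
  have "\<xi> \<bullet> edge_dir v j > 0" if j: "j \<in> tight v - ix F" for j
  proof -
    obtain e where e: "e > 0" "\<And>T. T \<subseteq> tight v \<Longrightarrow> v + e *\<^sub>R (\<Sum>j\<in>T. edge_dir v j) \<in> \<Delta>"
      using move_from_vertex[OF v(1)] by (meson less_eq_real_def order_refl)
    have "v + e *\<^sub>R edge_dir v j \<in> \<Delta>" using e(2)[of "{j}"] j by simp
    moreover have "slack i (v + e *\<^sub>R edge_dir v j) = 0" if "i \<in> ix F" for i
    proof -
      have i: "i \<in> tight v" using that ix_subset_tight[OF F v(2)] by blast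
      moreover have "i \<noteq> j" using that j by blast
      ultimately show ?thesis
        using slack_move[OF v(1) i, of "{j}" e] j by simp
    qed
    ultimately have "v + e *\<^sub>R edge_dir v j \<in> F"
      using face_eq_cut[OF F] by (auto simp: face_cut_def)
    then have "0 \<le> e * (\<xi> \<bullet> edge_dir v j)" using v(3) by (fastforce simp: inner_add_right)
    then have "0 \<le> \<xi> \<bullet> edge_dir v j" using e(1) by (simp add: zero_le_mult_iff)
    then show ?thesis using g v(1) j by (auto simp: generic_def less_le)
  qed
  then show "\<exists>v. v \<in> vertices \<and> v \<in> F \<and> (\<forall>j\<in>tight v - ix F. \<xi> \<bullet> edge_dir v j > 0)"
    using v by blast
  have uniq: "\<xi> \<bullet> v < \<xi> \<bullet> x" if v: "v \<in> vertices" "v \<in> F" "\<forall>j\<in>tight v - ix F. \<xi> \<bullet> edge_dir v j > 0"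
    and x: "x \<in> F" "x \<noteq> v" for v x
  proof -
    have sl0: "slack j x = 0" if "j \<in> ix F" for j
      using that x(1) ix_iff[OF face_subset[OF F]] by blast
    have xD: "x \<in> \<Delta>" using x face_subset[OF F] by blast
    have xv: "x - v = (\<Sum>j\<in>tight v - ix F. slack j x *\<^sub>R edge_dir v j)"
      unfolding expand_from_vertex[OF v(1), of x]
      by (rule sum.mono_neutral_right) (use sl0 in auto)
    have eq: "\<xi> \<bullet> x - \<xi> \<bullet> v = (\<Sum>j\<in>tight v - ix F. slack j x * (\<xi> \<bullet> edge_dir v j))"
      unfolding inner_diff_right[symmetric] xv inner_sum_right by simp
    have nn: "slack j x * (\<xi> \<bullet> edge_dir v j) \<ge> 0" if "j \<in> tight v - ix F" for j
    proof -
      have "j \<in> {1..d}" using that tight_le by blast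
      then have "slack j x \<ge> 0" using slack_nonneg[OF xD] by blast
      then show ?thesis using that v(3) by (meson less_imp_le mult_nonneg_nonneg)
    qed
    obtain j where j: "j \<in> tight v - ix F" "slack j x \<noteq> 0"
      using xv x(2) by (metis (no_types, lifting) eq_iff_diff_eq_0 scaleR_zero_left sum.neutral)
    then have "slack j x * (\<xi> \<bullet> edge_dir v j) > 0"
      using nn[OF j(1)] v(3) by (metis less_eq_real_def mult_eq_0_iff less_irrefl)
    then have "(\<Sum>j\<in>tight v - ix F. slack j x * (\<xi> \<bullet> edge_dir v j)) > 0"
      using j(1) nn by (intro sum_pos2[where i=j]) auto
    then show ?thesis using eq by simp
  qed
  show "v = w" if "v \<in> vertices \<and> v \<in> F \<and> (\<forall>j\<in>tight v - ix F. \<xi> \<bullet> edge_dir v j > 0)"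
    "w \<in> vertices \<and> w \<in> F \<and> (\<forall>j\<in>tight w - ix F. \<xi> \<bullet> edge_dir w j > 0)" for v w
    using uniq[of v w] uniq[of w v] that by force
qed

end

section \<open>Polar decomposition of a simple polytope\<close>

context presented_polytope
begin

text \<open>
  If \<open>w j\<close> is the truth value of the \<open>j\<close>-th inequality at a point \<open>x\<close>, the summand of \<open>v\<close> is, up to
  sign, the indicator function at \<open>x\<close> of the cone at \<open>v\<close> in which every edge direction that increases \<open>\<xi>\<close>
  is replaced by its opposite. Other values of \<open>w\<close> give weighted cones.\<close>
definition polar :: "real ^ 'n \<Rightarrow> (nat \<Rightarrow> real) \<Rightarrow> real" where
  "polar \<xi> w = (\<Sum>v\<in>vertices. \<Prod>j\<in>tight v. if \<xi> \<bullet> edge_dir v j < 0 then w j else w j - 1)"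

text \<open>
  Expand the products. The monomials at a vertex correspond to the faces through it, and for a
  given face only the vertex where \<open>\<xi>\<close> is minimal contributes. So the decomposition does not depend
  on the direction \<open>\<xi>\<close>.\<close>
lemma polar_eq_face_sum:
  assumes g: "generic \<xi>"
  shows "polar \<xi> w = (\<Sum>F\<in>faces \<Delta>. (-1) ^ (CARD('n) - card (ix F)) * (\<Prod>i\<in>ix F. w i))"
proof -
  define c where "c v j = (if \<xi> \<bullet> edge_dir v j < 0 then 0 else (-1::real))" for v j
  have term_eq: "(\<Prod>j\<in>tight v. if \<xi> \<bullet> edge_dir v j < 0 then w j else w j - 1)
      = (\<Sum>F | F \<in> faces \<Delta> \<and> v \<in> F. (\<Prod>i\<in>ix F. w i) * (\<Prod>j\<in>tight v - ix F. c v j))"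
    if v: "v \<in> vertices" for v
  proof -
    have "(\<Prod>j\<in>tight v. if \<xi> \<bullet> edge_dir v j < 0 then w j else w j - 1) = (\<Prod>j\<in>tight v. w j + c v j)"
      by (intro prod.cong) (auto simp: c_def)
    also have "\<dots> = (\<Sum>S\<in>Pow (tight v). (\<Prod>i\<in>S. w i) * (\<Prod>j\<in>tight v - S. c v j))"
      by (rule prod_add) simp
    also have "\<dots> = (\<Sum>F | F \<in> faces \<Delta> \<and> v \<in> F. (\<Prod>i\<in>ix F. w i) * (\<Prod>j\<in>tight v - ix F. c v j))"
    proof (rule sum.reindex_bij_witness[of _ ix face_cut])
      fix S assume "S \<in> Pow (tight v)"
      then have S: "S \<subseteq> tight v" by simp
      show "ix (face_cut S) = S" "face_cut S \<in> {F. F \<in> faces \<Delta> \<and> v \<in> F}"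
        using ix_face_cut[OF v S] by auto
      show "(\<Prod>i\<in>ix (face_cut S). w i) * (\<Prod>j\<in>tight v - ix (face_cut S). c v j)
          = (\<Prod>i\<in>S. w i) * (\<Prod>j\<in>tight v - S. c v j)"
        unfolding ix_face_cut(1)[OF v S] ..
    next
      fix F assume "F \<in> {F. F \<in> faces \<Delta> \<and> v \<in> F}"
      then show "face_cut (ix F) = F" "ix F \<in> Pow (tight v)"
        using face_eq_cut[of F] ix_subset_tight[of F v] by auto
    qed
    finally show ?thesis .
  qed
  have face_eq: "(\<Sum>v | v \<in> vertices \<and> v \<in> F. (\<Prod>i\<in>ix F. w i) * (\<Prod>j\<in>tight v - ix F. c v j))
      = (-1) ^ (CARD('n) - card (ix F)) * (\<Prod>i\<in>ix F. w i)" if F: "F \<in> faces \<Delta>" for F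
  proof -
    obtain v0 where v0: "v0 \<in> vertices" "v0 \<in> F" "\<forall>j\<in>tight v0 - ix F. \<xi> \<bullet> edge_dir v0 j > 0"
      and uniq: "\<And>v. v \<in> vertices \<Longrightarrow> v \<in> F \<Longrightarrow> \<forall>j\<in>tight v - ix F. \<xi> \<bullet> edge_dir v j > 0 \<Longrightarrow> v = v0"
      using unique_lowest_vertex[OF g F] by blast
    have "(\<Prod>j\<in>tight v - ix F. c v j) = (if v = v0 then (-1) ^ (CARD('n) - card (ix F)) else 0)"
      if v: "v \<in> vertices" "v \<in> F" for v
    proof (cases "v = v0")
      case True
      have "(\<Prod>j\<in>tight v - ix F. c v j) = (\<Prod>j\<in>tight v - ix F. -1)"
        using v0(3) True by (intro prod.cong refl) (auto simp: c_def dest: less_asym)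
      also have "\<dots> = (-1) ^ card (tight v - ix F)" by simp
      also have "card (tight v - ix F) = CARD('n) - card (ix F)"
        using ix_subset_tight[OF F v(2)] card_image_tight[OF v(1)] by (simp add: card_Diff_subset)
      finally show ?thesis using True by simp
    next
      case False
      then obtain j where j: "j \<in> tight v - ix F" "\<not> \<xi> \<bullet> edge_dir v j > 0" using uniq[OF v] by blast
      then have "c v j = 0" using g v(1) by (auto simp: c_def generic_def)
      then show ?thesis using j(1) False by (auto intro!: prod_zero)
    qed
    then have "(\<Sum>v | v \<in> vertices \<and> v \<in> F. (\<Prod>i\<in>ix F. w i) * (\<Prod>j\<in>tight v - ix F. c v j))
      = (\<Sum>v | v \<in> vertices \<and> v \<in> F. if v = v0 then (\<Prod>i\<in>ix F. w i) * (-1) ^ (CARD('n) - card (ix F)) else 0)"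
      by (intro sum.cong refl) auto
    also have "\<dots> = (\<Prod>i\<in>ix F. w i) * (-1) ^ (CARD('n) - card (ix F))"
      using v0 finite_vertices by (simp add: sum.delta')
    finally show ?thesis by (simp add: mult.commute)
  qed
  have "polar \<xi> w = (\<Sum>v\<in>vertices. \<Sum>F | F \<in> faces \<Delta> \<and> v \<in> F. (\<Prod>i\<in>ix F. w i) * (\<Prod>j\<in>tight v - ix F. c v j))"
    unfolding polar_def by (intro sum.cong refl term_eq)
  also have "\<dots> = (\<Sum>F\<in>faces \<Delta>. \<Sum>v | v \<in> vertices \<and> v \<in> F. (\<Prod>i\<in>ix F. w i) * (\<Prod>j\<in>tight v - ix F. c v j))"
    by (rule sum.swap_restrict[OF finite_vertices finite_faces])
  also have "\<dots> = (\<Sum>F\<in>faces \<Delta>. (-1) ^ (CARD('n) - card (ix F)) * (\<Prod>i\<in>ix F. w i))"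
    by (intro sum.cong refl face_eq)
  finally show ?thesis .
qed

text \<open>The point where the shifted facets through \<open>v\<close> meet.\<close>
definition shifted_vertex :: "(nat \<Rightarrow> real) \<Rightarrow> real ^ 'n \<Rightarrow> real ^ 'n" where
  "shifted_vertex h v = v - (\<Sum>j\<in>tight v. h j *\<^sub>R edge_dir v j)"

text \<open>The polar decomposition remains valid as long as the shifted vertices belong to the shifted polytope.\<close>
definition small_shift :: "(nat \<Rightarrow> real) \<Rightarrow> bool" where
  "small_shift h \<longleftrightarrow> (\<forall>v\<in>vertices. \<forall>i\<in>{1..d}. slack i (shifted_vertex h v) + h i \<ge> 0)"

lemma slack_shifted_tight:
  assumes v: "v \<in> vertices" and i: "i \<in> tight v"
  shows "slack i (shifted_vertex h v) = - h i"
proof -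
  have "(\<Sum>j\<in>tight v. h j * (u i \<bullet> edge_dir v j)) = (\<Sum>j\<in>tight v. if i = j then h j else 0)"
    by (intro sum.cong refl) (simp add: inner_edge_dir[OF v _ i])
  also have "\<dots> = h i" using i by simp
  finally show ?thesis
    using slack_tight[OF v i] by (simp add: shifted_vertex_def inner_diff_right inner_sum_right)
qed

lemma expand_from_shifted_vertex:
  assumes v: "v \<in> vertices"
  shows "x - shifted_vertex h v = (\<Sum>j\<in>tight v. (slack j x + h j) *\<^sub>R edge_dir v j)"
  using expand_from_vertex[OF v, of x]
  by (simp add: shifted_vertex_def scaleR_add_left sum.distrib algebra_simps)

lemma small_shift_near_0: "\<exists>\<epsilon>>0. \<forall>h. (\<forall>i\<in>{1..d}. \<bar>h i\<bar> < \<epsilon>) \<longrightarrow> small_shift h"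
proof -
  define M where "M = insert 1 ((\<lambda>(v, i). slack i v) ` (SIGMA v:vertices. {1..d} - tight v))"
  define m where "m = Min M"
  have finM: "finite M" unfolding M_def using finite_vertices by simp
  have "\<forall>y\<in>M. y > 0" using slack_not_tight by (auto simp: M_def)
  then have m: "m > 0" unfolding m_def using finM by (subst Min_gr_iff) (auto simp: M_def)
  have ms: "m \<le> slack i v" if "v \<in> vertices" "i \<in> {1..d} - tight v" for v i
    unfolding m_def by (rule Min_le[OF finM]) (use that in \<open>force simp: M_def\<close>)
  \<comment> \<open>The slack of \<open>shifted_vertex h v\<close> differs from that of \<open>v\<close> by at most \<open>C\<close> times the size of \<open>h\<close>.\<close>
  define C where "C = (\<Sum>v\<in>vertices. \<Sum>i\<in>{1..d}. 1 + (\<Sum>j\<in>tight v. \<bar>u i \<bullet> edge_dir v j\<bar>))"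
  define \<epsilon> where "\<epsilon> = m / (1 + C)"
  have C0: "C \<ge> 0" unfolding C_def by (intro sum_nonneg add_nonneg_nonneg) auto
  have \<epsilon>: "\<epsilon> > 0" using m C0 by (simp add: \<epsilon>_def)
  have "small_shift h" if h: "\<forall>i\<in>{1..d}. \<bar>h i\<bar> < \<epsilon>" for h
    unfolding small_shift_def
  proof (intro ballI)
    fix v i assume v: "v \<in> vertices" and i: "i \<in> {1..d}"
    show "slack i (shifted_vertex h v) + h i \<ge> 0"
    proof (cases "i \<in> tight v")
      case True
      then show ?thesis using slack_shifted_tight[OF v True] by simp
    next
      case False
      have "\<bar>\<Sum>j\<in>tight v. h j * (u i \<bullet> edge_dir v j)\<bar> \<le> (\<Sum>j\<in>tight v. \<epsilon> * \<bar>u i \<bullet> edge_dir v j\<bar>)"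
        unfolding abs_mult[symmetric]
      proof (rule order_trans[OF sum_abs], rule sum_mono)
        fix j assume "j \<in> tight v"
        then have "\<bar>h j\<bar> \<le> \<epsilon>" using h tight_le[of v] by force
        then show "\<bar>h j * (u i \<bullet> edge_dir v j)\<bar> \<le> \<epsilon> * \<bar>u i \<bullet> edge_dir v j\<bar>"
          by (simp add: abs_mult mult_right_mono)
      qed
      moreover have "\<bar>h i\<bar> \<le> \<epsilon>" using h i by force
      moreover have "\<epsilon> * (1 + (\<Sum>j\<in>tight v. \<bar>u i \<bullet> edge_dir v j\<bar>)) \<le> \<epsilon> * C"
      proof (rule mult_left_mono)
        have "(\<Sum>i\<in>{1..d}. 1 + (\<Sum>j\<in>tight v. \<bar>u i \<bullet> edge_dir v j\<bar>)) \<le> C"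
          unfolding C_def
          by (rule member_le_sum[OF v _ finite_vertices]) (intro sum_nonneg add_nonneg_nonneg, auto)
        moreover have "1 + (\<Sum>j\<in>tight v. \<bar>u i \<bullet> edge_dir v j\<bar>)
            \<le> (\<Sum>i\<in>{1..d}. 1 + (\<Sum>j\<in>tight v. \<bar>u i \<bullet> edge_dir v j\<bar>))"
          by (rule member_le_sum[OF i]) (auto intro!: sum_nonneg add_nonneg_nonneg)
        ultimately show "1 + (\<Sum>j\<in>tight v. \<bar>u i \<bullet> edge_dir v j\<bar>) \<le> C" by linarith
      qed (use \<epsilon> in simp)
      moreover have "\<epsilon> * C \<le> m"
      proof -
        have "\<epsilon> * (1 + C) = m" using C0 by (simp add: \<epsilon>_def)
        then show ?thesis using \<epsilon> by (simp add: algebra_simps)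
      qed
      moreover have "m \<le> slack i v" using ms v i False by blast
      moreover have "slack i (shifted_vertex h v) = slack i v - (\<Sum>j\<in>tight v. h j * (u i \<bullet> edge_dir v j))"
        by (simp add: shifted_vertex_def inner_diff_right inner_sum_right)
      ultimately show ?thesis by (simp add: algebra_simps sum_distrib_left abs_le_iff)
    qed
  qed
  then show ?thesis using \<epsilon> by blast
qed

lemma edge_dir_nonzero: "v \<in> vertices \<Longrightarrow> j \<in> tight v \<Longrightarrow> edge_dir v j \<noteq> 0"
  using inner_edge_dir[of v j j] by auto

lemma open_generic: "open {\<xi>. generic \<xi>}"
proof -
  have "{\<xi>. generic \<xi>} = (\<Inter>v\<in>vertices. \<Inter>j\<in>tight v. {\<xi>. \<xi> \<bullet> edge_dir v j \<noteq> 0})"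
    by (auto simp: generic_def)
  moreover have "open {\<xi>. \<xi> \<bullet> edge_dir v j \<noteq> 0}" for v j
    by (intro open_Collect_neq continuous_intros)
  ultimately show ?thesis using finite_vertices by (auto intro!: open_INT)
qed

lemma generic_dense:
  assumes "open U" "U \<noteq> {}"
  shows "\<exists>\<xi>\<in>U. generic \<xi>"
proof (rule ccontr)
  assume "\<not> ?thesis"
  then have "U \<subseteq> (\<Union>v\<in>vertices. \<Union>j\<in>tight v. {\<xi>. edge_dir v j \<bullet> \<xi> = 0})"
    by (auto simp: generic_def inner_commute)
  moreover have "negligible (\<Union>v\<in>vertices. \<Union>j\<in>tight v. {\<xi>. edge_dir v j \<bullet> \<xi> = 0})"
    using finite_vertices edge_dir_nonzero
    by (intro negligible_Union finite_imageI) (auto intro!: negligible_Union negligible_hyperplane)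
  ultimately show False using open_not_negligible[OF assms] negligible_subset by blast
qed

lemma generic_uminus: "generic (- \<xi>) = generic \<xi>"
  by (simp add: generic_def)

lemma Delta_in_faces: "\<Delta> \<in> faces \<Delta>" and ix_Delta: "ix \<Delta> = {}"
proof -
  have "\<Delta> \<noteq> {}" using aff_dim_Delta by auto
  then show *: "\<Delta> \<in> faces \<Delta>" using face_of_refl[OF convex_Delta] by (simp add: faces_def)
  obtain v where v: "v \<in> vertices" using extreme_point_exists_minimizing[OF *] by blast
  have "face_cut {} = \<Delta>" by (simp add: face_cut_def)
  then show "ix \<Delta> = {}" using ix_face_cut(1)[OF v, of "{}"] by simp
qed

text \<open>
  For a point of the polytope only the vertex maximising \<open>\<xi>\<close> contributes. For a point \<open>x\<close> outside,
  some functional \<open>\<eta>\<close> is larger at \<open>x\<close> than at all shifted vertices; with respect to \<open>\<eta>\<close> all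
  flipped cones miss \<open>x\<close>, and the decomposition with \<open>\<xi>\<close> has the same value as the one with \<open>\<eta>\<close>.\<close>
lemma polar_indicator:
  assumes g: "generic \<xi>" and h: "small_shift h"
  shows "polar \<xi> (\<lambda>i. if slack i x + h i \<ge> 0 then 1 else 0)
    = (\<Prod>i\<in>{1..d}. if slack i x + h i \<ge> 0 then 1 else 0)"
    (is "polar \<xi> ?w = _")
proof (cases "\<forall>i\<in>{1..d}. slack i x + h i \<ge> 0")
  case True
  have "generic (- \<xi>)" using g by (simp add: generic_uminus)
  from unique_lowest_vertex[OF this Delta_in_faces]
  have "\<exists>!v. v \<in> vertices \<and> (\<forall>j\<in>tight v. \<xi> \<bullet> edge_dir v j < 0)"
    using vertex_in_Delta by (simp add: ix_Delta) metis
  then obtain v0 where v0: "v0 \<in> vertices" "\<forall>j\<in>tight v0. \<xi> \<bullet> edge_dir v0 j < 0"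
    and uniq: "\<And>v. v \<in> vertices \<Longrightarrow> \<forall>j\<in>tight v. \<xi> \<bullet> edge_dir v j < 0 \<Longrightarrow> v = v0" by blast
  have w1: "?w j = 1" if "j \<in> tight v" for v j using that True tight_le[of v] by auto
  have "(\<Prod>j\<in>tight v. if \<xi> \<bullet> edge_dir v j < 0 then ?w j else ?w j - 1) = (if v = v0 then 1 else 0)"
    if v: "v \<in> vertices" for v
  proof (cases "v = v0")
    case True
    then show ?thesis using v0(2) w1 by (auto intro!: prod.neutral)
  next
    case False
    then obtain j where j: "j \<in> tight v" "\<not> \<xi> \<bullet> edge_dir v j < 0" using uniq[OF v] by blast
    then have "\<exists>j\<in>tight v. (if \<xi> \<bullet> edge_dir v j < 0 then ?w j else ?w j - 1) = 0"
      using w1[OF j(1)] by (intro bexI[of _ j]) auto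
    then show ?thesis using False by (simp add: prod_zero)
  qed
  then have "polar \<xi> ?w = (\<Sum>v\<in>vertices. if v = v0 then 1 else 0)"
    unfolding polar_def by (intro sum.cong refl)
  also have "\<dots> = 1" using v0 finite_vertices by simp
  finally show ?thesis using True by (simp add: prod.neutral)
next
  case False
  then obtain i where i: "i \<in> {1..d}" "slack i x + h i < 0" by force
  define U where "U = (\<Inter>v\<in>vertices. {\<eta>. \<eta> \<bullet> shifted_vertex h v < \<eta> \<bullet> x})"
  have "open U" unfolding U_def
    by (intro open_INT finite_vertices ballI open_Collect_less continuous_intros)
  moreover have "- u i \<in> U"
  proof -
    have "slack i (shifted_vertex h v) + h i \<ge> 0" if "v \<in> vertices" for v
      using h i(1) that unfolding small_shift_def by blast
    then have "- u i \<bullet> shifted_vertex h v < - u i \<bullet> x" if "v \<in> vertices" for v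
      using i(2) that by fastforce
    then show ?thesis by (auto simp: U_def)
  qed
  ultimately obtain \<eta> where \<eta>: "\<eta> \<in> U" "generic \<eta>" using generic_dense[of U] by blast
  have "(\<Prod>j\<in>tight v. if \<eta> \<bullet> edge_dir v j < 0 then ?w j else ?w j - 1) = 0"
    if v: "v \<in> vertices" for v
  proof (rule ccontr)
    assume "(\<Prod>j\<in>tight v. if \<eta> \<bullet> edge_dir v j < 0 then ?w j else ?w j - 1) \<noteq> 0"
    then have nz: "(if \<eta> \<bullet> edge_dir v j < 0 then ?w j else ?w j - 1) \<noteq> 0" if "j \<in> tight v" for j
      using that unfolding prod_zero_iff[OF finite_tight] by blast
    have "(slack j x + h j) * (\<eta> \<bullet> edge_dir v j) \<le> 0" if "j \<in> tight v" for j
      using nz[OF that] by (auto split: if_splits simp: mult_le_0_iff)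
    then have "(\<Sum>j\<in>tight v. (slack j x + h j) * (\<eta> \<bullet> edge_dir v j)) \<le> 0"
      by (rule sum_nonpos)
    moreover have "\<eta> \<bullet> (x - shifted_vertex h v) = (\<Sum>j\<in>tight v. (slack j x + h j) * (\<eta> \<bullet> edge_dir v j))"
      unfolding expand_from_shifted_vertex[OF v] inner_sum_right by simp
    ultimately show False using \<eta>(1) v by (force simp: U_def inner_diff_right)
  qed
  then have "polar \<eta> ?w = 0" unfolding polar_def by (rule sum.neutral[OF ballI])
  moreover have "polar \<xi> ?w = polar \<eta> ?w"
    using polar_eq_face_sum[OF g] polar_eq_face_sum[OF \<eta>(2)] by simp
  moreover have "\<exists>i\<in>{1..d}. ?w i = 0" using i by (intro bexI[of _ i]) auto
  then have "(\<Prod>i\<in>{1..d}. ?w i) = 0" by (intro prod_zero) simp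
  ultimately show ?thesis by simp
qed

end

text \<open>A product of affine functions of distinct variables is affine in each variable.\<close>
lemma prod_affine_average:
  fixes f :: "nat \<Rightarrow> real \<Rightarrow> real"
  assumes "finite A" "\<And>j. j \<in> A \<Longrightarrow> f j (1/2) = (f j 0 + f j 1) / 2"
  shows "(\<Prod>j\<in>A. f j ((w(i := 1/2)) j)) = ((\<Prod>j\<in>A. f j ((w(i := 0)) j)) + (\<Prod>j\<in>A. f j ((w(i := 1)) j))) / 2"
proof (cases "i \<in> A")
  case True
  have *: "(\<Prod>j\<in>A. f j ((w(i := c)) j)) = f i c * (\<Prod>j\<in>A - {i}. f j (w j))" for c
    using prod.remove[OF assms(1) True, of "\<lambda>j. f j ((w(i := c)) j)"] by (auto intro!: prod.cong)
  show ?thesis unfolding * assms(2)[OF True] by (simp add: field_simps)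
next
  case False
  have "(\<Prod>j\<in>A. f j ((w(i := c)) j)) = (\<Prod>j\<in>A. f j (w j))" for c
    using False by (intro prod.cong) auto
  then show ?thesis by simp
qed

text \<open>
  Replace the coordinates with value \<open>1/2\<close> by \<open>0\<close> and \<open>1\<close> one at a time.\<close>
lemma vanish_at_half_from_corners:
  fixes D :: "(nat \<Rightarrow> real) \<Rightarrow> real"
  assumes avg: "\<And>w i. D (w(i := 1/2)) = (D (w(i := 0)) + D (w(i := 1))) / 2"
    and "finite Z" "\<And>i. i \<in> Z \<Longrightarrow> w i = 1/2"
    and "\<And>w'. (\<And>i. i \<in> Z \<Longrightarrow> w' i = 0 \<or> w' i = 1) \<Longrightarrow> (\<And>i. i \<notin> Z \<Longrightarrow> w' i = w i) \<Longrightarrow> D w' = 0"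
  shows "D w = 0"
  using assms(2-4)
proof (induction Z arbitrary: w rule: finite_induct)
  case empty
  show ?case by (rule empty.prems(2)) auto
next
  case (insert i Z)
  have "D (w(i := c)) = 0" if c: "c = 0 \<or> c = 1" for c
  proof (rule insert.IH)
    fix j assume "j \<in> Z"
    then show "(w(i := c)) j = 1/2" using insert.hyps insert.prems(1) by auto
  next
    fix w' assume w': "\<And>j. j \<in> Z \<Longrightarrow> w' j = 0 \<or> w' j = 1" "\<And>j. j \<notin> Z \<Longrightarrow> w' j = (w(i := c)) j"
    show "D w' = 0"
    proof (rule insert.prems(2))
      show "w' j = 0 \<or> w' j = 1" if "j \<in> insert i Z" for j
        using that w' c insert.hyps(2) by (cases "j = i") auto
      show "w' j = w j" if "j \<notin> insert i Z" for j
        using that w'(2)[of j] by auto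
    qed
  qed
  then have "D (w(i := 1/2)) = 0" using avg[of w i] by simp
  moreover have "w(i := 1/2) = w" using insert.prems(1)[of i] by auto
  ultimately show ?case by simp
qed

context presented_polytope
begin

text \<open>
  Both sides are affine in the truth value of each inequality. At a point where the \<open>i\<close>-th
  inequality is an equality, its weight \<open>1/2\<close> is the midpoint of the truth values after a small
  outward and a small inward shift of the \<open>i\<close>-th facet, for which the identity is known.\<close>
lemma polar_weighted:
  assumes g: "generic \<xi>"
  shows "polar \<xi> (\<lambda>i. half_weight (slack i x)) = (\<Prod>i\<in>{1..d}. half_weight (slack i x))"
proof -
  obtain \<epsilon> where \<epsilon>: "\<epsilon> > 0" "\<And>h. (\<forall>i\<in>{1..d}. \<bar>h i\<bar> < \<epsilon>) \<Longrightarrow> small_shift h"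
    using small_shift_near_0 by blast
  define D where "D w = polar \<xi> w - (\<Prod>i\<in>{1..d}. w i)" for w
  define W where "W i = (if i \<in> {1..d} then half_weight (slack i x) else 0)" for i
  define Z where "Z = {i\<in>{1..d}. slack i x = 0}"
  have "D W = 0"
  proof (rule vanish_at_half_from_corners[of D Z])
    fix w :: "nat \<Rightarrow> real" and i
    have "polar \<xi> (w(i := 1/2)) = (polar \<xi> (w(i := 0)) + polar \<xi> (w(i := 1))) / 2"
      unfolding polar_def sum.distrib[symmetric] sum_divide_distrib
      by (intro sum.cong refl
          prod_affine_average[where f = "\<lambda>j y. if \<xi> \<bullet> edge_dir _ j < 0 then y else y - 1"]) auto
    moreover have "(\<Prod>j\<in>{1..d}. (w(i := 1/2)) j) = ((\<Prod>j\<in>{1..d}. (w(i := 0)) j) + (\<Prod>j\<in>{1..d}. (w(i := 1)) j)) / 2"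
      by (rule prod_affine_average[where f = "\<lambda>j y. y"]) auto
    ultimately show "D (w(i := 1/2)) = (D (w(i := 0)) + D (w(i := 1))) / 2"
      by (simp add: D_def field_simps)
  next
    show "finite Z" by (simp add: Z_def)
    show "W i = 1/2" if "i \<in> Z" for i using that by (simp add: Z_def W_def half_weight_def)
  next
    fix w' assume w': "\<And>i. i \<in> Z \<Longrightarrow> w' i = 0 \<or> w' i = 1" "\<And>i. i \<notin> Z \<Longrightarrow> w' i = W i"
    define h where "h i = (if i \<in> Z then if w' i = 1 then \<epsilon> / 2 else - \<epsilon> / 2 else 0)" for i
    have small: "small_shift h" by (rule \<epsilon>(2)) (use \<epsilon>(1) in \<open>auto simp: h_def\<close>)
    have eq: "w' i = (if slack i x + h i \<ge> 0 then 1 else 0)" if i: "i \<in> {1..d}" for i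
    proof (cases "i \<in> Z")
      case True
      then show ?thesis using w'(1)[OF True] \<epsilon>(1) by (auto simp: h_def Z_def)
    next
      case False
      then show ?thesis using w'(2)[OF False] i by (auto simp: h_def Z_def W_def half_weight_def)
    qed
    have "polar \<xi> w' = polar \<xi> (\<lambda>i. if slack i x + h i \<ge> 0 then 1 else 0)"
      unfolding polar_def
    proof (intro sum.cong prod.cong refl)
      fix v j assume "j \<in> tight v"
      then have "j \<in> {1..d}" using tight_le by blast
      from eq[OF this] show "(if \<xi> \<bullet> edge_dir v j < 0 then w' j else w' j - 1)
        = (if \<xi> \<bullet> edge_dir v j < 0 then (if slack j x + h j \<ge> 0 then 1 else 0)
           else (if slack j x + h j \<ge> 0 then 1 else 0) - 1)" by simp
    qed
    moreover have "(\<Prod>i\<in>{1..d}. w' i) = (\<Prod>i\<in>{1..d}. if slack i x + h i \<ge> 0 then 1 else 0)"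
      by (intro prod.cong refl eq)
    ultimately show "D w' = 0" unfolding D_def using polar_indicator[OF g small, of x] by simp
  qed
  moreover have "polar \<xi> W = polar \<xi> (\<lambda>i. half_weight (slack i x))"
    unfolding polar_def
  proof (intro sum.cong prod.cong refl)
    fix v j assume "j \<in> tight v"
    then have "j \<in> {1..d}" using tight_le by blast
    then show "(if \<xi> \<bullet> edge_dir v j < 0 then W j else W j - 1) =
       (if \<xi> \<bullet> edge_dir v j < 0 then half_weight (slack j x) else half_weight (slack j x) - 1)"
      by (simp add: W_def)
  qed
  moreover have "(\<Prod>i\<in>{1..d}. W i) = (\<Prod>i\<in>{1..d}. half_weight (slack i x))"
    by (intro prod.cong) (auto simp: W_def)
  ultimately show ?thesis by (simp add: D_def)
qed

lemma independent_edge_dirs: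
  assumes v: "v \<in> vertices"
  shows "independent (edge_dir v ` tight v)" "inj_on (edge_dir v) (tight v)"
proof -
  have sp: "span (edge_dir v ` tight v) = UNIV"
  proof -
    have "x \<in> span (edge_dir v ` tight v)" for x
      by (subst expand_edge_dir[OF v, of x]) (intro span_sum span_scale span_base, auto)
    then show ?thesis by blast
  qed
  have c: "card (edge_dir v ` tight v) \<le> CARD('n)"
    using card_image_le[of "tight v" "edge_dir v"] card_image_tight[OF v] by simp
  show "independent (edge_dir v ` tight v)"
    by (rule card_le_dim_spanning[of _ UNIV]) (use sp c in \<open>auto simp: dim_UNIV\<close>)
  show "inj_on (edge_dir v) (tight v)"
  proof (rule inj_onI)
    fix i j assume ij: "i \<in> tight v" "j \<in> tight v" "edge_dir v i = edge_dir v j"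
    then show "i = j"
      using inner_edge_dir[OF v ij(1) ij(1)] inner_edge_dir[OF v ij(2) ij(1)] by (auto split: if_splits)
  qed
qed

text \<open>At a vertex of \<open>F\<close>, the edges that stay in \<open>F\<close> form a basis of its direction space.\<close>
lemma aff_dim_face:
  assumes F: "F \<in> faces \<Delta>"
  shows "aff_dim F = int CARD('n) - int (card (ix F))"
proof -
  obtain v where v: "v \<in> vertices" "v \<in> F" using extreme_point_exists_minimizing[OF F] by blast
  define T where "T = tight v - ix F"
  have Tt: "T \<subseteq> tight v" by (auto simp: T_def)
  have "(\<lambda>x. x - v) ` F \<subseteq> span (edge_dir v ` T)"
  proof clarify
    fix x assume x: "x \<in> F"
    then have "slack j x = 0" if "j \<in> ix F" for j
      using that ix_iff[OF face_subset[OF F]] by blast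
    then have xv: "x - v = (\<Sum>j\<in>T. slack j x *\<^sub>R edge_dir v j)"
      unfolding expand_from_vertex[OF v(1), of x] T_def
      by (intro sum.mono_neutral_right) auto
    show "x - v \<in> span (edge_dir v ` T)"
      unfolding xv by (intro span_sum span_scale span_base) auto
  qed
  moreover have "edge_dir v ` T \<subseteq> span ((\<lambda>x. x - v) ` F)"
  proof clarify
    fix j assume j: "j \<in> T"
    obtain e where e: "e > 0" "\<And>S. S \<subseteq> tight v \<Longrightarrow> v + e *\<^sub>R (\<Sum>j\<in>S. edge_dir v j) \<in> \<Delta>"
      using move_from_vertex[OF v(1)] by (meson less_eq_real_def order_refl)
    have jt: "{j} \<subseteq> tight v" using j Tt by blast
    have "slack i (v + e *\<^sub>R edge_dir v j) = 0" if "i \<in> ix F" for i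
      using slack_move[OF v(1) _ jt, of i e] that j ix_subset_tight[OF F v(2)] by (auto simp: T_def)
    then have "v + e *\<^sub>R edge_dir v j \<in> face_cut (ix F)"
      using e(2)[OF jt] by (auto simp: face_cut_def)
    then have "v + e *\<^sub>R edge_dir v j \<in> F" using face_eq_cut[OF F] by simp
    then have "e *\<^sub>R edge_dir v j \<in> span ((\<lambda>x. x - v) ` F)"
      by (intro span_base) (auto intro!: image_eqI[of _ _ "v + e *\<^sub>R edge_dir v j"])
    then have "(1/e) *\<^sub>R e *\<^sub>R edge_dir v j \<in> span ((\<lambda>x. x - v) ` F)" by (rule span_scale)
    then show "edge_dir v j \<in> span ((\<lambda>x. x - v) ` F)" using e(1) by simp
  qed
  ultimately have "span ((\<lambda>x. x - v) ` F) = span (edge_dir v ` T)"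
    by (metis span_mono span_span subset_antisym)
  then have "dim ((\<lambda>x. x - v) ` F) = dim (edge_dir v ` T)" by (metis dim_span)
  also have "\<dots> = card (edge_dir v ` T)"
    using independent_edge_dirs(1)[OF v(1)] Tt
    by (intro dim_eq_card_independent) (meson image_mono independent_mono)
  also have "\<dots> = card T" using independent_edge_dirs(2)[OF v(1)] Tt card_image inj_on_subset by blast
  also have "\<dots> = CARD('n) - card (ix F)"
    unfolding T_def using ix_subset_tight[OF F v(2)] card_image_tight[OF v(1)] by (simp add: card_Diff_subset)
  finally have "dim ((\<lambda>x. x - v) ` F) = CARD('n) - card (ix F)" .
  moreover have "card (ix F) \<le> CARD('n)"
    using card_mono[OF _ ix_subset_tight[OF F v(2)]] card_image_tight[OF v(1)] by simp
  ultimately show ?thesis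
    using aff_dim_eq_dim_subtract[of v F] v(2) by (simp add: hull_inc of_nat_diff)
qed

text \<open>The facets that contain a point are those that contain its minimal face, and their number is the codimension of that face.\<close>
lemma point_weight_eq:
  assumes x: "x \<in> \<Delta>"
  shows "point_weight \<Delta> x = (\<Prod>i\<in>{1..d}. half_weight (slack i x))"
proof -
  obtain G where G: "G face_of \<Delta>" "x \<in> rel_interior G"
    using minimal_face_containing_point[OF polytope_Delta x] by blast
  have xG: "x \<in> G" using G rel_interior_subset by blast
  have GF: "G \<in> faces \<Delta>" using G xG by (auto simp: faces_def)
  have the: "(THE F. F \<in> faces \<Delta> \<and> x \<in> rel_interior F) = G"
  proof (rule the_equality)
    show "G \<in> faces \<Delta> \<and> x \<in> rel_interior G" using GF G by blast
    show "F = G" if "F \<in> faces \<Delta> \<and> x \<in> rel_interior F" for F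
      using that G by (intro face_of_eq[of F \<Delta> G]) (auto simp: faces_def)
  qed
  define Z where "Z = {i\<in>{1..d}. slack i x = 0}"
  have "ix G = Z"
  proof
    show "ix G \<subseteq> Z" using xG ix_iff[OF face_subset[OF GF]] by (auto simp: Z_def)
    show "Z \<subseteq> ix G"
    proof
      fix i assume i: "i \<in> Z"
      then have "nth_facet \<Delta> u \<mu> i face_of \<Delta>" 
        using facet_of_imp_face_of[OF facet_nth[of i]] unfolding Z_def by blast
      moreover have "x \<in> nth_facet \<Delta> u \<mu> i" using i x by (simp add: Z_def nth_facet_def)
      ultimately have "G \<subseteq> nth_facet \<Delta> u \<mu> i"
        using G(2) by (intro subset_of_face_of[OF _ face_subset[OF GF]]) blast+
      then show "i \<in> ix G" using i by (simp add: Z_def facet_ix_def)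
    qed
  qed
  then have "point_weight \<Delta> x = 1 / 2 ^ card Z"
    unfolding point_weight_def the Let_def aff_dim_Delta aff_dim_face[OF GF] by simp
  also have "\<dots> = (\<Prod>i\<in>Z. 1/2)" by (simp add: power_one_over)
  also have "\<dots> = (\<Prod>i\<in>{1..d}. half_weight (slack i x))"
  proof (rule prod.mono_neutral_cong_left)
    show "\<forall>i\<in>{1..d} - Z. half_weight (slack i x) = 1"
      using slack_nonneg[OF x] by (force simp: half_weight_def Z_def)
  qed (auto simp: Z_def half_weight_def)
  finally show ?thesis .
qed

end

section \<open>Weighted sums of exponentials over the integers\<close>

text \<open>
  The exponential \<open>exp (- s y)\<close> restricted, with sign, to the half-line on which it decays. In
  \<open>wkernel\<close> the end point has weight \<open>1/2\<close>; \<open>ckernel\<close> is its analogue for integration.\<close>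
definition wkernel :: "real \<Rightarrow> real \<Rightarrow> real" where
  "wkernel s y = (if 0 < s then half_weight y else half_weight y - 1) * exp (- s * y)"

definition ckernel :: "real \<Rightarrow> real \<Rightarrow> real" where
  "ckernel s y = (if 0 < s then (if y \<ge> 0 then 1 else 0) else (if y \<ge> 0 then 1 else 0) - 1) * exp (- s * y)"

text \<open>The sum of \<open>l ^ m * wkernel s m\<close> over the integers \<open>m\<close>.\<close>
definition char_sum :: "complex \<Rightarrow> real \<Rightarrow> complex" where
  "char_sum l s = (1 + l * exp (- of_real s)) / (2 * (1 - l * exp (- of_real s)))"

lemma wkernel_reflect: "s \<noteq> 0 \<Longrightarrow> wkernel s y = - wkernel (- s) (- y)"
  by (auto simp: wkernel_def half_weight_def)

lemma abs_wkernel_le: "s \<noteq> 0 \<Longrightarrow> \<bar>wkernel s y\<bar> \<le> exp (- \<bar>s\<bar> * \<bar>y\<bar>)"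
  by (auto simp: wkernel_def half_weight_def abs_mult)

lemma abs_summable_exp_int:
  assumes "(a::real) > 0"
  shows "(\<lambda>m::int. exp (- a * \<bar>of_int m\<bar>)) summable_on UNIV"
proof -
  have geo: "(\<lambda>n::nat. exp (- a * real n)) summable_on UNIV"
  proof (rule norm_summable_imp_summable_on)
    have "summable (\<lambda>n. exp (- a) ^ n)" using assms by (intro summable_geometric) simp
    then show "summable (\<lambda>n. norm (exp (- a * real n)))"
      by (simp add: exp_of_nat_mult[symmetric] mult.commute)
  qed
  have "(\<lambda>m::int. exp (- a * \<bar>of_int m\<bar>)) summable_on range int"
    by (subst summable_on_reindex) (use geo in \<open>auto simp: o_def inj_on_def\<close>)
  moreover have "(\<lambda>m::int. exp (- a * \<bar>of_int m\<bar>)) summable_on range (\<lambda>n. - int n)"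
    by (subst summable_on_reindex) (use geo in \<open>auto simp: o_def inj_on_def\<close>)
  ultimately have "(\<lambda>m::int. exp (- a * \<bar>of_int m\<bar>)) summable_on (range int \<union> range (\<lambda>n. - int n))"
    by (intro summable_on_union)
  moreover have "m \<in> range int \<union> range (\<lambda>n. - int n)" for m :: int
    by (cases m rule: int_cases2) auto
  then have "range int \<union> range (\<lambda>n. - int n) = UNIV" by blast
  ultimately show ?thesis by simp
qed

text \<open>A geometric series whose first term has weight \<open>1/2\<close>.\<close>
lemma has_sum_wkernel_pos:
  assumes l: "norm l = 1" and s: "s > 0"
  shows "((\<lambda>m::int. (l powi m) * of_real (wkernel s (of_int m))) has_sum char_sum l s) UNIV"
proof -
  define q where "q = l * exp (- of_real s)"
  have q: "norm q < 1" using l s by (simp add: q_def norm_mult)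
  then have q1: "1 - q \<noteq> 0" by auto
  have "(\<lambda>n. q ^ n) sums (1 / (1 - q))" using geometric_sums[OF q] .
  then have "(\<lambda>n. q * q ^ n) sums (q * (1 / (1 - q)))" by (rule sums_mult)
  then have "((\<lambda>n. q ^ Suc n) has_sum (q / (1 - q))) UNIV"
    using q by (intro norm_summable_imp_has_sum) (auto simp: norm_mult norm_power summable_geometric intro!: summable_mult)
  then have "((\<lambda>m::int. (l powi m) * of_real (wkernel s (of_int m))) has_sum (q / (1 - q))) (range (\<lambda>n. int (Suc n)))"
  proof (subst has_sum_reindex)
    have "(l powi int (Suc n)) * of_real (wkernel s (of_int (int (Suc n)))) = q ^ Suc n" for n
    proof -
      have "wkernel s (real (Suc n)) = exp (of_nat (Suc n) * (- s))"
        using s by (simp add: wkernel_def half_weight_def mult.commute del: of_nat_Suc)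
      also have "\<dots> = exp (- s) ^ Suc n" by (rule exp_of_nat_mult)
      finally have "wkernel s (real (Suc n)) = exp (- s) ^ Suc n" .
      then show ?thesis unfolding q_def power_mult_distrib
        by (simp only: power_int_of_nat of_int_of_nat_eq of_real_power exp_of_real[symmetric] of_real_minus)
    qed
    then show "((\<lambda>n. q ^ Suc n) has_sum (q / (1 - q))) UNIV \<Longrightarrow>
      (((\<lambda>m. l powi m * of_real (wkernel s (of_int m))) \<circ> (\<lambda>n. int (Suc n))) has_sum q / (1 - q)) UNIV"
      by (simp only: o_def)
  qed (auto simp: inj_on_def)
  then have "((\<lambda>m::int. (l powi m) * of_real (wkernel s (of_int m))) has_sum
      ((l powi 0) * of_real (wkernel s (of_int 0)) + q / (1 - q))) (insert 0 (range (\<lambda>n. int (Suc n))))"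
    by (rule has_sum_insert[rotated]) auto
  then have "((\<lambda>m::int. (l powi m) * of_real (wkernel s (of_int m))) has_sum (1/2 + q / (1 - q))) (insert 0 (range (\<lambda>n. int (Suc n))))"
    using s by (simp add: wkernel_def half_weight_def)
  moreover have "1/2 + q / (1 - q) = char_sum l s"
    using q1 unfolding char_sum_def q_def[symmetric] by (simp add: field_simps)
  moreover have "((\<lambda>m::int. (l powi m) * of_real (wkernel s (of_int m))) has_sum x) (insert 0 (range (\<lambda>n. int (Suc n))))
     \<longleftrightarrow> ((\<lambda>m::int. (l powi m) * of_real (wkernel s (of_int m))) has_sum x) UNIV" for x
  proof (rule has_sum_cong_neutral)
    fix m :: int assume "m \<in> UNIV - insert 0 (range (\<lambda>n. int (Suc n)))"
    then have "m \<noteq> 0" "\<forall>n. m \<noteq> int (Suc n)" by auto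
    then have "m < 0" by (cases m rule: int_cases3) (auto simp: gr0_conv_Suc)
    then show "(l powi m) * of_real (wkernel s (of_int m)) = 0"
      using s by (simp add: wkernel_def half_weight_def)
  qed auto
  ultimately show ?thesis by simp
qed

lemma char_sum_reflect:
  assumes l: "norm l = 1" and s: "s \<noteq> 0"
  shows "char_sum l s = - char_sum (inverse l) (- s)"
proof -
  define q where "q = l * exp (- of_real s)"
  have q0: "q \<noteq> 0" using l by (auto simp: q_def)
  have iq: "inverse l * exp (- of_real (- s)) = inverse q"
    by (simp add: q_def exp_minus)
  have "norm q \<noteq> 1" using l s by (simp add: q_def norm_mult)
  then have "q \<noteq> 1" by auto
  then show ?thesis
    unfolding char_sum_def iq q_def[symmetric] using q0 by (simp add: divide_simps) (simp add: algebra_simps)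
qed

lemma has_sum_wkernel:
  assumes l: "norm l = 1" and s: "s \<noteq> 0"
  shows "((\<lambda>m::int. (l powi m) * of_real (wkernel s (of_int m))) has_sum char_sum l s) UNIV"
proof (cases "s > 0")
  case True
  then show ?thesis using has_sum_wkernel_pos[OF l] by blast
next
  case False
  have "((\<lambda>m::int. (inverse l powi m) * of_real (wkernel (- s) (of_int m))) has_sum char_sum (inverse l) (- s)) UNIV"
    using False s l by (intro has_sum_wkernel_pos) (auto simp: norm_inverse)
  then have "((\<lambda>m::int. - ((inverse l powi m) * of_real (wkernel (- s) (of_int m)))) has_sum - char_sum (inverse l) (- s)) (range uminus)"
    unfolding has_sum_uminus surjI[of uminus uminus, OF minus_minus] by simp
  then have "(((\<lambda>m::int. - ((inverse l powi m) * of_real (wkernel (- s) (of_int m)))) \<circ> uminus) has_sum - char_sum (inverse l) (- s)) UNIV"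
    by (subst (asm) has_sum_reindex) auto
  moreover have "((\<lambda>m::int. - ((inverse l powi m) * of_real (wkernel (- s) (of_int m)))) \<circ> uminus)
      = (\<lambda>m::int. (l powi m) * of_real (wkernel s (of_int m)))"
    using wkernel_reflect[OF s] by (auto simp: fun_eq_iff power_int_minus power_int_inverse)
  ultimately show ?thesis using char_sum_reflect[OF l s] by simp
qed

lemma summable_on_prod_PiE:
  fixes f :: "'a \<Rightarrow> 'b \<Rightarrow> real"
  assumes A: "finite A" and nn: "\<And>i x. f i x \<ge> 0" and sm: "\<And>i. i \<in> A \<Longrightarrow> f i summable_on B i"
  shows "(\<lambda>g. \<Prod>i\<in>A. f i (g i)) summable_on PiE A B"
proof (rule nonneg_bdd_above_summable_on)
  show "bdd_above (sum (\<lambda>g. \<Prod>i\<in>A. f i (g i)) ` {F. F \<subseteq> PiE A B \<and> finite F})"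
  proof (rule bdd_aboveI2)
    fix F assume "F \<in> {F. F \<subseteq> PiE A B \<and> finite F}"
    then have F: "F \<subseteq> PiE A B" "finite F" by auto
    define P where "P i = (\<lambda>g. g i) ` F" for i
    have "(\<Sum>g\<in>F. \<Prod>i\<in>A. f i (g i)) \<le> (\<Sum>g\<in>PiE A P. \<Prod>i\<in>A. f i (g i))"
      using F by (intro sum_mono2 finite_PiE[OF A] prod_nonneg) (auto simp: P_def nn PiE_def)
    also have "\<dots> = (\<Prod>i\<in>A. \<Sum>x\<in>P i. f i x)"
      using A F(2) by (subst prod_sum_PiE) (auto simp: P_def)
    also have "\<dots> \<le> (\<Prod>i\<in>A. infsum (f i) (B i))"
    proof (intro prod_mono conjI)
      fix i assume i: "i \<in> A"
      show "0 \<le> sum (f i) (P i)" by (simp add: nn sum_nonneg)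
      show "sum (f i) (P i) \<le> infsum (f i) (B i)"
        using F i by (intro finite_sum_le_infsum sm) (auto simp: P_def nn)
    qed
    finally show "(\<Sum>g\<in>F. \<Prod>i\<in>A. f i (g i)) \<le> (\<Prod>i\<in>A. infsum (f i) (B i))" .
  qed
qed (auto intro: prod_nonneg nn)

definition int_vec :: "('n \<Rightarrow> int) \<Rightarrow> real ^ 'n" where
  "int_vec f = (\<chi> i. of_int (f i))"

lemma int_vec_nth [simp]: "int_vec f $ i = of_int (f i)" by (simp add: int_vec_def)

lemma inj_int_vec: "inj int_vec" by (auto simp: inj_on_def int_vec_def vec_eq_iff)

lemma range_int_vec: "range int_vec = (int_lattice :: (real ^ 'n) set)"
proof
  show "range int_vec \<subseteq> (int_lattice :: (real ^ 'n) set)" by (auto simp: int_lattice_def)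
  show "(int_lattice :: (real ^ 'n) set) \<subseteq> range int_vec"
  proof
    fix x :: "real ^ 'n" assume x: "x \<in> int_lattice"
    have "x = int_vec (\<lambda>i. \<lfloor>x $ i\<rfloor>)"
      using x by (auto simp: vec_eq_iff int_lattice_def)
    then show "x \<in> range int_vec" by blast
  qed
qed

text \<open>Fubini for absolutely convergent sums over \<open>\<int>\<^sup>n\<close>.\<close>
lemma has_sum_prod_lattice:
  fixes h :: "'n::finite \<Rightarrow> real \<Rightarrow> complex"
  assumes hs: "\<And>i. ((\<lambda>m::int. h i (of_int m)) has_sum S i) UNIV"
    and ab: "\<And>i. (\<lambda>m::int. norm (h i (of_int m))) summable_on UNIV"
  shows "((\<lambda>y::real^'n. \<Prod>i\<in>UNIV. h i (y $ i)) has_sum (\<Prod>i\<in>UNIV. S i)) int_lattice"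
proof -
  have "(\<lambda>g. \<Prod>i\<in>UNIV. norm (h i (of_int (g i)))) summable_on (PiE (UNIV::'n set) (\<lambda>_. UNIV :: int set))"
    by (rule summable_on_prod_PiE) (use ab in auto)
  then have "(\<lambda>g. norm (\<Prod>i\<in>UNIV. h i (of_int (g i)))) summable_on (PiE (UNIV::'n set) (\<lambda>_. UNIV :: int set))"
    by (simp add: prod_norm)
  then have "(\<lambda>g. \<Prod>i\<in>UNIV. h i (of_int (g i))) summable_on (PiE (UNIV::'n set) (\<lambda>_. UNIV :: int set))"
    by (rule abs_summable_summable)
  moreover have "infsum (\<lambda>g. \<Prod>i\<in>UNIV. h i (of_int (g i))) (PiE (UNIV::'n set) (\<lambda>_. UNIV :: int set))
     = (\<Prod>i\<in>UNIV. infsum (\<lambda>m::int. h i (of_int m)) UNIV)"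
    by (rule infsum_prod_PiE_abs) (use ab in auto)
  moreover have "infsum (\<lambda>m::int. h i (of_int m)) UNIV = S i" for i using hs[of i] by (rule infsumI)
  ultimately have "((\<lambda>g. \<Prod>i\<in>UNIV. h i (of_int (g i))) has_sum (\<Prod>i\<in>UNIV. S i)) (UNIV :: ('n \<Rightarrow> int) set)"
    using has_sum_infsum[of "\<lambda>g. \<Prod>i\<in>UNIV. h i (of_int (g i))" "UNIV :: ('n \<Rightarrow> int) set"]
    by (simp add: PiE_UNIV_domain)
  then show ?thesis
    unfolding range_int_vec[symmetric] has_sum_reindex[OF inj_int_vec] by (simp add: o_def)
qed

section \<open>Sublattices of finite index and their characters\<close>

lemma int_lattice_add: "x \<in> int_lattice \<Longrightarrow> y \<in> int_lattice \<Longrightarrow> x + y \<in> int_lattice"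
  and int_lattice_diff: "x \<in> int_lattice \<Longrightarrow> y \<in> int_lattice \<Longrightarrow> x - y \<in> int_lattice"
  and int_lattice_uminus: "x \<in> int_lattice \<Longrightarrow> - x \<in> int_lattice"
  by (auto simp: int_lattice_def)

lemma int_lattice_0 [simp]: "0 \<in> int_lattice" by (auto simp: int_lattice_def)

lemma int_lattice_inner: "x \<in> int_lattice \<Longrightarrow> y \<in> int_lattice \<Longrightarrow> x \<bullet> y \<in> \<int>"
  by (auto simp: int_lattice_def inner_vec_def)

definition int_matrix :: "real ^ 'n ^ 'n \<Rightarrow> bool" where
  "int_matrix A \<longleftrightarrow> (\<forall>i. A $ i \<in> int_lattice)"

lemma int_matrix_mult: "int_matrix A \<Longrightarrow> x \<in> int_lattice \<Longrightarrow> A *v x \<in> int_lattice"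
  by (auto simp: int_matrix_def int_lattice_def matrix_vector_mult_def)

lemma int_matrix_transpose: "int_matrix A \<Longrightarrow> int_matrix (transpose A)"
  by (auto simp: int_matrix_def int_lattice_def transpose_def)

lemma finite_bounded_int_lattice:
  fixes S :: "(real ^ 'n) set"
  assumes "bounded S"
  shows "finite (S \<inter> int_lattice)"
proof -
  obtain K where K: "\<And>x. x \<in> S \<Longrightarrow> norm x \<le> K" using assms by (auto simp: bounded_iff)
  have "S \<inter> int_lattice \<subseteq> int_vec ` (PiE UNIV (\<lambda>_. {- \<lceil>K\<rceil>..\<lceil>K\<rceil>}))"
  proof
    fix x assume x: "x \<in> S \<inter> int_lattice"
    then obtain f where f: "x = int_vec f" unfolding range_int_vec[symmetric] by blast
    have "\<bar>real_of_int (f i)\<bar> \<le> K" for i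
      using component_le_norm_cart[of x i] K[of x] x f by simp
    then have "f i \<in> {- \<lceil>K\<rceil>..\<lceil>K\<rceil>}" for i
      by (simp add: abs_le_iff) (metis (no_types, opaque_lifting) ceiling_mono ceiling_of_int minus_le_iff of_int_minus)
    then show "x \<in> int_vec ` (PiE UNIV (\<lambda>_. {- \<lceil>K\<rceil>..\<lceil>K\<rceil>}))" using f by auto
  qed
  then show ?thesis by (rule finite_subset) (intro finite_imageI finite_PiE, auto)
qed

definition unit_cell :: "(real ^ 'n) set" where
  "unit_cell = {x. \<forall>i. 0 \<le> x $ i \<and> x $ i < 1}"

definition floor_vec :: "real ^ 'n \<Rightarrow> real ^ 'n" where
  "floor_vec x = (\<chi> i. of_int \<lfloor>x $ i\<rfloor>)"

lemma floor_vec_int [simp]: "floor_vec x \<in> int_lattice"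
  by (auto simp: floor_vec_def int_lattice_def)

lemma diff_floor_vec [simp]: "x - floor_vec x \<in> unit_cell"
  by (auto simp: floor_vec_def unit_cell_def) linarith

lemma unit_cell_congruent_eq:
  assumes "x \<in> unit_cell" "y \<in> unit_cell" "x - y \<in> int_lattice"
  shows "x = y"
proof -
  have "x $ i = y $ i" for i
  proof -
    have "x $ i - y $ i \<in> \<int>" "\<bar>x $ i - y $ i\<bar> < 1"
      using assms by (auto simp: unit_cell_def int_lattice_def abs_less_iff) (smt (verit))+
    then show ?thesis by (metis Ints_eq_abs_less1 eq_iff_diff_eq_0 Ints_0 diff_zero)
  qed
  then show ?thesis by (simp add: vec_eq_iff)
qed

lemma bounded_unit_cell: "bounded unit_cell"
  by (rule bounded_subset[OF bounded_cbox[of 0 1]])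
    (auto simp: unit_cell_def mem_box_cart less_imp_le)

text \<open>
  Representatives of the integer vectors modulo the sublattice generated by the columns of the
  inverse of \<open>B\<close>.\<close>
definition cell_points :: "real ^ 'n ^ 'n \<Rightarrow> (real ^ 'n) set" where
  "cell_points B = {g \<in> int_lattice. B *v g \<in> unit_cell}"

text \<open>
  The columns of the integer matrix \<open>A\<close> span a sublattice of finite index, and \<open>B\<close> computes coordinates
  with respect to them. At a vertex, the rows of \<open>A\<close> are the facet normals and the columns of \<open>B\<close>
  the edge directions.\<close>
locale integer_basis =
  fixes A B :: "real ^ 'n ^ 'n"
  assumes int_A: "int_matrix A" and AB: "A ** B = mat 1"
begin

lemma BA: "B ** A = mat 1" using AB by (simp add: matrix_left_right_inverse)

lemma A_B_vec [simp]: "A *v (B *v x) = x" by (simp add: matrix_vector_mul_assoc AB)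

lemma B_A_vec [simp]: "B *v (A *v x) = x" by (simp add: matrix_vector_mul_assoc BA)

lemma finite_cell_points: "finite (cell_points B)"
proof -
  have "cell_points B \<subseteq> ((*v) A ` unit_cell) \<inter> int_lattice"
    by (auto simp: cell_points_def intro!: image_eqI[of _ _ "B *v _"])
  moreover have "bounded ((*v) A ` unit_cell)"
    by (intro bounded_linear_image bounded_unit_cell matrix_vector_mul_bounded_linear)
  ultimately show ?thesis using finite_bounded_int_lattice finite_subset by blast
qed

text \<open>The representative of \<open>g\<close> in the fundamental cell.\<close>
definition reduce :: "real ^ 'n \<Rightarrow> real ^ 'n" where
  "reduce g = g - A *v floor_vec (B *v g)"

lemma reduce_in: "g \<in> int_lattice \<Longrightarrow> reduce g \<in> cell_points B"
  by (auto simp: reduce_def cell_points_def matrix_vector_mult_diff_distrib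
      intro!: int_lattice_diff int_matrix_mult int_A)

lemma cell_points_eqI:
  assumes "g \<in> cell_points B" "h \<in> cell_points B" "B *v (g - h) \<in> int_lattice"
  shows "g = h"
proof -
  have "B *v g = B *v h"
    using assms by (intro unit_cell_congruent_eq) (auto simp: cell_points_def matrix_vector_mult_diff_distrib)
  then show ?thesis by (metis A_B_vec)
qed

lemma reduce_congruent: "B *v (reduce g - g) \<in> int_lattice"
proof -
  have "B *v (reduce g - g) = - floor_vec (B *v g)"
    by (simp add: reduce_def linear_neg[OF matrix_vector_mul_linear])
  then show ?thesis by (simp add: int_lattice_uminus)
qed

lemma zero_cell_point: "0 \<in> cell_points B"
  by (simp add: cell_points_def unit_cell_def)

lemma card_cell_points_pos: "card (cell_points B) > 0"
  using zero_cell_point finite_cell_points card_gt_0_iff by blast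

lemma bij_reduce_shift:
  assumes a: "a \<in> int_lattice"
  shows "bij_betw (\<lambda>g. reduce (g + a)) (cell_points B) (cell_points B)"
proof (rule bij_betwI[where g = "\<lambda>g. reduce (g - a)"])
  have cp: "g \<in> int_lattice" if "g \<in> cell_points B" for g using that by (simp add: cell_points_def)
  show "(\<lambda>g. reduce (g + a)) \<in> cell_points B \<rightarrow> cell_points B"
    using a by (auto intro!: reduce_in int_lattice_add intro: cp)
  show "(\<lambda>g. reduce (g - a)) \<in> cell_points B \<rightarrow> cell_points B"
    using a by (auto intro!: reduce_in int_lattice_diff intro: cp)
  fix g assume g: "g \<in> cell_points B"
  show "reduce (reduce (g + a) - a) = g"
  proof (rule cell_points_eqI)
    show "reduce (reduce (g + a) - a) \<in> cell_points B"
      using a cp[OF g] by (intro reduce_in int_lattice_diff int_lattice_add cp[OF reduce_in])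
    have "B *v (reduce (reduce (g + a) - a) - g)
        = B *v (reduce (reduce (g + a) - a) - (reduce (g + a) - a)) + B *v (reduce (g + a) - (g + a))"
      by (simp add: matrix_vector_mult_diff_distrib matrix_vector_right_distrib)
    then show "B *v (reduce (reduce (g + a) - a) - g) \<in> int_lattice"
      by (simp only:) (intro int_lattice_add reduce_congruent)
  qed (rule g)
  show "reduce (reduce (g - a) + a) = g"
  proof (rule cell_points_eqI)
    show "reduce (reduce (g - a) + a) \<in> cell_points B"
      using a cp[OF g] by (intro reduce_in int_lattice_diff int_lattice_add cp[OF reduce_in])
    have "B *v (reduce (reduce (g - a) + a) - g)
        = B *v (reduce (reduce (g - a) + a) - (reduce (g - a) + a)) + B *v (reduce (g - a) - (g - a))"
      by (simp add: matrix_vector_mult_diff_distrib matrix_vector_right_distrib)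
    then show "B *v (reduce (reduce (g - a) + a) - g) \<in> int_lattice"
      by (simp only:) (intro int_lattice_add reduce_congruent)
  qed (rule g)
qed

text \<open>The pairing between \<open>\<int>\<^sup>n / A \<int>\<^sup>n\<close> and the corresponding quotient for the transposed matrix.\<close>
definition pairing :: "real ^ 'n \<Rightarrow> real ^ 'n \<Rightarrow> complex" where
  "pairing y g = exp (2 * of_real pi * \<i> * of_real (y \<bullet> (B *v g)))"

end

lemma exp_2pi_int: "x \<in> \<int> \<Longrightarrow> exp (2 * of_real pi * \<i> * of_real x) = 1"
  using exp_integer_2pi[of "of_real x"] by (auto elim!: Ints_cases simp: mult_ac)

lemma exp_2pi_eq_1_iff: "exp (2 * of_real pi * \<i> * of_real x) = 1 \<longleftrightarrow> x \<in> \<int>"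
proof
  assume "exp (2 * of_real pi * \<i> * of_real x) = 1"
  then obtain n :: int where "2 * pi * x = of_int (2 * n) * pi" by (auto simp: exp_eq_1)
  then have "x = of_int n" by simp
  then show "x \<in> \<int>" by simp
qed (rule exp_2pi_int)

context integer_basis
begin

lemma pairing_reduce:
  assumes y: "y \<in> int_lattice"
  shows "pairing y (reduce g) = pairing y g"
proof -
  have "y \<bullet> (B *v reduce g) = y \<bullet> (B *v g) + y \<bullet> (B *v (reduce g - g))"
    by (simp add: matrix_vector_mult_diff_distrib inner_diff_right)
  then show ?thesis
    using exp_2pi_int[OF int_lattice_inner[OF y reduce_congruent[of g]]]
    by (simp add: pairing_def distrib_left exp_add)
qed

lemma pairing_add: "pairing y (g + h) = pairing y g * pairing y h"
  by (simp add: pairing_def matrix_vector_right_distrib inner_add_right distrib_left exp_add)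

text \<open>
  Orthogonality of characters: translating the sum over the finite group by a unit vector multiplies it by
  the value of the character at that vector, which can be chosen different from \<open>1\<close>.\<close>
lemma sum_pairing:
  assumes y: "y \<in> int_lattice"
  shows "(\<Sum>g\<in>cell_points B. pairing y g)
    = (if transpose B *v y \<in> int_lattice then of_nat (card (cell_points B)) else 0)"
proof (cases "transpose B *v y \<in> int_lattice")
  case True
  have "pairing y g = 1" if "g \<in> cell_points B" for g
  proof -
    have "y \<bullet> (B *v g) = (transpose B *v y) \<bullet> g"
      by (metis dot_lmul_matrix vector_transpose_matrix transpose_transpose)
    also have "\<dots> \<in> \<int>" using True that by (intro int_lattice_inner) (auto simp: cell_points_def)
    finally show ?thesis unfolding pairing_def by (rule exp_2pi_int)
  qed
  then show ?thesis using True by simp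
next
  case False
  then obtain i where i: "(transpose B *v y) $ i \<notin> \<int>" by (auto simp: int_lattice_def)
  let ?a = "axis i 1 :: real ^ 'n"
  have a: "?a \<in> int_lattice" by (auto simp: int_lattice_def axis_def)
  have "y \<bullet> (B *v ?a) = (transpose B *v y) \<bullet> ?a"
    by (metis dot_lmul_matrix vector_transpose_matrix transpose_transpose)
  also have "\<dots> = (transpose B *v y) $ i" by (simp add: inner_axis)
  finally have "pairing y ?a \<noteq> 1" using i unfolding pairing_def exp_2pi_eq_1_iff by simp
  moreover have "(\<Sum>g\<in>cell_points B. pairing y g) = (\<Sum>g\<in>cell_points B. pairing y (reduce (g + ?a)))"
    using sum.reindex_bij_betw[OF bij_reduce_shift[OF a], of "pairing y"] by simp
  then have "(\<Sum>g\<in>cell_points B. pairing y g) = (\<Sum>g\<in>cell_points B. pairing y g) * pairing y ?a"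
    unfolding pairing_reduce[OF y] pairing_add sum_distrib_right .
  ultimately show ?thesis using False by simp
qed

end

lemma transpose_integer_basis:
  assumes "integer_basis A B"
  shows "integer_basis (transpose A) (transpose B)"
proof -
  interpret integer_basis A B by fact
  show ?thesis
  proof
    show "int_matrix (transpose A)" by (rule int_matrix_transpose[OF int_A])
    show "transpose A ** transpose B = mat 1"
      using BA by (metis matrix_transpose_mul transpose_mat)
  qed
qed

text \<open>
  A finite group has as many characters as elements. Summing the pairing over both arguments
  gives either cardinality, by orthogonality in one argument or in the other.\<close>
lemma card_cell_points_transpose:
  assumes "integer_basis A B"
  shows "card (cell_points (transpose B)) = card (cell_points B)"
proof -
  have main: "(\<Sum>y\<in>cell_points (transpose B). \<Sum>g\<in>cell_points B. integer_basis.pairing B y g)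
      = of_nat (card (cell_points B))" if "integer_basis A B" for A B :: "real ^ 'n ^ 'n"
  proof -
    interpret integer_basis A B by fact
    interpret T: integer_basis "transpose A" "transpose B" by (rule transpose_integer_basis) fact
    have "(\<Sum>y\<in>cell_points (transpose B). \<Sum>g\<in>cell_points B. pairing y g)
        = (\<Sum>y\<in>cell_points (transpose B). if y = 0 then of_nat (card (cell_points B)) else 0)"
    proof (rule sum.cong[OF refl])
      fix y assume y: "y \<in> cell_points (transpose B)"
      have "transpose B *v y \<in> int_lattice \<longleftrightarrow> y = 0"
        using T.cell_points_eqI[OF y T.zero_cell_point] by auto
      then show "(\<Sum>g\<in>cell_points B. pairing y g) = (if y = 0 then of_nat (card (cell_points B)) else 0)"
        using y by (subst sum_pairing) (auto simp: cell_points_def)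
    qed
    also have "\<dots> = of_nat (card (cell_points B))"
      using T.finite_cell_points T.zero_cell_point by simp
    finally show ?thesis .
  qed
  interpret integer_basis A B by fact
  interpret T: integer_basis "transpose A" "transpose B" by (rule transpose_integer_basis) fact
  have "of_nat (card (cell_points B)) = (\<Sum>y\<in>cell_points (transpose B). \<Sum>g\<in>cell_points B. pairing y g)"
    using main[OF assms] by simp
  also have "\<dots> = (\<Sum>g\<in>cell_points B. \<Sum>y\<in>cell_points (transpose B). T.pairing g y)"
  proof (subst sum.swap, intro sum.cong refl)
    fix y g
    have "y \<bullet> (B *v g) = g \<bullet> (transpose B *v y)"
      by (metis dot_lmul_matrix vector_transpose_matrix transpose_transpose inner_commute)
    then show "pairing y g = T.pairing g y" by (simp add: pairing_def T.pairing_def)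
  qed
  also have "\<dots> = of_nat (card (cell_points (transpose B)))"
    using main[OF T.integer_basis_axioms] by simp
  finally show ?thesis by (metis of_nat_eq_iff)
qed

section \<open>Change of variables by an integer matrix\<close>

lemma nn_integral_prod_vec:
  fixes f :: "'n::finite \<Rightarrow> real \<Rightarrow> ennreal"
  assumes [measurable]: "\<And>i. f i \<in> borel_measurable borel"
  shows "(\<integral>\<^sup>+x. (\<Prod>i\<in>UNIV. f i (x $ i)) \<partial>(lborel :: (real ^ 'n) measure)) = (\<Prod>i\<in>UNIV. \<integral>\<^sup>+y. f i y \<partial>lborel)"
proof -
  define idx :: "real ^ 'n \<Rightarrow> 'n" where "idx b = (THE i. b = axis i 1)" for b
  have idx: "idx (axis i 1) = i" for i
    unfolding idx_def by (rule the_equality) (auto simp: axis_eq_axis)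
  have B: "(Basis :: (real ^ 'n) set) = (\<lambda>i. axis i 1) ` UNIV" by (auto simp: Basis_vec_def)
  have inj: "inj (\<lambda>i::'n. axis i (1::real))" by (auto simp: inj_on_def axis_eq_axis)
  have "(\<integral>\<^sup>+x. (\<Prod>b\<in>Basis. f (idx b) (x \<bullet> b)) \<partial>(lborel :: (real ^ 'n) measure))
      = (\<Prod>b\<in>(Basis :: (real ^ 'n) set). \<integral>\<^sup>+y. f (idx b) y \<partial>lborel)"
    by (rule nn_integral_lborel_prod) auto
  then show ?thesis
    unfolding B prod.reindex[OF inj] by (simp add: idx inner_axis o_def)
qed

lemma nn_integral_lborel_translate:
  fixes f :: "'a::euclidean_space \<Rightarrow> ennreal"
  assumes [measurable]: "f \<in> borel_measurable borel"
  shows "(\<integral>\<^sup>+x. f (c + x) \<partial>lborel) = (\<integral>\<^sup>+x. f x \<partial>lborel)"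
proof -
  have "(\<integral>\<^sup>+x. f x \<partial>lborel) = (\<integral>\<^sup>+x. f x \<partial>distr lborel borel ((+) c))" by (simp add: lborel_distr_plus)
  also have "\<dots> = (\<integral>\<^sup>+x. f (c + x) \<partial>lborel)" by (rule nn_integral_distr) auto
  finally show ?thesis by simp
qed

lemma unit_cell_measurable [measurable]: "(unit_cell :: (real ^ 'n) set) \<in> sets borel"
proof -
  have "(unit_cell :: (real ^ 'n) set) = (\<Inter>i. {x :: real ^ 'n. 0 \<le> x $ i} \<inter> {x. x $ i < 1})" by (auto simp: unit_cell_def)
  moreover have "{x :: real ^ 'n. 0 \<le> x $ i} \<inter> {x. x $ i < 1} \<in> sets borel" for i
    by (intro sets.Int borel_closed borel_open closed_Collect_le open_Collect_less continuous_intros)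
  then have "(\<Inter>i\<in>UNIV. {x :: real ^ 'n. 0 \<le> x $ i} \<inter> {x. x $ i < 1}) \<in> sets borel"
    by (intro sets.finite_INT) auto
  ultimately show ?thesis by simp
qed

lemma nn_integral_unit_cell: "(\<integral>\<^sup>+x. indicator unit_cell x \<partial>(lborel :: (real ^ 'n) measure)) = 1"
proof -
  have "(\<integral>\<^sup>+x. indicator unit_cell x \<partial>(lborel :: (real ^ 'n) measure))
    = (\<integral>\<^sup>+x. (\<Prod>i\<in>UNIV. indicator {0..<1} (x $ i)) \<partial>(lborel :: (real ^ 'n) measure))"
  proof (rule nn_integral_cong)
    fix x :: "real ^ 'n"
    show "indicator unit_cell x = (\<Prod>i\<in>UNIV. indicator {0..<1} (x $ i) :: ennreal)"
    proof (cases "x \<in> unit_cell")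
      case True
      then show ?thesis by (simp add: unit_cell_def)
    next
      case False
      then obtain i where "x $ i \<notin> {0..<1}" by (auto simp: unit_cell_def)
      then have "\<exists>i\<in>UNIV. indicator {0..<1} (x $ i) = (0::ennreal)" by (auto intro!: exI[of _ i])
      then show ?thesis using False by (simp add: prod_zero)
    qed
  qed
  also have "\<dots> = (\<Prod>i\<in>(UNIV::'n set). \<integral>\<^sup>+y. indicator {0..<1::real} y \<partial>lborel)"
    by (rule nn_integral_prod_vec[where f = "\<lambda>_::'n. indicator {0..<1}"]) auto
  also have "(\<integral>\<^sup>+y. indicator {0..<1::real} y \<partial>lborel) = (1 :: ennreal)"
    by (subst nn_integral_indicator) auto
  finally show ?thesis by simp
qed

lemma matrix_vector_borel [measurable]:
  fixes A :: "real ^ 'n ^ 'm"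
  shows "(\<lambda>x. A *v x) \<in> borel_measurable borel"
  by (intro borel_measurable_continuous_onI linear_continuous_on matrix_vector_mul_bounded_linear)

context integer_basis
begin

text \<open>
  Uniqueness of translation invariant measures: smear \<open>f\<close> over a translated unit cell, use Fubini
  and translate. The factor is determined afterwards by a comparison of volumes.\<close>
lemma nn_integral_linear_proportional:
  assumes f [measurable]: "f \<in> borel_measurable borel"
  shows "(\<integral>\<^sup>+x. f (A *v x) \<partial>lborel)
    = (\<integral>\<^sup>+x. indicator unit_cell (- (A *v x)) \<partial>lborel) * (\<integral>\<^sup>+x. f x \<partial>lborel)"
proof -
  have "(\<integral>\<^sup>+x. f (A *v x) \<partial>lborel) = (\<integral>\<^sup>+x. \<integral>\<^sup>+y. f (A *v x) * indicator unit_cell (- (A *v x) + y) \<partial>lborel \<partial>lborel)"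
  proof (rule nn_integral_cong)
    fix x
    have "(\<integral>\<^sup>+y. f (A *v x) * indicator unit_cell (- (A *v x) + y) \<partial>lborel)
        = f (A *v x) * (\<integral>\<^sup>+y. indicator unit_cell (- (A *v x) + y) \<partial>lborel)"
      by (rule nn_integral_cmult) measurable
    also have "(\<integral>\<^sup>+y. indicator unit_cell (- (A *v x) + y) \<partial>lborel) = 1"
      using nn_integral_lborel_translate[of "indicator unit_cell" "- (A *v x)"] nn_integral_unit_cell by simp
    finally show "f (A *v x) = (\<integral>\<^sup>+y. f (A *v x) * indicator unit_cell (- (A *v x) + y) \<partial>lborel)" by simp
  qed
  also have "\<dots> = (\<integral>\<^sup>+y. \<integral>\<^sup>+x. f (A *v x) * indicator unit_cell (- (A *v x) + y) \<partial>lborel \<partial>lborel)"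
    by (rule lborel_pair.Fubini') measurable
  also have "\<dots> = (\<integral>\<^sup>+y. \<integral>\<^sup>+x. f (y + A *v x) * indicator unit_cell (- (A *v x)) \<partial>lborel \<partial>lborel)"
  proof (rule nn_integral_cong)
    fix y
    have "(\<integral>\<^sup>+x. f (A *v x) * indicator unit_cell (- (A *v x) + y) \<partial>lborel)
      = (\<integral>\<^sup>+x. f (A *v (B *v y + x)) * indicator unit_cell (- (A *v (B *v y + x)) + y) \<partial>lborel)"
      by (rule nn_integral_lborel_translate[symmetric]) measurable
    then show "(\<integral>\<^sup>+x. f (A *v x) * indicator unit_cell (- (A *v x) + y) \<partial>lborel)
      = (\<integral>\<^sup>+x. f (y + A *v x) * indicator unit_cell (- (A *v x)) \<partial>lborel)"
      by (simp add: matrix_vector_right_distrib)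
  qed
  also have "\<dots> = (\<integral>\<^sup>+x. \<integral>\<^sup>+y. f (y + A *v x) * indicator unit_cell (- (A *v x)) \<partial>lborel \<partial>lborel)"
    by (rule lborel_pair.Fubini') measurable
  also have "\<dots> = (\<integral>\<^sup>+x. indicator unit_cell (- (A *v x)) * (\<integral>\<^sup>+y. f y \<partial>lborel) \<partial>lborel)"
  proof (rule nn_integral_cong)
    fix x
    have "(\<integral>\<^sup>+y. f (y + A *v x) * indicator unit_cell (- (A *v x)) \<partial>lborel)
        = (\<integral>\<^sup>+y. f (A *v x + y) \<partial>lborel) * indicator unit_cell (- (A *v x))"
      by (subst nn_integral_multc[symmetric]) (auto simp: add.commute)
    also have "(\<integral>\<^sup>+y. f (A *v x + y) \<partial>lborel) = (\<integral>\<^sup>+y. f y \<partial>lborel)"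
      by (rule nn_integral_lborel_translate) measurable
    finally show "(\<integral>\<^sup>+y. f (y + A *v x) * indicator unit_cell (- (A *v x)) \<partial>lborel)
      = indicator unit_cell (- (A *v x)) * (\<integral>\<^sup>+y. f y \<partial>lborel)" by (simp add: mult.commute)
  qed
  also have "\<dots> = (\<integral>\<^sup>+x. indicator unit_cell (- (A *v x)) \<partial>lborel) * (\<integral>\<^sup>+x. f x \<partial>lborel)"
    by (rule nn_integral_multc) measurable
  finally show ?thesis .
qed

text \<open>Every translate of the fundamental parallelepiped contains the same number of lattice points.\<close>
lemma card_translate_cell_points:
  "card {z \<in> int_lattice. B *v (x + z) \<in> unit_cell} = card (cell_points B)"
proof -
  let ?S = "{z \<in> int_lattice. B *v (x + z) \<in> unit_cell}"
  let ?g = "\<lambda>y. y - A *v floor_vec (B *v (x + y))"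
  have g: "?g y \<in> ?S" if "y \<in> int_lattice" for y
  proof -
    have "B *v (x + ?g y) = B *v (x + y) - floor_vec (B *v (x + y))"
      by (simp add: matrix_vector_mult_diff_distrib matrix_vector_right_distrib)
    then have "B *v (x + ?g y) \<in> unit_cell" by (simp only: diff_floor_vec)
    moreover have "?g y \<in> int_lattice"
      using that by (intro int_lattice_diff int_matrix_mult int_A floor_vec_int)
    ultimately show ?thesis by simp
  qed
  have "bij_betw reduce ?S (cell_points B)"
  proof (rule bij_betwI[where g = ?g])
    show "reduce \<in> ?S \<rightarrow> cell_points B" by (auto intro: reduce_in)
    show "?g \<in> cell_points B \<rightarrow> ?S" using g by (auto simp: cell_points_def)
    show "reduce (?g y) = y" if y: "y \<in> cell_points B" for y
    proof (rule cell_points_eqI)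
      have yl: "y \<in> int_lattice" using y by (simp add: cell_points_def)
      show "reduce (?g y) \<in> cell_points B" using g[OF yl] by (intro reduce_in) simp
      have "B *v (reduce (?g y) - y) = B *v (reduce (?g y) - ?g y) + - floor_vec (B *v (x + y))"
        by (simp add: matrix_vector_mult_diff_distrib)
      then show "B *v (reduce (?g y) - y) \<in> int_lattice"
        by (simp only:) (intro int_lattice_add reduce_congruent int_lattice_uminus floor_vec_int)
    qed (rule y)
    show "?g (reduce z) = z" if z: "z \<in> ?S" for z
    proof -
      have zl: "z \<in> int_lattice" "B *v (x + z) \<in> unit_cell" using z by auto
      have "reduce z \<in> int_lattice" using reduce_in[OF zl(1)] by (simp add: cell_points_def)
      then have gz: "B *v (x + ?g (reduce z)) \<in> unit_cell" using g by blast
      have "B *v (x + ?g (reduce z)) - B *v (x + z)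
        = B *v (reduce z - z) + - floor_vec (B *v (x + reduce z))"
        by (simp add: matrix_vector_mult_diff_distrib matrix_vector_right_distrib)
      then have "B *v (x + ?g (reduce z)) - B *v (x + z) \<in> int_lattice"
        by (simp only:) (intro int_lattice_add reduce_congruent int_lattice_uminus floor_vec_int)
      then have "B *v (x + ?g (reduce z)) = B *v (x + z)"
        by (rule unit_cell_congruent_eq[OF gz zl(2)])
      then have "x + ?g (reduce z) = x + z" by (metis A_B_vec)
      then show ?thesis by (simp only: add_left_cancel)
    qed
  qed
  then show ?thesis by (rule bij_betw_same_card)
qed

text \<open>
  The volume of the fundamental parallelepiped is its number of lattice points: cut it along the
  integer translates of the unit cell, move the pieces into the unit cell, and count how often each point is covered.\<close>
lemma nn_integral_parallelepiped:
  "(\<integral>\<^sup>+y. indicator unit_cell (B *v y) \<partial>lborel) = of_nat (card (cell_points B))"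
proof -
  define Z where "Z = {z \<in> int_lattice. \<exists>x\<in>unit_cell. B *v (x + z) \<in> unit_cell}"
  have "Z \<subseteq> (\<Union>a\<in>(*v) A ` unit_cell. \<Union>b\<in>unit_cell. {a - b}) \<inter> int_lattice"
  proof
    fix z assume "z \<in> Z"
    then obtain x where x: "z \<in> int_lattice" "x \<in> unit_cell" "B *v (x + z) \<in> unit_cell" by (auto simp: Z_def)
    then have "z = A *v (B *v (x + z)) - x" by simp
    then show "z \<in> (\<Union>a\<in>(*v) A ` unit_cell. \<Union>b\<in>unit_cell. {a - b}) \<inter> int_lattice"
      using x by blast
  qed
  moreover have "bounded (\<Union>a\<in>(*v) A ` unit_cell. \<Union>b\<in>unit_cell. {a - b})"
    by (intro bounded_differences bounded_linear_image bounded_unit_cell matrix_vector_mul_bounded_linear)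
  ultimately have finZ: "finite Z" using finite_bounded_int_lattice finite_subset by blast
  have split: "indicator unit_cell (B *v y) = (\<Sum>z\<in>Z. indicator unit_cell (- z + y) * indicator unit_cell (B *v y) :: ennreal)" for y
  proof (cases "B *v y \<in> unit_cell")
    case True
    have eq: "- z + y \<in> unit_cell \<longleftrightarrow> z = floor_vec y" if "z \<in> Z" for z
    proof
      assume "- z + y \<in> unit_cell"
      moreover have "(- z + y) - (y - floor_vec y) \<in> int_lattice"
        using int_lattice_diff[of "floor_vec y" z] that by (simp add: Z_def)
      ultimately have "- z + y = y - floor_vec y" by (intro unit_cell_congruent_eq) auto
      then show "z = floor_vec y" by (simp add: algebra_simps)
    next
      assume "z = floor_vec y"
      then show "- z + y \<in> unit_cell" using diff_floor_vec[of y] by simp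
    qed
    have "floor_vec y \<in> Z"
      unfolding Z_def using True by (auto intro!: bexI[of _ "y - floor_vec y"])
    then have "(\<Sum>z\<in>Z. indicator unit_cell (- z + y) :: ennreal) = (\<Sum>z\<in>Z. if z = floor_vec y then 1 else 0)"
      using eq by (intro sum.cong) (auto simp: indicator_def)
    also have "\<dots> = 1" using finZ \<open>floor_vec y \<in> Z\<close> by simp
    finally show ?thesis using True by simp
  qed simp
  have "(\<integral>\<^sup>+y. indicator unit_cell (B *v y) \<partial>lborel)
     = (\<integral>\<^sup>+y. (\<Sum>z\<in>Z. indicator unit_cell (- z + y) * indicator unit_cell (B *v y)) \<partial>lborel)"
    by (rule nn_integral_cong) (rule split)
  also have "\<dots> = (\<Sum>z\<in>Z. \<integral>\<^sup>+y. indicator unit_cell (- z + y) * indicator unit_cell (B *v y) \<partial>lborel)"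
    by (rule nn_integral_sum) measurable
  also have "\<dots> = (\<Sum>z\<in>Z. \<integral>\<^sup>+y. indicator unit_cell y * indicator unit_cell (B *v (z + y)) \<partial>lborel)"
  proof (rule sum.cong[OF refl])
    fix z assume "z \<in> Z"
    have "(\<integral>\<^sup>+y. indicator unit_cell (- z + (z + y)) * indicator unit_cell (B *v (z + y)) \<partial>lborel)
        = (\<integral>\<^sup>+y. indicator unit_cell (- z + y) * indicator unit_cell (B *v y) \<partial>lborel)"
      by (rule nn_integral_lborel_translate) measurable
    then show "(\<integral>\<^sup>+y. indicator unit_cell (- z + y) * indicator unit_cell (B *v y) \<partial>lborel)
      = (\<integral>\<^sup>+y. indicator unit_cell y * indicator unit_cell (B *v (z + y)) \<partial>lborel)" by simp
  qed
  also have "\<dots> = (\<integral>\<^sup>+y. (\<Sum>z\<in>Z. indicator unit_cell y * indicator unit_cell (B *v (z + y))) \<partial>lborel)"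
    by (rule nn_integral_sum[symmetric]) measurable
  also have "\<dots> = (\<integral>\<^sup>+y. of_nat (card (cell_points B)) * indicator unit_cell y \<partial>(lborel :: (real ^ 'n) measure))"
  proof (rule nn_integral_cong)
    fix y
    show "(\<Sum>z\<in>Z. indicator unit_cell y * indicator unit_cell (B *v (z + y)))
      = of_nat (card (cell_points B)) * (indicator unit_cell y :: ennreal)"
    proof (cases "y \<in> unit_cell")
      case True
      have "(\<Sum>z\<in>Z. indicator unit_cell y * indicator unit_cell (B *v (z + y)) :: ennreal)
          = (\<Sum>z\<in>Z. if B *v (y + z) \<in> unit_cell then 1 else 0)"
        using True by (intro sum.cong) (auto simp: indicator_def add.commute)
      also have "\<dots> = of_nat (card {z \<in> Z. B *v (y + z) \<in> unit_cell})"
        using finZ by (simp add: sum.If_cases Int_def)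
      also have "{z \<in> Z. B *v (y + z) \<in> unit_cell} = {z \<in> int_lattice. B *v (y + z) \<in> unit_cell}"
        using True by (auto simp: Z_def)
      finally show ?thesis using True card_translate_cell_points by simp
    qed simp
  qed
  also have "\<dots> = of_nat (card (cell_points B)) * (\<integral>\<^sup>+y. indicator unit_cell y \<partial>(lborel :: (real^'n) measure))"
    by (rule nn_integral_cmult) measurable
  finally show ?thesis by (simp only: nn_integral_unit_cell) simp
qed

lemma nn_integral_linear:
  assumes f [measurable]: "f \<in> borel_measurable borel"
  shows "(\<integral>\<^sup>+x. f (A *v x) \<partial>lborel) = (\<integral>\<^sup>+x. f x \<partial>lborel) / of_nat (card (cell_points B))"
proof -
  let ?c = "\<integral>\<^sup>+x. indicator unit_cell (- (A *v x)) \<partial>lborel"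
  let ?m = "of_nat (card (cell_points B)) :: ennreal"
  have "?c * ?m = 1"
    using nn_integral_linear_proportional[of "\<lambda>y. indicator unit_cell (B *v y)"]
      nn_integral_unit_cell[where 'n='n] nn_integral_parallelepiped by simp
  then have "?c = 1 / ?m"
    using card_cell_points_pos ennreal_mult_divide_eq[of ?m ?c]
    by (simp add: mult.commute)
  then show ?thesis
    using nn_integral_linear_proportional[OF f] by (simp add: ennreal_times_divide mult.commute)
qed

end

section \<open>Integrals and lattice sums over a simplicial cone\<close>

lemma ckernel_sign: "s \<noteq> 0 \<Longrightarrow> ckernel s y = sgn s * \<bar>ckernel s y\<bar>"
  by (auto simp: ckernel_def abs_mult)

lemma ckernel_measurable [measurable]: "ckernel s \<in> borel_measurable borel"
  unfolding ckernel_def[abs_def] by measurable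

lemma nn_integral_abs_ckernel_pos:
  assumes s: "s > 0"
  shows "(\<integral>\<^sup>+y. ennreal \<bar>ckernel s y\<bar> \<partial>lborel) = ennreal (1 / s)"
proof (rule nn_integral_has_integral_lborel)
  have "((\<lambda>y. if y \<in> {0..} then exp (- s * y) else 0) has_integral exp (- s * 0) / s) UNIV"
    unfolding has_integral_restrict_UNIV by (rule has_integral_exp_minus_to_infinity[OF s])
  moreover have "(\<lambda>y. if y \<in> {0..} then exp (- s * y) else 0) = (\<lambda>y. \<bar>ckernel s y\<bar>)"
    using s by (auto simp: ckernel_def fun_eq_iff)
  ultimately show "((\<lambda>y. \<bar>ckernel s y\<bar>) has_integral 1 / s) UNIV" by simp
qed auto

lemma nn_integral_abs_ckernel:
  assumes s: "s \<noteq> 0"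
  shows "(\<integral>\<^sup>+y. ennreal \<bar>ckernel s y\<bar> \<partial>lborel) = ennreal (1 / \<bar>s\<bar>)"
proof (cases "s > 0")
  case True
  then show ?thesis using nn_integral_abs_ckernel_pos by simp
next
  case False
  then have s': "- s > 0" using s by simp
  have "(\<integral>\<^sup>+y. ennreal \<bar>ckernel s y\<bar> \<partial>lborel) = (\<integral>\<^sup>+y. ennreal \<bar>ckernel s (0 + (-1) * y)\<bar> \<partial>lborel)"
    by (subst nn_integral_real_affine[of _ "-1" 0]) auto
  also have "\<dots> = (\<integral>\<^sup>+y. ennreal \<bar>ckernel (- s) y\<bar> \<partial>lborel)"
  proof (rule nn_integral_cong_AE)
    show "AE y in lborel. ennreal \<bar>ckernel s (0 + (-1) * y)\<bar> = ennreal \<bar>ckernel (- s) y\<bar>"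
      using AE_lborel_singleton[of "0::real"]
    proof eventually_elim
      case (elim y)
      then have "\<bar>ckernel s (0 + (-1) * y)\<bar> = \<bar>ckernel (- s) y\<bar>"
        using s' by (auto simp: ckernel_def abs_mult)
      then show ?case by simp
    qed
  qed
  also have "\<dots> = ennreal (1 / \<bar>s\<bar>)" using nn_integral_abs_ckernel_pos[OF s'] s' by simp
  finally show ?thesis .
qed

context integer_basis
begin

text \<open>
  In the coordinates \<open>A x\<close> the integrand is a product of functions of one variable. Up to sign it is
  nonnegative, so the nonnegative integral can be used.\<close>
lemma has_bochner_integral_cone:
  fixes s :: "'n \<Rightarrow> real"
  assumes s: "\<And>i. s i \<noteq> 0"
  shows "has_bochner_integral lborel (\<lambda>x. \<Prod>i\<in>UNIV. ckernel (s i) ((A *v x) $ i + c $ i))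
    ((\<Prod>i\<in>UNIV. 1 / s i) / real (card (cell_points B)))"
proof -
  let ?m = "real (card (cell_points B))"
  let ?F = "\<lambda>x. \<Prod>i\<in>UNIV. \<bar>ckernel (s i) ((A *v x) $ i + c $ i)\<bar>"
  have "(\<integral>\<^sup>+x. ennreal (?F x) \<partial>lborel) = ennreal ((\<Prod>i\<in>UNIV. 1 / \<bar>s i\<bar>) / ?m)"
  proof -
    let ?f = "\<lambda>x :: real ^ 'n. \<Prod>i\<in>UNIV. ennreal \<bar>ckernel (s i) (x $ i)\<bar>"
    have [measurable]: "?f \<in> borel_measurable borel" by measurable
    have "(\<integral>\<^sup>+x. ennreal (?F x) \<partial>lborel) = (\<integral>\<^sup>+x. ?f (A *v x + c) \<partial>lborel)"
      by (simp add: prod_ennreal)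
    also have "\<dots> = (\<integral>\<^sup>+x. ?f (A *v (B *v c + x)) \<partial>lborel)"
      by (simp add: matrix_vector_right_distrib add.commute)
    also have "\<dots> = (\<integral>\<^sup>+x. ?f (A *v x) \<partial>lborel)"
      by (rule nn_integral_lborel_translate) measurable
    also have "\<dots> = (\<integral>\<^sup>+x. ?f x \<partial>lborel) / of_nat (card (cell_points B))"
      by (rule nn_integral_linear) measurable
    also have "(\<integral>\<^sup>+x. ?f x \<partial>lborel) = (\<Prod>i\<in>UNIV. ennreal (1 / \<bar>s i\<bar>))"
      by (subst nn_integral_prod_vec[where f = "\<lambda>i y. ennreal \<bar>ckernel (s i) y\<bar>"])
        (auto simp: nn_integral_abs_ckernel s)
    also have "\<dots> = ennreal (\<Prod>i\<in>UNIV. 1 / \<bar>s i\<bar>)" by (rule prod_ennreal) auto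
    finally show ?thesis
      using card_cell_points_pos by (simp add: divide_ennreal ennreal_of_nat_eq_real_of_nat prod_nonneg)
  qed
  moreover have "(\<lambda>x. (A *v x) $ i) \<in> borel_measurable lborel" for i
  proof -
    have "continuous_on UNIV (\<lambda>x. (A *v x) $ i)"
      by (intro continuous_on_component linear_continuous_on matrix_vector_mul_bounded_linear)
    then show ?thesis by (simp add: borel_measurable_continuous_onI)
  qed
  then have "?F \<in> borel_measurable lborel"
    by (intro borel_measurable_prod borel_measurable_abs
        measurable_compose[OF borel_measurable_add[OF _ borel_measurable_const] ckernel_measurable]) auto
  ultimately have "has_bochner_integral lborel ?F ((\<Prod>i\<in>UNIV. 1 / \<bar>s i\<bar>) / ?m)"
    by (intro has_bochner_integral_nn_integral) (auto intro!: prod_nonneg divide_nonneg_nonneg AE_I2)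
  then have "has_bochner_integral lborel (\<lambda>x. (\<Prod>i\<in>UNIV. sgn (s i)) * ?F x)
      ((\<Prod>i\<in>UNIV. sgn (s i)) * ((\<Prod>i\<in>UNIV. 1 / \<bar>s i\<bar>) / ?m))"
    by (intro has_bochner_integral_mult_right)
  moreover have "(\<Prod>i\<in>UNIV. sgn (s i)) * ?F x = (\<Prod>i\<in>UNIV. ckernel (s i) ((A *v x) $ i + c $ i))" for x
    unfolding prod.distrib[symmetric] by (intro prod.cong refl) (use ckernel_sign[OF s] in simp)
  moreover have "(\<Prod>i\<in>UNIV. sgn (s i)) * ((\<Prod>i\<in>UNIV. 1 / \<bar>s i\<bar>) / ?m) = (\<Prod>i\<in>UNIV. 1 / s i) / ?m"
  proof -
    have "sgn (s i) * (1 / \<bar>s i\<bar>) = 1 / s i" for i using s[of i] by (auto simp: sgn_if)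
    then have "(\<Prod>i\<in>UNIV. sgn (s i)) * (\<Prod>i\<in>UNIV. 1 / \<bar>s i\<bar>) = (\<Prod>i\<in>UNIV. 1 / s i)"
      unfolding prod.distrib[symmetric] by simp
    then show ?thesis by simp
  qed
  ultimately show ?thesis by (simp only:)
qed

end

lemma has_sum_sum:
  fixes f :: "'i \<Rightarrow> 'a \<Rightarrow> 'b::topological_comm_monoid_add"
  assumes "finite I" "\<And>i. i \<in> I \<Longrightarrow> (f i has_sum S i) A"
  shows "((\<lambda>x. \<Sum>i\<in>I. f i x) has_sum (\<Sum>i\<in>I. S i)) A"
  using assms by (induction I rule: finite_induct) (auto intro!: has_sum_add)

context integer_basis
begin

text \<open>The characters of the finite quotient group in the coordinates of the cone.\<close>
definition root_of :: "real ^ 'n \<Rightarrow> 'n \<Rightarrow> complex" where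
  "root_of g i = exp (2 * of_real pi * \<i> * of_real ((transpose B *v g) $ i))"

text \<open>
  In the coordinates \<open>y = A z\<close> the sum runs over a sublattice of \<open>\<int>\<^sup>n\<close>. By orthogonality
  its indicator function is the average of the characters, and the sum over \<open>\<int>\<^sup>n\<close> of a
  character times the integrand is a product of sums over the integers.\<close>
lemma has_sum_lattice_cone:
  fixes s :: "'n \<Rightarrow> real"
  assumes s: "\<And>i. s i \<noteq> 0"
  shows "((\<lambda>z. complex_of_real (\<Prod>i\<in>UNIV. wkernel (s i) ((A *v z) $ i))) has_sum
     ((\<Sum>g\<in>cell_points (transpose B). \<Prod>i\<in>UNIV. char_sum (root_of g i) (s i)) / of_nat (card (cell_points B)))) int_lattice"
proof -
  interpret T: integer_basis "transpose A" "transpose B"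
    by (rule transpose_integer_basis) (rule integer_basis_axioms)
  let ?m = "of_nat (card (cell_points B)) :: complex"
  have m0: "?m \<noteq> 0" using card_cell_points_pos by simp
  define G where "G y = (\<Prod>i\<in>UNIV. wkernel (s i) (y $ i))" for y
  \<comment> \<open>The contribution of one character factors over the coordinates.\<close>
  have one: "((\<lambda>y. T.pairing y g * of_real (G y)) has_sum (\<Prod>i\<in>UNIV. char_sum (root_of g i) (s i))) int_lattice" for g
  proof -
    define c where "c = transpose B *v g"
    define h where "h i y = exp (2 * of_real pi * \<i> * of_real (c $ i * y)) * complex_of_real (wkernel (s i) y)" for i y
    have pw: "exp (2 * of_real pi * \<i> * of_real (c $ i * of_int m)) = root_of g i powi m" for i and m :: int
    proof -
      have "root_of g i powi m = exp (of_int m * (2 * of_real pi * \<i> * of_real (c $ i)))"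
        unfolding root_of_def c_def[symmetric] by (rule exp_power_int)
      then show ?thesis by (simp add: mult_ac)
    qed
    have "((\<lambda>y::real^'n. \<Prod>i\<in>UNIV. h i (y $ i)) has_sum (\<Prod>i\<in>UNIV. char_sum (root_of g i) (s i))) int_lattice"
    proof (rule has_sum_prod_lattice)
      fix i
      have nr: "norm (root_of g i) = 1" by (simp add: root_of_def)
      show "((\<lambda>m::int. h i (of_int m)) has_sum char_sum (root_of g i) (s i)) UNIV"
        unfolding h_def pw by (rule has_sum_wkernel[OF nr s])
      show "(\<lambda>m::int. norm (h i (of_int m))) summable_on UNIV"
      proof (rule summable_on_comparison_test)
        show "(\<lambda>m::int. exp (- \<bar>s i\<bar> * \<bar>of_int m\<bar>)) summable_on UNIV"
          using s by (intro abs_summable_exp_int) simp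
        show "norm (h i (of_int m)) \<le> exp (- \<bar>s i\<bar> * \<bar>of_int m\<bar>)" for m :: int
          using abs_wkernel_le[OF s, of i "of_int m"] by (simp add: h_def norm_mult)
      qed auto
    qed
    moreover have "(\<Prod>i\<in>UNIV. h i (y $ i)) = T.pairing y g * of_real (G y)" for y
    proof -
      have "T.pairing y g = (\<Prod>i\<in>UNIV. exp (2 * of_real pi * \<i> * of_real (c $ i * y $ i)))"
        unfolding T.pairing_def c_def[symmetric] inner_vec_def
        by (subst exp_sum[symmetric]) (auto simp: sum_distrib_left mult_ac)
      then show ?thesis by (simp add: h_def prod.distrib G_def)
    qed
    ultimately show ?thesis by simp
  qed
  have "((\<lambda>y. \<Sum>g\<in>cell_points (transpose B). T.pairing y g * of_real (G y)) has_sum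
     (\<Sum>g\<in>cell_points (transpose B). \<Prod>i\<in>UNIV. char_sum (root_of g i) (s i))) int_lattice"
    by (rule has_sum_sum[OF T.finite_cell_points one])
  then have "((\<lambda>y. (1 / ?m) * (\<Sum>g\<in>cell_points (transpose B). T.pairing y g * of_real (G y))) has_sum
     ((1 / ?m) * (\<Sum>g\<in>cell_points (transpose B). \<Prod>i\<in>UNIV. char_sum (root_of g i) (s i)))) int_lattice"
    by (rule has_sum_cmult_right)
  then have "((\<lambda>y. complex_of_real (G y)) has_sum
     ((1 / ?m) * (\<Sum>g\<in>cell_points (transpose B). \<Prod>i\<in>UNIV. char_sum (root_of g i) (s i)))) ((*v) A ` int_lattice)"
  proof (rule iffD1[OF has_sum_cong_neutral, rotated -1])
    \<comment> \<open>Summing over the characters keeps the sublattice only.\<close>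
    have sp: "(\<Sum>g\<in>cell_points (transpose B). T.pairing y g * of_real (G y))
      = (if B *v y \<in> int_lattice then ?m else 0) * of_real (G y)" if "y \<in> int_lattice" for y
      unfolding sum_distrib_right[symmetric] T.sum_pairing[OF that] transpose_transpose
        card_cell_points_transpose[OF integer_basis_axioms] ..
    fix y
    show "complex_of_real (G y) = 0" if "y \<in> (*v) A ` int_lattice - int_lattice"
      using that int_matrix_mult[OF int_A] by auto
    show "(1 / ?m) * (\<Sum>g\<in>cell_points (transpose B). T.pairing y g * of_real (G y)) = 0"
      if y: "y \<in> int_lattice - (*v) A ` int_lattice"
    proof -
      have "B *v y \<notin> int_lattice" using y by (metis A_B_vec DiffD2 image_eqI)
      then show ?thesis using sp[of y] y by simp
    qed
    show "(1 / ?m) * (\<Sum>g\<in>cell_points (transpose B). T.pairing y g * of_real (G y)) = of_real (G y)"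
      if y: "y \<in> int_lattice \<inter> (*v) A ` int_lattice"
    proof -
      have "B *v y \<in> int_lattice" using y by auto
      then show ?thesis using sp[of y] y m0 by simp
    qed
  qed
  moreover have "inj_on ((*v) A) int_lattice" by (rule inj_on_inverseI[of _ "(*v) B"]) simp
  ultimately show ?thesis
    by (subst (asm) has_sum_reindex) (auto simp: o_def G_def)
qed

end

section \<open>The periodic functions \<open>Q\<close>\<close>

text \<open>
  Differentiating \<open>exp ((a + b t) S)\<close> in \<open>t\<close> multiplies it by \<open>b S\<close>. The lemma serves twice: for the
  polynomial pieces of \<open>Q\<close> and for the derivatives in the shifts of the facets.\<close>
lemma fps_exp_linear_nth_derivative:
  fixes A :: "complex fps" and a b :: real
  shows "((\<lambda>t. fps_nth (A * fps_exp (of_real (a + b * t))) N) has_vector_derivative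
     fps_nth (fps_const (of_real b) * fps_X * (A * fps_exp (of_real (a + b * t)))) N) (at t)"
proof -
  define E where "E t = fps_exp (complex_of_real (a + b * t))" for t
  have E: "((\<lambda>t. fps_nth (E t) k) has_vector_derivative fps_nth (fps_const (of_real b) * fps_X * E t) k) (at t)" for k
  proof (cases k)
    case 0
    then show ?thesis by (simp add: E_def mult.assoc)
  next
    case (Suc j)
    have "((\<lambda>t. complex_of_real ((a + b * t) ^ Suc j / fact (Suc j))) has_vector_derivative
        of_real (b * (a + b * t) ^ j / fact j)) (at t)"
    proof (rule has_vector_derivative_of_real)
      have "((\<lambda>t. (a + b * t) ^ Suc j / fact (Suc j)) has_real_derivative
        (real (Suc j) * (a + b * t) ^ j * b) / fact (Suc j)) (at t)"
        by (rule derivative_eq_intros refl | simp)+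
      moreover have "(real (Suc j) * (a + b * t) ^ j * b) / fact (Suc j) = b * (a + b * t) ^ j / fact j"
        by (simp add: divide_simps del: of_nat_Suc)
      ultimately show "((\<lambda>t. (a + b * t) ^ Suc j / fact (Suc j)) has_real_derivative b * (a + b * t) ^ j / fact j) (at t)"
        by (simp only:)
    qed
    moreover have "fps_nth (E t) (Suc j) = complex_of_real ((a + b * t) ^ Suc j / fact (Suc j))" for t
      by (simp add: E_def del: power_Suc fact_Suc)
    moreover have "fps_nth (fps_const (of_real b) * fps_X * E t) (Suc j) = of_real (b * (a + b * t) ^ j / fact j)"
      by (simp add: E_def mult.assoc)
    ultimately show ?thesis unfolding Suc by (simp only:)
  qed
  have "((\<lambda>t. \<Sum>i=0..N. fps_nth A i * fps_nth (E t) (N - i)) has_vector_derivative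
      (\<Sum>i=0..N. fps_nth A i * fps_nth (fps_const (of_real b) * fps_X * E t) (N - i))) (at t)"
    by (intro has_vector_derivative_sum has_vector_derivative_mult_right E)
  also have "(\<Sum>i=0..N. fps_nth A i * fps_nth (fps_const (of_real b) * fps_X * E t) (N - i))
     = fps_nth (A * (fps_const (of_real b) * fps_X * E t)) N" by (simp only: fps_mult_nth)
  also have "A * (fps_const (of_real b) * fps_X * E t) = fps_const (of_real b) * fps_X * (A * E t)"
    by (simp only: mult_ac)
  also have "(\<lambda>t. \<Sum>i=0..N. fps_nth A i * fps_nth (E t) (N - i)) = (\<lambda>t. fps_nth (A * E t) N)"
    by (simp only: fps_mult_nth)
  finally show ?thesis by (simp only: E_def)
qed

text \<open>The generating function of the numbers \<open>Q\<^sub>m(0)\<close>, \<open>m \<ge> 1\<close>, up to the shift of the index by one.\<close>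
definition Q_gen :: "complex \<Rightarrow> complex fps" where
  "Q_gen l = fps_const l / (fps_exp 1 - fps_const l)"

lemma Q_gen_eq:
  assumes "l \<noteq> 1"
  shows "Q_gen l * (fps_exp 1 - fps_const l) = fps_const l"
proof -
  have "fps_nth (fps_exp 1 - fps_const l) 0 \<noteq> 0" using assms by simp
  then show ?thesis unfolding Q_gen_def by (simp add: fps_divide_unit mult.assoc inverse_mult_eq_1)
qed

text \<open>The restriction of \<open>Q\<^sub>m\<close> to the unit interval, of degree \<open>m - 1\<close>.\<close>
definition Q_piece :: "complex \<Rightarrow> nat \<Rightarrow> real \<Rightarrow> complex" where
  "Q_piece l m y = fps_nth (Q_gen l * fps_exp (of_real y)) (m - 1)"

text \<open>Crossing an integer multiplies the solution by \<open>l\<close>.\<close>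
definition Q_val :: "complex \<Rightarrow> nat \<Rightarrow> real \<Rightarrow> complex" where
  "Q_val l m x = l powi \<lfloor>x\<rfloor> * Q_piece l m (x - of_int \<lfloor>x\<rfloor>)"

lemma Q_piece_1: "l \<noteq> 1 \<Longrightarrow> Q_piece l 1 y = l / (1 - l)"
  by (simp add: Q_piece_def Q_gen_def fps_divide_unit divide_inverse)

text \<open>This is what makes \<open>Q_val\<close> continuous at the integers, and it is why \<open>Q_gen\<close> has the denominator \<open>exp S - l\<close>.\<close>
lemma Q_piece_wrap:
  assumes "l \<noteq> 1" "m \<ge> 2"
  shows "Q_piece l m 1 = l * Q_piece l m 0"
proof -
  have "Q_gen l * fps_exp 1 = fps_const l + fps_const l * Q_gen l"
    using Q_gen_eq[OF assms(1)] by (simp add: algebra_simps)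
  then show ?thesis using assms(2) by (simp add: Q_piece_def)
qed

lemma Q_piece_derivative:
  assumes "m \<ge> 2"
  shows "(Q_piece l m has_vector_derivative Q_piece l (m - 1) y) (at y)"
proof -
  obtain k where k: "m = Suc (Suc k)" using assms add_2_eq_Suc le_Suc_ex by blast
  show ?thesis
    using fps_exp_linear_nth_derivative[of "Q_gen l" 0 1 "m - 1" y]
    unfolding Q_piece_def k by (simp add: mult.assoc)
qed

lemma continuous_Q_piece: "continuous_on S (Q_piece l m)"
proof -
  have "(Q_piece l m has_vector_derivative
     fps_nth (fps_const (of_real 1) * fps_X * (Q_gen l * fps_exp (of_real (0 + 1 * t)))) (m - 1)) (at t)" for t
    using fps_exp_linear_nth_derivative[of "Q_gen l" 0 1 "m - 1" t] unfolding Q_piece_def by simp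
  then show ?thesis
    by (intro continuous_at_imp_continuous_on ballI has_vector_derivative_continuous)
qed

locale nontrivial_root =
  fixes l :: complex
  assumes l1: "l \<noteq> 1" and root: "\<exists>N>0. l ^ N = 1"
begin

abbreviation N :: nat where "N \<equiv> root_order l"

lemma N_pos: "N > 0" and l_N: "l ^ N = 1"
  using LeastI_ex[of "\<lambda>N. N > 0 \<and> l ^ N = 1"] root by (auto simp: root_order_def)

lemma l0: "l \<noteq> 0" using l_N N_pos by (auto simp: power_0_left)

lemma norm_l: "norm l = 1"
  using power_eq_1_iff[OF l_N] N_pos by simp

lemma Q_val_on_cell:
  assumes "m \<ge> 2" "x \<in> {of_int n..of_int n + 1}"
  shows "Q_val l m x = l powi n * Q_piece l m (x - of_int n)"
proof (cases "x = of_int n + 1")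
  case True
  then have "\<lfloor>x\<rfloor> = n + 1" by linarith
  then show ?thesis using True Q_piece_wrap[OF l1 assms(1)] l0
    by (simp add: Q_val_def power_int_add)
next
  case False
  then have "\<lfloor>x\<rfloor> = n" using assms(2) by (simp add: floor_eq_iff)
  then show ?thesis by (simp add: Q_val_def)
qed

lemma continuous_Q_val:
  assumes m: "m \<ge> 2"
  shows "continuous_on S (Q_val l m)"
proof -
  have cell: "continuous_on {of_int n..of_int n + 1} (Q_val l m)" for n :: int
  proof -
    have "continuous_on {of_int n..of_int n + 1} (\<lambda>x. l powi n * Q_piece l m (x - of_int n))"
      by (intro continuous_intros continuous_on_compose2[OF continuous_Q_piece[of UNIV]]) auto
    then show ?thesis
      by (rule continuous_on_eq) (use Q_val_on_cell[OF m] in auto)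
  qed
  have "isCont (Q_val l m) x" for x
  proof -
    define n where "n = \<lfloor>x\<rfloor>"
    have nx: "of_int n \<le> x" "x < of_int n + 1" by (auto simp: n_def)
    have "continuous_on ({of_int (n - 1)..of_int (n - 1) + 1} \<union> {of_int n..of_int n + 1}) (Q_val l m)"
      by (intro continuous_on_closed_Un cell) auto
    moreover have "{of_int (n - 1)..of_int (n - 1) + 1} \<union> {of_int n..of_int n + 1} = {of_int n - 1..of_int n + (1::real)}"
      by auto
    ultimately have "continuous_on {of_int n - 1..of_int n + (1::real)} (Q_val l m)" by simp
    then show ?thesis
      by (rule continuous_on_interior) (use nx in auto)
  qed
  then show ?thesis by (simp add: continuous_at_imp_continuous_on)
qed

lemma Q_val_derivative:
  assumes m: "m \<ge> 2" and x: "x \<notin> \<int>"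
  shows "(Q_val l m has_vector_derivative Q_val l (m - 1) x) (at x)"
proof -
  define n where "n = \<lfloor>x\<rfloor>"
  have nx: "of_int n < x" "x < of_int n + 1"
  proof -
    have "x \<noteq> of_int n" using x by (metis Ints_of_int)
    moreover have "of_int n \<le> x" "x < of_int n + 1" by (auto simp: n_def)
    ultimately show "of_int n < x" "x < of_int n + 1" by auto
  qed
  have fl: "\<lfloor>y\<rfloor> = n" if "y \<in> {of_int n<..<of_int n + 1}" for y :: real
    using that by (simp add: floor_eq_iff)
  have "(Q_piece l m has_vector_derivative Q_piece l (m - 1) (x - of_int n)) (at (x - of_int n))"
    by (rule Q_piece_derivative[OF m])
  then have "((\<lambda>y. Q_piece l m (y - of_int n)) has_vector_derivative Q_piece l (m - 1) (x - of_int n)) (at x)"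
  proof -
    assume d: "(Q_piece l m has_vector_derivative Q_piece l (m - 1) (x - of_int n)) (at (x - of_int n))"
    have "((\<lambda>y. y - of_int n) has_vector_derivative (1 - 0)) (at x)"
      by (intro has_vector_derivative_diff has_vector_derivative_id has_vector_derivative_const)
    from vector_diff_chain_at[OF this d] show ?thesis by (simp add: o_def)
  qed
  then have "((\<lambda>y. l powi n * Q_piece l m (y - of_int n)) has_vector_derivative
      l powi n * Q_piece l (m - 1) (x - of_int n)) (at x)"
    by (rule has_vector_derivative_mult_right)
  then have "(Q_val l m has_vector_derivative l powi n * Q_piece l (m - 1) (x - of_int n)) (at x)"
    by (rule has_vector_derivative_transform_within_open[of _ _ _ "{of_int n<..<of_int n + 1}"])
      (use nx fl in \<open>auto simp: Q_val_def\<close>)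
  then show ?thesis by (simp add: Q_val_def n_def)
qed

lemma finite_Ints_atLeastAtMost: "finite (\<int> \<inter> {a..b::real})"
proof -
  have "\<int> \<inter> {a..b} \<subseteq> of_int ` {\<lfloor>a\<rfloor>..\<lceil>b\<rceil>}"
    by (auto elim!: Ints_cases) (metis atLeastAtMost_iff floor_mono floor_of_int ceiling_mono ceiling_of_int image_eqI)
  then show ?thesis by (rule finite_subset) simp
qed

text \<open>The derivative may be missing at the finitely many integers of the interval, because the antiderivative is continuous there.\<close>
lemma has_integral_Q_val:
  assumes m: "m \<ge> 1" and ab: "a \<le> b"
  shows "(Q_val l m has_integral (Q_val l (Suc m) b - Q_val l (Suc m) a)) {a..b}"
proof (rule fundamental_theorem_of_calculus_interior_strong[OF finite_Ints_atLeastAtMost[of a b] ab])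
  show "(Q_val l (Suc m) has_vector_derivative Q_val l m x) (at x)" if "x \<in> {a<..<b} - \<int> \<inter> {a..b}" for x
    using Q_val_derivative[of "Suc m" x] m that by auto
  show "continuous_on {a..b} (Q_val l (Suc m))" using m by (intro continuous_Q_val) simp
qed

lemma Q_val_periodic: "Q_val l m (x + real N) = Q_val l m x"
proof -
  have "\<lfloor>x + real N\<rfloor> = \<lfloor>x\<rfloor> + int N" by (metis floor_add_int of_int_of_nat_eq)
  then show ?thesis using l_N l0 by (simp add: Q_val_def power_int_add)
qed

lemma Q_val_1: "Q_val l 1 x = l powi \<lfloor>x\<rfloor> * (l / (1 - l))"
  using Q_piece_1[OF l1] by (simp add: Q_val_def)

lemma absolutely_integrable_Q_val:
  assumes m: "m \<ge> 1"
  shows "Q_val l m absolutely_integrable_on {a..b}"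
proof (cases "m = 1")
  case False
  then show ?thesis
    using m by (intro absolutely_integrable_continuous_real continuous_Q_val) simp
next
  case True
  show ?thesis
  proof (rule measurable_bounded_by_integrable_imp_absolutely_integrable)
    have "Q_val l m \<in> borel_measurable borel"
      unfolding True Q_val_1[abs_def]
      by (intro borel_measurable_times borel_measurable_const
          measurable_compose[OF measurable_real_floor]) simp
    then show "Q_val l m \<in> borel_measurable (lebesgue_on {a..b})"
      by (intro measurable_restrict_space1 measurable_completion) simp
    show "(\<lambda>_. norm (l / (1 - l))) integrable_on {a..b}" by (rule integrable_const_ivl)
    show "norm (Q_val l m x) \<le> norm (l / (1 - l))" for x
      unfolding True Q_val_1 norm_mult by (simp add: norm_power_int norm_l)
  qed auto
qed

end

section \<open>Smooth functions and test functions\<close>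

text \<open>A set of functions that contains a derivative of each of its members consists of smooth functions.\<close>
lemma smooth_coinduct:
  assumes closed: "\<And>f. f \<in> S \<Longrightarrow> \<exists>f'\<in>S. \<forall>x. (f has_vector_derivative f' x) (at x)"
    and "f \<in> S"
  shows "((\<lambda>g t. vector_derivative g (at t)) ^^ m) f differentiable (at (x::real))"
proof -
  have "((\<lambda>g t. vector_derivative g (at t)) ^^ m) f \<in> S" for m
  proof (induction m)
    case (Suc m)
    then obtain f' where "f' \<in> S" "\<forall>x. (((\<lambda>g t. vector_derivative g (at t)) ^^ m) f has_vector_derivative f' x) (at x)"
      using closed by blast
    then have "((\<lambda>g t. vector_derivative g (at t)) ^^ Suc m) f = f'"
      by (auto simp: fun_eq_iff intro: vector_derivative_at)
    then show ?case using \<open>f' \<in> S\<close> by simp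
  qed (use assms in simp)
  then show ?thesis using closed differentiableI_vector by blast
qed

text \<open>The standard flat function \<open>exp (- 1/x)\<close> times a polynomial in \<open>1/x\<close>: a class closed under differentiation.\<close>
definition flat_exp :: "real poly \<Rightarrow> real \<Rightarrow> real" where
  "flat_exp p x = (if x > 0 then poly p (1 / x) * exp (- (1 / x)) else 0)"

lemma tendsto_poly_times_exp_neg: "((\<lambda>y. poly p y * exp (- y)) \<longlongrightarrow> (0::real)) at_top"
proof -
  have "((\<lambda>y. \<Sum>i\<le>degree p. coeff p i * (y ^ i / exp y)) \<longlongrightarrow> (\<Sum>i\<le>degree p. coeff p i * 0)) at_top"
    by (intro tendsto_sum tendsto_mult tendsto_const tendsto_power_div_exp_0)
  then show ?thesis
    by (simp add: poly_altdef sum_distrib_right exp_minus divide_inverse mult.assoc)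
qed

lemma flat_exp_derivative:
  "(flat_exp p has_real_derivative flat_exp (monom 1 2 * (p - pderiv p)) x) (at x)"
proof -
  consider "x > 0" | "x < 0" | "x = 0" by linarith
  then show ?thesis
  proof cases
    case 1
    have "((\<lambda>x. poly p (1 / x) * exp (- (1 / x))) has_real_derivative
        poly (monom 1 2 * (p - pderiv p)) (1 / x) * exp (- (1 / x))) (at x)"
      using 1 by (auto intro!: derivative_eq_intros DERIV_chain2[OF poly_DERIV]
          simp: poly_monom field_simps power2_eq_square)
    then have "(flat_exp p has_real_derivative poly (monom 1 2 * (p - pderiv p)) (1 / x) * exp (- (1 / x))) (at x)"
      by (rule has_field_derivative_transform_within_open[of _ _ _ "{0<..}"]) (use 1 in \<open>auto simp: flat_exp_def\<close>)
    then show ?thesis using 1 by (simp add: flat_exp_def)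
  next
    case 2
    have "((\<lambda>x. 0) has_real_derivative 0) (at x)" by (rule DERIV_const)
    then have "(flat_exp p has_real_derivative 0) (at x)"
      by (rule has_field_derivative_transform_within_open[of _ _ _ "{..<0}"]) (use 2 in \<open>auto simp: flat_exp_def\<close>)
    then show ?thesis using 2 by (simp add: flat_exp_def)
  next
    case 3
    have "((\<lambda>y. poly (monom 1 1 * p) y * exp (- y)) \<longlongrightarrow> 0) at_top" by (rule tendsto_poly_times_exp_neg)
    then have "((\<lambda>h. poly (monom 1 1 * p) (inverse h) * exp (- inverse h)) \<longlongrightarrow> 0) (at_right 0)"
      by (rule filterlim_compose) (rule filterlim_inverse_at_top_right)
    then have "((\<lambda>h. (flat_exp p h - flat_exp p 0) / (h - 0)) \<longlongrightarrow> 0) (at_right 0)"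
      by (rule Lim_transform_eventually)
        (auto intro!: eventually_at_rightI[of 0 1] simp: flat_exp_def poly_monom divide_inverse)
    moreover have "((\<lambda>h. (flat_exp p h - flat_exp p 0) / (h - 0)) \<longlongrightarrow> 0) (at_left 0)"
      by (rule Lim_transform_eventually[OF tendsto_const])
        (auto intro!: eventually_at_leftI[of "-1"] simp: flat_exp_def)
    ultimately have "((\<lambda>h. (flat_exp p h - flat_exp p 0) / (h - 0)) \<longlongrightarrow> 0) (at 0)"
      by (simp add: filterlim_split_at)
    then show ?thesis using 3 by (simp add: has_field_derivative_iff flat_exp_def)
  qed
qed

text \<open>The smallest class containing the flat functions that is visibly closed under differentiation, by the product rule.\<close>
inductive_set bumps :: "(real \<Rightarrow> complex) set" where
  base: "(\<lambda>x. of_real (flat_exp p (a + b * x))) \<in> bumps"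
| mult: "f \<in> bumps \<Longrightarrow> g \<in> bumps \<Longrightarrow> (\<lambda>x. f x * g x) \<in> bumps"
| add: "f \<in> bumps \<Longrightarrow> g \<in> bumps \<Longrightarrow> (\<lambda>x. f x + g x) \<in> bumps"
| scale: "f \<in> bumps \<Longrightarrow> (\<lambda>x. c * f x) \<in> bumps"

lemma bumps_derivative:
  assumes "f \<in> bumps"
  shows "\<exists>f'\<in>bumps. \<forall>x. (f has_vector_derivative f' x) (at x)"
  using assms
proof induction
  case (base p a b)
  let ?q = "monom 1 2 * (p - pderiv p)"
  have e: "complex_of_real b * of_real y = of_real (y * b)" for y by simp
  have "((\<lambda>x. flat_exp p (a + b * x)) has_real_derivative flat_exp ?q (a + b * x) * b) (at x)" for x
    by (rule DERIV_chain2[OF flat_exp_derivative]) (auto intro!: derivative_eq_intros)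
  then have "((\<lambda>x. complex_of_real (flat_exp p (a + b * x))) has_vector_derivative of_real (flat_exp ?q (a + b * x) * b)) (at x)" for x
    by (rule has_vector_derivative_of_real)
  then have "((\<lambda>x. complex_of_real (flat_exp p (a + b * x))) has_vector_derivative of_real b * of_real (flat_exp ?q (a + b * x))) (at x)" for x
    unfolding e .
  then show ?case
    by (intro bexI[of _ "\<lambda>x. of_real b * of_real (flat_exp ?q (a + b * x))"] bumps.intros allI)
next
  case (mult f g)
  then obtain f' g' where "f' \<in> bumps" "\<forall>x. (f has_vector_derivative f' x) (at x)"
    "g' \<in> bumps" "\<forall>x. (g has_vector_derivative g' x) (at x)" by blast
  then show ?case using mult.hyps
    by (intro bexI[of _ "\<lambda>x. f x * g' x + f' x * g x"] bumps.intros allI has_vector_derivative_mult) auto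
next
  case (add f g)
  then obtain f' g' where "f' \<in> bumps" "\<forall>x. (f has_vector_derivative f' x) (at x)"
    "g' \<in> bumps" "\<forall>x. (g has_vector_derivative g' x) (at x)" by blast
  then show ?case
    by (intro bexI[of _ "\<lambda>x. f' x + g' x"] bumps.intros allI has_vector_derivative_add) auto
next
  case (scale f c)
  then obtain f' where "f' \<in> bumps" "\<forall>x. (f has_vector_derivative f' x) (at x)" by blast
  then show ?case
    by (intro bexI[of _ "\<lambda>x. c * f' x"] bumps.intros allI has_vector_derivative_mult_right) auto
qed

text \<open>The differentiability condition in \<open>test_function\<close>.\<close>
definition smooth :: "(real \<Rightarrow> complex) \<Rightarrow> bool" where
  "smooth f \<longleftrightarrow> (\<forall>m x. ((\<lambda>g t. vector_derivative g (at t)) ^^ m) f differentiable (at x))"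

lemma smoothI_coinduct:
  assumes "\<And>f. f \<in> S \<Longrightarrow> \<exists>f'\<in>S. \<forall>x. (f has_vector_derivative f' x) (at x)" "f \<in> S"
  shows "smooth f"
  unfolding smooth_def using smooth_coinduct[OF assms] by simp

lemma smooth_bumps: "f \<in> bumps \<Longrightarrow> smooth f"
  by (rule smoothI_coinduct[OF bumps_derivative])

lemma smooth_has_derivative:
  assumes "smooth f"
  shows "(f has_vector_derivative vector_derivative f (at x)) (at x)"
proof -
  have "((\<lambda>g t. vector_derivative g (at t)) ^^ 0) f differentiable (at x)"
    using assms unfolding smooth_def by blast
  then show ?thesis by (simp add: vector_derivative_works)
qed

lemma smooth_deriv:
  assumes "smooth f"
  shows "smooth (\<lambda>x. vector_derivative f (at x))"
proof -
  have "((\<lambda>g t. vector_derivative g (at t)) ^^ m) (\<lambda>t. vector_derivative f (at t)) differentiable (at x)" for m x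
  proof -
    have "((\<lambda>g t. vector_derivative g (at t)) ^^ Suc m) f differentiable (at x)"
      using assms unfolding smooth_def by blast
    then show ?thesis unfolding funpow_Suc_right o_def .
  qed
  then show ?thesis unfolding smooth_def by simp
qed

lemma smooth_antideriv:
  assumes "\<And>x. (F has_vector_derivative f x) (at x)" "smooth f"
  shows "smooth F"
proof -
  define S where "S = {F. smooth F \<or> (\<exists>f. smooth f \<and> (\<forall>x. (F has_vector_derivative f x) (at x)))}"
  have closed: "\<exists>f'\<in>S. \<forall>x. (f has_vector_derivative f' x) (at x)" if f: "f \<in> S" for f
  proof (cases "smooth f")
    case True
    then have "(\<lambda>x. vector_derivative f (at x)) \<in> S" using smooth_deriv by (simp add: S_def)
    then show ?thesis using smooth_has_derivative[OF True] by (intro bexI) auto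
  next
    case False
    then obtain f0 where f0: "smooth f0" "\<forall>x. (f has_vector_derivative f0 x) (at x)"
      using f by (auto simp: S_def)
    then have "f0 \<in> S" by (simp add: S_def)
    with f0(2) show ?thesis by (intro bexI)
  qed
  have "F \<in> S" unfolding S_def using assms by (intro CollectI disjI2 exI[of _ f] conjI allI)
  with closed show ?thesis by (rule smoothI_coinduct[of S F])
qed

lemma smooth_combination:
  assumes "smooth f" "smooth g"
  shows "smooth (\<lambda>x. f x + c * g x)"
proof -
  define S where "S = {\<lambda>x. f x + c * g x | f g. smooth f \<and> smooth g}"
  have closed: "\<exists>h'\<in>S. \<forall>x. (h has_vector_derivative h' x) (at x)" if h: "h \<in> S" for h
  proof -
    obtain f g where fg: "h = (\<lambda>x. f x + c * g x)" "smooth f" "smooth g" using h unfolding S_def by blast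
    have "(h has_vector_derivative vector_derivative f (at x) + c * vector_derivative g (at x)) (at x)" for x
      unfolding fg(1)
      by (intro has_vector_derivative_add has_vector_derivative_mult_right smooth_has_derivative fg)
    moreover have "(\<lambda>x. vector_derivative f (at x) + c * vector_derivative g (at x)) \<in> S"
      unfolding S_def using smooth_deriv[OF fg(2)] smooth_deriv[OF fg(3)]
      by (intro CollectI exI[of _ "\<lambda>x. vector_derivative f (at x)"] exI[of _ "\<lambda>x. vector_derivative g (at x)"] conjI refl)
    ultimately show ?thesis by (intro bexI[of _ "\<lambda>x. vector_derivative f (at x) + c * vector_derivative g (at x)"] allI)
  qed
  have "(\<lambda>x. f x + c * g x) \<in> S"
    unfolding S_def using assms by (intro CollectI exI[of _ f] exI[of _ g] conjI refl)
  with closed show ?thesis by (rule smoothI_coinduct[of S])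
qed

lemma smooth_shift:
  assumes "smooth f"
  shows "smooth (\<lambda>x. f (x + a))"
proof -
  define S where "S = {\<lambda>x. f (x + a) | f. smooth f}"
  have closed: "\<exists>h'\<in>S. \<forall>x. (h has_vector_derivative h' x) (at x)" if h: "h \<in> S" for h
  proof -
    obtain f where f: "h = (\<lambda>x. f (x + a))" "smooth f" using h unfolding S_def by blast
    have "(h has_vector_derivative vector_derivative f (at (x + a))) (at x)" for x
    proof -
      have "((\<lambda>x. x + a) has_vector_derivative (1 + 0)) (at x)"
        by (intro has_vector_derivative_add has_vector_derivative_id has_vector_derivative_const)
      from vector_diff_chain_at[OF this smooth_has_derivative[OF f(2)]]
      show ?thesis by (simp add: f(1) o_def)
    qed
    moreover have "(\<lambda>x. vector_derivative f (at (x + a))) \<in> S" 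
      unfolding S_def using smooth_deriv[OF f(2)]
      by (intro CollectI exI[of _ "\<lambda>x. vector_derivative f (at x)"] conjI refl)
    ultimately show ?thesis by (intro bexI[of _ "\<lambda>x. vector_derivative f (at (x + a))"] allI)
  qed
  have "(\<lambda>x. f (x + a)) \<in> S" unfolding S_def using assms by (intro CollectI exI[of _ f] conjI refl)
  with closed show ?thesis by (rule smoothI_coinduct[of S])
qed

lemma smooth_continuous: "smooth f \<Longrightarrow> continuous_on S f"
  by (meson continuous_at_imp_continuous_on has_vector_derivative_continuous smooth_has_derivative)

lemma test_function_iff: "test_function f \<longleftrightarrow> smooth f \<and> (\<exists>R. \<forall>x. \<bar>x\<bar> > R \<longrightarrow> f x = 0)"
  by (simp add: test_function_def smooth_def)

definition bump :: "real \<Rightarrow> real \<Rightarrow> real" where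
  "bump \<epsilon> x = flat_exp 1 x * flat_exp 1 (\<epsilon> - x)"

lemma bump_pos: "0 < x \<Longrightarrow> x < \<epsilon> \<Longrightarrow> bump \<epsilon> x > 0"
  by (simp add: bump_def flat_exp_def)

lemma bump_zero: "x \<le> 0 \<or> x \<ge> \<epsilon> \<Longrightarrow> bump \<epsilon> x = 0"
  by (auto simp: bump_def flat_exp_def)

lemma bump_nonneg: "bump \<epsilon> x \<ge> 0"
  by (auto simp: bump_def flat_exp_def)

lemma smooth_bump: "smooth (\<lambda>x. of_real (bump \<epsilon> x))"
proof -
  have "(\<lambda>x. complex_of_real (flat_exp 1 (0 + 1 * x)) * of_real (flat_exp 1 (\<epsilon> + (-1) * x))) \<in> bumps"
    by (intro bumps.intros)
  then show ?thesis using smooth_bumps by (simp add: bump_def)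
qed

lemma continuous_bump: "continuous_on S (bump \<epsilon>)"
  using continuous_on_Re[OF smooth_continuous[OF smooth_bump]] by simp

lemma integral_bump_pos:
  assumes "\<epsilon> > 0"
  shows "integral {0..\<epsilon>} (bump \<epsilon>) > 0"
proof -
  have "integral {0..\<epsilon>} (bump \<epsilon>) \<noteq> 0"
  proof
    assume "integral {0..\<epsilon>} (bump \<epsilon>) = 0"
    then have "(bump \<epsilon> has_integral 0) (cbox 0 \<epsilon>)"
      using integrable_integral[OF integrable_continuous_real[OF continuous_bump[of "{0..\<epsilon>}" \<epsilon>]]] by simp
    then have "bump \<epsilon> (\<epsilon> / 2) = 0"
      by (rule has_integral_0_cbox_imp_0[OF continuous_bump bump_nonneg]) (use assms in auto)
    then show False using bump_pos[of "\<epsilon> / 2" \<epsilon>] assms by simp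
  qed
  moreover have "integral {0..\<epsilon>} (bump \<epsilon>) \<ge> 0" by (intro integral_nonneg integrable_continuous_real continuous_bump bump_nonneg)
  ultimately show ?thesis by linarith
qed

section \<open>The family \<open>Q_val\<close> satisfies the distributional conditions\<close>

lemma abs_integrable_mult_continuous:
  fixes f g :: "real \<Rightarrow> complex"
  assumes "f absolutely_integrable_on {a..b}" "continuous_on {a..b} g"
  shows "(\<lambda>x. f x * g x) absolutely_integrable_on {a..b}"
proof -
  have "bounded (g ` {a..b})" using assms(2) compact_continuous_image compact_imp_bounded by blast
  then have "(\<lambda>x. g x * f x) absolutely_integrable_on {a..b}"
    using assms by (intro absolutely_integrable_bounded_measurable_product[of "(*)"])
      (auto intro: continuous_imp_measurable_on_sets_lebesgue bilinear_times)
  then show ?thesis by (simp add: mult.commute)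
qed

lemma integral_eq_zero_on:
  fixes f :: "'a::euclidean_space \<Rightarrow> 'b::real_normed_vector"
  shows "(\<And>x. x \<in> S \<Longrightarrow> f x = 0) \<Longrightarrow> integral S f = 0"
  by (intro integral_unique has_integral_is_0) auto

lemma has_integral_compact_support:
  fixes F :: "real \<Rightarrow> complex"
  assumes "(F has_integral I) {a..b}" "\<And>x. x \<notin> {a..b} \<Longrightarrow> F x = 0"
  shows "integral UNIV F = I"
  by (rule integral_unique) (rule has_integral_on_superset[OF assms(1)], use assms(2) in auto)

lemma test_function_support:
  assumes "test_function \<phi>"
  obtains K :: nat where "K > 0" "\<And>x. \<bar>x\<bar> \<ge> real K \<Longrightarrow> \<phi> x = 0" "\<And>x. \<bar>x\<bar> \<ge> real K \<Longrightarrow> vector_derivative \<phi> (at x) = 0"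
proof -
  obtain R where R: "\<And>x. \<bar>x\<bar> > R \<Longrightarrow> \<phi> x = 0" using assms by (auto simp: test_function_iff)
  obtain K0 :: nat where K0: "real K0 > R" using reals_Archimedean2 by blast
  have der: "vector_derivative \<phi> (at x) = 0" if x: "\<bar>x\<bar> \<ge> real (Suc K0)" for x
  proof -
    have "open {y::real. \<bar>y\<bar> > R}" by (intro open_Collect_less continuous_intros)
    then have "(\<phi> has_vector_derivative 0) (at x)"
      by (rule has_vector_derivative_transform_within_open[OF has_vector_derivative_const[of 0]])
        (use x K0 R in auto)
    then show ?thesis by (rule vector_derivative_at)
  qed
  show ?thesis by (rule that[of "Suc K0"]) (use der R K0 in auto)
qed

lemma continuous_vector_derivative_test:
  assumes "test_function \<phi>"
  shows "continuous_on S \<phi>" "continuous_on S (\<lambda>x. vector_derivative \<phi> (at x))"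
  using assms smooth_continuous smooth_deriv unfolding test_function_iff by blast+

context nontrivial_root
begin

text \<open>Integration by parts over an interval that contains the support of the test function.\<close>
lemma Q_val_distr_deriv:
  assumes m: "m \<ge> 2" and \<phi>: "test_function \<phi>"
  shows "distr_deriv (distr_of (Q_val l m)) \<phi> = distr_of (Q_val l (m - 1)) \<phi>"
proof -
  obtain K :: nat where K: "K > 0" "\<And>x. \<bar>x\<bar> \<ge> real K \<Longrightarrow> \<phi> x = 0"
    "\<And>x. \<bar>x\<bar> \<ge> real K \<Longrightarrow> vector_derivative \<phi> (at x) = 0" using test_function_support[OF \<phi>] by blast
  let ?I = "{- real K..real K}"
  have "((\<lambda>x. Q_val l m x * vector_derivative \<phi> (at x) + Q_val l (m - 1) x * \<phi> x) has_integral
      (Q_val l m (real K) * \<phi> (real K) - Q_val l m (- real K) * \<phi> (- real K))) ?I"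
  proof (rule fundamental_theorem_of_calculus_interior_strong[OF finite_Ints_atLeastAtMost[of "- real K" "real K"]])
    show "((\<lambda>x. Q_val l m x * \<phi> x) has_vector_derivative
       Q_val l m x * vector_derivative \<phi> (at x) + Q_val l (m - 1) x * \<phi> x) (at x)"
      if x: "x \<in> {- real K<..<real K} - \<int> \<inter> ?I" for x
    proof -
      have "x \<notin> \<int>" "smooth \<phi>" using x \<phi> by (auto simp: test_function_iff)
      then show ?thesis
        by (intro has_vector_derivative_mult smooth_has_derivative Q_val_derivative[OF m])
    qed
    show "continuous_on ?I (\<lambda>x. Q_val l m x * \<phi> x)"
      by (intro continuous_on_mult continuous_Q_val[OF m] continuous_vector_derivative_test[OF \<phi>])
  qed simp
  then have sum0: "((\<lambda>x. Q_val l m x * vector_derivative \<phi> (at x) + Q_val l (m - 1) x * \<phi> x) has_integral 0) ?I"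
    using K by simp
  have int1: "(\<lambda>x. Q_val l m x * vector_derivative \<phi> (at x)) integrable_on ?I"
    by (intro integrable_continuous_real continuous_on_mult continuous_Q_val[OF m] continuous_vector_derivative_test[OF \<phi>])
  define J where "J = integral ?I (\<lambda>x. Q_val l m x * vector_derivative \<phi> (at x))"
  have J: "((\<lambda>x. Q_val l m x * vector_derivative \<phi> (at x)) has_integral J) ?I"
    using int1 by (simp add: J_def integrable_integral)
  have J': "((\<lambda>x. Q_val l (m - 1) x * \<phi> x) has_integral - J) ?I"
    using has_integral_diff[OF sum0 J] by simp
  have out: "\<bar>x\<bar> \<ge> real K" if "x \<notin> ?I" for x using that by auto
  have "integral UNIV (\<lambda>x. Q_val l m x * vector_derivative \<phi> (at x)) = J"
    by (rule has_integral_compact_support[OF J]) (use K(3)[OF out] in auto)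
  moreover have "integral UNIV (\<lambda>x. Q_val l (m - 1) x * \<phi> x) = - J"
    by (rule has_integral_compact_support[OF J']) (use K(2)[OF out] in auto)
  ultimately show ?thesis
    unfolding distr_deriv_def distr_of_def by simp
qed

text \<open>
  \<open>Q_val l 1\<close> is the step function with value \<open>l\<^sup>n l / (1 - l)\<close> on \<open>[n, n + 1)\<close>. Integrating the
  derivative of the test function over each step and summing by parts leaves the jumps \<open>- l\<^sup>n\<close> at the integers.\<close>
lemma Q_val_1_distr_deriv:
  assumes \<phi>: "test_function \<phi>"
  shows "distr_deriv (distr_of (Q_val l 1)) \<phi> = Q_zero l \<phi>"
proof -
  obtain K :: nat where K: "K > 0" "\<And>x. \<bar>x\<bar> \<ge> real K \<Longrightarrow> \<phi> x = 0"
    "\<And>x. \<bar>x\<bar> \<ge> real K \<Longrightarrow> vector_derivative \<phi> (at x) = 0" using test_function_support[OF \<phi>] by blast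
  let ?F = "\<lambda>x. Q_val l 1 x * vector_derivative \<phi> (at x)"
  define a where "a = - int K"
  define c where "c = 1 / (1 - l)"
  have c: "c * l = l / (1 - l)" "(1 - c) = - (c * l)" using l1 by (simp_all add: c_def field_simps)
  have cell: "(?F has_integral (l powi n * (l / (1 - l)) * (\<phi> (of_int n + 1) - \<phi> (of_int n)))) {of_int n..of_int n + 1}" for n
  proof -
    have "((\<lambda>x. vector_derivative \<phi> (at x)) has_integral (\<phi> (of_int n + 1) - \<phi> (of_int n))) {of_int n..of_int n + 1}"
      by (rule fundamental_theorem_of_calculus)
        (use \<phi> in \<open>auto simp: test_function_iff intro: has_vector_derivative_at_within smooth_has_derivative\<close>)
    then have "((\<lambda>x. l powi n * (l / (1 - l)) * vector_derivative \<phi> (at x)) has_integral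
       (l powi n * (l / (1 - l)) * (\<phi> (of_int n + 1) - \<phi> (of_int n)))) {of_int n..of_int n + 1}"
      by (rule has_integral_mult_right)
    then show ?thesis
    proof (rule has_integral_spike_finite[rotated 2])
      show "finite {real_of_int n + 1}" by simp
      fix x assume x: "x \<in> {of_int n..of_int n + 1} - {real_of_int n + 1}"
      then have "\<lfloor>x\<rfloor> = n" by (simp add: floor_eq_iff)
      then show "?F x = l powi n * (l / (1 - l)) * vector_derivative \<phi> (at x)" unfolding Q_val_1 by simp
    qed
  qed
  \<comment> \<open>Summation by parts: after \<open>j\<close> steps only the boundary term at \<open>a + j\<close> remains beside the sum.\<close>
  have partial: "(?F has_integral (\<Sum>i<j. l powi (a + int i) * \<phi> (of_int (a + int i))) + c * (l powi (a + int j) * \<phi> (of_int (a + int j)))) {of_int a..of_int a + real j}" for j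
  proof (induction j)
    case 0
    have "\<phi> (of_int a) = 0" using K(2) by (simp add: a_def)
    then show ?case by (simp add: has_integral_refl)
  next
    case (Suc j)
    let ?n = "a + int j"
    have "(?F has_integral ((\<Sum>i<j. l powi (a + int i) * \<phi> (of_int (a + int i))) + c * (l powi ?n * \<phi> (of_int ?n)))
       + (l powi ?n * (l / (1 - l)) * (\<phi> (of_int ?n + 1) - \<phi> (of_int ?n)))) {of_int a..of_int ?n + 1}"
      by (rule has_integral_combine[where c = "of_int ?n"]) (use Suc.IH cell[of ?n] in auto)
    moreover have "((\<Sum>i<j. l powi (a + int i) * \<phi> (of_int (a + int i))) + c * (l powi ?n * \<phi> (of_int ?n)))
       + (l powi ?n * (l / (1 - l)) * (\<phi> (of_int ?n + 1) - \<phi> (of_int ?n)))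
      = (\<Sum>i<Suc j. l powi (a + int i) * \<phi> (of_int (a + int i))) + c * (l powi (a + int (Suc j)) * \<phi> (of_int (a + int (Suc j))))"
    proof -
      have p: "l powi (a + int (Suc j)) = l powi ?n * l" using l0 by (simp add: power_int_add add.assoc[symmetric])
      have q: "real_of_int (a + int (Suc j)) = of_int ?n + 1" by simp
      have "(c * (l powi ?n * \<phi> (of_int ?n))) + (l powi ?n * (l / (1 - l)) * (\<phi> (of_int ?n + 1) - \<phi> (of_int ?n)))
        = (c - c * l) * (l powi ?n * \<phi> (of_int ?n)) + c * (l powi ?n * l * \<phi> (of_int ?n + 1))"
        unfolding c(1)[symmetric] by (simp add: algebra_simps)
      also have "c - c * l = 1" using l1 by (simp add: c_def field_simps)
      finally show ?thesis unfolding p q by simp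
    qed
    moreover have "real_of_int ?n + 1 = of_int a + real (Suc j)" by simp
    ultimately show ?case by (simp only:)
  qed
  have "(?F has_integral (\<Sum>i<2*K. l powi (a + int i) * \<phi> (of_int (a + int i)))) {- real K..real K}"
    using partial[of "2 * K"] K(2)[of "real K"] by (simp add: a_def)
  then have "integral UNIV ?F = (\<Sum>i<2*K. l powi (a + int i) * \<phi> (of_int (a + int i)))"
    by (rule has_integral_compact_support) (use K(3) in auto)
  also have "\<dots> = (\<Sum>n\<in>{- int K..<int K}. l powi n * \<phi> (of_int n))"
    by (rule sum.reindex_bij_witness[of _ "\<lambda>n. nat (n + int K)" "\<lambda>i. a + int i"]) (auto simp: a_def)
  also have "\<dots> = (\<Sum>\<^sub>\<infinity>n\<in>{- int K..<int K}. l powi n * \<phi> (of_int n))" by simp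
  also have "\<dots> = (\<Sum>\<^sub>\<infinity>n\<in>(UNIV :: int set). l powi n * \<phi> (of_int n))"
  proof (rule infsum_cong_neutral)
    fix n :: int assume "n \<in> UNIV - {- int K..<int K}"
    then have "\<bar>real_of_int n\<bar> \<ge> real K" by auto
    then show "l powi n * \<phi> (of_int n) = 0" using K(2) by simp
  qed auto
  finally show ?thesis by (simp add: distr_deriv_def distr_of_def Q_zero_def)
qed

lemma Q_family_Q_val: "Q_family l (Q_val l)"
  unfolding Q_family_def
proof (intro conjI allI impI)
  fix m :: nat assume m: "1 \<le> m"
  show "Q_val l m absolutely_integrable_on {a..b}" for a b by (rule absolutely_integrable_Q_val[OF m])
  show "Q_val l m (x + real N) = Q_val l m x" for x by (rule Q_val_periodic)
  show "integral {0..real N} (Q_val l m) = 0"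
    using has_integral_Q_val[OF m, of 0 "real N"] Q_val_periodic[of "Suc m" 0] by (simp add: integral_unique)
  show "distr_deriv (distr_of (Q_val l m)) \<phi> = (if m = 1 then Q_zero l else distr_of (Q_val l (m - 1))) \<phi>"
    if "test_function \<phi>" for \<phi>
    using that m Q_val_1_distr_deriv Q_val_distr_deriv[of m] by (cases "m = 1") auto
qed (rule continuous_Q_val)

end

section \<open>Uniqueness of the values of \<open>Q\<close>\<close>

definition smooth_step :: "real \<Rightarrow> real" where
  "smooth_step x = integral {-1..x} (bump 1) / integral {0..1} (bump 1)"

lemma integral_bump_initial: "x \<le> 0 \<Longrightarrow> integral {-1..x} (bump 1) = 0"
  by (rule integral_eq_zero_on) (auto simp: bump_zero)

lemma smooth_step_0: "x \<le> 0 \<Longrightarrow> smooth_step x = 0"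
  by (simp add: smooth_step_def integral_bump_initial)

lemma smooth_step_1:
  assumes "x \<ge> 1"
  shows "smooth_step x = 1"
proof -
  have int: "bump 1 integrable_on {a..b}" for a b by (rule integrable_continuous_real[OF continuous_bump])
  have "integral {-1..x} (bump 1) = integral {-1..0} (bump 1) + integral {0..x} (bump 1)"
    using assms by (intro Henstock_Kurzweil_Integration.integral_combine[symmetric] int) auto
  also have "integral {0..x} (bump 1) = integral {0..1} (bump 1) + integral {1..x} (bump 1)"
    using assms by (intro Henstock_Kurzweil_Integration.integral_combine[symmetric] int) auto
  also have "integral {1..x} (bump 1) = 0" by (rule integral_eq_zero_on) (auto simp: bump_zero)
  finally show ?thesis using integral_bump_pos[of 1] by (simp add: smooth_step_def integral_bump_initial)
qed

lemma smooth_step_derivative: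
  "((\<lambda>x. complex_of_real (smooth_step x)) has_vector_derivative
     of_real (bump 1 x) / of_real (integral {0..1} (bump 1))) (at x)"
proof -
  have "(smooth_step has_real_derivative bump 1 x / integral {0..1} (bump 1)) (at x)"
  proof (cases "x < 0")
    case True
    have "(smooth_step has_real_derivative 0) (at x)"
      by (rule has_field_derivative_transform_within_open[OF DERIV_const[of 0], of "{..<0}"])
        (use True smooth_step_0 in auto)
    then show ?thesis using True by (simp add: bump_zero)
  next
    case False
    have "((\<lambda>y. integral {-1..y} (bump 1)) has_real_derivative bump 1 x) (at x within {-1..x + 1})"
      by (rule integral_has_real_derivative[OF continuous_bump]) (use False in auto)
    then have "((\<lambda>y. integral {-1..y} (bump 1)) has_real_derivative bump 1 x) (at x)"
      using False by (subst (asm) at_within_interior) auto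
    then show ?thesis unfolding smooth_step_def[abs_def] by (rule DERIV_cdivide)
  qed
  then have "((\<lambda>x. complex_of_real (smooth_step x)) has_vector_derivative
     of_real (bump 1 x / integral {0..1} (bump 1))) (at x)" by (rule has_vector_derivative_of_real)
  then show ?thesis by simp
qed

lemma smooth_smooth_step: "smooth (\<lambda>x. of_real (smooth_step x))"
proof (rule smooth_antideriv[OF smooth_step_derivative])
  have "smooth (\<lambda>x. 0 + (1 / of_real (integral {0..1} (bump 1))) * of_real (bump 1 x))"
  proof (rule smooth_combination[OF _ smooth_bump])
    have "(\<lambda>x. 0 * complex_of_real (flat_exp 1 (0 + 0 * x))) \<in> bumps" by (intro bumps.intros)
    then show "smooth (\<lambda>x. 0)" using smooth_bumps by simp
  qed
  then show "smooth (\<lambda>x. of_real (bump 1 x) / of_real (integral {0..1} (bump 1)))"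
    by (simp add: field_simps)
qed

text \<open>
  The translates of this test function by multiples of \<open>N\<close> form a partition of unity, so testing an \<open>N\<close>-periodic
  function against it gives the integral over a period.\<close>
definition plateau :: "nat \<Rightarrow> real \<Rightarrow> complex" where
  "plateau N x = of_real (smooth_step x) + (-1) * of_real (smooth_step (x + (- real N)))"

lemma test_function_plateau: "test_function (plateau N)"
  unfolding test_function_iff
proof (intro conjI exI[of _ "real N + 1"] allI impI)
  show "smooth (plateau N)"
    unfolding plateau_def[abs_def]
    by (intro smooth_combination smooth_smooth_step smooth_shift[of "\<lambda>x. of_real (smooth_step x)"])
  show "plateau N x = 0" if "\<bar>x\<bar> > real N + 1" for x
  proof (cases "x \<ge> 0")
    case True
    then have "x > real N + 1" using that by simp
    then show ?thesis by (simp add: plateau_def smooth_step_1)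
  next
    case False
    then show ?thesis by (simp add: plateau_def smooth_step_0)
  qed
qed

lemma has_integral_shift_interval:
  fixes f :: "real \<Rightarrow> complex"
  shows "((\<lambda>x. f (c + x)) has_integral I) {a..b} \<longleftrightarrow> (f has_integral I) {a + c..b + c}"
  using has_integral_shift_cbox_iff[of f c I a b] by (simp add: o_def)

lemma integral_periodic_plateau:
  fixes D :: "real \<Rightarrow> complex"
  assumes N: "N \<ge> 1" and int: "\<And>a b. D absolutely_integrable_on {a..b}"
    and per: "\<And>x. D (x + real N) = D x"
  shows "integral UNIV (\<lambda>x. D x * plateau N x) = integral {0..real N} D"
proof -
  have iD: "D integrable_on {a..b}" for a b using int absolutely_integrable_on_def by blast
  have cs: "continuous_on S (\<lambda>x. complex_of_real (smooth_step x))" for S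
    by (rule smooth_continuous[OF smooth_smooth_step])
  have iDs: "(\<lambda>x. D x * of_real (smooth_step x)) integrable_on {a..b}" for a b
    using abs_integrable_mult_continuous[OF int cs] absolutely_integrable_on_def by blast
  define s where "s x = complex_of_real (smooth_step x)" for x
  define A where "A = integral {0..1} (\<lambda>x. D x * s x)"
  have A: "((\<lambda>x. D x * s x) has_integral A) {0..1}"
    using iDs by (simp add: A_def s_def integrable_integral)
  define C where "C = integral {1..real N + 1} D"
  have CD: "(D has_integral C) {1..real N + 1}" using iD by (simp add: C_def integrable_integral)
  then have "((\<lambda>x. D x * s x) has_integral C) {1..real N + 1}"
    by (rule has_integral_eq[rotated]) (simp add: s_def smooth_step_1)
  then have 1: "((\<lambda>x. D x * s x) has_integral (A + C)) {0..real N + 1}"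
    by (intro has_integral_combine[where c = 1, OF _ _ A]) auto
  have per': "D (real N + x) = D x" for x using per[of x] by (simp add: add.commute)
  have "((\<lambda>x. D (real N + x) * s (real N + x - real N)) has_integral A) {0..1}"
    using A per' by simp
  then have "((\<lambda>x. D x * s (x - real N)) has_integral A) {0 + real N..1 + real N}"
    using has_integral_shift_interval[of "\<lambda>x. D x * s (x - real N)" "real N" A 0 1] by simp
  moreover have "((\<lambda>x. D x * s (x - real N)) has_integral 0) {0..real N}"
    by (rule has_integral_eq[OF _ has_integral_0]) (auto simp: s_def smooth_step_0)
  ultimately have 2: "((\<lambda>x. D x * s (x - real N)) has_integral (0 + A)) {0..real N + 1}"
    by (intro has_integral_combine[where c = "real N"]) (auto simp: add.commute)
  have "((\<lambda>x. D x * s x - D x * s (x - real N)) has_integral (A + C - (0 + A))) {0..real N + 1}"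
    by (rule has_integral_diff[OF 1 2])
  then have "((\<lambda>x. D x * plateau N x) has_integral C) {0..real N + 1}"
    by (simp add: plateau_def s_def algebra_simps)
  then have "integral UNIV (\<lambda>x. D x * plateau N x) = C"
    by (rule has_integral_compact_support)
      (auto simp: plateau_def smooth_step_0 smooth_step_1 not_le)
  also have "C = integral {0..real N} D"
  proof -
    have "integral {0..1} D + integral {1..real N + 1} D = integral {0..real N + 1} D"
      by (intro Henstock_Kurzweil_Integration.integral_combine iD) auto
    moreover have "integral {0..real N} D + integral {real N..real N + 1} D = integral {0..real N + 1} D"
      by (intro Henstock_Kurzweil_Integration.integral_combine iD) auto
    moreover have "integral {real N..real N + 1} D = integral {0..1} D"
    proof (rule integral_unique)
      have "((\<lambda>x. D (real N + x)) has_integral integral {0..1} D) {0..1}"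
        using iD[of 0 1] per' by (simp add: integrable_integral)
      then show "(D has_integral integral {0..1} D) {real N..real N + 1}"
        using has_integral_shift_interval[of D "real N" _ 0 1] by (simp add: add.commute)
    qed
    ultimately show ?thesis by (metis C_def add.commute add_left_cancel)
  qed
  finally show ?thesis .
qed

lemma integrable_times_compact:
  fixes f \<psi> :: "real \<Rightarrow> complex"
  assumes "\<And>a b. f absolutely_integrable_on {a..b}" "continuous_on UNIV \<psi>" "\<And>x. \<bar>x\<bar> \<ge> R \<Longrightarrow> \<psi> x = 0"
  shows "(\<lambda>x. f x * \<psi> x) integrable_on UNIV"
proof -
  have "(\<lambda>x. f x * \<psi> x) absolutely_integrable_on {- R..R}"
    using assms by (intro abs_integrable_mult_continuous continuous_on_subset[OF assms(2)]) auto
  then have int: "(\<lambda>x. f x * \<psi> x) integrable_on {- R..R}" using absolutely_integrable_on_def by blast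
  show ?thesis
  proof (rule integrable_on_superset[OF int])
    show "f x * \<psi> x = 0" if "x \<notin> {- R..R}" for x
    proof -
      have "\<bar>x\<bar> \<ge> R" using that by auto
      then show ?thesis using assms(3) by simp
    qed
  qed auto
qed

lemma integrable_times_test:
  fixes f :: "real \<Rightarrow> complex"
  assumes "\<And>a b. f absolutely_integrable_on {a..b}" "test_function \<phi>"
  shows "(\<lambda>x. f x * \<phi> x) integrable_on UNIV" "(\<lambda>x. f x * vector_derivative \<phi> (at x)) integrable_on UNIV"
proof -
  obtain K :: nat where K: "K > 0" "\<And>x. \<bar>x\<bar> \<ge> real K \<Longrightarrow> \<phi> x = 0"
    "\<And>x. \<bar>x\<bar> \<ge> real K \<Longrightarrow> vector_derivative \<phi> (at x) = 0" using test_function_support[OF assms(2)] by blast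
  show "(\<lambda>x. f x * \<phi> x) integrable_on UNIV"
    by (rule integrable_times_compact[OF assms(1) continuous_vector_derivative_test(1)[OF assms(2)] K(2)])
  show "(\<lambda>x. f x * vector_derivative \<phi> (at x)) integrable_on UNIV"
    by (rule integrable_times_compact[OF assms(1) continuous_vector_derivative_test(2)[OF assms(2)] K(3)])
qed

text \<open>
  The lemma of du Bois-Reymond for periodic functions of mean zero. A test function differs from
  the derivative of a test function by a multiple of \<open>plateau N\<close>, which is annihilated because of the mean.\<close>
lemma annihilates_tests_if_annihilates_derivatives:
  fixes D :: "real \<Rightarrow> complex"
  assumes N: "N \<ge> 1" and int: "\<And>a b. D absolutely_integrable_on {a..b}"
    and per: "\<And>x. D (x + real N) = D x" and mean: "integral {0..real N} D = 0"
    and ann: "\<And>\<phi>. test_function \<phi> \<Longrightarrow> integral UNIV (\<lambda>x. D x * vector_derivative \<phi> (at x)) = 0"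
    and \<phi>: "test_function \<phi>"
  shows "integral UNIV (\<lambda>x. D x * \<phi> x) = 0"
proof -
  \<comment> \<open>The multiple of the plateau that makes the integral vanish, so that the primitive has compact support.\<close>
  define c where "c = integral UNIV (\<lambda>x. 1 * \<phi> x) / of_nat N"
  define g where "g x = \<phi> x + (- c) * plateau N x" for x
  have one_int: "(\<lambda>_. 1 :: complex) absolutely_integrable_on {a..b}" for a b :: real
    by (rule absolutely_integrable_continuous_real) (rule continuous_on_const)
  have plat1: "integral UNIV (\<lambda>x. 1 * plateau N x) = of_nat N"
    using integral_periodic_plateau[OF N one_int] by (simp add: scaleR_conv_of_real)
  have "integral UNIV (\<lambda>x. 1 * \<phi> x + 1 * (- c) * plateau N x) = integral UNIV (\<lambda>x. 1 * \<phi> x) + (- c) * of_nat N"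
    using integral_add[OF integrable_times_test(1)[OF one_int \<phi>]
        integrable_on_mult_right[OF integrable_times_test(1)[OF one_int test_function_plateau[of N]], of "- c"]]
      plat1 by (simp add: algebra_simps)
  then have g_mean: "integral UNIV g = 0" using N by (simp add: g_def[abs_def] c_def)
  have g_smooth: "smooth g"
    unfolding g_def[abs_def] using \<phi> test_function_plateau[of N]
    by (intro smooth_combination) (auto simp: test_function_iff)
  obtain K1 :: nat where "K1 > 0" and K1: "\<And>x. \<bar>x\<bar> \<ge> real K1 \<Longrightarrow> \<phi> x = 0"
    and "\<And>x. \<bar>x\<bar> \<ge> real K1 \<Longrightarrow> vector_derivative \<phi> (at x) = 0"
    using test_function_support[OF \<phi>] by blast
  obtain K2 :: nat where "K2 > 0" and K2: "\<And>x. \<bar>x\<bar> \<ge> real K2 \<Longrightarrow> plateau N x = 0"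
    and "\<And>x. \<bar>x\<bar> \<ge> real K2 \<Longrightarrow> vector_derivative (plateau N) (at x) = 0"
    using test_function_support[OF test_function_plateau[of N]] by blast
  define K where "K = real (max K1 K2)"
  have K0: "K \<ge> 0" by (simp add: K_def)
  have gK: "g x = 0" if "\<bar>x\<bar> \<ge> K" for x using K1[of x] K2[of x] that by (simp add: g_def K_def)
  have gc: "continuous_on S g" for S by (rule smooth_continuous[OF g_smooth])
  define \<psi> where "\<psi> x = integral {- K - 1..x} g" for x
  have \<psi>0: "\<psi> x = 0" if "x \<le> - K" for x
    unfolding \<psi>_def by (rule integral_eq_zero_on) (use that K0 gK in auto)
  have \<psi>K: "\<psi> x = 0" if "x \<ge> K" for x
  proof -
    have "(g has_integral \<psi> x) {- K - 1..x}"
      unfolding \<psi>_def by (intro integrable_integral integrable_continuous_real gc)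
    then have "integral UNIV g = \<psi> x"
      by (rule has_integral_compact_support) (use gK that K0 in auto)
    then show ?thesis using g_mean by simp
  qed
  have der: "(\<psi> has_vector_derivative g x) (at x)" for x
  proof (cases "x < - K")
    case True
    have "(\<psi> has_vector_derivative 0) (at x)"
      by (rule has_vector_derivative_transform_within_open[OF has_vector_derivative_const[of 0], of "{..< - K}"])
        (use True \<psi>0 in auto)
    then show ?thesis using gK[of x] True by simp
  next
    case False
    have "(\<psi> has_vector_derivative g x) (at x within {- K - 1..x + 1})"
      unfolding \<psi>_def by (rule integral_has_vector_derivative[OF gc]) (use False in auto)
    then show ?thesis using False by (subst (asm) at_within_interior) auto
  qed
  have "test_function \<psi>"
    unfolding test_function_iff
  proof (intro conjI exI[of _ K] allI impI)
    show "smooth \<psi>" by (rule smooth_antideriv[OF der g_smooth])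
    show "\<psi> x = 0" if "K < \<bar>x\<bar>" for x using that \<psi>0[of x] \<psi>K[of x] by linarith
  qed
  then have "integral UNIV (\<lambda>x. D x * vector_derivative \<psi> (at x)) = 0" by (rule ann)
  then have "integral UNIV (\<lambda>x. D x * g x) = 0" by (simp add: vector_derivative_at[OF der])
  moreover have "integral UNIV (\<lambda>x. D x * g x) = integral UNIV (\<lambda>x. D x * \<phi> x) + (- c) * integral UNIV (\<lambda>x. D x * plateau N x)"
    using integral_add[OF integrable_times_test(1)[OF int \<phi>]
        integrable_on_mult_right[OF integrable_times_test(1)[OF int test_function_plateau[of N]], of "- c"]]
    by (simp add: g_def algebra_simps)
  moreover have "integral UNIV (\<lambda>x. D x * plateau N x) = 0"
    using integral_periodic_plateau[OF N int per] mean by simp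
  ultimately show ?thesis by simp
qed

text \<open>Test with a bump so narrow that \<open>D\<close> is almost constant on its support.\<close>
lemma continuous_zero_if_annihilates_tests:
  fixes D :: "real \<Rightarrow> complex"
  assumes cont: "continuous_on UNIV D"
    and ann: "\<And>\<phi>. test_function \<phi> \<Longrightarrow> integral UNIV (\<lambda>x. D x * \<phi> x) = 0"
  shows "D 0 = 0"
proof (rule ccontr)
  assume nz: "D 0 \<noteq> 0"
  define \<delta> where "\<delta> = norm (D 0)"
  have \<delta>: "\<delta> > 0" using nz by (simp add: \<delta>_def)
  obtain e where e: "e > 0" "\<And>x. \<bar>x\<bar> < e \<Longrightarrow> norm (D x - D 0) < \<delta> / 2"
    using cont \<delta> unfolding continuous_on_iff by (metis UNIV_I dist_norm half_gt_zero diff_zero real_norm_def)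
  define \<epsilon> where "\<epsilon> = e / 2"
  have \<epsilon>: "\<epsilon> > 0" "\<epsilon> < e" using e by (auto simp: \<epsilon>_def)
  let ?b = "\<lambda>x. complex_of_real (bump \<epsilon> x)"
  define B where "B = integral {0..\<epsilon>} (bump \<epsilon>)"
  have B: "B > 0" using integral_bump_pos[OF \<epsilon>(1)] by (simp add: B_def)
  have bB: "(bump \<epsilon> has_integral B) {0..\<epsilon>}"
    unfolding B_def by (intro integrable_integral integrable_continuous_real continuous_bump)
  have "test_function ?b"
    unfolding test_function_iff
    by (intro conjI smooth_bump exI[of _ \<epsilon>]) (auto simp: bump_zero abs_if)
  then have "integral UNIV (\<lambda>x. D x * ?b x) = 0" by (rule ann)
  moreover have cDb: "continuous_on {0..\<epsilon>} (\<lambda>x. D x * ?b x)"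
    by (intro continuous_intros continuous_on_subset[OF cont] continuous_bump) auto
  have "((\<lambda>x. D x * ?b x) has_integral integral {0..\<epsilon>} (\<lambda>x. D x * ?b x)) {0..\<epsilon>}"
    by (intro integrable_integral integrable_continuous_real cDb)
  then have "integral UNIV (\<lambda>x. D x * ?b x) = integral {0..\<epsilon>} (\<lambda>x. D x * ?b x)"
    by (rule has_integral_compact_support) (auto simp: bump_zero)
  ultimately have zero: "((\<lambda>x. D x * ?b x) has_integral 0) {0..\<epsilon>}"
    using integrable_integral[OF integrable_continuous_real[OF cDb]] by simp
  have "((\<lambda>x. D 0 * ?b x) has_integral (D 0 * of_real B)) {0..\<epsilon>}"
    by (intro has_integral_mult_right has_integral_of_real bB)
  from has_integral_diff[OF zero this]
  have "((\<lambda>x. (D x - D 0) * ?b x) has_integral (- (D 0 * of_real B))) {0..\<epsilon>}"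
    by (simp add: algebra_simps)
  moreover have "((\<lambda>x. \<delta> / 2 * bump \<epsilon> x) has_integral (\<delta> / 2 * B)) {0..\<epsilon>}"
    by (intro has_integral_mult_right bB)
  moreover have "norm ((D x - D 0) * ?b x) \<le> \<delta> / 2 * bump \<epsilon> x" if "x \<in> {0..\<epsilon>}" for x
    unfolding norm_mult using that e(2)[of x] \<epsilon> \<delta> bump_nonneg[of \<epsilon> x]
    by (intro mult_mono) (auto intro: less_imp_le)
  ultimately have "norm (- (D 0 * of_real B)) \<le> \<delta> / 2 * B"
    using integral_norm_bound_integral[of "\<lambda>x. (D x - D 0) * ?b x" "{0..\<epsilon>}" "\<lambda>x. \<delta> / 2 * bump \<epsilon> x"]
    by (simp only: has_integral_iff)
  then have "\<delta> * B \<le> \<delta> / 2 * B" using B by (simp add: norm_mult \<delta>_def)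
  then show False using B \<delta> by (simp add: field_simps)
qed

context nontrivial_root
begin

text \<open>
  The difference of two families satisfies \<open>D\<^sub>1' = 0\<close> and \<open>D\<^sub>m' = D\<^bsub>m-1\<^esub>\<close> as distributions, and all
  its members have mean zero. Inductively each annihilates all test functions; from index \<open>2\<close> on they are continuous.\<close>
lemma Q_family_unique:
  assumes Q: "Q_family l Q" and m: "m \<ge> 2"
  shows "Q m 0 = Q_val l m 0"
proof -
  define D where "D m x = Q m x - Q_val l m x" for m x
  note fam = Q Q_family_Q_val
  have int: "R m absolutely_integrable_on {a..b}" if "Q_family l R" "m \<ge> 1" for R m a b
    using that unfolding Q_family_def by blast
  have Dint: "D m absolutely_integrable_on {a..b}" if "m \<ge> 1" for m a b
    unfolding D_def using int[OF Q that] int[OF Q_family_Q_val that] by (rule set_integral_diff(1))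
  have Dper: "D m (x + real N) = D m x" if "m \<ge> 1" for m x
    unfolding D_def using that fam unfolding Q_family_def by simp
  have Dmean: "integral {0..real N} (D m) = 0" if "m \<ge> 1" for m
  proof -
    have "integral {0..real N} (D m) = integral {0..real N} (Q m) - integral {0..real N} (Q_val l m)"
      unfolding D_def using int[OF Q that, of 0 "real N"] int[OF Q_family_Q_val that, of 0 "real N"]
      by (intro integral_diff) (auto simp: absolutely_integrable_on_def)
    moreover have "integral {0..real N} (Q m) = 0" "integral {0..real N} (Q_val l m) = 0"
      using fam that unfolding Q_family_def by blast+
    ultimately show ?thesis by simp
  qed
  have split: "integral UNIV (\<lambda>x. D m x * \<phi> x) = distr_of (Q m) \<phi> - distr_of (Q_val l m) \<phi>"
    "integral UNIV (\<lambda>x. D m x * vector_derivative \<phi> (at x))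
       = distr_deriv (distr_of (Q_val l m)) \<phi> - distr_deriv (distr_of (Q m)) \<phi>"
    if "m \<ge> 1" "test_function \<phi>" for m \<phi>
    unfolding distr_deriv_def distr_of_def D_def left_diff_distrib
    using integral_diff[OF integrable_times_test(1)[OF int[OF Q that(1)] that(2)]
        integrable_times_test(1)[OF int[OF Q_family_Q_val that(1)] that(2)]]
      integral_diff[OF integrable_times_test(2)[OF int[OF Q that(1)] that(2)]
        integrable_times_test(2)[OF int[OF Q_family_Q_val that(1)] that(2)]]
    by simp_all
  have rel: "distr_deriv (distr_of (R m)) \<phi> = (if m = 1 then Q_zero l else distr_of (R (m - 1))) \<phi>"
    if "Q_family l R" "m \<ge> 1" "test_function \<phi>" for R m \<phi>
    using that unfolding Q_family_def by blast
  have N1: "N \<ge> 1" using N_pos by simp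
  have ann: "\<forall>\<phi>. test_function \<phi> \<longrightarrow> integral UNIV (\<lambda>x. D (Suc m) x * \<phi> x) = 0" for m
  proof (induction m)
    case 0
    have "integral UNIV (\<lambda>x. D 1 x * vector_derivative \<phi> (at x)) = 0" if "test_function \<phi>" for \<phi>
      using split(2)[of 1 \<phi>] rel[OF Q, of 1 \<phi>] rel[OF Q_family_Q_val, of 1 \<phi>] that by simp
    then show ?case
      using annihilates_tests_if_annihilates_derivatives[OF N1 Dint[of 1] Dper[of 1] Dmean[of 1]] by simp
  next
    case (Suc m)
    let ?k = "Suc (Suc m)"
    have "integral UNIV (\<lambda>x. D ?k x * vector_derivative \<phi> (at x)) = 0" if t: "test_function \<phi>" for \<phi>
    proof -
      have "integral UNIV (\<lambda>x. D ?k x * vector_derivative \<phi> (at x))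
          = distr_of (Q_val l (Suc m)) \<phi> - distr_of (Q (Suc m)) \<phi>"
        using split(2)[of ?k \<phi>] rel[OF Q, of ?k \<phi>] rel[OF Q_family_Q_val, of ?k \<phi>] t by simp
      also have "\<dots> = - integral UNIV (\<lambda>x. D (Suc m) x * \<phi> x)"
        using split(1)[of "Suc m" \<phi>] t by simp
      also have "\<dots> = 0" using Suc.IH t by simp
      finally show ?thesis .
    qed
    then show ?case
      using annihilates_tests_if_annihilates_derivatives[OF N1 Dint[of ?k] Dper[of ?k] Dmean[of ?k]] by simp
  qed
  have "D m 0 = 0"
  proof (rule continuous_zero_if_annihilates_tests)
    show "continuous_on UNIV (D m)"
      unfolding D_def using Q m by (intro continuous_on_diff continuous_Q_val) (auto simp: Q_family_def)
    show "integral UNIV (\<lambda>x. D m x * \<phi> x) = 0" if "test_function \<phi>" for \<phi>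
      using ann[of "m - 1"] m that by simp
  qed
  then show ?thesis by (simp add: D_def)
qed

lemma Q_fun_0:
  assumes "m \<ge> 2"
  shows "Q_fun l m 0 = fps_nth (Q_gen l) (m - 1)"
proof -
  have "Q_family l (Q_fun l)"
    unfolding Q_fun_def by (rule someI[of "Q_family l"]) (rule Q_family_Q_val)
  then have "Q_fun l m 0 = Q_val l m 0" using Q_family_unique assms by blast
  then show ?thesis by (simp add: Q_val_def Q_piece_def)
qed

end

section \<open>The polynomials \<open>M\<close> as truncated Taylor series\<close>

definition Todd_num :: "complex \<Rightarrow> complex \<Rightarrow> complex fps" where
  "Todd_num l s = fps_const (s / 2) * fps_X * (1 + fps_const l * fps_exp (- s))"

definition Todd_den :: "complex \<Rightarrow> complex \<Rightarrow> complex fps" where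
  "Todd_den l s = 1 - fps_const l * fps_exp (- s)"

text \<open>
  The Taylor series at \<open>0\<close> of \<open>t \<mapsto> t s char_sum l (t s)\<close>. For \<open>l = 1\<close> numerator and
  denominator both vanish at \<open>0\<close>, and the quotient is \<open>L (s S)\<close>.\<close>
definition Todd_fps :: "complex \<Rightarrow> complex \<Rightarrow> complex fps" where
  "Todd_fps l s = Todd_num l s / Todd_den l s"

lemma fps_shift_X: "fps_nth f 0 = 0 \<Longrightarrow> f = fps_shift 1 f * fps_X" for f :: "complex fps"
  by (rule fps_ext) auto

lemma Todd_den_nonzero: "s \<noteq> 0 \<Longrightarrow> Todd_den l s \<noteq> 0"
proof
  assume s: "s \<noteq> 0" and z: "Todd_den l s = 0"
  have "fps_nth (Todd_den l s) 0 = 0" "fps_nth (Todd_den l s) 1 = 0" using z by auto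
  then show False using s by (simp add: Todd_den_def)
qed

lemma Todd_den_dvd_num:
  assumes s: "s \<noteq> 0"
  shows "Todd_den l s dvd Todd_num l s"
proof (cases "l = 1")
  case False
  then have "is_unit (Todd_den l s)" by (simp add: Todd_den_def fps_is_unit_iff)
  then show ?thesis using unit_imp_dvd by blast
next
  case True
  define U where "U = fps_shift 1 (Todd_den l s)"
  have den: "Todd_den l s = U * fps_X"
    unfolding U_def by (rule fps_shift_X) (simp add: True Todd_den_def)
  have "fps_nth U 0 = s" using True by (simp add: U_def Todd_den_def)
  then have "is_unit U" using s by (simp add: fps_is_unit_iff)
  then have "U dvd fps_const (s / 2) * (1 + fps_const l * fps_exp (- s))" using unit_imp_dvd by blast
  then have "U * fps_X dvd fps_const (s / 2) * (1 + fps_const l * fps_exp (- s)) * fps_X" by (rule mult_dvd_mono) simp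
  then show ?thesis unfolding den Todd_num_def by (simp only: mult_ac)
qed

lemma Todd_fps_mult: "s \<noteq> 0 \<Longrightarrow> Todd_fps l s * Todd_den l s = Todd_num l s"
  unfolding Todd_fps_def by (rule dvd_div_mult_self[OF Todd_den_dvd_num])

lemma Todd_fps_scale:
  assumes s: "s \<noteq> 0"
  shows "fps_nth (Todd_fps l s) m = s ^ m * fps_nth (Todd_fps l 1) m"
proof -
  have c0: "fps_nth (fps_const s * fps_X) 0 = 0" by simp
  have den: "fps_compose (Todd_den l 1) (fps_const s * fps_X) = Todd_den l s"
    by (simp add: Todd_den_def fps_compose_sub_distrib fps_compose_mult_distrib[OF c0] fps_compose_linear fps_ext power_mult_distrib[symmetric])
  have num: "fps_compose (Todd_num l 1) (fps_const s * fps_X) = Todd_num l s"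
  proof -
    have "fps_compose (fps_const (1 / 2) * fps_X :: complex fps) (fps_const s * fps_X) = fps_const (s / 2) * fps_X"
      by (simp add: fps_compose_mult_distrib[OF c0] fps_eq_iff)
    moreover have "fps_compose (1 + fps_const l * fps_exp (- 1)) (fps_const s * fps_X) = 1 + fps_const l * fps_exp (- s)"
      by (simp add: fps_compose_add_distrib fps_compose_mult_distrib[OF c0] fps_exp_compose_linear)
    ultimately show ?thesis unfolding Todd_num_def by (simp only: fps_compose_mult_distrib[OF c0])
  qed
  have "fps_compose (Todd_fps l 1) (fps_const s * fps_X) * Todd_den l s = Todd_num l s"
    using Todd_fps_mult[of 1 l] unfolding den[symmetric] num[symmetric]
    by (simp only: fps_compose_mult_distrib[OF c0, symmetric]) simp
  also have "\<dots> = Todd_fps l s * Todd_den l s" using Todd_fps_mult[OF s] by simp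
  finally have "fps_compose (Todd_fps l 1) (fps_const s * fps_X) = Todd_fps l s"
    using Todd_den_nonzero[OF s] by simp
  then have "fps_nth (Todd_fps l s) m = fps_nth (fps_compose (Todd_fps l 1) (fps_const s * fps_X)) m" by simp
  then show ?thesis by (simp add: fps_compose_linear)
qed

text \<open>This rests on \<open>1/2 (1 + q) / (1 - q) = 1/2 + q / (1 - q)\<close> with \<open>q = l exp (- S)\<close>.\<close>
lemma Todd_fps_nontrivial:
  assumes l: "l \<noteq> 1"
  shows "Todd_fps l 1 = fps_X * (fps_const (1 / 2) + Q_gen l)"
proof -
  have "Q_gen l * Todd_den l 1 = fps_const l * fps_exp (- 1)"
  proof -
    have "Q_gen l * (fps_exp 1 - fps_const l) * fps_exp (- 1) = fps_const l * fps_exp (- 1)"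
      by (simp add: Q_gen_eq[OF l])
    moreover have "(fps_exp 1 - fps_const l) * fps_exp (- 1) = Todd_den l 1"
      by (simp add: Todd_den_def left_diff_distrib fps_exp_add_mult[symmetric])
    ultimately show ?thesis by (simp add: mult.assoc)
  qed
  then have "fps_X * (fps_const (1 / 2) + Q_gen l) * Todd_den l 1
      = fps_X * (fps_const (1 / 2) * Todd_den l 1 + fps_const l * fps_exp (- 1))"
    by (simp add: algebra_simps)
  also have "fps_const (1 / 2) * Todd_den l 1 + fps_const l * fps_exp (- 1)
     = fps_const (1 / 2) * (1 + fps_const l * fps_exp (- 1))"
  proof -
    have "fps_const l * fps_exp (- 1) = fps_const (1/2) * (fps_const l * fps_exp (- 1)) + fps_const (1/2) * (fps_const l * fps_exp (- 1))"
      by (simp add: fps_eq_iff)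
    then show ?thesis unfolding Todd_den_def by (simp add: algebra_simps)
  qed
  also have "fps_X * (fps_const (1 / 2) * (1 + fps_const l * fps_exp (- 1))) = Todd_num l 1"
    by (simp add: Todd_num_def mult_ac)
  also have "\<dots> = Todd_fps l 1 * Todd_den l 1" using Todd_fps_mult[of 1 l] by simp
  finally show ?thesis using Todd_den_nonzero[of 1 l] by simp
qed

text \<open>Multiply numerator and denominator of \<open>(S/2) cosh (S/2) / sinh (S/2)\<close> by \<open>2 exp (- S/2)\<close>.\<close>
lemma Todd_fps_1: "Todd_fps 1 1 = L_series"
proof -
  define T :: "complex fps" where "T = fps_sinh (1/2) / fps_cosh (1/2)"
  have u: "fps_nth (fps_cosh (1/2)) 0 = 1" by (simp add: fps_cosh_def)
  then have cu: "is_unit (fps_cosh (1/2))" by (simp add: fps_is_unit_iff)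
  have T: "T * fps_cosh (1/2) = fps_sinh (1/2)"
    unfolding T_def by (rule dvd_div_mult_self[OF unit_imp_dvd[OF cu]])
  have T0: "fps_nth T 0 = 0" and T1: "fps_nth T 1 = 1 / 2"
  proof -
    have "fps_nth (T * fps_cosh (1/2)) 0 = fps_nth (fps_sinh (1/2)) 0"
      "fps_nth (T * fps_cosh (1/2)) 1 = fps_nth (fps_sinh (1/2)) 1" using T by auto
    then show "fps_nth T 0 = 0" "fps_nth T 1 = 1 / 2" using u by (auto simp: fps_sinh_def fps_mult_nth_1)
  qed
  define U where "U = fps_shift 1 T"
  have TU: "T = U * fps_X" unfolding U_def by (rule fps_shift_X[OF T0])
  have "fps_nth U 0 = fps_nth T 1" by (simp add: U_def)
  then have "fps_nth U 0 \<noteq> 0" using T1 by (metis zero_neq_numeral divide_eq_0_iff zero_neq_one)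
  then have "is_unit U" by (simp add: fps_is_unit_iff)
  then have "U * fps_X dvd fps_const (1/2) * fps_X" by (intro mult_dvd_mono) (auto intro: unit_imp_dvd)
  then have "L_series * T = fps_const (1/2) * fps_X"
    unfolding L_series_def T_def[symmetric] using TU by (intro dvd_div_mult_self) simp
  then have "L_series * T * fps_cosh (1/2) = fps_const (1/2) * fps_X * fps_cosh (1/2)" by simp
  then have "L_series * fps_sinh (1/2) = fps_const (1/2) * fps_X * fps_cosh (1/2)" by (simp only: mult.assoc T)
  then have "fps_const 2 * fps_exp (- (1/2)) * (L_series * fps_sinh (1/2))
      = fps_const 2 * fps_exp (- (1/2)) * (fps_const (1/2) * fps_X * fps_cosh (1/2))" by (simp only:)
  then have "L_series * (fps_const 2 * fps_exp (- (1/2)) * fps_sinh (1/2))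
      = fps_const (1/2) * fps_X * (fps_const 2 * fps_exp (- (1/2)) * fps_cosh (1/2))" by (simp only: mult_ac)
  moreover have "fps_const 2 * fps_exp (- (1/2)) * fps_sinh (1/2) = Todd_den 1 1"
    "fps_const 2 * fps_exp (- (1/2)) * fps_cosh (1/2) = 1 + fps_exp (- 1 :: complex)"
  proof -
    have e: "fps_exp (- (1/2)) * fps_exp (1/2) = (1 :: complex fps)" "fps_exp (- (1/2)) * fps_exp (- (1/2)) = (fps_exp (- 1) :: complex fps)"
      by (simp_all add: fps_exp_add_mult[symmetric])
    have c: "fps_const 2 * fps_const (1/2) = (1 :: complex fps)" by simp
    have "fps_const 2 * fps_exp (- (1/2)) * fps_sinh (1/2)
        = fps_const 2 * fps_const (1/2) * (fps_exp (- (1/2)) * fps_exp (1/2) - fps_exp (- (1/2)) * fps_exp (- (1/2)))"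
      unfolding fps_sinh_def by (simp only: right_diff_distrib mult_ac)
    then show "fps_const 2 * fps_exp (- (1/2)) * fps_sinh (1/2) = Todd_den 1 1"
      unfolding e c by (simp add: Todd_den_def)
    have "fps_const 2 * fps_exp (- (1/2)) * fps_cosh (1/2)
        = fps_const 2 * fps_const (1/2) * (fps_exp (- (1/2)) * fps_exp (1/2) + fps_exp (- (1/2)) * fps_exp (- (1/2)))"
      unfolding fps_cosh_def by (simp only: distrib_left mult_ac)
    then show "fps_const 2 * fps_exp (- (1/2)) * fps_cosh (1/2) = 1 + fps_exp (- 1 :: complex)"
      unfolding e c by simp
  qed
  ultimately have "L_series * Todd_den 1 1 = Todd_num 1 1" by (simp add: Todd_num_def)
  also have "\<dots> = Todd_fps 1 1 * Todd_den 1 1" using Todd_fps_mult[of 1 1] by simp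
  finally show ?thesis using Todd_den_nonzero[of 1 1] by simp
qed

lemma Todd_fps_nth_0: "fps_nth (Todd_fps l 1) 0 = (if l = 1 then 1 else 0)"
proof (cases "l = 1")
  case True
  have "fps_nth (Todd_fps 1 1 * Todd_den 1 1) 1 = fps_nth (Todd_num 1 1) 1" using Todd_fps_mult[of 1 1] by simp
  then show ?thesis using True by (simp add: fps_mult_nth_1 Todd_den_def Todd_num_def mult.assoc)
next
  case False
  then show ?thesis by (simp add: Todd_fps_nontrivial)
qed

text \<open>
  For \<open>l = 1\<close> the truncation in \<open>M_poly\<close> is at the even number \<open>2 (k div 2)\<close>, which is at least
  \<open>k - 1\<close>; hence the bound on \<open>m\<close>.\<close>
lemma coeff_M_poly:
  assumes root: "\<exists>N>0. l ^ N = 1" and m: "Suc m \<le> k"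
  shows "coeff (M_poly k l) m = fps_nth (Todd_fps l 1) m"
proof (cases "l = 1")
  case True
  have "m \<le> 2 * (k div 2)" using m by linarith
  then have "(\<Sum>x\<le>2 * (k div 2). if x = m then fps_nth L_series x else 0) = fps_nth L_series m" by simp
  then show ?thesis using True by (simp add: M_poly_def coeff_sum Todd_fps_1)
next
  case False
  interpret nontrivial_root l by standard (use False root in auto)
  have cf: "coeff (M_poly k l) m = (if m = 1 then 1 / 2 + l / (1 - l) else 0) + (if m \<in> {2..k} then Q_fun l m 0 else 0)"
  proof -
    have "(\<Sum>x = 2..k. coeff (monom (Q_fun l x 0) x) m) = (if m \<in> {2..k} then Q_fun l m 0 else 0)"
      unfolding coeff_monom by (rule sum.delta) simp
    then show ?thesis using False by (simp only: M_poly_def if_False coeff_add coeff_monom coeff_sum) simp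
  qed
  have Q0: "fps_nth (Q_gen l) 0 = l / (1 - l)"
    using Q_piece_1[OF False, of 0] by (simp add: Q_piece_def)
  show ?thesis
  proof (cases m)
    case 0
    then show ?thesis unfolding cf by (simp add: Todd_fps_nontrivial[OF False])
  next
    case (Suc j)
    show ?thesis
    proof (cases j)
      case 0
      then show ?thesis unfolding cf Todd_fps_nontrivial[OF False] using Suc by (simp add: Q0)
    next
      case (Suc i)
      then have "m \<ge> 2" using \<open>m = Suc j\<close> by simp
      then show ?thesis
        unfolding cf Todd_fps_nontrivial[OF False] using Q_fun_0[of m] m \<open>m = Suc j\<close> Suc by simp
    qed
  qed
qed

lemma has_fps_expansion_char_sum:
  assumes s: "s \<noteq> 0"
  shows "\<exists>f. f has_fps_expansion Todd_fps l (of_real s) \<and>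
    (\<forall>t>0. f (of_real t) = of_real (t * s) * char_sum l (t * s))"
proof -
  define c where "c = fps_nth (Todd_num l (of_real s)) (subdegree (Todd_den l (of_real s))) /
     fps_nth (Todd_den l (of_real s)) (subdegree (Todd_den l (of_real s)))"
  let ?n = "\<lambda>z :: complex. (of_real s / 2) * z * (1 + l * exp (- of_real s * z))"
  let ?d = "\<lambda>z :: complex. 1 - l * exp (- of_real s * z)"
  have s0: "complex_of_real s \<noteq> 0" using s by simp
  have "(\<lambda>z. if z = 0 then c else ?n z / ?d z) has_fps_expansion Todd_fps l (of_real s)"
    unfolding Todd_fps_def
  proof (rule has_fps_expansion_divide)
    show "?n has_fps_expansion Todd_num l (of_real s)" unfolding Todd_num_def by (intro fps_expansion_intros)
    show "?d has_fps_expansion Todd_den l (of_real s)" unfolding Todd_den_def by (intro fps_expansion_intros)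
    show "Todd_den l (of_real s) \<noteq> 0" by (rule Todd_den_nonzero[OF s0])
    have "Todd_num l (of_real s) = 0 \<or> subdegree (Todd_den l (of_real s)) \<le> subdegree (Todd_num l (of_real s))"
      using Todd_den_dvd_num[OF s0] fps_dvd_iff[of "Todd_den l (of_real s)" "Todd_num l (of_real s)"] Todd_den_nonzero[OF s0] by metis
    moreover have "Todd_num l (of_real s) \<noteq> 0"
    proof
      assume z: "Todd_num l (of_real s) = 0"
      have "fps_nth (Todd_num l (of_real s)) 1 = 0" "fps_nth (Todd_num l (of_real s)) 2 = 0" using z by auto
      then show False using s by (auto simp: Todd_num_def mult.assoc numeral_2_eq_2)
    qed
    ultimately show "subdegree (Todd_den l (of_real s)) \<le> subdegree (Todd_num l (of_real s))" by blast
  qed (simp add: c_def)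
  moreover have "(if complex_of_real t = 0 then c else ?n (of_real t) / ?d (of_real t)) = of_real (t * s) * char_sum l (t * s)"
    if "t > 0" for t
    using that by (simp add: char_sum_def mult_ac)
  ultimately show ?thesis by blast
qed

text \<open>If the difference were nonzero, dividing it by the power of \<open>z\<close> in its leading term would give a function with a nonzero limit at \<open>0\<close>.\<close>
lemma fps_eq_if_eq_on_positive:
  fixes f g :: "complex \<Rightarrow> complex"
  assumes "f has_fps_expansion F" "g has_fps_expansion G" "\<And>t. t > 0 \<Longrightarrow> f (of_real t) = g (of_real t)"
  shows "F = G"
proof (rule ccontr)
  assume "F \<noteq> G"
  define H where "H = F - G"
  have H: "(\<lambda>z. f z - g z) has_fps_expansion H" unfolding H_def by (intro has_fps_expansion_diff assms)
  have H0: "H \<noteq> 0" using \<open>F \<noteq> G\<close> by (simp add: H_def)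
  define k where "k = subdegree H"
  define q where "q z = (if z = 0 then fps_nth H k else (f z - g z) / z ^ k)" for z
  have "q has_fps_expansion fps_shift k H"
    unfolding q_def[abs_def] by (rule has_fps_expansion_shift[OF H]) (auto simp: k_def)
  then have "isCont q 0" by (rule has_fps_expansion_imp_continuous[of _ _ UNIV])
  then have "(q \<longlongrightarrow> q 0) (at 0)" by (simp add: isCont_def)
  moreover have "filterlim (\<lambda>t::real. complex_of_real t) (at 0) (at_right 0)"
    by (rule filterlim_atI) (auto intro!: tendsto_eq_intros eventually_at_rightI[of 0 1])
  ultimately have "((\<lambda>t. q (of_real t)) \<longlongrightarrow> q 0) (at_right 0)" by (rule filterlim_compose)
  moreover have "((\<lambda>t::real. q (of_real t)) \<longlongrightarrow> 0) (at_right 0)"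
    by (rule Lim_transform_eventually[OF tendsto_const])
      (auto intro!: eventually_at_rightI[of 0 1] simp: q_def assms(3))
  ultimately have "q 0 = 0" using tendsto_unique[OF trivial_limit_at_right_real] by blast
  then show False using H0 by (simp add: q_def k_def)
qed

section \<open>Differential operators in the shifts of the facets\<close>

text \<open>Dominated convergence for the exponential series, uniformly bounded on a compact set.\<close>
lemma moment_generating_sums:
  fixes f :: "'a::euclidean_space \<Rightarrow> real" and z :: complex
  assumes K: "compact K" and f: "continuous_on UNIV f"
  shows "(\<lambda>m. (\<integral>x. indicator K x *\<^sub>R (complex_of_real (f x) ^ m / fact m) \<partial>lborel) * z ^ m)
     sums (\<integral>x. indicator K x *\<^sub>R exp (z * of_real (f x)) \<partial>lborel)"
proof -
  have "bounded (f ` K)"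
    by (intro compact_imp_bounded compact_continuous_image continuous_on_subset[OF f] K) simp
  then obtain B where B: "\<And>x. x \<in> K \<Longrightarrow> \<bar>f x\<bar> \<le> B" by (auto simp: bounded_iff)
  have [measurable]: "f \<in> borel_measurable borel" by (rule borel_measurable_continuous_onI[OF f])
  have fin: "emeasure lborel K < \<infinity>" by (rule emeasure_bounded_finite[OF compact_imp_bounded[OF K]])
  have [measurable]: "K \<in> sets borel" by (rule borel_compact[OF K])
  define g where "g m x = indicator K x *\<^sub>R (complex_of_real (f x) ^ m / fact m * z ^ m)" for m x
  define b where "b = norm z * \<bar>B\<bar>"
  have gb: "norm (g m x) \<le> indicator K x * (b ^ m / fact m)" for m x
  proof (cases "x \<in> K")
    case True
    have "\<bar>f x\<bar> \<le> \<bar>B\<bar>" using B[OF True] by linarith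
    then have "\<bar>f x\<bar> * norm z \<le> b"
      using mult_left_mono[of "\<bar>f x\<bar>" "\<bar>B\<bar>" "norm z"] by (simp add: b_def mult.commute)
    then have "(\<bar>f x\<bar> * norm z) ^ m \<le> b ^ m" by (intro power_mono) auto
    then have "(\<bar>f x\<bar> * norm z) ^ m / fact m \<le> b ^ m / fact m" by (rule divide_right_mono) simp
    then show ?thesis using True
      by (simp add: g_def norm_mult norm_power norm_divide power_mult_distrib)
  qed (simp add: g_def)
  have ind: "integrable lborel (\<lambda>x. indicator K x * c)" for c :: real
    by (intro integrable_mult_left integrable_real_indicator fin) simp
  have gint: "integrable lborel (g m)" for m
  proof (rule Bochner_Integration.integrable_bound[OF ind[of "b ^ m / fact m"]])
    show "g m \<in> borel_measurable lborel"
      unfolding g_def[abs_def] by measurable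
    show "AE x in lborel. norm (g m x) \<le> norm (indicator K x * (b ^ m / fact m))"
      using gb by (intro AE_I2) (simp add: b_def)
  qed
  have "(\<lambda>m. integral\<^sup>L lborel (g m)) sums (\<integral>x. suminf (\<lambda>m. g m x) \<partial>lborel)"
  proof (rule sums_integral[OF gint])
    have sb: "summable (\<lambda>m. b ^ m / fact m)" using summable_exp[of b] by (simp add: divide_inverse mult.commute)
    show "AE x in lborel. summable (\<lambda>m. norm (g m x))"
      by (intro AE_I2 summable_comparison_test'[OF summable_mult[OF sb], of 0]) (use gb in auto)
    show "summable (\<lambda>m. \<integral>x. norm (g m x) \<partial>lborel)"
    proof (rule summable_comparison_test'[OF summable_mult[OF sb, of "measure lborel K"], of 0])
      fix m
      have "(\<integral>x. norm (g m x) \<partial>lborel) \<le> (\<integral>x. indicator K x * (b ^ m / fact m) \<partial>lborel)"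
        by (rule integral_mono[OF integrable_norm[OF gint] ind gb])
      also have "\<dots> = measure lborel K * (b ^ m / fact m)"
      proof -
        have "has_bochner_integral lborel (\<lambda>x. indicator K x * (b ^ m / fact m)) (measure lborel K * (b ^ m / fact m))"
          by (intro has_bochner_integral_mult_left has_bochner_integral_real_indicator)
            (use fin in auto)
        then show ?thesis by (rule has_bochner_integral_integral_eq)
      qed
      finally show "norm (\<integral>x. norm (g m x) \<partial>lborel) \<le> measure lborel K * (b ^ m / fact m)"
        by simp
    qed
  qed
  moreover have "suminf (\<lambda>m. g m x) = indicator K x *\<^sub>R exp (z * of_real (f x))" for x
  proof -
    have "(\<lambda>m. (z * of_real (f x)) ^ m /\<^sub>R fact m) sums exp (z * of_real (f x))" by (rule exp_converges)
    then have "(\<lambda>m. indicator K x *\<^sub>R ((z * of_real (f x)) ^ m /\<^sub>R fact m)) sums (indicator K x *\<^sub>R exp (z * of_real (f x)))"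
      by (rule sums_scaleR_right)
    moreover have "indicator K x *\<^sub>R ((z * of_real (f x)) ^ m /\<^sub>R fact m) = g m x" for m
      by (simp add: g_def power_mult_distrib scaleR_conv_of_real divide_inverse mult_ac)
    ultimately show ?thesis by (simp add: sums_iff)
  qed
  moreover have "integral\<^sup>L lborel (g m) = (\<integral>x. indicator K x *\<^sub>R (complex_of_real (f x) ^ m / fact m) \<partial>lborel) * z ^ m" for m
    unfolding g_def by (subst integral_mult_left_zero[symmetric]) (simp add: scaleR_conv_of_real mult_ac)
  ultimately show ?thesis by simp
qed

definition near_zero :: "real \<Rightarrow> nat \<Rightarrow> (nat \<Rightarrow> real) set" where
  "near_zero \<epsilon> d = {h. \<forall>j\<in>{1..d}. \<bar>h j\<bar> < \<epsilon>}"

text \<open>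
  The coefficient of \<open>S\<^sup>N\<close> in \<open>A(S) exp ((a + \<Sum>\<^sub>j s\<^sub>j h\<^sub>j) S)\<close>, as a function of the shift
  \<open>h\<close>. Differentiation in \<open>h\<^sub>j\<close> multiplies \<open>A\<close> by \<open>s\<^sub>j S\<close>.\<close>
definition exp_coeff :: "nat \<Rightarrow> real \<Rightarrow> (nat \<Rightarrow> real) \<Rightarrow> nat \<Rightarrow> complex fps \<Rightarrow> (nat \<Rightarrow> real) \<Rightarrow> complex" where
  "exp_coeff d a s N A h = fps_nth (A * fps_exp (of_real (a + (\<Sum>j\<in>{1..d}. s j * h j)))) N"

text \<open>
  Functions of the shift that agree near \<open>0\<close> with a linear combination of functions \<open>exp_coeff\<close>; these are
  polynomials in \<open>h\<close>. The last rule is needed because the integral over the shifted polytope has this form for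
  small shifts only, while the operators are applied to the integral itself.\<close>
inductive shift_polynomial :: "real \<Rightarrow> nat \<Rightarrow> ((nat \<Rightarrow> real) \<Rightarrow> complex) \<Rightarrow> bool" for \<epsilon> d where
  base: "shift_polynomial \<epsilon> d (exp_coeff d a s N A)"
| lincomb: "shift_polynomial \<epsilon> d F \<Longrightarrow> shift_polynomial \<epsilon> d G \<Longrightarrow> shift_polynomial \<epsilon> d (\<lambda>h. b * F h + c * G h)"
| cong: "shift_polynomial \<epsilon> d F \<Longrightarrow> (\<And>h. h \<in> near_zero \<epsilon> d \<Longrightarrow> F h = G h) \<Longrightarrow> shift_polynomial \<epsilon> d G"

lemma exp_coeff_partial:
  assumes j: "j \<in> {1..d}"
  shows "((\<lambda>t. exp_coeff d a s N A (h(j := t))) has_vector_derivative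
      exp_coeff d a s N (fps_const (of_real (s j)) * fps_X * A) h) (at (h j))"
proof -
  define r where "r = a + (\<Sum>i\<in>{1..d} - {j}. s i * h i)"
  have upd: "a + (\<Sum>i\<in>{1..d}. s i * (h(j := t)) i) = r + s j * t" for t
  proof -
    have "(\<Sum>i\<in>{1..d}. s i * (h(j := t)) i) = s j * t + (\<Sum>i\<in>{1..d} - {j}. s i * (h(j := t)) i)"
      using j by (subst sum.remove[of _ j]) auto
    also have "(\<Sum>i\<in>{1..d} - {j}. s i * (h(j := t)) i) = (\<Sum>i\<in>{1..d} - {j}. s i * h i)"
      by (intro sum.cong) auto
    finally show ?thesis by (simp add: r_def)
  qed
  have "h(j := h j) = h" by simp
  then have "a + (\<Sum>i\<in>{1..d}. s i * h i) = r + s j * h j" using upd[of "h j"] by simp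
  then show ?thesis
    using fps_exp_linear_nth_derivative[of A r "s j" N "h j"]
    unfolding exp_coeff_def upd by (simp only: mult.assoc)
qed

lemma near_zero_update:
  assumes "h \<in> near_zero \<epsilon> d"
  shows "\<forall>\<^sub>F t in nhds (h j). h(j := t) \<in> near_zero \<epsilon> d"
proof (cases "j \<in> {1..d}")
  case True
  then have "\<bar>h j\<bar> < \<epsilon>" using assms by (simp add: near_zero_def)
  then have "\<forall>\<^sub>F t in nhds (h j). \<bar>t\<bar> < \<epsilon>"
    by (intro order_tendstoD(2)[where f = "\<lambda>t. \<bar>t\<bar>" and y = "\<bar>h j\<bar>"] tendsto_rabs) (auto simp: filterlim_ident)
  then show ?thesis
    by eventually_elim (use assms in \<open>auto simp: near_zero_def\<close>)
next
  case False
  then show ?thesis using assms by (intro always_eventually) (auto simp: near_zero_def)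
qed

lemma has_vector_derivative_cong_nhds:
  assumes "\<forall>\<^sub>F t in nhds x. f t = g t"
  shows "(f has_vector_derivative D) (at x) \<longleftrightarrow> (g has_vector_derivative D) (at x)"
proof -
  obtain S where S: "open S" "x \<in> S" "\<And>t. t \<in> S \<Longrightarrow> f t = g t"
    using assms unfolding eventually_nhds by blast
  show ?thesis
    using has_vector_derivative_transform_within_open[OF _ S(1,2), of f D g]
      has_vector_derivative_transform_within_open[OF _ S(1,2), of g D f] S(3) by auto
qed

lemma partial_h_cong:
  assumes "\<And>h. h \<in> near_zero \<epsilon> d \<Longrightarrow> F h = G h" "h \<in> near_zero \<epsilon> d"
  shows "partial_h j F h = partial_h j G h"
proof -
  have "\<forall>\<^sub>F t in nhds (h j). F (h(j := t)) = G (h(j := t))"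
    using near_zero_update[OF assms(2), of j] by eventually_elim (rule assms(1))
  then show ?thesis
    unfolding partial_h_def vector_derivative_def by (simp only: has_vector_derivative_cong_nhds)
qed

lemma shift_polynomial_partial:
  assumes "shift_polynomial \<epsilon> d F" "j \<in> {1..d}"
  shows "shift_polynomial \<epsilon> d (partial_h j F) \<and>
    (\<forall>h\<in>near_zero \<epsilon> d. ((\<lambda>t. F (h(j := t))) has_vector_derivative partial_h j F h) (at (h j)))"
  using assms(1)
proof induction
  case (base a s N A)
  have p: "partial_h j (exp_coeff d a s N A) = exp_coeff d a s N (fps_const (of_real (s j)) * fps_X * A)"
    unfolding partial_h_def fun_eq_iff using exp_coeff_partial[OF assms(2)] by (auto intro: vector_derivative_at)
  show ?case unfolding p using exp_coeff_partial[OF assms(2)] by (intro conjI ballI shift_polynomial.base)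
next
  case (lincomb F G b c)
  note IHF = lincomb.IH(1)[THEN conjunct2, rule_format] and IHG = lincomb.IH(2)[THEN conjunct2, rule_format]
  have d: "((\<lambda>t. b * F (h(j := t)) + c * G (h(j := t))) has_vector_derivative b * partial_h j F h + c * partial_h j G h) (at (h j))"
    if "h \<in> near_zero \<epsilon> d" for h
    by (intro has_vector_derivative_add has_vector_derivative_mult_right IHF[OF that] IHG[OF that])
  have eq: "partial_h j (\<lambda>h. b * F h + c * G h) h = b * partial_h j F h + c * partial_h j G h"
    if "h \<in> near_zero \<epsilon> d" for h
    using vector_derivative_at[OF d[OF that]] unfolding partial_h_def .
  have "shift_polynomial \<epsilon> d (\<lambda>h. b * partial_h j F h + c * partial_h j G h)"
    by (intro shift_polynomial.lincomb lincomb.IH(1)[THEN conjunct1] lincomb.IH(2)[THEN conjunct1])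
  then have "shift_polynomial \<epsilon> d (partial_h j (\<lambda>h. b * F h + c * G h))"
    by (rule shift_polynomial.cong) (rule eq[symmetric])
  then show ?case
  proof (intro conjI ballI)
    fix h assume h: "h \<in> near_zero \<epsilon> d"
    show "((\<lambda>t. b * F (h(j := t)) + c * G (h(j := t))) has_vector_derivative
        partial_h j (\<lambda>h. b * F h + c * G h) h) (at (h j))"
      unfolding eq[OF h] by (rule d[OF h])
  qed
next
  case (cong F G)
  have eq: "partial_h j F h = partial_h j G h" if "h \<in> near_zero \<epsilon> d" for h
    by (rule partial_h_cong[OF cong.hyps(2) that])
  have "shift_polynomial \<epsilon> d (partial_h j G)"
    by (rule shift_polynomial.cong[OF cong.IH[THEN conjunct1]]) (rule eq)
  moreover have "((\<lambda>t. G (h(j := t))) has_vector_derivative partial_h j G h) (at (h j))" if h: "h \<in> near_zero \<epsilon> d" for h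
  proof -
    have "\<forall>\<^sub>F t in nhds (h j). F (h(j := t)) = G (h(j := t))"
      using near_zero_update[OF h, of j] by eventually_elim (rule cong.hyps(2))
    from iffD1[OF has_vector_derivative_cong_nhds[OF this] cong.IH[THEN conjunct2, rule_format, OF h]]
    show ?thesis unfolding eq[OF h] .
  qed
  ultimately show ?case by blast
qed

text \<open>
  The vector derivative has an arbitrary value where a function is not differentiable, so
  \<open>partial_h\<close> is linear on suitable functions only. This predicate collects what survives
  composition: the class is preserved, only the values near \<open>0\<close> matter, and the operator is linear on the class.\<close>
definition shift_operator :: "real \<Rightarrow> nat \<Rightarrow> (((nat \<Rightarrow> real) \<Rightarrow> complex) \<Rightarrow> (nat \<Rightarrow> real) \<Rightarrow> complex) \<Rightarrow> bool" where
  "shift_operator \<epsilon> d T \<longleftrightarrow>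
     (\<forall>F. shift_polynomial \<epsilon> d F \<longrightarrow> shift_polynomial \<epsilon> d (T F)) \<and>
     (\<forall>F G. (\<forall>h\<in>near_zero \<epsilon> d. F h = G h) \<longrightarrow> (\<forall>h\<in>near_zero \<epsilon> d. T F h = T G h)) \<and>
     (\<forall>F G b c. shift_polynomial \<epsilon> d F \<longrightarrow> shift_polynomial \<epsilon> d G \<longrightarrow>
        (\<forall>h\<in>near_zero \<epsilon> d. T (\<lambda>h. b * F h + c * G h) h = b * T F h + c * T G h))"

lemma shift_operatorI:
  assumes "\<And>F. shift_polynomial \<epsilon> d F \<Longrightarrow> shift_polynomial \<epsilon> d (T F)"
    and "\<And>F G h. (\<And>h. h \<in> near_zero \<epsilon> d \<Longrightarrow> F h = G h) \<Longrightarrow> h \<in> near_zero \<epsilon> d \<Longrightarrow> T F h = T G h"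
    and "\<And>F G b c h. shift_polynomial \<epsilon> d F \<Longrightarrow> shift_polynomial \<epsilon> d G \<Longrightarrow> h \<in> near_zero \<epsilon> d \<Longrightarrow>
      T (\<lambda>h. b * F h + c * G h) h = b * T F h + c * T G h"
  shows "shift_operator \<epsilon> d T"
  unfolding shift_operator_def
proof (intro conjI allI impI ballI)
  show "shift_polynomial \<epsilon> d (T F)" if "shift_polynomial \<epsilon> d F" for F by (rule assms(1)[OF that])
  show "T F h = T G h" if "\<forall>h\<in>near_zero \<epsilon> d. F h = G h" "h \<in> near_zero \<epsilon> d" for F G h
    by (rule assms(2)[OF bspec[OF that(1)] that(2)])
  show "T (\<lambda>h. b * F h + c * G h) h = b * T F h + c * T G h"
    if "shift_polynomial \<epsilon> d F" "shift_polynomial \<epsilon> d G" "h \<in> near_zero \<epsilon> d" for F G b c h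
    by (rule assms(3)[OF that])
qed

lemma shift_operator_polynomial: "shift_operator \<epsilon> d T \<Longrightarrow> shift_polynomial \<epsilon> d F \<Longrightarrow> shift_polynomial \<epsilon> d (T F)"
  unfolding shift_operator_def by (drule conjunct1) (drule spec, erule mp)

lemma shift_operator_cong:
  assumes "shift_operator \<epsilon> d T" "\<And>h. h \<in> near_zero \<epsilon> d \<Longrightarrow> F h = G h" "h \<in> near_zero \<epsilon> d"
  shows "T F h = T G h"
  by (rule assms(1)[unfolded shift_operator_def, THEN conjunct2, THEN conjunct1, rule_format, OF assms(2,3)])

lemma shift_operator_linear:
  assumes "shift_operator \<epsilon> d T" "shift_polynomial \<epsilon> d F" "shift_polynomial \<epsilon> d G" "h \<in> near_zero \<epsilon> d"
  shows "T (\<lambda>h. b * F h + c * G h) h = b * T F h + c * T G h"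
  using assms(1)[unfolded shift_operator_def, THEN conjunct2, THEN conjunct2, rule_format, OF assms(2-4)] .

lemma shift_operator_partial:
  assumes j: "j \<in> {1..d}"
  shows "shift_operator \<epsilon> d (partial_h j)"
proof (rule shift_operatorI)
  show "shift_polynomial \<epsilon> d (partial_h j F)" if "shift_polynomial \<epsilon> d F" for F
    using shift_polynomial_partial[OF that j] by (rule conjunct1)
  show "partial_h j F h = partial_h j G h"
    if "\<And>h. h \<in> near_zero \<epsilon> d \<Longrightarrow> F h = G h" "h \<in> near_zero \<epsilon> d" for F G h
    using that by (rule partial_h_cong)
  fix F G b c h assume F: "shift_polynomial \<epsilon> d F" and G: "shift_polynomial \<epsilon> d G" and h: "h \<in> near_zero \<epsilon> d"
  have "((\<lambda>t. b * F (h(j := t)) + c * G (h(j := t))) has_vector_derivative b * partial_h j F h + c * partial_h j G h) (at (h j))"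
    by (intro has_vector_derivative_add has_vector_derivative_mult_right
        shift_polynomial_partial[OF F j, THEN conjunct2, rule_format, OF h]
        shift_polynomial_partial[OF G j, THEN conjunct2, rule_format, OF h])
  from vector_derivative_at[OF this]
  show "partial_h j (\<lambda>h. b * F h + c * G h) h = b * partial_h j F h + c * partial_h j G h"
    unfolding partial_h_def .
qed

lemma shift_operator_id: "shift_operator \<epsilon> d (\<lambda>F. F)" by (rule shift_operatorI) simp_all

lemma shift_operator_comp:
  assumes S: "shift_operator \<epsilon> d S" and T: "shift_operator \<epsilon> d T"
  shows "shift_operator \<epsilon> d (\<lambda>F. S (T F))"
proof (rule shift_operatorI)
  show "shift_polynomial \<epsilon> d (S (T F))" if "shift_polynomial \<epsilon> d F" for F
    by (intro shift_operator_polynomial[OF S] shift_operator_polynomial[OF T] that)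
  show "S (T F) h = S (T G) h"
    if "\<And>h. h \<in> near_zero \<epsilon> d \<Longrightarrow> F h = G h" "h \<in> near_zero \<epsilon> d" for F G h
    by (rule shift_operator_cong[OF S shift_operator_cong[OF T that(1)] that(2)])
  fix F G b c h assume *: "shift_polynomial \<epsilon> d F" "shift_polynomial \<epsilon> d G" "h \<in> near_zero \<epsilon> d"
  have "S (T (\<lambda>h. b * F h + c * G h)) h = S (\<lambda>h. b * T F h + c * T G h) h"
    by (rule shift_operator_cong[OF S shift_operator_linear[OF T *(1,2)] *(3)])
  also have "\<dots> = b * S (T F) h + c * S (T G) h"
    by (rule shift_operator_linear[OF S shift_operator_polynomial[OF T *(1)] shift_operator_polynomial[OF T *(2)] *(3)])
  finally show "S (T (\<lambda>h. b * F h + c * G h)) h = b * S (T F) h + c * S (T G) h" .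
qed

lemma shift_operator_lincomb:
  assumes S: "shift_operator \<epsilon> d S" and T: "shift_operator \<epsilon> d T"
  shows "shift_operator \<epsilon> d (\<lambda>F h. p * S F h + q * T F h)"
proof (rule shift_operatorI)
  show "shift_polynomial \<epsilon> d (\<lambda>h. p * S F h + q * T F h)" if "shift_polynomial \<epsilon> d F" for F
    by (intro shift_polynomial.lincomb shift_operator_polynomial[OF S] shift_operator_polynomial[OF T] that)
  show "p * S F h + q * T F h = p * S G h + q * T G h"
    if "\<And>h. h \<in> near_zero \<epsilon> d \<Longrightarrow> F h = G h" "h \<in> near_zero \<epsilon> d" for F G h
    using shift_operator_cong[OF S that] shift_operator_cong[OF T that] by simp
  fix F G b c h assume *: "shift_polynomial \<epsilon> d F" "shift_polynomial \<epsilon> d G" "h \<in> near_zero \<epsilon> d"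
  show "p * S (\<lambda>h. b * F h + c * G h) h + q * T (\<lambda>h. b * F h + c * G h) h
      = b * (p * S F h + q * T F h) + c * (p * S G h + q * T G h)"
    unfolding shift_operator_linear[OF S *] shift_operator_linear[OF T *] by (simp add: algebra_simps)
qed

lemma shift_operator_funpow:
  assumes "shift_operator \<epsilon> d T"
  shows "shift_operator \<epsilon> d (T ^^ m)"
proof (induction m)
  case 0
  then show ?case using shift_operator_id by (simp add: id_def)
next
  case (Suc m)
  then show ?case using shift_operator_comp[OF assms Suc.IH] by (simp add: o_def)
qed

lemma shift_operator_zero: "shift_operator \<epsilon> d (\<lambda>F h. 0)"
  using shift_operator_lincomb[OF shift_operator_id shift_operator_id, of \<epsilon> d 0 0] by simp

lemma shift_operator_poly_diff_op:
  assumes j: "j \<in> {1..d}"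
  shows "shift_operator \<epsilon> d (poly_diff_op P j)"
proof -
  have "shift_operator \<epsilon> d (\<lambda>F h. \<Sum>m<k. coeff P m * (partial_h j ^^ m) F h)" for k
  proof (induction k)
    case 0
    then show ?case using shift_operator_zero by simp
  next
    case (Suc k)
    then show ?case
      using shift_operator_lincomb[OF Suc.IH shift_operator_funpow[OF shift_operator_partial[OF j]], of 1 "coeff P k" k] by simp
  qed
  from this[of "Suc (degree P)"] show ?thesis
    unfolding poly_diff_op_def[abs_def] lessThan_Suc_atMost .
qed

lemma shift_operator_foldr:
  assumes "set xs \<subseteq> {1..d}"
  shows "shift_operator \<epsilon> d (foldr (\<lambda>j. poly_diff_op (P j) j) xs)"
  using assms
proof (induction xs)
  case Nil
  then show ?case using shift_operator_id by (simp add: id_def)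
next
  case (Cons x xs)
  then show ?case
    using shift_operator_comp[OF shift_operator_poly_diff_op[of x d \<epsilon> "P x"]] by (simp add: o_def)
qed

lemma shift_polynomial_sum:
  assumes "finite V" "\<And>v. v \<in> V \<Longrightarrow> shift_polynomial \<epsilon> d (F v)"
  shows "shift_polynomial \<epsilon> d (\<lambda>h. \<Sum>v\<in>V. c v * F v h)"
  using assms
proof (induction V rule: finite_induct)
  case empty
  have "shift_polynomial \<epsilon> d (\<lambda>h. 0 * exp_coeff d 0 (\<lambda>_. 0) 0 0 h + 0 * exp_coeff d 0 (\<lambda>_. 0) 0 0 h)"
    by (intro shift_polynomial.intros)
  then show ?case by simp
next
  case (insert v V)
  have "shift_polynomial \<epsilon> d (\<lambda>h. c v * F v h + 1 * (\<Sum>v\<in>V. c v * F v h))"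
    using insert by (intro shift_polynomial.lincomb) auto
  then show ?case using insert by simp
qed

lemma shift_operator_sum:
  assumes T: "shift_operator \<epsilon> d T" and "finite V" "\<And>v. v \<in> V \<Longrightarrow> shift_polynomial \<epsilon> d (F v)" "h \<in> near_zero \<epsilon> d"
  shows "T (\<lambda>h. \<Sum>v\<in>V. c v * F v h) h = (\<Sum>v\<in>V. c v * T (F v) h)"
  using assms(2,3)
proof (induction V rule: finite_induct)
  case empty
  have "T (\<lambda>h. 0 * exp_coeff d 0 (\<lambda>_. 0) 0 0 h + 0 * exp_coeff d 0 (\<lambda>_. 0) 0 0 h) h = 0"
    unfolding shift_operator_linear[OF T shift_polynomial.base shift_polynomial.base assms(4)] by simp
  then show ?case by simp
next
  case (insert v V)
  have "T (\<lambda>h. c v * F v h + 1 * (\<Sum>v\<in>V. c v * F v h)) h = c v * T (F v) h + 1 * T (\<lambda>h. \<Sum>v\<in>V. c v * F v h) h"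
    by (intro shift_operator_linear[OF T _ _ assms(4)] shift_polynomial_sum insert.hyps insert.prems) auto
  then show ?case using insert by simp
qed

text \<open>The polynomial \<open>P(s S)\<close> as a power series in \<open>S\<close>.\<close>
definition scaled_poly :: "complex poly \<Rightarrow> complex \<Rightarrow> complex fps" where
  "scaled_poly P s = (\<Sum>m\<le>degree P. fps_const (coeff P m) * (fps_const s * fps_X) ^ m)"

lemma nth_scaled_poly: "fps_nth (scaled_poly P s) m = s ^ m * coeff P m"
proof -
  have "fps_nth (scaled_poly P s) m = (\<Sum>i\<le>degree P. if i = m then coeff P i * s ^ i else 0)"
    unfolding scaled_poly_def fps_sum_nth
  proof (intro sum.cong refl)
    fix i
    show "fps_nth (fps_const (coeff P i) * (fps_const s * fps_X) ^ i) m = (if i = m then coeff P i * s ^ i else 0)"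
      unfolding power_mult_distrib fps_const_power fps_mult_left_const_nth fps_X_power_nth by auto
  qed
  also have "\<dots> = (if m \<le> degree P then coeff P m * s ^ m else 0)" by simp
  finally show ?thesis using coeff_eq_0[of P m] by auto
qed

lemma poly_diff_op_exp_coeff:
  assumes j: "j \<in> {1..d}"
  shows "poly_diff_op P j (exp_coeff d a s N A) = exp_coeff d a s N (scaled_poly P (of_real (s j)) * A)"
proof
  fix h
  have p: "partial_h j (exp_coeff d a s N A) = exp_coeff d a s N (fps_const (of_real (s j)) * fps_X * A)" for A
    unfolding partial_h_def fun_eq_iff using exp_coeff_partial[OF j] by (auto intro: vector_derivative_at)
  have it: "(partial_h j ^^ m) (exp_coeff d a s N A) = exp_coeff d a s N ((fps_const (of_real (s j)) * fps_X) ^ m * A)" for m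
    by (induction m) (simp_all add: p mult.assoc)
  have "poly_diff_op P j (exp_coeff d a s N A) h
     = (\<Sum>m\<le>degree P. fps_nth (fps_const (coeff P m) * ((fps_const (of_real (s j)) * fps_X) ^ m * A
         * fps_exp (of_real (a + (\<Sum>j\<in>{1..d}. s j * h j))))) N)"
    unfolding poly_diff_op_def it by (simp add: exp_coeff_def)
  also have "\<dots> = fps_nth (\<Sum>m\<le>degree P. fps_const (coeff P m) * ((fps_const (of_real (s j)) * fps_X) ^ m * A
         * fps_exp (of_real (a + (\<Sum>j\<in>{1..d}. s j * h j))))) N"
    by (simp only: fps_sum_nth)
  also have "(\<Sum>m\<le>degree P. fps_const (coeff P m) * ((fps_const (of_real (s j)) * fps_X) ^ m * A
         * fps_exp (of_real (a + (\<Sum>j\<in>{1..d}. s j * h j)))))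
      = scaled_poly P (of_real (s j)) * A * fps_exp (of_real (a + (\<Sum>j\<in>{1..d}. s j * h j)))"
    unfolding scaled_poly_def sum_distrib_right by (simp only: mult.assoc)
  finally show "poly_diff_op P j (exp_coeff d a s N A) h = exp_coeff d a s N (scaled_poly P (of_real (s j)) * A) h"
    unfolding exp_coeff_def[of d a s N "scaled_poly P (of_real (s j)) * A" h] .
qed

text \<open>A differential operator acts on these functions as multiplication by its symbol, evaluated at the rates \<open>s\<^sub>j S\<close>.\<close>
lemma foldr_poly_diff_op_exp_coeff:
  assumes "set xs \<subseteq> {1..d}"
  shows "foldr (\<lambda>j. poly_diff_op (P j) j) xs (exp_coeff d a s N A)
    = exp_coeff d a s N (prod_list (map (\<lambda>j. scaled_poly (P j) (of_real (s j))) xs) * A)"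
  using assms
proof (induction xs)
  case (Cons x xs)
  then have "foldr (\<lambda>j. poly_diff_op (P j) j) (x # xs) (exp_coeff d a s N A)
    = poly_diff_op (P x) x (exp_coeff d a s N (prod_list (map (\<lambda>j. scaled_poly (P j) (of_real (s j))) xs) * A))"
    by (simp del: One_nat_def)
  also have "\<dots> = exp_coeff d a s N (scaled_poly (P x) (of_real (s x)) *
      (prod_list (map (\<lambda>j. scaled_poly (P j) (of_real (s j))) xs) * A))"
    by (rule poly_diff_op_exp_coeff) (use Cons.prems in simp)
  finally show ?case by (simp only: list.map prod_list.Cons mult.assoc)
qed simp

lemma fps_nth_mult_cong:
  fixes A B C D :: "complex fps"
  assumes "\<And>m. m \<le> N \<Longrightarrow> fps_nth A m = fps_nth B m" "\<And>m. m \<le> N \<Longrightarrow> fps_nth C m = fps_nth D m" "m \<le> N"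
  shows "fps_nth (A * C) m = fps_nth (B * D) m"
  unfolding fps_mult_nth
proof (intro sum.cong refl)
  fix i assume "i \<in> {0..m}"
  then have "i \<le> N" "m - i \<le> N" using assms(3) by auto
  then show "fps_nth A i * fps_nth C (m - i) = fps_nth B i * fps_nth D (m - i)"
    using assms(1)[of i] assms(2)[of "m - i"] by simp
qed

lemma fps_nth_prod_cong:
  fixes A B :: "'i \<Rightarrow> complex fps"
  assumes "\<And>i m. i \<in> I \<Longrightarrow> m \<le> N \<Longrightarrow> fps_nth (A i) m = fps_nth (B i) m" "m \<le> N"
  shows "fps_nth (\<Prod>i\<in>I. A i) m = fps_nth (\<Prod>i\<in>I. B i) m"
  using assms
proof (induction I arbitrary: m rule: infinite_finite_induct)
  case (insert i I)
  have "fps_nth (A i * (\<Prod>i\<in>I. A i)) m = fps_nth (B i * (\<Prod>i\<in>I. B i)) m"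
    by (rule fps_nth_mult_cong[of N]) (use insert in auto)
  then show ?case using insert.hyps by simp
qed auto

section \<open>Exponential integrals and sums over the polytope\<close>

lemma fps_has_expansion_moments:
  fixes f :: "'a::euclidean_space \<Rightarrow> real"
  assumes K: "compact K" and f: "continuous_on UNIV f"
  shows "(\<lambda>z. \<integral>x. indicator K x *\<^sub>R exp (z * of_real (f x)) \<partial>lborel) has_fps_expansion
    Abs_fps (\<lambda>m. \<integral>x. indicator K x *\<^sub>R (complex_of_real (f x) ^ m / fact m) \<partial>lborel)"
  by (rule has_fps_expansionI) (simp add: moment_generating_sums[OF K f])

locale integral_presented_polytope = presented_polytope \<Delta> d u \<mu>
  for \<Delta> :: "(real ^ 'n) set" and d :: nat and u :: "nat \<Rightarrow> real ^ 'n" and \<mu> :: "nat \<Rightarrow> real" +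
  assumes integral: "integral_polytope \<Delta>"
begin

lemma vertex_lattice: "v \<in> vertices \<Longrightarrow> v \<in> int_lattice"
  using integral by (simp add: integral_polytope_def vertices_def)

lemma normal_lattice:
  assumes "i \<in> {1..d}"
  shows "u i \<in> int_lattice"
proof -
  have "\<forall>i\<in>{1..d}. primitive_vec (u i)"
    using presentation unfolding facet_presentation_def by (elim conjE)
  then show ?thesis using assms by (simp add: primitive_vec_def)
qed

text \<open>A numbering by the coordinates of the ambient space, so that the normals at \<open>v\<close> can be arranged in a matrix.\<close>
definition enum :: "real ^ 'n \<Rightarrow> 'n \<Rightarrow> nat" where
  "enum v = (SOME \<sigma>. bij_betw \<sigma> (UNIV :: 'n set) (tight v))"

lemma enum_bij:
  assumes "v \<in> vertices"
  shows "bij_betw (enum v) UNIV (tight v)"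
proof -
  have "\<exists>\<sigma>. bij_betw \<sigma> (UNIV :: 'n set) (tight v)"
    using card_image_tight(2)[OF assms] by (intro finite_same_card_bij) auto
  then show ?thesis unfolding enum_def by (rule someI_ex)
qed

lemma enum_tight: "v \<in> vertices \<Longrightarrow> enum v i \<in> tight v"
  using bij_betwE[OF enum_bij] by blast

lemma prod_enum: "v \<in> vertices \<Longrightarrow> (\<Prod>i\<in>UNIV. f (enum v i)) = (\<Prod>j\<in>tight v. f j)"
  by (rule prod.reindex_bij_betw[OF enum_bij])

definition normal_matrix :: "real ^ 'n \<Rightarrow> real ^ 'n ^ 'n" where
  "normal_matrix v = (\<chi> i. u (enum v i))"

definition edge_matrix :: "real ^ 'n \<Rightarrow> real ^ 'n ^ 'n" where
  "edge_matrix v = (\<chi> i j. edge_dir v (enum v j) $ i)"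

lemma normal_matrix_mult: "(normal_matrix v *v x) $ i = u (enum v i) \<bullet> x"
  by (simp add: normal_matrix_def matrix_vector_mult_def inner_vec_def)

lemma transpose_edge_matrix_mult: "(transpose (edge_matrix v) *v g) $ j = g \<bullet> edge_dir v (enum v j)"
  by (simp add: edge_matrix_def matrix_vector_mult_def inner_vec_def transpose_def mult.commute)

lemma integer_basis_vertex:
  assumes v: "v \<in> vertices"
  shows "integer_basis (normal_matrix v) (edge_matrix v)"
proof
  show "int_matrix (normal_matrix v)"
    using normal_lattice enum_tight[OF v] tight_le by (fastforce simp: int_matrix_def normal_matrix_def)
  have inj: "enum v i = enum v j \<longleftrightarrow> i = j" for i j
    using bij_betw_imp_inj_on[OF enum_bij[OF v]] by (auto simp: inj_on_def)
  have "(normal_matrix v ** edge_matrix v) $ i $ j = (mat 1 :: real ^ 'n ^ 'n) $ i $ j" for i j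
  proof -
    have "(normal_matrix v ** edge_matrix v) $ i $ j = u (enum v i) \<bullet> edge_dir v (enum v j)"
      by (simp add: matrix_matrix_mult_def normal_matrix_def edge_matrix_def inner_vec_def)
    also have "\<dots> = (if i = j then 1 else 0)"
      using inner_edge_dir[OF v enum_tight[OF v, of j] enum_tight[OF v, of i]] inj by simp
    finally show ?thesis by (simp add: mat_def)
  qed
  then show "normal_matrix v ** edge_matrix v = mat 1" by (simp add: vec_eq_iff)
qed

text \<open>
  Representatives of the group \<open>\<Gamma>\<^sub>v\<close> in the half-open parallelepiped spanned by the normals
  at \<open>v\<close>; \<open>chi\<close> gives the roots of unity \<open>\<lambda>\<close> in terms of representatives.\<close>
definition cell :: "real ^ 'n \<Rightarrow> (real ^ 'n) set" where
  "cell v = {g \<in> int_lattice. \<forall>j\<in>tight v. 0 \<le> g \<bullet> edge_dir v j \<and> g \<bullet> edge_dir v j < 1}"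

definition chi :: "real ^ 'n \<Rightarrow> real ^ 'n \<Rightarrow> nat \<Rightarrow> complex" where
  "chi v g j = exp (2 * complex_of_real pi * \<i> * complex_of_real (g \<bullet> edge_dir v j))"

lemma cell_eq:
  assumes v: "v \<in> vertices"
  shows "cell_points (transpose (edge_matrix v)) = cell v"
proof -
  have "(\<forall>i. 0 \<le> g \<bullet> edge_dir v (enum v i) \<and> g \<bullet> edge_dir v (enum v i) < 1)
    \<longleftrightarrow> (\<forall>j\<in>tight v. 0 \<le> g \<bullet> edge_dir v j \<and> g \<bullet> edge_dir v j < 1)" for g
    unfolding bij_betw_imp_surj_on[OF enum_bij[OF v], symmetric] by auto
  then show ?thesis
    unfolding cell_points_def cell_def unit_cell_def mem_Collect_eq transpose_edge_matrix_mult by simp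
qed

lemma finite_cell: "v \<in> vertices \<Longrightarrow> finite (cell v)"
  using integer_basis.finite_cell_points[OF transpose_integer_basis[OF integer_basis_vertex]] cell_eq by metis

lemma card_cell:
  assumes "v \<in> vertices"
  shows "card (cell_points (edge_matrix v)) = card (cell v)" "card (cell v) > 0"
  using card_cell_points_transpose[OF integer_basis_vertex[OF assms]] cell_eq[OF assms]
    integer_basis.card_cell_points_pos[OF integer_basis_vertex[OF assms]] by auto

lemma has_bochner_integral_vertex_cone:
  assumes v: "v \<in> vertices" and S: "\<And>j. j \<in> tight v \<Longrightarrow> S j \<noteq> 0"
  shows "has_bochner_integral lborel (\<lambda>x. \<Prod>j\<in>tight v. ckernel (S j) (slack j x + h j))
    ((\<Prod>j\<in>tight v. 1 / S j) / real (card (cell v)))"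
proof -
  interpret integer_basis "normal_matrix v" "edge_matrix v" by (rule integer_basis_vertex[OF v])
  have "has_bochner_integral lborel
    (\<lambda>x. \<Prod>i\<in>UNIV. ckernel (S (enum v i)) ((normal_matrix v *v x) $ i + (\<chi> i. \<mu> (enum v i) + h (enum v i)) $ i))
    ((\<Prod>i\<in>UNIV. 1 / S (enum v i)) / real (card (cell_points (edge_matrix v))))"
    by (rule has_bochner_integral_cone) (use S enum_tight[OF v] in blast)
  moreover have "(\<Prod>i\<in>UNIV. ckernel (S (enum v i)) ((normal_matrix v *v x) $ i + (\<chi> i. \<mu> (enum v i) + h (enum v i)) $ i))
      = (\<Prod>j\<in>tight v. ckernel (S j) (slack j x + h j))" for x
    unfolding prod_enum[OF v, symmetric] by (simp add: normal_matrix_mult add.assoc)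
  ultimately show ?thesis
    using prod_enum[OF v, of "\<lambda>j. 1 / S j"] card_cell[OF v] by simp
qed

text \<open>The vertex is a lattice point, so translating by it reduces the cone at \<open>v\<close> to a cone at the origin.\<close>
lemma has_sum_vertex_cone:
  assumes v: "v \<in> vertices" and S: "\<And>j. j \<in> tight v \<Longrightarrow> S j \<noteq> 0"
  shows "((\<lambda>x. complex_of_real (\<Prod>j\<in>tight v. wkernel (S j) (slack j x))) has_sum
    ((\<Sum>g\<in>cell v. \<Prod>j\<in>tight v. char_sum (chi v g j) (S j)) / of_nat (card (cell v)))) int_lattice"
proof -
  interpret integer_basis "normal_matrix v" "edge_matrix v" by (rule integer_basis_vertex[OF v])
  have "((\<lambda>z. complex_of_real (\<Prod>i\<in>UNIV. wkernel (S (enum v i)) ((normal_matrix v *v z) $ i))) has_sum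
     ((\<Sum>g\<in>cell_points (transpose (edge_matrix v)). \<Prod>i\<in>UNIV. char_sum (root_of g i) (S (enum v i)))
        / of_nat (card (cell_points (edge_matrix v))))) int_lattice"
    by (rule has_sum_lattice_cone) (use S enum_tight[OF v] in blast)
  moreover have "root_of g i = chi v g (enum v i)" for g i
    unfolding root_of_def chi_def transpose_edge_matrix_mult ..
  moreover have "(\<Prod>i\<in>UNIV. wkernel (S (enum v i)) ((normal_matrix v *v z) $ i)) = (\<Prod>j\<in>tight v. wkernel (S j) (slack j (v + z)))" for z
  proof -
    have "(\<Prod>j\<in>tight v. wkernel (S j) (slack j (v + z))) = (\<Prod>j\<in>tight v. wkernel (S j) (u j \<bullet> z))"
    proof (rule prod.cong[OF refl])
      fix j assume "j \<in> tight v"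
      then have "slack j (v + z) = u j \<bullet> z" using slack_tight[OF v, of j] by (simp add: inner_add_right)
      then show "wkernel (S j) (slack j (v + z)) = wkernel (S j) (u j \<bullet> z)" by simp
    qed
    then show ?thesis using prod_enum[OF v, of "\<lambda>j. wkernel (S j) (u j \<bullet> z)"] by (simp add: normal_matrix_mult)
  qed
  ultimately have "((\<lambda>z. complex_of_real (\<Prod>j\<in>tight v. wkernel (S j) (slack j (v + z)))) has_sum
    ((\<Sum>g\<in>cell v. \<Prod>j\<in>tight v. char_sum (chi v g j) (S j)) / of_nat (card (cell v)))) int_lattice"
    using prod_enum[OF v, of "\<lambda>j. char_sum (chi v _ j) (S j)"] card_cell[OF v] cell_eq[OF v]
    by (simp add: prod_enum[OF v, of "\<lambda>j. char_sum (chi v _ j) (S j)"])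
  then have "(((\<lambda>x. complex_of_real (\<Prod>j\<in>tight v. wkernel (S j) (slack j x))) \<circ> (\<lambda>z. v + z)) has_sum
    ((\<Sum>g\<in>cell v. \<Prod>j\<in>tight v. char_sum (chi v g j) (S j)) / of_nat (card (cell v)))) int_lattice"
    by (simp only: o_def)
  then have "((\<lambda>x. complex_of_real (\<Prod>j\<in>tight v. wkernel (S j) (slack j x))) has_sum
    ((\<Sum>g\<in>cell v. \<Prod>j\<in>tight v. char_sum (chi v g j) (S j)) / of_nat (card (cell v)))) ((\<lambda>z. v + z) ` int_lattice)"
    by (subst has_sum_reindex) (auto simp: inj_on_def)
  moreover have "(\<lambda>z. v + z) ` int_lattice = int_lattice"
  proof
    show "(\<lambda>z. v + z) ` int_lattice \<subseteq> int_lattice" using int_lattice_add[OF vertex_lattice[OF v]] by blast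
    show "int_lattice \<subseteq> (\<lambda>z. v + z) ` int_lattice"
    proof
      fix x :: "real ^ 'n" assume "x \<in> int_lattice"
      then have "x - v \<in> int_lattice" using int_lattice_diff vertex_lattice[OF v] by blast
      moreover have "x = v + (x - v)" by simp
      ultimately show "x \<in> (\<lambda>z. v + z) ` int_lattice" by (rule image_eqI[rotated])
    qed
  qed
  ultimately show ?thesis by simp
qed

text \<open>The rate at which \<open>exp \<langle>\<xi>, x\<rangle>\<close> decays when \<open>x\<close> moves away from \<open>v\<close> along the \<open>j\<close>-th edge.\<close>
definition rate :: "real ^ 'n \<Rightarrow> real ^ 'n \<Rightarrow> nat \<Rightarrow> real" where
  "rate \<xi> v j = - (\<xi> \<bullet> edge_dir v j)"

lemma rate_nonzero: "generic \<xi> \<Longrightarrow> v \<in> vertices \<Longrightarrow> j \<in> tight v \<Longrightarrow> rate \<xi> v j \<noteq> 0"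
  by (simp add: generic_def rate_def)

lemma exp_split_at_vertex:
  assumes v: "v \<in> vertices"
  shows "exp (t * (\<xi> \<bullet> x)) = exp (t * (\<xi> \<bullet> shifted_vertex h v)) * (\<Prod>j\<in>tight v. exp (- (t * rate \<xi> v j) * (slack j x + h j)))"
proof -
  have "\<xi> \<bullet> x = \<xi> \<bullet> shifted_vertex h v + \<xi> \<bullet> (x - shifted_vertex h v)" by (simp add: inner_diff_right)
  also have "\<xi> \<bullet> (x - shifted_vertex h v) = (\<Sum>j\<in>tight v. (slack j x + h j) * (\<xi> \<bullet> edge_dir v j))"
    unfolding expand_from_shifted_vertex[OF v] inner_sum_right by simp
  finally have "t * (\<xi> \<bullet> x) = t * (\<xi> \<bullet> shifted_vertex h v) + (\<Sum>j\<in>tight v. - (t * rate \<xi> v j) * (slack j x + h j))"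
    by (simp add: rate_def algebra_simps sum_distrib_left)
  then show ?thesis by (simp add: exp_add exp_sum)
qed

text \<open>
  The exponential splits into one factor for each edge, and the sign of its rate decides in the polar
  decomposition whether the edge is flipped. So every factor of a product is one of the kernels.\<close>
lemma polar_times_exp:
  assumes "t > 0"
  shows "polar \<xi> w * exp (t * (\<xi> \<bullet> x)) = (\<Sum>v\<in>vertices. exp (t * (\<xi> \<bullet> shifted_vertex h v)) *
     (\<Prod>j\<in>tight v. (if 0 < t * rate \<xi> v j then w j else w j - 1) * exp (- (t * rate \<xi> v j) * (slack j x + h j))))"
  unfolding polar_def sum_distrib_right
proof (rule sum.cong[OF refl])
  fix v assume v: "v \<in> vertices"
  have "(\<Prod>j\<in>tight v. if \<xi> \<bullet> edge_dir v j < 0 then w j else w j - 1) = (\<Prod>j\<in>tight v. if 0 < t * rate \<xi> v j then w j else w j - 1)"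
    using assms by (intro prod.cong refl) (simp add: rate_def zero_less_mult_iff mult_less_0_iff)
  then show "(\<Prod>j\<in>tight v. if \<xi> \<bullet> edge_dir v j < 0 then w j else w j - 1) * exp (t * (\<xi> \<bullet> x)) =
      exp (t * (\<xi> \<bullet> shifted_vertex h v)) *
     (\<Prod>j\<in>tight v. (if 0 < t * rate \<xi> v j then w j else w j - 1) * exp (- (t * rate \<xi> v j) * (slack j x + h j)))"
    unfolding exp_split_at_vertex[OF v, of t \<xi> x h] prod.distrib by simp
qed

lemma integral_exp_shifted:
  assumes g: "generic \<xi>" and h: "small_shift h" and t: "t > 0"
  shows "has_bochner_integral lborel (\<lambda>x. indicator (shifted_polytope d u \<mu> h) x * exp (t * (\<xi> \<bullet> x)))
    (\<Sum>v\<in>vertices. exp (t * (\<xi> \<bullet> shifted_vertex h v)) * ((\<Prod>j\<in>tight v. 1 / (t * rate \<xi> v j)) / real (card (cell v))))"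
proof -
  have "has_bochner_integral lborel
     (\<lambda>x. \<Sum>v\<in>vertices. exp (t * (\<xi> \<bullet> shifted_vertex h v)) * (\<Prod>j\<in>tight v. ckernel (t * rate \<xi> v j) (slack j x + h j)))
     (\<Sum>v\<in>vertices. exp (t * (\<xi> \<bullet> shifted_vertex h v)) * ((\<Prod>j\<in>tight v. 1 / (t * rate \<xi> v j)) / real (card (cell v))))"
    by (intro has_bochner_integral_sum has_bochner_integral_mult_right has_bochner_integral_vertex_cone)
      (use t rate_nonzero[OF g] in auto)
  moreover have "(\<Sum>v\<in>vertices. exp (t * (\<xi> \<bullet> shifted_vertex h v)) * (\<Prod>j\<in>tight v. ckernel (t * rate \<xi> v j) (slack j x + h j)))
     = indicator (shifted_polytope d u \<mu> h) x * exp (t * (\<xi> \<bullet> x))" for x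
  proof -
    have "(\<Prod>i\<in>{1..d}. if slack i x + h i \<ge> 0 then 1 else 0) = (indicator (shifted_polytope d u \<mu> h) x :: real)"
    proof (cases "x \<in> shifted_polytope d u \<mu> h")
      case True
      then show ?thesis by (simp add: shifted_polytope_def)
    next
      case False
      then obtain i where "i \<in> {1..d}" "\<not> slack i x + h i \<ge> 0" unfolding shifted_polytope_def by blast
      then have "\<exists>i\<in>{1..d}. (if slack i x + h i \<ge> 0 then 1 else 0) = (0::real)" by (intro bexI[of _ i]) auto
      then show ?thesis using False by (simp add: prod_zero)
    qed
    then show ?thesis
      using polar_times_exp[OF t, of \<xi> "\<lambda>i. if slack i x + h i \<ge> 0 then 1 else 0" x h]
      unfolding polar_indicator[OF g h] ckernel_def by simp
  qed
  ultimately show ?thesis by simp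
qed

lemma lattice_sum_exp:
  assumes g: "generic \<xi>" and t: "t > 0"
  shows "(\<Sum>x\<in>\<Delta> \<inter> int_lattice. complex_of_real (point_weight \<Delta> x * exp (t * (\<xi> \<bullet> x))))
    = (\<Sum>v\<in>vertices. of_real (exp (t * (\<xi> \<bullet> v))) *
        ((\<Sum>g\<in>cell v. \<Prod>j\<in>tight v. char_sum (chi v g j) (t * rate \<xi> v j)) / of_nat (card (cell v))))"
proof -
  have sv: "shifted_vertex (\<lambda>_. 0) v = v" for v by (simp add: shifted_vertex_def)
  let ?W = "\<lambda>x. (\<Prod>i\<in>{1..d}. half_weight (slack i x)) * exp (t * (\<xi> \<bullet> x))"
  have "((\<lambda>x. \<Sum>v\<in>vertices. of_real (exp (t * (\<xi> \<bullet> v))) * complex_of_real (\<Prod>j\<in>tight v. wkernel (t * rate \<xi> v j) (slack j x))) has_sum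
     (\<Sum>v\<in>vertices. of_real (exp (t * (\<xi> \<bullet> v))) *
        ((\<Sum>g\<in>cell v. \<Prod>j\<in>tight v. char_sum (chi v g j) (t * rate \<xi> v j)) / of_nat (card (cell v))))) int_lattice"
    by (intro has_sum_sum finite_vertices has_sum_cmult_right has_sum_vertex_cone)
      (use t rate_nonzero[OF g] in auto)
  moreover have "(\<Sum>v\<in>vertices. of_real (exp (t * (\<xi> \<bullet> v))) * complex_of_real (\<Prod>j\<in>tight v. wkernel (t * rate \<xi> v j) (slack j x)))
     = complex_of_real (?W x)" for x
    using polar_times_exp[OF t, of \<xi> "\<lambda>i. half_weight (slack i x)" x "\<lambda>_. 0"]
    unfolding polar_weighted[OF g] wkernel_def sv by (simp add: of_real_sum)
  ultimately have hs: "((\<lambda>x. complex_of_real (?W x)) has_sum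
     (\<Sum>v\<in>vertices. of_real (exp (t * (\<xi> \<bullet> v))) *
        ((\<Sum>g\<in>cell v. \<Prod>j\<in>tight v. char_sum (chi v g j) (t * rate \<xi> v j)) / of_nat (card (cell v))))) int_lattice"
    by simp
  have fin: "finite (\<Delta> \<inter> int_lattice)"
    by (rule finite_bounded_int_lattice[OF compact_imp_bounded[OF compact_Delta]])
  have "((\<lambda>x. complex_of_real (?W x)) has_sum (\<Sum>x\<in>\<Delta> \<inter> int_lattice. complex_of_real (?W x))) (\<Delta> \<inter> int_lattice)"
    by (rule has_sum_finite[OF fin])
  then have "((\<lambda>x. complex_of_real (?W x)) has_sum (\<Sum>x\<in>\<Delta> \<inter> int_lattice. complex_of_real (?W x))) int_lattice"
  proof (rule iffD1[OF has_sum_cong_neutral, rotated -1])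
    fix x assume "x \<in> int_lattice - \<Delta> \<inter> int_lattice"
    then have "x \<notin> \<Delta>" by blast
    then obtain i where "i \<in> {1..d}" "\<not> slack i x \<ge> 0" unfolding Delta_iff by blast
    then have "\<exists>i\<in>{1..d}. half_weight (slack i x) = 0" by (intro bexI[of _ i]) (auto simp: half_weight_def)
    then show "complex_of_real (?W x) = 0" by (simp add: prod_zero)
  qed auto
  from has_sum_unique[OF this hs] show ?thesis
    by (simp add: point_weight_eq)
qed

end

section \<open>Integrals and lattice sums of powers of linear forms\<close>

context presented_polytope
begin

lemma interior_point_exists:
  obtains x where "\<And>i. i \<in> {1..d} \<Longrightarrow> slack i x > 0"
proof -
  have "\<Delta> \<noteq> {}" using aff_dim_Delta by auto
  then obtain x where x: "x \<in> rel_interior \<Delta>"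
    using rel_interior_eq_empty[OF convex_Delta] by blast
  have xD: "x \<in> \<Delta>" using x rel_interior_subset by blast
  have "slack i x > 0" if i: "i \<in> {1..d}" for i
  proof -
    have "x \<notin> nth_facet \<Delta> u \<mu> i"
      using x facet_nth[OF i] rel_interior_of_polyhedron[OF polytope_imp_polyhedron[OF polytope_Delta]] by blast
    then have "slack i x \<noteq> 0" using xD by (simp add: nth_facet_def)
    then show ?thesis using slack_nonneg[OF xD i] by linarith
  qed
  then show ?thesis using that by blast
qed

text \<open>
  For an interior point \<open>x0\<close> and a shift smaller than all its slacks, the midpoint of \<open>x0\<close> and any
  point of the shifted polytope satisfies the original inequalities. So the shifted polytope lies in the
  dilation of \<open>\<Delta>\<close> by \<open>2\<close> from \<open>x0\<close>.\<close>
lemma compact_shifted_polytope: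
  "\<exists>\<epsilon>>0. \<forall>h\<in>near_zero \<epsilon> d. small_shift h \<and> compact (shifted_polytope d u \<mu> h)"
proof -
  obtain \<epsilon>1 where \<epsilon>1: "\<epsilon>1 > 0" "\<And>h. (\<forall>i\<in>{1..d}. \<bar>h i\<bar> < \<epsilon>1) \<Longrightarrow> small_shift h"
    using small_shift_near_0 by blast
  obtain x0 where x0: "\<And>i. i \<in> {1..d} \<Longrightarrow> slack i x0 > 0" using interior_point_exists by blast
  define \<delta> where "\<delta> = Min (insert 1 ((\<lambda>i. slack i x0) ` {1..d}))"
  have \<delta>: "\<delta> > 0" unfolding \<delta>_def using x0 by (subst Min_gr_iff) auto
  have \<delta>le: "\<delta> \<le> slack i x0" if "i \<in> {1..d}" for i
    unfolding \<delta>_def by (rule Min_le) (use that in auto)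
  have comp: "compact (shifted_polytope d u \<mu> h)" if h: "h \<in> near_zero \<delta> d" for h
  proof -
    have "shifted_polytope d u \<mu> h \<subseteq> (\<lambda>y. 2 *\<^sub>R y - x0) ` \<Delta>"
    proof
      fix x assume x: "x \<in> shifted_polytope d u \<mu> h"
      let ?y = "(1/2) *\<^sub>R (x + x0)"
      have "slack i ?y \<ge> 0" if i: "i \<in> {1..d}" for i
      proof -
        have "slack i x + h i \<ge> 0" using x i unfolding shifted_polytope_def by blast
        moreover have "\<bar>h i\<bar> < \<delta>" using h i unfolding near_zero_def by blast
        ultimately have "slack i x + slack i x0 \<ge> 0" using \<delta>le[OF i] by linarith
        moreover have eq: "slack i ?y = (slack i x + slack i x0) / 2" by (simp add: inner_add_right field_simps)
        ultimately show ?thesis unfolding eq by simp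
      qed
      then have "?y \<in> \<Delta>" unfolding Delta_iff by blast
      moreover have "x = 2 *\<^sub>R ?y - x0" by simp
      ultimately show "x \<in> (\<lambda>y. 2 *\<^sub>R y - x0) ` \<Delta>" by (rule image_eqI[rotated])
    qed
    moreover have "bounded ((\<lambda>y. 2 *\<^sub>R y - x0) ` \<Delta>)"
      by (intro compact_imp_bounded compact_continuous_image compact_Delta continuous_intros)
    ultimately have "bounded (shifted_polytope d u \<mu> h)" using bounded_subset by blast
    moreover have "closed (shifted_polytope d u \<mu> h)"
    proof -
      have "shifted_polytope d u \<mu> h = (\<Inter>i\<in>{1..d}. {x. slack i x + h i \<ge> 0})"
        by (auto simp: shifted_polytope_def)
      moreover have "closed {x. slack i x + h i \<ge> 0}" for i
        by (intro closed_Collect_le continuous_intros)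
      ultimately show ?thesis by (simp add: closed_INT)
    qed
    ultimately show ?thesis by (simp add: compact_eq_bounded_closed)
  qed
  define \<epsilon> where "\<epsilon> = min \<epsilon>1 \<delta>"
  have "small_shift h \<and> compact (shifted_polytope d u \<mu> h)" if h: "h \<in> near_zero \<epsilon> d" for h
  proof -
    have "\<forall>i\<in>{1..d}. \<bar>h i\<bar> < \<epsilon>1" "h \<in> near_zero \<delta> d" using h by (auto simp: near_zero_def \<epsilon>_def)
    then show ?thesis using \<epsilon>1(2) comp by blast
  qed
  moreover have "\<epsilon> > 0" using \<epsilon>1 \<delta> by (simp add: \<epsilon>_def)
  ultimately show ?thesis by blast
qed

end

context integral_presented_polytope
begin

definition vertex_coeff :: "real ^ 'n \<Rightarrow> real ^ 'n \<Rightarrow> real" where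
  "vertex_coeff \<xi> v = (\<Prod>j\<in>tight v. 1 / rate \<xi> v j) / real (card (cell v))"

text \<open>
  The terms of the exponential formula have poles of order \<open>n\<close> at \<open>t = 0\<close>. After multiplication
  by \<open>t\<^sup>n\<close> both sides are analytic at \<open>0\<close>, and the coefficients of \<open>t\<^bsup>m+n\<^esup>\<close> agree.\<close>
lemma integral_power_linear:
  assumes g: "generic \<xi>" and h: "small_shift h" and K: "compact (shifted_polytope d u \<mu> h)"
  shows "(\<integral>x. indicator (shifted_polytope d u \<mu> h) x *\<^sub>R (complex_of_real (\<xi> \<bullet> x) ^ m / fact m) \<partial>lborel)
    = (\<Sum>v\<in>vertices. fps_nth (fps_const (of_real (vertex_coeff \<xi> v)) * fps_exp (of_real (\<xi> \<bullet> shifted_vertex h v))) (m + CARD('n)))"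
proof -
  let ?K = "shifted_polytope d u \<mu> h"
  let ?n = "CARD('n)"
  define A where "A = Abs_fps (\<lambda>m. \<integral>x. indicator ?K x *\<^sub>R (complex_of_real (\<xi> \<bullet> x) ^ m / fact m) \<partial>lborel)"
  have "(\<lambda>z. z ^ ?n * (\<integral>x. indicator ?K x *\<^sub>R exp (z * of_real (\<xi> \<bullet> x)) \<partial>lborel)) has_fps_expansion fps_X ^ ?n * A"
    unfolding A_def
    by (intro has_fps_expansion_mult has_fps_expansion_fps_X_power fps_has_expansion_moments[OF K] continuous_intros)
  moreover have "(\<lambda>z::complex. \<Sum>v\<in>vertices. of_real (vertex_coeff \<xi> v) * exp (of_real (\<xi> \<bullet> shifted_vertex h v) * z)) has_fps_expansion
      (\<Sum>v\<in>vertices. fps_const (of_real (vertex_coeff \<xi> v)) * fps_exp (of_real (\<xi> \<bullet> shifted_vertex h v)))"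
    by (intro fps_expansion_intros)
  moreover have "complex_of_real t ^ ?n * (\<integral>x. indicator ?K x *\<^sub>R exp (complex_of_real t * of_real (\<xi> \<bullet> x)) \<partial>lborel)
     = (\<Sum>v\<in>vertices. of_real (vertex_coeff \<xi> v) * exp (of_real (\<xi> \<bullet> shifted_vertex h v) * of_real t))" if t: "t > 0" for t
  proof -
    have "has_bochner_integral lborel (\<lambda>x. complex_of_real (indicator ?K x * exp (t * (\<xi> \<bullet> x))))
      (of_real (\<Sum>v\<in>vertices. exp (t * (\<xi> \<bullet> shifted_vertex h v)) * ((\<Prod>j\<in>tight v. 1 / (t * rate \<xi> v j)) / real (card (cell v)))))"
      by (intro has_bochner_integral_of_real integral_exp_shifted[OF g h t])
    moreover have "complex_of_real (indicator ?K x * exp (t * (\<xi> \<bullet> x))) = indicator ?K x *\<^sub>R exp (complex_of_real t * of_real (\<xi> \<bullet> x))" for x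
      by (simp add: scaleR_conv_of_real exp_of_real[symmetric])
    ultimately have "(\<integral>x. indicator ?K x *\<^sub>R exp (complex_of_real t * of_real (\<xi> \<bullet> x)) \<partial>lborel)
      = of_real (\<Sum>v\<in>vertices. exp (t * (\<xi> \<bullet> shifted_vertex h v)) * ((\<Prod>j\<in>tight v. 1 / (t * rate \<xi> v j)) / real (card (cell v))))"
      by (simp add: has_bochner_integral_integral_eq)
    then have "complex_of_real t ^ ?n * (\<integral>x. indicator ?K x *\<^sub>R exp (complex_of_real t * of_real (\<xi> \<bullet> x)) \<partial>lborel)
      = of_real (t ^ ?n * (\<Sum>v\<in>vertices. exp (t * (\<xi> \<bullet> shifted_vertex h v)) * ((\<Prod>j\<in>tight v. 1 / (t * rate \<xi> v j)) / real (card (cell v)))))"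
      by (simp only: of_real_mult of_real_power)
    also have "t ^ ?n * (\<Sum>v\<in>vertices. exp (t * (\<xi> \<bullet> shifted_vertex h v)) * ((\<Prod>j\<in>tight v. 1 / (t * rate \<xi> v j)) / real (card (cell v))))
      = (\<Sum>v\<in>vertices. t ^ ?n * (exp (t * (\<xi> \<bullet> shifted_vertex h v)) * ((\<Prod>j\<in>tight v. 1 / (t * rate \<xi> v j)) / real (card (cell v)))))"
      by (rule sum_distrib_left)
    also have "(\<Sum>v\<in>vertices. t ^ ?n * (exp (t * (\<xi> \<bullet> shifted_vertex h v)) * ((\<Prod>j\<in>tight v. 1 / (t * rate \<xi> v j)) / real (card (cell v)))))
       = (\<Sum>v\<in>vertices. vertex_coeff \<xi> v * exp (t * (\<xi> \<bullet> shifted_vertex h v)))"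
    proof (rule sum.cong[OF refl])
      fix v assume v: "v \<in> vertices"
      have "(\<Prod>j\<in>tight v. 1 / (t * rate \<xi> v j)) = (\<Prod>j\<in>tight v. (1 / t) * (1 / rate \<xi> v j))" by simp
      also have "\<dots> = (1 / t) ^ ?n * (\<Prod>j\<in>tight v. 1 / rate \<xi> v j)"
        unfolding prod.distrib prod_constant card_image_tight(2)[OF v] ..
      finally have "t ^ ?n * (\<Prod>j\<in>tight v. 1 / (t * rate \<xi> v j)) = (\<Prod>j\<in>tight v. 1 / rate \<xi> v j)"
        using t by (simp add: power_one_over)
      moreover have "a * (e * (p / c)) = q / c * e" if "a * p = q" for a e p c q :: real
        unfolding that[symmetric] by (simp add: mult_ac)
      ultimately show "t ^ ?n * (exp (t * (\<xi> \<bullet> shifted_vertex h v)) * ((\<Prod>j\<in>tight v. 1 / (t * rate \<xi> v j)) / real (card (cell v))))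
        = vertex_coeff \<xi> v * exp (t * (\<xi> \<bullet> shifted_vertex h v))"
        unfolding vertex_coeff_def by blast
    qed
    finally show ?thesis
      by (simp add: exp_of_real[symmetric] mult.commute)
  qed
  ultimately have "fps_X ^ ?n * A = (\<Sum>v\<in>vertices. fps_const (of_real (vertex_coeff \<xi> v)) * fps_exp (of_real (\<xi> \<bullet> shifted_vertex h v)))"
    by (rule fps_eq_if_eq_on_positive)
  then have "fps_nth (fps_X ^ ?n * A) (m + ?n) = fps_nth (\<Sum>v\<in>vertices. fps_const (of_real (vertex_coeff \<xi> v)) * fps_exp (of_real (\<xi> \<bullet> shifted_vertex h v))) (m + ?n)" by simp
  then have "fps_nth A m = fps_nth (\<Sum>v\<in>vertices. fps_const (of_real (vertex_coeff \<xi> v)) * fps_exp (of_real (\<xi> \<bullet> shifted_vertex h v))) (m + ?n)"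
    by (simp only: fps_X_power_mult_nth) simp
  then show ?thesis by (simp only: A_def fps_nth_Abs_fps fps_sum_nth)
qed

text \<open>The exponent of the summand of \<open>v\<close> does not depend on the shifts of the facets that miss \<open>v\<close>.\<close>
definition shift_rate :: "real ^ 'n \<Rightarrow> real ^ 'n \<Rightarrow> nat \<Rightarrow> real" where
  "shift_rate \<xi> v j = (if j \<in> tight v then rate \<xi> v j else 0)"

lemma inner_shifted_vertex:
  "\<xi> \<bullet> shifted_vertex h v = \<xi> \<bullet> v + (\<Sum>j\<in>{1..d}. shift_rate \<xi> v j * h j)"
proof -
  have "(\<Sum>j\<in>{1..d}. shift_rate \<xi> v j * h j) = (\<Sum>j\<in>tight v. rate \<xi> v j * h j)"
    using tight_le[of v] by (intro sum.mono_neutral_cong_right) (auto simp: shift_rate_def)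
  also have "\<dots> = - (\<Sum>j\<in>tight v. h j * (\<xi> \<bullet> edge_dir v j))"
    by (simp add: rate_def sum_negf[symmetric] mult.commute)
  finally show ?thesis by (simp add: shifted_vertex_def inner_diff_right inner_sum_right)
qed

lemma integral_power_linear_exp_coeff:
  assumes g: "generic \<xi>" and h: "small_shift h" and K: "compact (shifted_polytope d u \<mu> h)"
  shows "integral (shifted_polytope d u \<mu> h) (\<lambda>x. complex_of_real (\<xi> \<bullet> x) ^ m)
    = (\<Sum>v\<in>vertices. (fact m * of_real (vertex_coeff \<xi> v)) * exp_coeff d (\<xi> \<bullet> v) (shift_rate \<xi> v) (m + CARD('n)) 1 h)"
proof -
  let ?K = "shifted_polytope d u \<mu> h"
  have int: "integrable lborel (\<lambda>x. indicator ?K x *\<^sub>R (complex_of_real (\<xi> \<bullet> x) ^ m))"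
    by (intro borel_integrable_compact K continuous_intros)
  have "integral ?K (\<lambda>x. complex_of_real (\<xi> \<bullet> x) ^ m) = (\<integral>x. indicator ?K x *\<^sub>R (complex_of_real (\<xi> \<bullet> x) ^ m) \<partial>lborel)"
    using set_borel_integral_eq_integral(2)[of ?K "\<lambda>x. complex_of_real (\<xi> \<bullet> x) ^ m"] int
    by (simp add: set_integrable_def set_lebesgue_integral_def)
  also have "\<dots> = fact m * (\<integral>x. indicator ?K x *\<^sub>R (complex_of_real (\<xi> \<bullet> x) ^ m / fact m) \<partial>lborel)"
    by (subst integral_mult_right_zero[symmetric]) (simp add: scaleR_conv_of_real)
  also have "\<dots> = (\<Sum>v\<in>vertices. fact m * fps_nth (fps_const (of_real (vertex_coeff \<xi> v)) * fps_exp (of_real (\<xi> \<bullet> shifted_vertex h v))) (m + CARD('n)))"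
    unfolding integral_power_linear[OF assms] sum_distrib_left ..
  also have "\<dots> = (\<Sum>v\<in>vertices. (fact m * of_real (vertex_coeff \<xi> v)) * exp_coeff d (\<xi> \<bullet> v) (shift_rate \<xi> v) (m + CARD('n)) 1 h)"
    unfolding exp_coeff_def inner_shifted_vertex fps_mult_left_const_nth by (simp only: mult_1 mult.assoc)
  finally show ?thesis .
qed

text \<open>The same comparison of coefficients for the lattice sum.\<close>
lemma lattice_sum_power_linear:
  assumes g: "generic \<xi>"
  shows "(\<Sum>x\<in>\<Delta> \<inter> int_lattice. complex_of_real (point_weight \<Delta> x) * (of_real (\<xi> \<bullet> x) ^ m / fact m))
    = (\<Sum>v\<in>vertices. of_real (vertex_coeff \<xi> v) * fps_nth ((\<Sum>g\<in>cell v. \<Prod>j\<in>tight v. Todd_fps (chi v g j) (of_real (rate \<xi> v j)))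
        * fps_exp (of_real (\<xi> \<bullet> v))) (m + CARD('n)))"
proof -
  let ?n = "CARD('n)"
  \<comment> \<open>One analytic function for each root of unity and rate, so that the expansion rules apply under the sum.\<close>
  have "\<exists>ff. \<forall>l s. s \<noteq> 0 \<longrightarrow> ff l s has_fps_expansion Todd_fps l (of_real s) \<and>
    (\<forall>t>0. ff l s (of_real t) = of_real (t * s) * char_sum l (t * s))"
  proof (intro choice allI)
    fix l s
    show "\<exists>f. s \<noteq> 0 \<longrightarrow> f has_fps_expansion Todd_fps l (of_real s) \<and>
      (\<forall>t>0. f (of_real t) = of_real (t * s) * char_sum l (t * s))"
      using has_fps_expansion_char_sum[of s l] by blast
  qed
  then obtain ff where ff: "\<And>l s. s \<noteq> 0 \<Longrightarrow> ff l s has_fps_expansion Todd_fps l (of_real s)"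
    "\<And>l s t. s \<noteq> 0 \<Longrightarrow> t > 0 \<Longrightarrow> ff l s (of_real t) = of_real (t * s) * char_sum l (t * s)" by blast
  define A where "A = (\<Sum>x\<in>\<Delta> \<inter> int_lattice. fps_const (complex_of_real (point_weight \<Delta> x)) * fps_exp (of_real (\<xi> \<bullet> x)))"
  define H where "H v = fps_const (of_real (vertex_coeff \<xi> v)) *
     ((\<Sum>g\<in>cell v. \<Prod>j\<in>tight v. Todd_fps (chi v g j) (of_real (rate \<xi> v j))) * fps_exp (of_real (\<xi> \<bullet> v)))" for v
  have "(\<lambda>z. z ^ ?n * (\<Sum>x\<in>\<Delta> \<inter> int_lattice. complex_of_real (point_weight \<Delta> x) * exp (of_real (\<xi> \<bullet> x) * z)))
      has_fps_expansion fps_X ^ ?n * A"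
    unfolding A_def by (intro fps_expansion_intros)
  moreover have "(\<lambda>z. \<Sum>v\<in>vertices. of_real (vertex_coeff \<xi> v) *
     ((\<Sum>g\<in>cell v. \<Prod>j\<in>tight v. ff (chi v g j) (rate \<xi> v j) z) * exp (of_real (\<xi> \<bullet> v) * z))) has_fps_expansion (\<Sum>v\<in>vertices. H v)"
    unfolding H_def by (intro fps_expansion_intros ff(1) rate_nonzero[OF g])
  moreover have "complex_of_real t ^ ?n * (\<Sum>x\<in>\<Delta> \<inter> int_lattice. complex_of_real (point_weight \<Delta> x) * exp (of_real (\<xi> \<bullet> x) * of_real t))
    = (\<Sum>v\<in>vertices. of_real (vertex_coeff \<xi> v) *
     ((\<Sum>g\<in>cell v. \<Prod>j\<in>tight v. ff (chi v g j) (rate \<xi> v j) (of_real t)) * exp (of_real (\<xi> \<bullet> v) * of_real t)))" if t: "t > 0" for t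
  proof -
    have "(\<Sum>x\<in>\<Delta> \<inter> int_lattice. complex_of_real (point_weight \<Delta> x) * exp (of_real (\<xi> \<bullet> x) * of_real t))
      = (\<Sum>x\<in>\<Delta> \<inter> int_lattice. complex_of_real (point_weight \<Delta> x * exp (t * (\<xi> \<bullet> x))))"
      by (simp add: exp_of_real[symmetric] mult.commute)
    also have "complex_of_real t ^ ?n * \<dots> = (\<Sum>v\<in>vertices. of_real t ^ ?n * (of_real (exp (t * (\<xi> \<bullet> v))) *
        ((\<Sum>g\<in>cell v. \<Prod>j\<in>tight v. char_sum (chi v g j) (t * rate \<xi> v j)) / of_nat (card (cell v)))))"
      unfolding lattice_sum_exp[OF g t] sum_distrib_left ..
    also have "\<dots> = (\<Sum>v\<in>vertices. of_real (vertex_coeff \<xi> v) *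
     ((\<Sum>g\<in>cell v. \<Prod>j\<in>tight v. ff (chi v g j) (rate \<xi> v j) (of_real t)) * exp (of_real (\<xi> \<bullet> v) * of_real t)))"
    proof (rule sum.cong[OF refl])
      fix v assume v: "v \<in> vertices"
      have r: "rate \<xi> v j \<noteq> 0" if "j \<in> tight v" for j using rate_nonzero[OF g v that] .
      have "(\<Prod>j\<in>tight v. ff (chi v g j) (rate \<xi> v j) (of_real t))
        = of_real (t ^ ?n * (\<Prod>j\<in>tight v. rate \<xi> v j)) * (\<Prod>j\<in>tight v. char_sum (chi v g j) (t * rate \<xi> v j))" for g
      proof -
        have "(\<Prod>j\<in>tight v. ff (chi v g j) (rate \<xi> v j) (of_real t))
          = (\<Prod>j\<in>tight v. of_real (t * rate \<xi> v j) * char_sum (chi v g j) (t * rate \<xi> v j))"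
          by (intro prod.cong refl ff(2) r t)
        also have "\<dots> = of_real (\<Prod>j\<in>tight v. t * rate \<xi> v j) * (\<Prod>j\<in>tight v. char_sum (chi v g j) (t * rate \<xi> v j))"
          by (subst prod.distrib) (simp only: of_real_prod)
        also have "(\<Prod>j\<in>tight v. t * rate \<xi> v j) = t ^ ?n * (\<Prod>j\<in>tight v. rate \<xi> v j)"
          unfolding prod.distrib prod_constant card_image_tight(2)[OF v] ..
        finally show ?thesis .
      qed
      then have s: "(\<Sum>g\<in>cell v. \<Prod>j\<in>tight v. ff (chi v g j) (rate \<xi> v j) (of_real t))
        = of_real (t ^ ?n * (\<Prod>j\<in>tight v. rate \<xi> v j)) * (\<Sum>g\<in>cell v. \<Prod>j\<in>tight v. char_sum (chi v g j) (t * rate \<xi> v j))"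
        by (simp add: sum_distrib_left)
      have nz: "(\<Prod>j\<in>tight v. rate \<xi> v j) \<noteq> 0" using r by simp
      have "vertex_coeff \<xi> v * (t ^ ?n * (\<Prod>j\<in>tight v. rate \<xi> v j)) = t ^ ?n / real (card (cell v))"
        unfolding vertex_coeff_def prod_dividef using nz by simp
      then have c: "complex_of_real (vertex_coeff \<xi> v) * of_real (t ^ ?n * (\<Prod>j\<in>tight v. rate \<xi> v j)) = of_real t ^ ?n / of_nat (card (cell v))"
        by (metis of_real_divide of_real_mult of_real_of_nat_eq of_real_power)
      have e: "exp (complex_of_real (\<xi> \<bullet> v) * of_real t) = of_real (exp (t * (\<xi> \<bullet> v)))"
        by (simp add: exp_of_real[symmetric] mult.commute)
      define X where "X = (\<Sum>g\<in>cell v. \<Prod>j\<in>tight v. char_sum (chi v g j) (t * rate \<xi> v j))"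
      have "of_real (vertex_coeff \<xi> v) * (of_real (t ^ ?n * (\<Prod>j\<in>tight v. rate \<xi> v j)) * X * of_real (exp (t * (\<xi> \<bullet> v))))
         = (complex_of_real (vertex_coeff \<xi> v) * of_real (t ^ ?n * (\<Prod>j\<in>tight v. rate \<xi> v j))) * (X * of_real (exp (t * (\<xi> \<bullet> v))))"
        by (simp only: mult.assoc)
      also have "\<dots> = of_real t ^ ?n * (of_real (exp (t * (\<xi> \<bullet> v))) * (X / of_nat (card (cell v))))"
        unfolding c by simp
      finally show "of_real t ^ ?n * (of_real (exp (t * (\<xi> \<bullet> v))) *
        ((\<Sum>g\<in>cell v. \<Prod>j\<in>tight v. char_sum (chi v g j) (t * rate \<xi> v j)) / of_nat (card (cell v))))
        = of_real (vertex_coeff \<xi> v) *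
     ((\<Sum>g\<in>cell v. \<Prod>j\<in>tight v. ff (chi v g j) (rate \<xi> v j) (of_real t)) * exp (of_real (\<xi> \<bullet> v) * of_real t))"
        unfolding s e X_def by (rule sym)
    qed
    finally show ?thesis .
  qed
  ultimately have "fps_X ^ ?n * A = (\<Sum>v\<in>vertices. H v)" by (rule fps_eq_if_eq_on_positive)
  then have "fps_nth (fps_X ^ ?n * A) (m + ?n) = fps_nth (\<Sum>v\<in>vertices. H v) (m + ?n)" by simp
  then have "fps_nth A m = fps_nth (\<Sum>v\<in>vertices. H v) (m + ?n)"
    by (simp only: fps_X_power_mult_nth) simp
  moreover have "fps_nth A m = (\<Sum>x\<in>\<Delta> \<inter> int_lattice. complex_of_real (point_weight \<Delta> x) * (of_real (\<xi> \<bullet> x) ^ m / fact m))"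
    unfolding A_def fps_sum_nth fps_mult_left_const_nth fps_exp_nth of_nat_fact ..
  moreover have "fps_nth (\<Sum>v\<in>vertices. H v) (m + ?n) = (\<Sum>v\<in>vertices. of_real (vertex_coeff \<xi> v) * fps_nth ((\<Sum>g\<in>cell v. \<Prod>j\<in>tight v. Todd_fps (chi v g j) (of_real (rate \<xi> v j)))
        * fps_exp (of_real (\<xi> \<bullet> v))) (m + ?n))"
    unfolding H_def fps_sum_nth fps_mult_left_const_nth ..
  ultimately show ?thesis by simp
qed

end

section \<open>The characters at a vertex, grouped by faces\<close>

context presented_polytope
begin

lemma expand_dual:
  assumes v: "v \<in> vertices"
  shows "x = (\<Sum>j\<in>tight v. (x \<bullet> edge_dir v j) *\<^sub>R u j)"
proof -
  have "(\<Sum>j\<in>tight v. (x \<bullet> edge_dir v j) *\<^sub>R u j) \<bullet> y = x \<bullet> y" for y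
  proof -
    have "x \<bullet> y = x \<bullet> (\<Sum>j\<in>tight v. (u j \<bullet> y) *\<^sub>R edge_dir v j)"
      using expand_edge_dir[OF v, of y] by simp
    then show ?thesis by (simp add: inner_sum_right inner_sum_left mult.commute)
  qed
  then show ?thesis by (metis vector_eq_rdot)
qed

lemma span_coeff_zero:
  assumes v: "v \<in> vertices" and I: "I \<subseteq> tight v" and x: "x \<in> span (u ` I)" and j: "j \<in> tight v - I"
  shows "x \<bullet> edge_dir v j = 0"
  using x
proof (induction rule: span_induct_alt)
  case base
  then show ?case by simp
next
  case (step c y z)
  then obtain i where i: "i \<in> I" "y = u i" by blast
  have "u i \<bullet> edge_dir v j = 0"
    using inner_edge_dir[OF v, of j i] i I j by auto
  then show ?case using step i by (simp add: inner_add_left)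
qed

lemma expand_in_span:
  assumes v: "v \<in> vertices" and I: "I \<subseteq> tight v" and x: "x \<in> span (u ` I)"
  shows "x = (\<Sum>i\<in>I. (x \<bullet> edge_dir v i) *\<^sub>R u i)"
proof -
  have "(\<Sum>i\<in>I. (x \<bullet> edge_dir v i) *\<^sub>R u i) = (\<Sum>j\<in>tight v. (x \<bullet> edge_dir v j) *\<^sub>R u j)"
    using I span_coeff_zero[OF v I x] by (intro sum.mono_neutral_left) auto
  then show ?thesis using expand_dual[OF v, of x] by simp
qed

lemma coeff_of_sum:
  assumes v: "v \<in> vertices" and I: "I \<subseteq> tight v" and i: "i \<in> tight v"
  shows "(\<Sum>j\<in>I. c j *\<^sub>R u j) \<bullet> edge_dir v i = (if i \<in> I then c i else 0)"
proof -
  have "(\<Sum>j\<in>I. c j *\<^sub>R u j) \<bullet> edge_dir v i = (\<Sum>j\<in>I. if j = i then c j else 0)"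
    unfolding inner_sum_left
    by (intro sum.cong refl) (use I inner_edge_dir[OF v i] in auto)
  also have "\<dots> = (if i \<in> I then c i else 0)"
    using finite_subset[OF I finite_tight] by simp
  finally show ?thesis .
qed

lemma generated_latticeI: "x = (\<Sum>i\<in>I. of_int (c i) *\<^sub>R u i) \<Longrightarrow> x \<in> generated_lattice u I"
  unfolding generated_lattice_def by blast

lemma generated_in_span: "generated_lattice u I \<subseteq> span (u ` I)"
proof
  fix x assume "x \<in> generated_lattice u I"
  then obtain c where c: "x = (\<Sum>i\<in>I. of_int (c i) *\<^sub>R u i)" unfolding generated_lattice_def by blast
  show "x \<in> span (u ` I)" unfolding c by (intro span_sum span_scale span_base imageI)
qed

text \<open>The coordinates with respect to the normals in \<open>I\<close> are read off by pairing with the edge directions.\<close>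
lemma generated_iff:
  assumes v: "v \<in> vertices" and I: "I \<subseteq> tight v"
  shows "x \<in> generated_lattice u I \<longleftrightarrow> x \<in> span (u ` I) \<and> (\<forall>i\<in>I. x \<bullet> edge_dir v i \<in> \<int>)"
proof
  assume x: "x \<in> generated_lattice u I"
  then obtain c where c: "x = (\<Sum>i\<in>I. of_int (c i) *\<^sub>R u i)" unfolding generated_lattice_def by blast
  have "x \<bullet> edge_dir v i \<in> \<int>" if "i \<in> I" for i
    using coeff_of_sum[OF v I, of i "\<lambda>i. of_int (c i)"] that I unfolding c by auto
  then show "x \<in> span (u ` I) \<and> (\<forall>i\<in>I. x \<bullet> edge_dir v i \<in> \<int>)"
    using x generated_in_span by blast
next
  assume x: "x \<in> span (u ` I) \<and> (\<forall>i\<in>I. x \<bullet> edge_dir v i \<in> \<int>)"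
  have "x = (\<Sum>i\<in>I. (x \<bullet> edge_dir v i) *\<^sub>R u i)" using expand_in_span[OF v I] x by blast
  also have "\<dots> = (\<Sum>i\<in>I. of_int \<lfloor>x \<bullet> edge_dir v i\<rfloor> *\<^sub>R u i)"
    using x by (intro sum.cong refl) auto
  finally show "x \<in> generated_lattice u I" by (rule generated_latticeI)
qed

lemma generated_diff: "x \<in> generated_lattice u I \<Longrightarrow> y \<in> generated_lattice u I \<Longrightarrow> x - y \<in> generated_lattice u I"
proof -
  assume "x \<in> generated_lattice u I" "y \<in> generated_lattice u I"
  then obtain a b where "x = (\<Sum>i\<in>I. of_int (a i) *\<^sub>R u i)" "y = (\<Sum>i\<in>I. of_int (b i) *\<^sub>R u i)"
    unfolding generated_lattice_def by blast
  then have "x - y = (\<Sum>i\<in>I. of_int (a i - b i) *\<^sub>R u i)"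
    by (simp add: sum_subtractf scaleR_left_diff_distrib)
  then show ?thesis by (rule generated_latticeI)
qed

lemma generated_zero: "0 \<in> generated_lattice u I"
  by (rule generated_latticeI[where c = "\<lambda>_. 0"]) simp

lemma generated_mono:
  assumes "I \<subseteq> J" "finite J"
  shows "generated_lattice u I \<subseteq> generated_lattice u J"
proof
  fix x assume "x \<in> generated_lattice u I"
  then obtain a where a: "x = (\<Sum>i\<in>I. of_int (a i) *\<^sub>R u i)" unfolding generated_lattice_def by blast
  have "x = (\<Sum>i\<in>J. of_int (if i \<in> I then a i else 0) *\<^sub>R u i)"
    unfolding a using assms by (intro sum.mono_neutral_cong_left) auto
  then show "x \<in> generated_lattice u J" by (rule generated_latticeI)
qed

lemma saturated_mono: "I \<subseteq> J \<Longrightarrow> saturated_lattice u I \<subseteq> saturated_lattice u J"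
  unfolding saturated_lattice_def by (intro Int_mono span_mono image_mono order_refl)

lemma coset_image_iff:
  assumes "g \<in> saturated_lattice u I"
  shows "x \<in> coset_rel u I `` {g} \<longleftrightarrow> x \<in> saturated_lattice u I \<and> x - g \<in> generated_lattice u I"
  using assms generated_diff[OF generated_zero, of "g - x" I] generated_diff[OF generated_zero, of "x - g" I]
  by (auto simp: coset_rel_def)

lemma coset_eq:
  assumes "g \<in> saturated_lattice u I" "h \<in> saturated_lattice u I" "g - h \<in> generated_lattice u I"
  shows "coset_rel u I `` {g} = coset_rel u I `` {h}"
proof -
  have "x - g \<in> generated_lattice u I \<longleftrightarrow> x - h \<in> generated_lattice u I" for x
  proof
    assume "x - g \<in> generated_lattice u I"
    from generated_diff[OF this generated_diff[OF generated_zero assms(3)]]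
    show "x - h \<in> generated_lattice u I" by (simp add: algebra_simps)
  next
    assume "x - h \<in> generated_lattice u I"
    from generated_diff[OF this assms(3)]
    show "x - g \<in> generated_lattice u I" by (simp add: algebra_simps)
  qed
  then show ?thesis using coset_image_iff[OF assms(1)] coset_image_iff[OF assms(2)] by blast
qed

lemma group_map_coset:
  assumes "I \<subseteq> J" "finite J" "g \<in> saturated_lattice u I"
  shows "group_map u J (coset_rel u I `` {g}) = coset_rel u J `` {g}"
proof
  have gJ: "g \<in> saturated_lattice u J" using assms saturated_mono by blast
  have gI: "g \<in> coset_rel u I `` {g}"
    unfolding coset_image_iff[OF assms(3)] using assms(3) generated_zero by simp
  then show "coset_rel u J `` {g} \<subseteq> group_map u J (coset_rel u I `` {g})"
    unfolding group_map_def by blast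
  show "group_map u J (coset_rel u I `` {g}) \<subseteq> coset_rel u J `` {g}"
  proof
    fix x assume "x \<in> group_map u J (coset_rel u I `` {g})"
    then obtain y where y: "y \<in> coset_rel u I `` {g}" "x \<in> coset_rel u J `` {y}"
      unfolding group_map_def by blast
    have y': "y \<in> saturated_lattice u I" "y - g \<in> generated_lattice u J"
      using y(1) generated_mono[OF assms(1,2)] unfolding coset_image_iff[OF assms(3)] by blast+
    then have "coset_rel u J `` {y} = coset_rel u J `` {g}"
      using gJ saturated_mono[OF assms(1)] by (intro coset_eq) auto
    then show "x \<in> coset_rel u J `` {g}" using y(2) by simp
  qed
qed

end

context integral_presented_polytope
begin

text \<open>The choice made in \<open>lambda_face\<close>; \<open>coeff_independent_of_vertex\<close> shows that it does not matter.\<close>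
definition some_vertex :: "(real ^ 'n) set \<Rightarrow> real ^ 'n" where
  "some_vertex F = (SOME v. v extreme_point_of \<Delta> \<and> v \<in> F)"

lemma some_vertex:
  assumes "F \<in> faces \<Delta>"
  shows "some_vertex F \<in> vertices" "some_vertex F \<in> F" "ix F \<subseteq> tight (some_vertex F)"
proof -
  obtain v where "v \<in> vertices" "v \<in> F" using extreme_point_exists_minimizing[OF assms] by blast
  then have "\<exists>v. v extreme_point_of \<Delta> \<and> v \<in> F" by (auto simp: vertices_def)
  from someI_ex[OF this] show *: "some_vertex F \<in> vertices" "some_vertex F \<in> F"
    by (auto simp: some_vertex_def vertices_def)
  show "ix F \<subseteq> tight (some_vertex F)" by (rule ix_subset_tight[OF assms *(2)])
qed

text \<open>
  Every coset in \<open>\<Gamma>\<^sub>F\<close> has one representative with coordinates in \<open>[0, 1)\<close>. It comes from a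
  larger face exactly if one of the coordinates is \<open>0\<close>, so the open box represents \<open>\<Gamma>\<^sub>F\<^sup>\<flat>\<close>.\<close>
definition flat_points :: "(real ^ 'n) set \<Rightarrow> (real ^ 'n) set" where
  "flat_points F = {g \<in> saturated_lattice u (ix F).
     \<forall>j\<in>ix F. 0 < g \<bullet> edge_dir (some_vertex F) j \<and> g \<bullet> edge_dir (some_vertex F) j < 1}"

definition face_char :: "(real ^ 'n) set \<Rightarrow> real ^ 'n \<Rightarrow> nat \<Rightarrow> complex" where
  "face_char F g j = (if j \<in> ix F then chi (some_vertex F) g j else 1)"

lemma lambda_face_coset:
  assumes F: "F \<in> faces \<Delta>" and g: "g \<in> saturated_lattice u (ix F)"
  shows "lambda_face \<Delta> d u \<mu> F (coset_rel u (ix F) `` {g}) = face_char F g"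
proof
  fix j
  let ?v = "some_vertex F"
  note v = some_vertex[OF F]
  show "lambda_face \<Delta> d u \<mu> F (coset_rel u (ix F) `` {g}) j = face_char F g j"
  proof (cases "j \<in> ix F")
    case True
    have gv: "g \<in> saturated_lattice u (tight ?v)" using g saturated_mono[OF v(3)] by blast
    define g' where "g' = (SOME g'. g' \<in> coset_rel u (tight ?v) `` {g})"
    have "g \<in> coset_rel u (tight ?v) `` {g}"
      unfolding coset_image_iff[OF gv] using gv generated_zero by simp
    then have "g' \<in> coset_rel u (tight ?v) `` {g}" unfolding g'_def by (rule someI)
    then have "g' - g \<in> generated_lattice u (tight ?v)" unfolding coset_image_iff[OF gv] by blast
    then have "(g' - g) \<bullet> edge_dir ?v j \<in> \<int>"
      using generated_iff[OF v(1) order_refl] True v(3) by blast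
    then have "exp (2 * complex_of_real pi * \<i> * complex_of_real (g' \<bullet> edge_dir ?v j - g \<bullet> edge_dir ?v j)) = 1"
      by (intro exp_2pi_int) (simp add: inner_diff_left)
    then have "exp (2 * complex_of_real pi * \<i> * complex_of_real (g' \<bullet> edge_dir ?v j))
      = exp (2 * complex_of_real pi * \<i> * complex_of_real (g \<bullet> edge_dir ?v j))"
      by (simp add: right_diff_distrib exp_diff)
    then have "lambda_vertex u (tight ?v) (coset_rel u (tight ?v) `` {g}) j = chi ?v g j"
      unfolding lambda_vertex_def g'_def[symmetric] chi_def edge_dir_def[symmetric] .
    then show ?thesis
      using True unfolding lambda_face_def some_vertex_def[symmetric] Let_def
        group_map_coset[OF v(3) finite_tight g] face_char_def by simp
  next
    case False
    then show ?thesis by (simp add: lambda_face_def face_char_def)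
  qed
qed

lemma saturated_diff_generated:
  assumes "I \<subseteq> {1..d}" "g \<in> saturated_lattice u I"
  shows "g - (\<Sum>i\<in>I. of_int (c i) *\<^sub>R u i) \<in> saturated_lattice u I"
proof -
  have "(\<Sum>i\<in>I. of_int (c i) *\<^sub>R u i) \<in> span (u ` I)"
    by (intro span_sum span_scale span_base) auto
  moreover have "(\<Sum>i\<in>I. of_int (c i) *\<^sub>R u i) \<in> int_lattice"
  proof -
    have "u i $ k \<in> \<int>" if "i \<in> I" for i k using normal_lattice[of i] assms(1) that by (auto simp: int_lattice_def)
    then show ?thesis by (auto simp: int_lattice_def intro!: Ints_sum Ints_mult)
  qed
  ultimately show ?thesis
    using assms(2) unfolding saturated_lattice_def by (auto intro: span_diff int_lattice_diff)
qed

lemma bij_flat_points: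
  assumes F: "F \<in> faces \<Delta>"
  shows "bij_betw (\<lambda>g. coset_rel u (ix F) `` {g}) (flat_points F) (Gamma_flat \<Delta> d u \<mu> F)"
proof -
  let ?v = "some_vertex F"
  let ?I = "ix F"
  let ?c = "\<lambda>g i. g \<bullet> edge_dir ?v i"
  note v = some_vertex[OF F]
  have inj: "inj_on (\<lambda>g. coset_rel u ?I `` {g}) (flat_points F)"
  proof (rule inj_onI)
    fix g h assume g: "g \<in> flat_points F" and h: "h \<in> flat_points F" and eq: "coset_rel u ?I `` {g} = coset_rel u ?I `` {h}"
    have gs: "g \<in> saturated_lattice u ?I" "h \<in> saturated_lattice u ?I" using g h by (auto simp: flat_points_def)
    have "g \<in> coset_rel u ?I `` {g}" unfolding coset_image_iff[OF gs(1)] using gs generated_zero by simp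
    then have "g - h \<in> generated_lattice u ?I" unfolding eq coset_image_iff[OF gs(2)] by blast
    then have d: "g - h \<in> span (u ` ?I)" "\<forall>i\<in>?I. ?c (g - h) i \<in> \<int>" using generated_iff[OF v(1,3)] by blast+
    have "?c (g - h) i = 0" if i: "i \<in> ?I" for i
    proof -
      have "0 < ?c g i" "?c g i < 1" "0 < ?c h i" "?c h i < 1" using g h i unfolding flat_points_def by blast+
      then have "\<bar>?c (g - h) i\<bar> < 1" unfolding inner_diff_left by linarith
      then show ?thesis using d(2) i Ints_nonzero_abs_less1 by blast
    qed
    then have "g - h = 0" using expand_in_span[OF v(1,3) d(1)] by simp
    then show "g = h" by simp
  qed
  have into: "coset_rel u ?I `` {g} \<in> Gamma_flat \<Delta> d u \<mu> F" if g: "g \<in> flat_points F" for g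
  proof -
    have gs: "g \<in> saturated_lattice u ?I" using g by (simp add: flat_points_def)
    have "coset_rel u ?I `` {g} \<notin> group_map u ?I ` Gamma_group u (ix E)" if E: "E \<in> faces \<Delta>" "F \<subset> E" for E
    proof
      assume "coset_rel u ?I `` {g} \<in> group_map u ?I ` Gamma_group u (ix E)"
      then obtain x where x: "x \<in> saturated_lattice u (ix E)" "coset_rel u ?I `` {g} = group_map u ?I (coset_rel u (ix E) `` {x})"
        unfolding Gamma_group_def quotient_def by blast
      have sub: "ix E \<subseteq> ?I" using E(2) ix_mono by blast
      have "ix E \<noteq> ?I" using face_eq_cut[OF E(1)] face_eq_cut[OF F] E(2) by auto
      then obtain i where i: "i \<in> ?I" "i \<notin> ix E" using sub by blast
      have xs: "x \<in> saturated_lattice u ?I" using x(1) saturated_mono[OF sub] by blast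
      have eq: "coset_rel u ?I `` {g} = coset_rel u ?I `` {x}"
        using x(2) group_map_coset[OF sub finite_ix x(1)] by simp
      have "g \<in> coset_rel u ?I `` {g}" unfolding coset_image_iff[OF gs] using gs generated_zero by simp
      then have "g - x \<in> generated_lattice u ?I" unfolding eq coset_image_iff[OF xs] by blast
      then have "?c (g - x) i \<in> \<int>" using generated_iff[OF v(1,3)] i by blast
      moreover have "?c x i = 0"
        using x(1) sub v(3) i by (intro span_coeff_zero[OF v(1), of "ix E"]) (auto simp: saturated_lattice_def)
      ultimately have "?c g i \<in> \<int>" by (simp add: inner_diff_left)
      moreover have "0 < ?c g i" "?c g i < 1" using g i unfolding flat_points_def by blast+
      ultimately show False using Ints_nonzero_abs_less1 by fastforce
    qed
    moreover have "coset_rel u ?I `` {g} \<in> Gamma_group u ?I" unfolding Gamma_group_def by (rule quotientI[OF gs])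
    ultimately show ?thesis unfolding Gamma_flat_def by blast
  qed
  have onto: "\<exists>g\<in>flat_points F. \<gamma> = coset_rel u ?I `` {g}" if \<gamma>: "\<gamma> \<in> Gamma_flat \<Delta> d u \<mu> F" for \<gamma>
  proof -
    have "\<gamma> \<in> Gamma_group u ?I" using \<gamma> by (simp add: Gamma_flat_def)
    then obtain x where x: "x \<in> saturated_lattice u ?I" "\<gamma> = coset_rel u ?I `` {x}"
      unfolding Gamma_group_def quotient_def by blast
    define g where "g = x - (\<Sum>i\<in>?I. of_int \<lfloor>?c x i\<rfloor> *\<^sub>R u i)"
    have gs: "g \<in> saturated_lattice u ?I" unfolding g_def by (rule saturated_diff_generated[OF ix_le x(1)])
    have cg: "?c g i = ?c x i - of_int \<lfloor>?c x i\<rfloor>" if "i \<in> ?I" for i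
      using coeff_of_sum[OF v(1,3), of i "\<lambda>i. of_int \<lfloor>?c x i\<rfloor>"] that v(3) by (auto simp: g_def inner_diff_left)
    have "x - g = (\<Sum>i\<in>?I. of_int \<lfloor>?c x i\<rfloor> *\<^sub>R u i)" unfolding g_def by simp
    then have "x - g \<in> generated_lattice u ?I" by (rule generated_latticeI)
    then have \<gamma>g: "\<gamma> = coset_rel u ?I `` {g}" unfolding x(2) by (rule coset_eq[OF x(1) gs])
    have "?c g i \<noteq> 0" if i: "i \<in> ?I" for i
    proof
      assume z: "?c g i = 0"
      \<comment> \<open>The normals with index in \<open>S\<close> belong to a larger face, whose group already contains the coset.\<close>
      define S where "S = ?I - {i}"
      have St: "S \<subseteq> tight ?v" using v(3) by (auto simp: S_def)
      let ?E = "face_cut S"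
      have E: "ix ?E = S" "?E \<in> faces \<Delta>" using ix_face_cut[OF v(1) St] by auto
      have "F \<subseteq> ?E" using face_eq_cut[OF F] by (auto simp: face_cut_def S_def)
      moreover have "F \<noteq> ?E" using E(1) i by (auto simp: S_def)
      ultimately have FE: "F \<subset> ?E" by blast
      have "g = (\<Sum>j\<in>?I. ?c g j *\<^sub>R u j)" using gs by (intro expand_in_span[OF v(1,3)]) (simp add: saturated_lattice_def)
      also have "\<dots> = (\<Sum>j\<in>S. ?c g j *\<^sub>R u j)"
        using z by (intro sum.mono_neutral_right) (auto simp: S_def)
      finally have ge: "g = (\<Sum>j\<in>S. ?c g j *\<^sub>R u j)" .
      have "(\<Sum>j\<in>S. ?c g j *\<^sub>R u j) \<in> span (u ` S)"
        by (intro span_sum span_scale span_base) auto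
      then have "g \<in> span (u ` S)" using ge by simp
      then have gS: "g \<in> saturated_lattice u (ix ?E)" using gs E(1) by (simp add: saturated_lattice_def)
      have sub: "ix ?E \<subseteq> ?I" using E(1) by (simp add: S_def)
      have \<gamma>E: "\<gamma> = group_map u ?I (coset_rel u (ix ?E) `` {g})"
        unfolding \<gamma>g by (rule group_map_coset[symmetric, OF sub finite_ix gS])
      have "coset_rel u (ix ?E) `` {g} \<in> Gamma_group u (ix ?E)"
        unfolding Gamma_group_def by (rule quotientI[OF gS])
      then have "\<gamma> \<in> group_map u ?I ` Gamma_group u (ix ?E)" unfolding \<gamma>E by (rule imageI)
      moreover have "?E \<in> {E \<in> faces \<Delta>. F \<subset> E}" using E(2) FE by simp
      ultimately have "\<gamma> \<in> (\<Union>E \<in> {E \<in> faces \<Delta>. F \<subset> E}. group_map u ?I ` Gamma_group u (ix E))"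
        by (rule UN_I[rotated])
      then show False using \<gamma> unfolding Gamma_flat_def by simp
    qed
    moreover have "0 \<le> ?c g i" "?c g i < 1" if "i \<in> ?I" for i
      unfolding cg[OF that] by linarith+
    ultimately have "0 < ?c g i \<and> ?c g i < 1" if "i \<in> ?I" for i
      using that by (simp add: less_le)
    then have "g \<in> flat_points F" using gs unfolding flat_points_def by simp
    then show ?thesis using \<gamma>g by (rule bexI[rotated])
  qed
  have "(\<lambda>g. coset_rel u ?I `` {g}) ` flat_points F = Gamma_flat \<Delta> d u \<mu> F"
  proof (intro equalityI subsetI)
    fix \<gamma> assume "\<gamma> \<in> Gamma_flat \<Delta> d u \<mu> F"
    from onto[OF this] show "\<gamma> \<in> (\<lambda>g. coset_rel u ?I `` {g}) ` flat_points F" by (auto intro: imageI)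
  next
    fix \<gamma> assume "\<gamma> \<in> (\<lambda>g. coset_rel u ?I `` {g}) ` flat_points F"
    then show "\<gamma> \<in> Gamma_flat \<Delta> d u \<mu> F" by (rule imageE) (simp only: into)
  qed
  with inj show ?thesis by (rule bij_betw_imageI)
qed

lemma coeff_independent_of_vertex:
  assumes F: "F \<in> faces \<Delta>" and v: "v \<in> vertices" "v \<in> F" and g: "g \<in> span (u ` ix F)" and i: "i \<in> ix F"
  shows "g \<bullet> edge_dir v i = g \<bullet> edge_dir (some_vertex F) i"
proof -
  have I: "ix F \<subseteq> tight v" by (rule ix_subset_tight[OF F v(2)])
  have "g = (\<Sum>j\<in>ix F. (g \<bullet> edge_dir (some_vertex F) j) *\<^sub>R u j)"
    by (rule expand_in_span[OF some_vertex(1,3)[OF F] g])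
  then have "g \<bullet> edge_dir v i = (\<Sum>j\<in>ix F. (g \<bullet> edge_dir (some_vertex F) j) *\<^sub>R u j) \<bullet> edge_dir v i" by simp
  also have "\<dots> = g \<bullet> edge_dir (some_vertex F) i"
    using coeff_of_sum[OF v(1) I, of i "\<lambda>j. g \<bullet> edge_dir (some_vertex F) j"] i I by auto
  finally show ?thesis .
qed

text \<open>In the coordinates at a vertex \<open>v\<close> of \<open>F\<close>, the face is the support of the representative.\<close>
lemma flat_points_at_vertex:
  assumes F: "F \<in> faces \<Delta>" and v: "v \<in> vertices" "v \<in> F"
  shows "flat_points F = {g \<in> cell v. {j\<in>tight v. g \<bullet> edge_dir v j \<noteq> 0} = ix F}"
proof
  have I: "ix F \<subseteq> tight v" by (rule ix_subset_tight[OF F v(2)])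
  show "flat_points F \<subseteq> {g \<in> cell v. {j\<in>tight v. g \<bullet> edge_dir v j \<noteq> 0} = ix F}"
  proof
    fix g assume g: "g \<in> flat_points F"
    then have gs: "g \<in> span (u ` ix F)" "g \<in> int_lattice" by (auto simp: flat_points_def saturated_lattice_def)
    have pos: "0 < g \<bullet> edge_dir v j" "g \<bullet> edge_dir v j < 1" if "j \<in> ix F" for j
      using g that coeff_independent_of_vertex[OF F v gs(1) that] by (auto simp: flat_points_def)
    have zero: "g \<bullet> edge_dir v j = 0" if "j \<in> tight v - ix F" for j
      by (rule span_coeff_zero[OF v(1) I gs(1) that])
    have "g \<in> cell v"
      unfolding cell_def
    proof (intro CollectI conjI ballI gs(2))
      fix j assume "j \<in> tight v"
      then show "0 \<le> g \<bullet> edge_dir v j" "g \<bullet> edge_dir v j < 1"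
        using pos[of j] zero[of j] by (cases "j \<in> ix F"; force)+
    qed
    moreover have "{j\<in>tight v. g \<bullet> edge_dir v j \<noteq> 0} = ix F" using pos zero I by force
    ultimately show "g \<in> {g \<in> cell v. {j\<in>tight v. g \<bullet> edge_dir v j \<noteq> 0} = ix F}" by blast
  qed
  show "{g \<in> cell v. {j\<in>tight v. g \<bullet> edge_dir v j \<noteq> 0} = ix F} \<subseteq> flat_points F"
  proof
    fix g assume "g \<in> {g \<in> cell v. {j\<in>tight v. g \<bullet> edge_dir v j \<noteq> 0} = ix F}"
    then have g: "g \<in> cell v" "{j\<in>tight v. g \<bullet> edge_dir v j \<noteq> 0} = ix F" by auto
    have "g = (\<Sum>j\<in>tight v. (g \<bullet> edge_dir v j) *\<^sub>R u j)" by (rule expand_dual[OF v(1)])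
    also have "\<dots> = (\<Sum>j\<in>ix F. (g \<bullet> edge_dir v j) *\<^sub>R u j)"
      using g(2) by (intro sum.mono_neutral_right) auto
    finally have ge: "g = (\<Sum>j\<in>ix F. (g \<bullet> edge_dir v j) *\<^sub>R u j)" .
    have "(\<Sum>j\<in>ix F. (g \<bullet> edge_dir v j) *\<^sub>R u j) \<in> span (u ` ix F)"
      by (intro span_sum span_scale span_base) auto
    then have gs: "g \<in> span (u ` ix F)" using ge by simp
    have "0 < g \<bullet> edge_dir (some_vertex F) j \<and> g \<bullet> edge_dir (some_vertex F) j < 1" if j: "j \<in> ix F" for j
    proof -
      have jt: "j \<in> tight v" "g \<bullet> edge_dir v j \<noteq> 0" using g(2) j by blast+
      then have "0 \<le> g \<bullet> edge_dir v j" "g \<bullet> edge_dir v j < 1" using g(1) unfolding cell_def by blast+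
      then show ?thesis using jt(2) coeff_independent_of_vertex[OF F v gs j] by simp
    qed
    then show "g \<in> flat_points F"
      using gs g(1) unfolding flat_points_def saturated_lattice_def cell_def by blast
  qed
qed

lemma face_char_at_vertex:
  assumes F: "F \<in> faces \<Delta>" and v: "v \<in> vertices" "v \<in> F" and g: "g \<in> flat_points F" and j: "j \<in> tight v"
  shows "face_char F g j = chi v g j"
proof (cases "j \<in> ix F")
  case True
  have "g \<in> span (u ` ix F)" using g by (simp add: flat_points_def saturated_lattice_def)
  from coeff_independent_of_vertex[OF F v this True] show ?thesis using True by (simp add: face_char_def chi_def)
next
  case False
  then have "g \<bullet> edge_dir v j = 0" using g j unfolding flat_points_at_vertex[OF F v] by blast
  then show ?thesis using False by (simp add: face_char_def chi_def)
qed

lemma face_char_nontrivial: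
  assumes g: "g \<in> flat_points F" and j: "j \<in> ix F"
  shows "face_char F g j \<noteq> 1"
proof
  assume "face_char F g j = 1"
  then have "g \<bullet> edge_dir (some_vertex F) j \<in> \<int>" using j by (simp add: face_char_def chi_def exp_2pi_eq_1_iff)
  moreover have "0 < g \<bullet> edge_dir (some_vertex F) j" "g \<bullet> edge_dir (some_vertex F) j < 1"
    using g j unfolding flat_points_def by blast+
  ultimately show False using Ints_nonzero_abs_less1 by fastforce
qed

text \<open>Every element of the cell lies in the part of exactly one face through \<open>v\<close>, the one cut out by its support.\<close>
lemma sum_cell_by_faces:
  assumes v: "v \<in> vertices"
  shows "(\<Sum>F | F \<in> faces \<Delta> \<and> v \<in> F. \<Sum>g\<in>flat_points F. f g) = (\<Sum>g\<in>cell v. f g)"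
proof -
  let ?supp = "\<lambda>g. {j\<in>tight v. g \<bullet> edge_dir v j \<noteq> 0}"
  have "(\<Sum>F | F \<in> faces \<Delta> \<and> v \<in> F. \<Sum>g\<in>flat_points F. f g)
      = (\<Sum>F | F \<in> faces \<Delta> \<and> v \<in> F. \<Sum>g | g \<in> cell v \<and> face_cut (?supp g) = F. f g)"
  proof (intro sum.cong refl)
    fix F assume "F \<in> {F. F \<in> faces \<Delta> \<and> v \<in> F}"
    then have F: "F \<in> faces \<Delta>" "v \<in> F" by auto
    have "?supp g = ix F \<longleftrightarrow> face_cut (?supp g) = F" for g
    proof
      assume "?supp g = ix F"
      then show "face_cut (?supp g) = F" using face_eq_cut[OF F(1)] by simp
    next
      assume "face_cut (?supp g) = F"
      then show "?supp g = ix F" using ix_face_cut(1)[OF v Collect_restrict] by metis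
    qed
    then show "flat_points F = {g. g \<in> cell v \<and> face_cut (?supp g) = F}"
      unfolding flat_points_at_vertex[OF F(1) v F(2)] by simp
  qed
  also have "\<dots> = (\<Sum>g\<in>cell v. f g)"
  proof (rule sum.group[OF finite_cell[OF v]])
    show "finite {F \<in> faces \<Delta>. v \<in> F}" using finite_faces by simp
    show "(\<lambda>g. face_cut (?supp g)) ` cell v \<subseteq> {F \<in> faces \<Delta>. v \<in> F}"
    proof (rule image_subsetI)
      fix g
      have "?supp g \<subseteq> tight v" by (rule Collect_restrict)
      from ix_face_cut(2,3)[OF v this] show "face_cut (?supp g) \<in> {F \<in> faces \<Delta>. v \<in> F}" by simp
    qed
  qed
  finally show ?thesis .
qed

text \<open>The group \<open>\<Gamma>\<^sub>v\<close> is finite: two multiples of \<open>g\<close> have the same representative.\<close>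
lemma chi_root_of_unity:
  assumes v: "v \<in> vertices" and g: "g \<in> int_lattice" and j: "j \<in> tight v"
  shows "\<exists>N>0. chi v g j ^ N = 1"
proof -
  interpret T: integer_basis "transpose (normal_matrix v)" "transpose (edge_matrix v)"
    by (rule transpose_integer_basis[OF integer_basis_vertex[OF v]])
  have mg: "of_nat m *\<^sub>R g \<in> int_lattice" for m :: nat
    using g by (auto simp: int_lattice_def)
  define r where "r m = T.reduce (of_nat m *\<^sub>R g)" for m :: nat
  have "range r \<subseteq> cell_points (transpose (edge_matrix v))"
    unfolding r_def by (intro image_subsetI T.reduce_in mg)
  then have "finite (range r)" by (rule finite_subset[OF _ T.finite_cell_points])
  then have "\<not> inj r" using finite_imageD infinite_UNIV_nat by blast
  then have "\<exists>a b. a < b \<and> r a = r b" using linorder_injI[of r] by blast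
  then obtain a b where ab: "a < b" and rab: "r a = r b" by blast
  have ab: "a < b" "T.reduce (of_nat a *\<^sub>R g) = T.reduce (of_nat b *\<^sub>R g)"
    by (rule ab) (rule rab[unfolded r_def])
  let ?E = "transpose (edge_matrix v)"
  have "?E *v (T.reduce (of_nat b *\<^sub>R g) - of_nat a *\<^sub>R g) \<in> int_lattice"
    using T.reduce_congruent[of "of_nat a *\<^sub>R g"] unfolding ab(2) .
  then have "?E *v (T.reduce (of_nat b *\<^sub>R g) - of_nat a *\<^sub>R g) - ?E *v (T.reduce (of_nat b *\<^sub>R g) - of_nat b *\<^sub>R g) \<in> int_lattice"
    by (intro int_lattice_diff T.reduce_congruent)
  also have "?E *v (T.reduce (of_nat b *\<^sub>R g) - of_nat a *\<^sub>R g) - ?E *v (T.reduce (of_nat b *\<^sub>R g) - of_nat b *\<^sub>R g)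
     = ?E *v ((of_nat b - of_nat a) *\<^sub>R g)"
    unfolding matrix_vector_mult_diff_distrib[symmetric] by (simp add: scaleR_left_diff_distrib)
  finally have "?E *v ((of_nat b - of_nat a) *\<^sub>R g) \<in> int_lattice" .
  moreover obtain i where "j = enum v i" using enum_bij[OF v] j unfolding bij_betw_def by blast
  ultimately have "((of_nat b - of_nat a) *\<^sub>R g) \<bullet> edge_dir v j \<in> \<int>"
    unfolding int_lattice_def mem_Collect_eq transpose_edge_matrix_mult by blast
  then have int: "real (b - a) * (g \<bullet> edge_dir v j) \<in> \<int>" using ab(1) by (simp add: of_nat_diff)
  have "chi v g j ^ (b - a) = exp (of_nat (b - a) * (2 * complex_of_real pi * \<i> * complex_of_real (g \<bullet> edge_dir v j)))"
    unfolding chi_def by (rule exp_of_nat_mult[symmetric])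
  also have "of_nat (b - a) * (2 * complex_of_real pi * \<i> * complex_of_real (g \<bullet> edge_dir v j))
     = 2 * complex_of_real pi * \<i> * complex_of_real (real (b - a) * (g \<bullet> edge_dir v j))"
    by (simp only: of_real_mult of_real_of_nat_eq mult_ac)
  also have "exp \<dots> = 1" by (rule exp_2pi_int[OF int])
  finally show ?thesis using ab(1) by (intro exI[of _ "b - a"]) simp
qed

lemma face_char_root_of_unity:
  assumes "F \<in> faces \<Delta>" "g \<in> flat_points F"
  shows "\<exists>N>0. face_char F g j ^ N = 1"
proof (cases "j \<in> ix F")
  case True
  have "g \<in> int_lattice" using assms(2) by (simp add: flat_points_def saturated_lattice_def)
  then show ?thesis
    using chi_root_of_unity[OF some_vertex(1)[OF assms(1)], of g j] True some_vertex(3)[OF assms(1)]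
    by (auto simp: face_char_def)
next
  case False
  then show ?thesis by (auto simp: face_char_def)
qed

end

section \<open>The Euler-Maclaurin formula\<close>

context integral_presented_polytope
begin

definition face_op :: "nat \<Rightarrow> (real ^ 'n) set \<Rightarrow> real ^ 'n \<Rightarrow> ((nat \<Rightarrow> real) \<Rightarrow> complex) \<Rightarrow> (nat \<Rightarrow> real) \<Rightarrow> complex" where
  "face_op k F g = foldr (\<lambda>j. poly_diff_op (M_poly k (face_char F g j)) j) [1..<Suc d]"

lemma M_op_coset:
  assumes F: "F \<in> faces \<Delta>" and g: "g \<in> flat_points F"
  shows "M_op \<Delta> d u \<mu> k F (coset_rel u (ix F) `` {g}) = face_op k F g"
proof -
  have "g \<in> saturated_lattice u (ix F)" using g by (simp add: flat_points_def)
  from lambda_face_coset[OF F this] show ?thesis unfolding M_op_def face_op_def by simp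
qed

lemma shift_operator_face_op: "shift_operator \<epsilon> d (face_op k F g)"
  unfolding face_op_def by (rule shift_operator_foldr) auto

lemma face_op_exp_coeff:
  "face_op k F g (exp_coeff d a s N 1) (\<lambda>_. 0) =
     fps_nth ((\<Prod>j\<in>{1..d}. scaled_poly (M_poly k (face_char F g j)) (of_real (s j))) * fps_exp (of_real a)) N"
proof -
  have "prod_list (map (\<lambda>j. scaled_poly (M_poly k (face_char F g j)) (of_real (s j))) [1..<Suc d])
      = (\<Prod>j\<in>set [1..<Suc d]. scaled_poly (M_poly k (face_char F g j)) (of_real (s j)))"
    by (rule prod.distinct_set_conv_list[symmetric, OF distinct_upt])
  also have "set [1..<Suc d] = {1..d}" by auto
  finally have *: "prod_list (map (\<lambda>j. scaled_poly (M_poly k (face_char F g j)) (of_real (s j))) [1..<Suc d])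
      = (\<Prod>j\<in>{1..d}. scaled_poly (M_poly k (face_char F g j)) (of_real (s j)))" .
  have "face_op k F g (exp_coeff d a s N 1) (\<lambda>_. 0) = exp_coeff d a s N
      (prod_list (map (\<lambda>j. scaled_poly (M_poly k (face_char F g j)) (of_real (s j))) [1..<Suc d]) * 1) (\<lambda>_. 0)"
    unfolding face_op_def by (subst foldr_poly_diff_op_exp_coeff) (auto simp del: upt_Suc)
  then show ?thesis unfolding * exp_coeff_def by simp
qed

lemma scaled_M_poly_nth:
  assumes "\<exists>N>0. l ^ N = 1" "Suc m \<le> k" "s \<noteq> 0"
  shows "fps_nth (scaled_poly (M_poly k l) s) m = fps_nth (Todd_fps l s) m"
  unfolding nth_scaled_poly coeff_M_poly[OF assms(1,2)] Todd_fps_scale[OF assms(3)] ..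

text \<open>The facets that miss a vertex have rate \<open>0\<close> there, and only the constant term acts.\<close>
lemma scaled_M_poly_0:
  assumes "\<exists>N>0. l ^ N = 1" "0 < k"
  shows "scaled_poly (M_poly k l) 0 = (if l = 1 then 1 else 0)"
proof (rule fps_ext)
  fix m
  show "fps_nth (scaled_poly (M_poly k l) 0) m = fps_nth (if l = 1 then 1 else 0) m"
  proof (cases m)
    case 0
    then show ?thesis using assms coeff_M_poly[OF assms(1), of 0 k] by (simp add: nth_scaled_poly Todd_fps_nth_0)
  qed (simp add: nth_scaled_poly)
qed

text \<open>
  If \<open>v\<close> is not in \<open>F\<close>, some facet contains \<open>F\<close> but not \<open>v\<close>; its factor has a nontrivial root of unity
  and rate \<open>0\<close>, and it annihilates the term. If \<open>v\<close> is in \<open>F\<close>, the factors of the facets that miss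
  \<open>v\<close> are \<open>1\<close>, and the others agree with the full Taylor series up to the degree that matters.\<close>
lemma face_op_at_vertex:
  assumes F: "F \<in> faces \<Delta>" and g: "g \<in> flat_points F" and v: "v \<in> vertices" and \<xi>: "generic \<xi>" and k: "Suc N \<le> k"
  shows "face_op k F g (exp_coeff d (\<xi> \<bullet> v) (shift_rate \<xi> v) N 1) (\<lambda>_. 0) =
    (if v \<in> F then fps_nth ((\<Prod>j\<in>tight v. Todd_fps (chi v g j) (of_real (rate \<xi> v j))) * fps_exp (of_real (\<xi> \<bullet> v))) N else 0)"
proof (cases "v \<in> F")
  case False
  then obtain j where j: "j \<in> ix F" "j \<notin> tight v" using vertex_mem_face_iff[OF F v] by blast
  have k0: "0 < k" using k by simp
  have "scaled_poly (M_poly k (face_char F g j)) (of_real (shift_rate \<xi> v j)) = 0"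
    using scaled_M_poly_0[OF face_char_root_of_unity[OF F g, of j] k0] face_char_nontrivial[OF g j(1)] j(2) by (simp add: shift_rate_def)
  moreover have "j \<in> {1..d}" using j(1) ix_le by blast
  ultimately have zero: "(\<Prod>j\<in>{1..d}. scaled_poly (M_poly k (face_char F g j)) (of_real (shift_rate \<xi> v j))) = 0"
    by (intro prod_zero bexI[of _ j]) auto
  show ?thesis unfolding face_op_exp_coeff zero using False by simp
next
  case True
  define T where "T j = (if j \<in> tight v then Todd_fps (chi v g j) (of_real (rate \<xi> v j)) else 1)" for j
  have "fps_nth (scaled_poly (M_poly k (face_char F g j)) (of_real (shift_rate \<xi> v j))) m = fps_nth (T j) m" if m: "m \<le> N" for j m
  proof (cases "j \<in> tight v")
    case jt: True
    have "Suc m \<le> k" using m k by simp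
    moreover have "complex_of_real (rate \<xi> v j) \<noteq> 0" using rate_nonzero[OF \<xi> v jt] by simp
    ultimately show ?thesis
      using scaled_M_poly_nth[OF face_char_root_of_unity[OF F g, of j]] jt
      by (simp add: shift_rate_def T_def face_char_at_vertex[OF F v True g jt])
  next
    case False
    then have "j \<notin> ix F" using ix_subset_tight[OF F True] by blast
    then have "face_char F g j = 1" by (simp add: face_char_def)
    then show ?thesis
      using scaled_M_poly_0[OF face_char_root_of_unity[OF F g, of j], of k] k False by (simp add: shift_rate_def T_def)
  qed
  then have "fps_nth (\<Prod>j\<in>{1..d}. scaled_poly (M_poly k (face_char F g j)) (of_real (shift_rate \<xi> v j))) m
      = fps_nth (\<Prod>j\<in>{1..d}. T j) m" if "m \<le> N" for m
    by (intro fps_nth_prod_cong[of _ N] that)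
  then have "fps_nth ((\<Prod>j\<in>{1..d}. scaled_poly (M_poly k (face_char F g j)) (of_real (shift_rate \<xi> v j))) * fps_exp (of_real (\<xi> \<bullet> v))) N
      = fps_nth ((\<Prod>j\<in>{1..d}. T j) * fps_exp (of_real (\<xi> \<bullet> v))) N"
    by (intro fps_nth_mult_cong[of N] refl order_refl)
  also have "(\<Prod>j\<in>{1..d}. T j) = (\<Prod>j\<in>tight v. Todd_fps (chi v g j) (of_real (rate \<xi> v j)))"
    using tight_le[of v] by (intro prod.mono_neutral_cong_right) (auto simp: T_def)
  finally show ?thesis unfolding face_op_exp_coeff using True by simp
qed

text \<open>One radius for all integrands, so that the functions of the shift can be added.\<close>
definition shift_radius :: real where
  "shift_radius = (SOME \<epsilon>. \<epsilon> > 0 \<and> (\<forall>h\<in>near_zero \<epsilon> d. small_shift h \<and> compact (shifted_polytope d u \<mu> h)))"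

lemma shift_radius:
  "shift_radius > 0"
  "h \<in> near_zero shift_radius d \<Longrightarrow> small_shift h"
  "h \<in> near_zero shift_radius d \<Longrightarrow> compact (shifted_polytope d u \<mu> h)"
proof -
  have "\<exists>\<epsilon>. \<epsilon> > 0 \<and> (\<forall>h\<in>near_zero \<epsilon> d. small_shift h \<and> compact (shifted_polytope d u \<mu> h))"
    using compact_shifted_polytope by blast
  from someI_ex[OF this] show "shift_radius > 0"
    "h \<in> near_zero shift_radius d \<Longrightarrow> small_shift h"
    "h \<in> near_zero shift_radius d \<Longrightarrow> compact (shifted_polytope d u \<mu> h)"
    unfolding shift_radius_def by blast+
qed

lemma zero_near_zero: "(\<lambda>_. 0) \<in> near_zero shift_radius d"
  using shift_radius(1) by (simp add: near_zero_def)

definition volume_fun :: "(real ^ 'n \<Rightarrow> complex) \<Rightarrow> (nat \<Rightarrow> real) \<Rightarrow> complex" where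
  "volume_fun q h = integral (shifted_polytope d u \<mu> h) q"

definition face_sum :: "nat \<Rightarrow> (real ^ 'n \<Rightarrow> complex) \<Rightarrow> complex" where
  "face_sum k q = (\<Sum>F\<in>faces \<Delta>. \<Sum>g\<in>flat_points F. face_op k F g (volume_fun q) (\<lambda>_. 0))"

text \<open>
  The functions for which the formula holds. The condition on \<open>volume_fun\<close> makes this a linear
  space, since the operators are linear only on such functions of the shift.\<close>
definition EM_functions :: "nat \<Rightarrow> (real ^ 'n \<Rightarrow> complex) set" where
  "EM_functions k = {q. continuous_on UNIV q \<and> shift_polynomial shift_radius d (volume_fun q) \<and> weighted_sum \<Delta> q = face_sum k q}"

lemma volume_fun_power_linear:
  assumes \<xi>: "generic \<xi>" and h: "h \<in> near_zero shift_radius d"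
  shows "volume_fun (\<lambda>x. complex_of_real (\<xi> \<bullet> x) ^ m) h
    = (\<Sum>v\<in>vertices. (fact m * of_real (vertex_coeff \<xi> v)) * exp_coeff d (\<xi> \<bullet> v) (shift_rate \<xi> v) (m + CARD('n)) 1 h)"
  unfolding volume_fun_def by (rule integral_power_linear_exp_coeff[OF \<xi> shift_radius(2,3)[OF h]])

text \<open>
  Both sides are sums over vertices. Exchanging the sum over vertices with the sum over faces, the
  faces through a vertex contribute the characters of its group, each once.\<close>
lemma power_linear_EM:
  assumes \<xi>: "generic \<xi>" and k: "m + CARD('n) + 1 \<le> k"
  shows "(\<lambda>x. complex_of_real (\<xi> \<bullet> x) ^ m) \<in> EM_functions k"
proof -
  let ?q = "\<lambda>x. complex_of_real (\<xi> \<bullet> x) ^ m"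
  let ?N = "m + CARD('n)"
  let ?E = "\<lambda>v. exp_coeff d (\<xi> \<bullet> v) (shift_rate \<xi> v) ?N 1"
  let ?a = "\<lambda>v. fact m * complex_of_real (vertex_coeff \<xi> v)"
  define T where "T v g = fps_nth ((\<Prod>j\<in>tight v. Todd_fps (chi v g j) (of_real (rate \<xi> v j))) * fps_exp (of_real (\<xi> \<bullet> v))) ?N" for v g
  have N: "Suc ?N \<le> k" using k by simp
  have "shift_polynomial shift_radius d (\<lambda>h. \<Sum>v\<in>vertices. ?a v * ?E v h)"
    by (intro shift_polynomial_sum finite_vertices shift_polynomial.base)
  then have shift_polynomial: "shift_polynomial shift_radius d (volume_fun ?q)"
    by (rule shift_polynomial.cong) (rule volume_fun_power_linear[OF \<xi>, symmetric])
  have op: "face_op k F g (volume_fun ?q) (\<lambda>_. 0) = (\<Sum>v\<in>vertices. ?a v * (if v \<in> F then T v g else 0))"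
    if F: "F \<in> faces \<Delta>" and g: "g \<in> flat_points F" for F g
  proof -
    have "face_op k F g (volume_fun ?q) (\<lambda>_. 0) = face_op k F g (\<lambda>h. \<Sum>v\<in>vertices. ?a v * ?E v h) (\<lambda>_. 0)"
      by (rule shift_operator_cong[OF shift_operator_face_op volume_fun_power_linear[OF \<xi>] zero_near_zero])
    also have "\<dots> = (\<Sum>v\<in>vertices. ?a v * face_op k F g (?E v) (\<lambda>_. 0))"
      by (rule shift_operator_sum[OF shift_operator_face_op finite_vertices shift_polynomial.base zero_near_zero])
    also have "\<dots> = (\<Sum>v\<in>vertices. ?a v * (if v \<in> F then T v g else 0))"
    proof (intro sum.cong refl)
      fix v assume v: "v \<in> vertices"
      show "?a v * face_op k F g (?E v) (\<lambda>_. 0) = ?a v * (if v \<in> F then T v g else 0)"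
        unfolding face_op_at_vertex[OF F g v \<xi> N] T_def ..
    qed
    finally show ?thesis .
  qed
  have "face_sum k ?q = (\<Sum>F\<in>faces \<Delta>. \<Sum>g\<in>flat_points F. \<Sum>v\<in>vertices. ?a v * (if v \<in> F then T v g else 0))"
    unfolding face_sum_def by (intro sum.cong refl op)
  also have "\<dots> = (\<Sum>F\<in>faces \<Delta>. \<Sum>v\<in>vertices. \<Sum>g\<in>flat_points F. ?a v * (if v \<in> F then T v g else 0))"
    by (intro sum.cong refl sum.swap)
  also have "\<dots> = (\<Sum>v\<in>vertices. \<Sum>F\<in>faces \<Delta>. \<Sum>g\<in>flat_points F. ?a v * (if v \<in> F then T v g else 0))"
    by (rule sum.swap)
  also have "\<dots> = (\<Sum>v\<in>vertices. ?a v * (\<Sum>g\<in>cell v. T v g))"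
  proof (intro sum.cong refl)
    fix v assume v: "v \<in> vertices"
    have "(\<Sum>F\<in>faces \<Delta>. \<Sum>g\<in>flat_points F. ?a v * (if v \<in> F then T v g else 0))
      = (\<Sum>F | F \<in> faces \<Delta> \<and> v \<in> F. \<Sum>g\<in>flat_points F. ?a v * T v g)"
      by (rule sum.mono_neutral_cong_right) (auto simp: finite_faces)
    also have "\<dots> = (\<Sum>g\<in>cell v. ?a v * T v g)" by (rule sum_cell_by_faces[OF v])
    finally show "(\<Sum>F\<in>faces \<Delta>. \<Sum>g\<in>flat_points F. ?a v * (if v \<in> F then T v g else 0)) = ?a v * (\<Sum>g\<in>cell v. T v g)"
      by (simp only: sum_distrib_left)
  qed
  also have "\<dots> = fact m * (\<Sum>v\<in>vertices. of_real (vertex_coeff \<xi> v) * (\<Sum>g\<in>cell v. T v g))"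
    unfolding sum_distrib_left[of "fact m"] by (simp only: mult.assoc)
  also have "\<dots> = fact m * (\<Sum>x\<in>\<Delta> \<inter> int_lattice. complex_of_real (point_weight \<Delta> x) * (of_real (\<xi> \<bullet> x) ^ m / fact m))"
    unfolding lattice_sum_power_linear[OF \<xi>] T_def sum_distrib_right fps_sum_nth ..
  also have "\<dots> = weighted_sum \<Delta> ?q"
    unfolding weighted_sum_def sum_distrib_left by (intro sum.cong refl) simp
  finally have "weighted_sum \<Delta> ?q = face_sum k ?q" by (rule sym)
  moreover have "continuous_on UNIV ?q" by (intro continuous_intros)
  ultimately show ?thesis using shift_polynomial unfolding EM_functions_def by simp
qed

lemma volume_fun_lincomb:
  assumes q: "continuous_on UNIV q" and r: "continuous_on UNIV r" and h: "h \<in> near_zero shift_radius d"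
  shows "volume_fun (\<lambda>x. b * q x + c * r x) h = b * volume_fun q h + c * volume_fun r h"
proof -
  let ?K = "shifted_polytope d u \<mu> h"
  have int: "f integrable_on ?K" if "continuous_on UNIV f" for f :: "real ^ 'n \<Rightarrow> complex"
  proof -
    have "integrable lborel (\<lambda>x. indicator ?K x *\<^sub>R f x)"
      by (rule borel_integrable_compact[OF shift_radius(3)[OF h] continuous_on_subset[OF that subset_UNIV]])
    then show ?thesis by (intro set_borel_integral_eq_integral(1)) (simp add: set_integrable_def)
  qed
  have "integral ?K (\<lambda>x. b * q x + c * r x) = integral ?K (\<lambda>x. b * q x) + integral ?K (\<lambda>x. c * r x)"
    by (intro Henstock_Kurzweil_Integration.integral_add int continuous_intros q r)
  then show ?thesis by (simp add: volume_fun_def)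
qed

lemma lincomb_EM:
  assumes q: "q \<in> EM_functions k" and r: "r \<in> EM_functions k"
  shows "(\<lambda>x. b * q x + c * r x) \<in> EM_functions k"
proof -
  let ?f = "\<lambda>x. b * q x + c * r x"
  have qc: "continuous_on UNIV q" "shift_polynomial shift_radius d (volume_fun q)" "weighted_sum \<Delta> q = face_sum k q"
    and rc: "continuous_on UNIV r" "shift_polynomial shift_radius d (volume_fun r)" "weighted_sum \<Delta> r = face_sum k r"
    using q r by (simp_all add: EM_functions_def)
  note eq = volume_fun_lincomb[OF qc(1) rc(1)]
  have "shift_polynomial shift_radius d (\<lambda>h. b * volume_fun q h + c * volume_fun r h)" by (intro shift_polynomial.lincomb qc rc)
  then have shift_polynomial: "shift_polynomial shift_radius d (volume_fun ?f)" by (rule shift_polynomial.cong) (rule eq[symmetric])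
  have "face_op k F g (volume_fun ?f) (\<lambda>_. 0) = b * face_op k F g (volume_fun q) (\<lambda>_. 0) + c * face_op k F g (volume_fun r) (\<lambda>_. 0)" for F g
  proof -
    have "face_op k F g (volume_fun ?f) (\<lambda>_. 0) = face_op k F g (\<lambda>h. b * volume_fun q h + c * volume_fun r h) (\<lambda>_. 0)"
      by (rule shift_operator_cong[OF shift_operator_face_op eq zero_near_zero])
    also have "\<dots> = b * face_op k F g (volume_fun q) (\<lambda>_. 0) + c * face_op k F g (volume_fun r) (\<lambda>_. 0)"
      by (rule shift_operator_linear[OF shift_operator_face_op qc(2) rc(2) zero_near_zero])
    finally show ?thesis .
  qed
  then have "face_sum k ?f = b * face_sum k q + c * face_sum k r"
    by (simp add: face_sum_def sum.distrib sum_distrib_left)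
  moreover have "weighted_sum \<Delta> ?f = b * weighted_sum \<Delta> q + c * weighted_sum \<Delta> r"
    by (simp add: weighted_sum_def sum.distrib sum_distrib_left algebra_simps)
  ultimately have "weighted_sum \<Delta> ?f = face_sum k ?f" using qc(3) rc(3) by simp
  moreover have "continuous_on UNIV ?f" by (intro continuous_intros qc rc)
  ultimately show ?thesis using shift_polynomial by (simp add: EM_functions_def)
qed

end

text \<open>
  A polynomial curve that lies in a linear space at infinitely many parameters has its coefficients
  in that space. Dividing differences by \<open>s - s0\<close> gives a curve of lower degree with the same top
  coefficient.\<close>
lemma coefficients_in_linear_space:
  fixes V :: "('a \<Rightarrow> complex) set" and w :: "nat \<Rightarrow> 'a \<Rightarrow> complex" and S :: "complex set"
  assumes lin: "\<And>p q b c. p \<in> V \<Longrightarrow> q \<in> V \<Longrightarrow> (\<lambda>x. b * p x + c * q x) \<in> V"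
    and S: "infinite S" and P: "\<And>s. s \<in> S \<Longrightarrow> (\<lambda>x. \<Sum>j\<le>D. s ^ j * w j x) \<in> V"
    and i: "i \<le> D"
  shows "w i \<in> V"
  using S P i
proof (induction D arbitrary: w S i)
  case 0
  obtain s where "s \<in> S" using 0(1) by fastforce
  then show ?case using 0(2)[of s] 0(3) by simp
next
  case (Suc D)
  obtain s0 where s0: "s0 \<in> S" using Suc.prems(1) by fastforce
  define w' where "w' i x = (\<Sum>j\<le>Suc D. if i < j then s0 ^ (j - Suc i) * w j x else 0)" for i x
  have "(\<lambda>x. \<Sum>i\<le>D. s ^ i * w' i x) \<in> V" if s: "s \<in> S - {s0}" for s
  proof -
    have ne: "s - s0 \<noteq> 0" using s by auto
    have "(\<Sum>j\<le>Suc D. s ^ j * w j x) - (\<Sum>j\<le>Suc D. s0 ^ j * w j x) = (s - s0) * (\<Sum>i\<le>D. s ^ i * w' i x)" for x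
    proof -
      have "s ^ j - s0 ^ j = (s - s0) * (\<Sum>i\<le>D. if i < j then s ^ i * s0 ^ (j - Suc i) else 0)" if "j \<le> Suc D" for j
      proof -
        have "s ^ j - s0 ^ j = (s - s0) * (\<Sum>i<j. s0 ^ (j - Suc i) * s ^ i)" by (rule power_diff_sumr2)
        also have "(\<Sum>i<j. s0 ^ (j - Suc i) * s ^ i) = (\<Sum>i\<le>D. if i < j then s ^ i * s0 ^ (j - Suc i) else 0)"
          using that by (intro sum.mono_neutral_cong_left) auto
        finally show ?thesis .
      qed
      then have "(\<Sum>j\<le>Suc D. (s ^ j - s0 ^ j) * w j x)
          = (\<Sum>j\<le>Suc D. (s - s0) * (\<Sum>i\<le>D. if i < j then s ^ i * s0 ^ (j - Suc i) else 0) * w j x)"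
        by (intro sum.cong refl) simp
      also have "\<dots> = (s - s0) * (\<Sum>j\<le>Suc D. \<Sum>i\<le>D. s ^ i * (if i < j then s0 ^ (j - Suc i) * w j x else 0))"
        unfolding sum_distrib_left sum_distrib_right by (intro sum.cong refl) auto
      also have "(\<Sum>j\<le>Suc D. \<Sum>i\<le>D. s ^ i * (if i < j then s0 ^ (j - Suc i) * w j x else 0)) = (\<Sum>i\<le>D. s ^ i * w' i x)"
        unfolding w'_def sum_distrib_left by (rule sum.swap)
      finally show ?thesis by (simp only: left_diff_distrib sum_subtractf)
    qed
    then have "(\<lambda>x. \<Sum>i\<le>D. s ^ i * w' i x)
      = (\<lambda>x. 1 / (s - s0) * (\<Sum>j\<le>Suc D. s ^ j * w j x) + (- 1 / (s - s0)) * (\<Sum>j\<le>Suc D. s0 ^ j * w j x))"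
    proof (intro ext)
      fix x
      assume *: "\<And>x. (\<Sum>j\<le>Suc D. s ^ j * w j x) - (\<Sum>j\<le>Suc D. s0 ^ j * w j x) = (s - s0) * (\<Sum>i\<le>D. s ^ i * w' i x)"
      have "z = 1 / e * A + (- 1 / e) * B" if "A - B = e * z" "e \<noteq> 0" for A B e z :: complex
        using that by (simp add: field_simps)
      from this[OF * ne] show "(\<Sum>i\<le>D. s ^ i * w' i x) = 1 / (s - s0) * (\<Sum>j\<le>Suc D. s ^ j * w j x) + (- 1 / (s - s0)) * (\<Sum>j\<le>Suc D. s0 ^ j * w j x)" .
    qed
    also have "\<dots> \<in> V" by (rule lin) (use Suc.prems(2) s s0 in blast)+
    finally show ?thesis .
  qed
  moreover have "infinite (S - {s0})" using Suc.prems(1) by simp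
  ultimately have "w' D \<in> V" using Suc.IH by blast
  moreover have "w' D = w (Suc D)" by (simp add: w'_def fun_eq_iff)
  ultimately have top: "w (Suc D) \<in> V" by simp
  show ?case
  proof (cases "i = Suc D")
    case False
    have "(\<lambda>x. \<Sum>j\<le>D. s ^ j * w j x) \<in> V" if s: "s \<in> S" for s
    proof -
      have "(\<lambda>x. 1 * (\<Sum>j\<le>Suc D. s ^ j * w j x) + (- (s ^ Suc D)) * w (Suc D) x) \<in> V"
        by (rule lin[OF Suc.prems(2)[OF s] top])
      then show ?thesis by simp
    qed
    then show ?thesis using Suc.IH[OF Suc.prems(1)] Suc.prems(3) False by simp
  qed (use top in simp)
qed

context integral_presented_polytope
begin

text \<open>The generic directions form an open set.\<close>
lemma generic_line_infinite:
  assumes "generic \<xi>"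
  shows "infinite {s :: complex. \<exists>t. s = of_real t \<and> generic (\<xi> + t *\<^sub>R e)}"
proof -
  have "open ((\<lambda>t. \<xi> + t *\<^sub>R e) -` {\<xi>. generic \<xi>})"
    by (intro open_vimage open_generic continuous_intros)
  moreover have "0 \<in> (\<lambda>t. \<xi> + t *\<^sub>R e) -` {\<xi>. generic \<xi>}" using assms by simp
  ultimately have "infinite ((\<lambda>t::real. \<xi> + t *\<^sub>R e) -` {\<xi>. generic \<xi>})"
    using finite_imp_not_open by blast
  then have "infinite (complex_of_real ` ((\<lambda>t. \<xi> + t *\<^sub>R e) -` {\<xi>. generic \<xi>}))"
    by (subst finite_image_iff) (auto simp: inj_on_def)
  then show ?thesis by (rule contrapos_nn) (erule finite_subset[rotated], auto)
qed

text \<open>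
  Polarisation, one coordinate at a time: replace \<open>\<xi>\<close> by \<open>\<xi> + t e\<^sub>i\<close> and take the coefficient of
  \<open>t\<close>. This trades one factor \<open>\<langle>\<xi>, x\<rangle>\<close> for the coordinate \<open>x\<^sub>i\<close>.\<close>
lemma monomial_times_power_EM:
  assumes k: "m + CARD('n) + 1 \<le> k"
  shows "r \<le> m \<Longrightarrow> (\<Sum>i\<in>UNIV. e i) = r \<Longrightarrow> generic \<xi> \<Longrightarrow>
    (\<lambda>x. (\<Prod>i\<in>UNIV. complex_of_real (x $ i) ^ e i) * complex_of_real (\<xi> \<bullet> x) ^ (m - r)) \<in> EM_functions k"
proof (induction r arbitrary: e \<xi>)
  case 0
  then have "e i = 0" for i by simp
  then show ?case using power_linear_EM[OF 0(3) k] by simp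
next
  case (Suc r)
  obtain i where i: "e i > 0" using Suc.prems(2) by (metis gr0I nat.distinct(1) sum.neutral)
  define e' where "e' = e(i := e i - 1)"
  let ?M = "\<lambda>x. \<Prod>i\<in>UNIV. complex_of_real (x $ i) ^ e' i"
  have e: "(\<Prod>i\<in>UNIV. complex_of_real (x $ i) ^ e i) = of_real (x $ i) * ?M x" for x
  proof -
    have "(\<Prod>i\<in>UNIV - {i}. complex_of_real (x $ i) ^ e i) = (\<Prod>i\<in>UNIV - {i}. complex_of_real (x $ i) ^ e' i)"
      by (intro prod.cong) (auto simp: e'_def)
    moreover have "complex_of_real (x $ i) ^ e i = of_real (x $ i) * complex_of_real (x $ i) ^ e' i"
      using i by (simp add: e'_def power_Suc[symmetric] del: power_Suc)
    ultimately show ?thesis by (simp add: prod.remove[of UNIV i])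
  qed
  have "(\<Sum>i\<in>UNIV - {i}. e i) = (\<Sum>i\<in>UNIV - {i}. e' i)" by (intro sum.cong) (auto simp: e'_def)
  moreover have "e i = Suc (e' i)" using i by (simp add: e'_def)
  ultimately have se': "(\<Sum>i\<in>UNIV. e' i) = r" using Suc.prems(2) by (simp add: sum.remove[of UNIV i])
  define p where "p = m - Suc r"
  have p: "m - r = Suc p" using Suc.prems(1) by (simp add: p_def)
  define w where "w j x = of_nat (Suc p choose j) * (?M x * (of_real (x $ i) ^ j * of_real (\<xi> \<bullet> x) ^ (Suc p - j)))" for j x
  let ?S = "{s :: complex. \<exists>t. s = of_real t \<and> generic (\<xi> + t *\<^sub>R axis i 1)}"
  have mem: "(\<lambda>x. \<Sum>j\<le>Suc p. s ^ j * w j x) \<in> EM_functions k" if s: "s \<in> ?S" for s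
  proof -
    obtain t where t: "s = of_real t" "generic (\<xi> + t *\<^sub>R axis i 1)" using s by blast
    have "(\<Sum>j\<le>Suc p. s ^ j * w j x) = ?M x * complex_of_real ((\<xi> + t *\<^sub>R axis i 1) \<bullet> x) ^ (m - r)" for x
    proof -
      have "complex_of_real ((\<xi> + t *\<^sub>R axis i 1) \<bullet> x) = s * of_real (x $ i) + of_real (\<xi> \<bullet> x)"
        by (simp add: t(1) inner_add_left inner_axis' add.commute)
      then have "complex_of_real ((\<xi> + t *\<^sub>R axis i 1) \<bullet> x) ^ (m - r)
        = (\<Sum>j\<le>Suc p. of_nat (Suc p choose j) * (s * of_real (x $ i)) ^ j * of_real (\<xi> \<bullet> x) ^ (Suc p - j))"
        unfolding p by (simp only: binomial_ring)
      then show ?thesis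
        unfolding w_def by (simp only: sum_distrib_left power_mult_distrib mult_ac)
    qed
    then show ?thesis using Suc.IH[OF _ se' t(2)] Suc.prems(1) by simp
  qed
  have w1: "w 1 \<in> EM_functions k"
  proof (rule coefficients_in_linear_space[where w = w and S = ?S and D = "Suc p" and i = 1])
    show "infinite ?S" by (rule generic_line_infinite[OF Suc.prems(3)])
    show "(\<lambda>x. b * f x + c * g x) \<in> EM_functions k" if "f \<in> EM_functions k" "g \<in> EM_functions k" for f g b c
      by (rule lincomb_EM[OF that])
    show "(\<lambda>x. \<Sum>j\<le>Suc p. s ^ j * w j x) \<in> EM_functions k" if "s \<in> ?S" for s
      by (rule mem[OF that])
  qed simp
  have "(\<lambda>x. 1 / of_nat (Suc p) * w 1 x + 0 * w 1 x) \<in> EM_functions k" by (rule lincomb_EM[OF w1 w1])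
  then have "(\<lambda>x. 1 / of_nat (Suc p) * w 1 x) \<in> EM_functions k" by (simp only: mult_zero_left add_0_right)
  also have "(\<lambda>x. 1 / of_nat (Suc p) * w 1 x) = (\<lambda>x. (\<Prod>i\<in>UNIV. complex_of_real (x $ i) ^ e i) * complex_of_real (\<xi> \<bullet> x) ^ (m - Suc r))"
    unfolding w_def e p_def[symmetric] by (simp add: mult_ac del: of_nat_Suc)
  finally show ?case .
qed

lemma mp_eval_EM:
  assumes k: "mp_total_degree p + CARD('n) + 1 \<le> k"
  shows "mp_eval p \<in> EM_functions k"
proof -
  obtain \<xi> where \<xi>: "generic \<xi>" using generic_dense[of UNIV] by auto
  have one: "(\<lambda>x. 1) \<in> EM_functions k" using power_linear_EM[OF \<xi>, of 0 k] k by simp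
  have mono: "(\<lambda>x. \<Prod>i\<in>UNIV. complex_of_real (x $ i) ^ Poly_Mapping.lookup m i) \<in> EM_functions k"
    if m: "m \<in> Poly_Mapping.keys p" for m
  proof -
    let ?s = "\<Sum>i\<in>UNIV. Poly_Mapping.lookup m i"
    have "?s \<le> mp_total_degree p"
      unfolding mp_total_degree_def by (rule Max_ge) (use m in auto)
    then have "?s + CARD('n) + 1 \<le> k" using k by simp
    from monomial_times_power_EM[OF this order_refl refl \<xi>] show ?thesis by simp
  qed
  have "(\<lambda>x. \<Sum>m\<in>A. Poly_Mapping.lookup p m * (\<Prod>i\<in>UNIV. complex_of_real (x $ i) ^ Poly_Mapping.lookup m i)) \<in> EM_functions k"
    if "finite A" "A \<subseteq> Poly_Mapping.keys p" for A
    using that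
  proof (induction A rule: finite_induct)
    case empty
    then show ?case using lincomb_EM[OF one one, of 0 0] by simp
  next
    case (insert m A)
    then show ?case
      using lincomb_EM[OF mono[of m] insert.IH, of "Poly_Mapping.lookup p m" 1] by simp
  qed
  from this[OF finite_keys order_refl] show ?thesis unfolding mp_eval_def[abs_def] .
qed

lemma face_sum_eq:
  "face_sum k q = (\<Sum>F\<in>faces \<Delta>. \<Sum>\<gamma>\<in>Gamma_flat \<Delta> d u \<mu> F.
       M_op \<Delta> d u \<mu> k F \<gamma> (\<lambda>h. integral (shifted_polytope d u \<mu> h) q) (\<lambda>_. 0))"
  unfolding face_sum_def
proof (intro sum.cong refl)
  fix F assume F: "F \<in> faces \<Delta>"
  show "(\<Sum>g\<in>flat_points F. face_op k F g (volume_fun q) (\<lambda>_. 0)) = (\<Sum>\<gamma>\<in>Gamma_flat \<Delta> d u \<mu> F.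
       M_op \<Delta> d u \<mu> k F \<gamma> (\<lambda>h. integral (shifted_polytope d u \<mu> h) q) (\<lambda>_. 0))"
    unfolding sum.reindex_bij_betw[OF bij_flat_points[OF F], symmetric]
    by (intro sum.cong refl) (simp add: M_op_coset[OF F] volume_fun_def[abs_def])
qed

end

theorem corollary93:
  fixes \<Delta> :: "(real ^ 'n) set"
    and d :: nat and u :: "nat \<Rightarrow> real ^ 'n" and \<mu> :: "nat \<Rightarrow> real"
    and p :: "'n mpolynomial" and k :: nat
  assumes "integral_polytope \<Delta>"
    and "simple_polytope \<Delta>"
    and "facet_presentation \<Delta> d u \<mu>"
    and "k \<ge> mp_total_degree p + CARD('n) + 1"
  shows "weighted_sum \<Delta> (mp_eval p) =
    (\<Sum>F\<in>faces \<Delta>. \<Sum>\<gamma>\<in>Gamma_flat \<Delta> d u \<mu> F.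
       M_op \<Delta> d u \<mu> k F \<gamma>
         (\<lambda>h. integral (shifted_polytope d u \<mu> h) (mp_eval p)) (\<lambda>_. 0))"
proof -
  interpret integral_presented_polytope \<Delta> d u \<mu>
    by unfold_locales (use assms in auto)
  show ?thesis
    using mp_eval_EM[OF assms(4)] unfolding EM_functions_def face_sum_eq by blast
qed

end
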